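(* Let $R$ be a commutative ring and let $A$ be an associative algebra up to homotopy over $R$ such that $H(A)$ and $Z(A)$ are graded projective $R$-modules. If $HH^{r+1}_{r-2}(H(A))=0$ for all $r\geq 3$, then there exists an $A_\infty$-algebra structure $(m_i)_{i\geq 1}$ on $A$ with $m_1$ the differential of $A$ and $m_2$ its product.
   Context: A dgmodule over the commutative ring $R$ is a $\mathbb{Z}$-graded $R$-module $C=(C_i)_{i\in\mathbb{Z}}$ with an $R$-linear differential $\partial_C$ of degree $-1$, $\partial_C^2=0$. Put $Z_i(C)=\ker(\partial_C:C_i\to C_{i-1})$, $B_i(C)=\mathrm{im}(\partial_C:C_{i+1}\to C_i)$, $H_i(C)=Z_i(C)/B_i(C)$. A graded module is graded projective if it is projective in each degree. Tensor products are over $R$ with $(C\otimes D)_n=\bigoplus_{i+j=n}C_i\otimes D_j$ and $\partial(c\otimes d)=\partial c\otimes d+(-1)^i c\otimes\partial d$ for $c\in C_i$. $\mathrm{Hom}_i(C,D)=\prod_n\mathrm{Hom}_R(C_n,D_{n+i})$ with differential $\partial f=\partial_D f-(-1)^i f\partial_C$ for $f\in\mathrm{Hom}_i(C,D)$. Koszul sign rule: $(f\otimes g)(x\otimes y)=(-1)^{|x||g|}f(x)\otimes g(y)$, where here $|x|,|g|$ are the degrees. For a graded module $V$, $\mathrm{End}^n_i(V)=\mathrm{Hom}_i(V^{\otimes n},V)$; an element $f\in\mathrm{End}^n_i(V)$ has weight $|f|=i+n-1$. For $f\in\mathrm{End}^n_i(V)$, $g\in\mathrm{End}^m_j(V)$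 set $$f\circ g=(-1)^{|g|(n-1)}\sum_{k=1}^n(-1)^{(m-1)(k-1)} f(\mathrm{id}^{\otimes k-1}\otimes g\otimes\mathrm{id}^{\otimes n-k}),\qquad [f,g]=f\circ g-(-1)^{|f||g|}g\circ f$$ (with weights in the signs). An $A_\infty$-algebra structure on a graded $R$-module $V$ is a collection $m_i\in\mathrm{Hom}_{i-2}(V^{\otimes i},V)$, $i\geq 1$, with $\sum_{i+j=n+1}m_i\circ m_j=0$ for all $n\geq 1$ ($i,j\ge1$). An associative algebra up to homotopy is a dgmodule $A$ with differential $m_1$ and a product $m_2\in\mathrm{End}^2_0(A)$ which is a morphism of dgmodules ($\partial m_2=0$) and is associative up to homotopy: there exists $m_3\in\mathrm{End}^3_1(A)$ with $\partial m_3=-m_2\circ m_2$. Then $\overline{m_2}([x]\otimes[y])=[m_2(x\otimes y)]$ makes $H(A)$ a graded associative algebra. For a graded associative algebra $(B,\mu)$ (i.e. $\mu\in\mathrm{End}^2_0(B)$ with $\mu\circ\mu=0$), the map $\mathrm{d}=[\mu,-]:\mathrm{End}^n_i(B)\to\mathrm{End}^{n+1}_i(B)$ satisfies $\mathrm{d}^2=0$; $HH^n_i(B)$ denotes $\ker(\mathrm{d}:\mathrm{End}^n_i(B)\to\mathrm{End}^{n+1}_i(B))/\mathrm{im}(\mathrm{d}:\mathrm{End}^{n-1}_i(B)\to\mathrm{End}^n_i(B))$ (Hochschild cohomology). *)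

theory Defs
  imports "HOL-Algebra.Module" "HOL-Algebra.AbelCoset"
begin

section \<open>Modules\<close>

text \<open>Modules are records over HOL-Algebra's \<^locale>\<open>module\<close>; the ring multiplication and unit
  fields that such a record inherits play no role and are left unspecified. Elements of a Hom-module
  are extensional functions, so that equality in it is equality of functions.\<close>

definition mod_hom ::
  "('r, 'c) ring_scheme \<Rightarrow> ('r, 'a) module \<Rightarrow> ('r, 'b) module \<Rightarrow> ('a \<Rightarrow> 'b) set" where
  "mod_hom R M N = {f \<in> carrier M \<rightarrow>\<^sub>E carrier N.
     (\<forall>x\<in>carrier M. \<forall>y\<in>carrier M. f (x \<oplus>\<^bsub>M\<^esub> y) = f x \<oplus>\<^bsub>N\<^esub> f y) \<and>
     (\<forall>a\<in>carrier R. \<forall>x\<in>carrier M. f (a \<odot>\<^bsub>M\<^esub> x) = a \<odot>\<^bsub>N\<^esub> f x)}"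

definition ker_module :: "('r, 'a) module \<Rightarrow> ('r, 'b) module \<Rightarrow> ('a \<Rightarrow> 'b) \<Rightarrow> ('r, 'a) module" where
  "ker_module M N f = M\<lparr>carrier := {x \<in> carrier M. f x = \<zero>\<^bsub>N\<^esub>}\<rparr>"

definition quot_module :: "('r, 'a) module \<Rightarrow> 'a set \<Rightarrow> ('r, 'a set) module" where
  "quot_module M N = \<lparr>carrier = a_rcosets\<^bsub>M\<^esub> N, monoid.mult = undefined, one = undefined,
     zero = N, add = (\<lambda>X Y. X <+>\<^bsub>M\<^esub> Y), smult = (\<lambda>a X. \<Union>x\<in>X. N +>\<^bsub>M\<^esub> (a \<odot>\<^bsub>M\<^esub> x))\<rparr>"

definition zero_module :: "('r, 'a) module \<Rightarrow> bool" where
  "zero_module M \<longleftrightarrow> carrier M = {\<zero>\<^bsub>M\<^esub>}"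

definition direct_sum :: "'i set \<Rightarrow> ('i \<Rightarrow> ('r, 'a) module) \<Rightarrow> ('r, 'i \<Rightarrow> 'a) module" where
  "direct_sum I M = \<lparr>
     carrier = {t \<in> \<Pi>\<^sub>E i\<in>I. carrier (M i). finite {i \<in> I. t i \<noteq> \<zero>\<^bsub>M i\<^esub>}},
     monoid.mult = undefined, one = undefined,
     zero = (\<lambda>i\<in>I. \<zero>\<^bsub>M i\<^esub>), add = (\<lambda>s t. \<lambda>i\<in>I. s i \<oplus>\<^bsub>M i\<^esub> t i),
     smult = (\<lambda>a t. \<lambda>i\<in>I. a \<odot>\<^bsub>M i\<^esub> t i)\<rparr>"

definition submodule_span :: "('r, 'c) ring_scheme \<Rightarrow> ('r, 'a) module \<Rightarrow> 'a set \<Rightarrow> 'a set" where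
  "submodule_span R M S = \<Inter>{N. submodule N R M \<and> S \<subseteq> N}"

definition free_module :: "('r, 'c) ring_scheme \<Rightarrow> 's set \<Rightarrow> ('r, 's \<Rightarrow> 'r) module" where
  "free_module R S = \<lparr>
     carrier = {u. (\<forall>s. u s \<in> carrier R) \<and> (\<forall>s. s \<notin> S \<longrightarrow> u s = \<zero>\<^bsub>R\<^esub>) \<and> finite {s. u s \<noteq> \<zero>\<^bsub>R\<^esub>}},
     monoid.mult = undefined, one = undefined,
     zero = (\<lambda>_. \<zero>\<^bsub>R\<^esub>), add = (\<lambda>u v s. u s \<oplus>\<^bsub>R\<^esub> v s), smult = (\<lambda>a u s. a \<otimes>\<^bsub>R\<^esub> u s)\<rparr>"

definition basis_vec :: "('r, 'c) ring_scheme \<Rightarrow> 's \<Rightarrow> 's \<Rightarrow> 'r" where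
  "basis_vec R s = (\<lambda>t. if t = s then \<one>\<^bsub>R\<^esub> else \<zero>\<^bsub>R\<^esub>)"

text \<open>The lifting property. HOL cannot quantify over the types of \<open>M\<close> and \<open>N\<close> inside a
  definition; the types chosen here suffice, since \<open>N = P\<close> and the free module on the carrier of
  \<open>P\<close> are among the instances, so that \<open>P\<close> is a direct summand of a free module.\<close>

definition projective :: "('r, 'c) ring_scheme \<Rightarrow> ('r, 'p) module \<Rightarrow> bool" where
  "projective R P \<longleftrightarrow> module R P \<and>
     (\<forall>(M :: ('r, 'p \<Rightarrow> 'r) module) (N :: ('r, 'p) module) g f.
        module R M \<and> module R N \<and> g \<in> mod_hom R M N \<and> g ` carrier M = carrier N \<and> f \<in> mod_hom R P N
        \<longrightarrow> (\<exists>h \<in> mod_hom R P M. \<forall>x\<in>carrier P. g (h x) = f x))"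


section \<open>Tensor products of finitely many modules\<close>

definition tuples :: "('r, 'a) module list \<Rightarrow> 'a list set" where
  "tuples Ms = {xs. length xs = length Ms \<and> (\<forall>k<length Ms. xs ! k \<in> carrier (Ms ! k))}"

definition tensor_relations ::
  "('r, 'c) ring_scheme \<Rightarrow> ('r, 'a) module list \<Rightarrow> ('a list \<Rightarrow> 'r) set" where
  "tensor_relations R Ms =
     {basis_vec R (xs[k := x \<oplus>\<^bsub>Ms ! k\<^esub> y])
        \<ominus>\<^bsub>free_module R (tuples Ms)\<^esub>
          (basis_vec R (xs[k := x]) \<oplus>\<^bsub>free_module R (tuples Ms)\<^esub> basis_vec R (xs[k := y]))
      | xs k x y. xs \<in> tuples Ms \<and> k < length Ms \<and> x \<in> carrier (Ms ! k) \<and> y \<in> carrier (Ms ! k)} \<union>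
     {basis_vec R (xs[k := a \<odot>\<^bsub>Ms ! k\<^esub> x])
        \<ominus>\<^bsub>free_module R (tuples Ms)\<^esub> (a \<odot>\<^bsub>free_module R (tuples Ms)\<^esub> basis_vec R (xs[k := x]))
      | xs k a x. xs \<in> tuples Ms \<and> k < length Ms \<and> a \<in> carrier R \<and> x \<in> carrier (Ms ! k)}"

definition tensor_module ::
  "('r, 'c) ring_scheme \<Rightarrow> ('r, 'a) module list \<Rightarrow> ('r, ('a list \<Rightarrow> 'r) set) module" where
  "tensor_module R Ms = quot_module (free_module R (tuples Ms))
     (submodule_span R (free_module R (tuples Ms)) (tensor_relations R Ms))"

definition pure_tensor ::
  "('r, 'c) ring_scheme \<Rightarrow> ('r, 'a) module list \<Rightarrow> 'a list \<Rightarrow> ('a list \<Rightarrow> 'r) set" where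
  "pure_tensor R Ms xs =
     submodule_span R (free_module R (tuples Ms)) (tensor_relations R Ms)
       +>\<^bsub>free_module R (tuples Ms)\<^esub> basis_vec R xs"


section \<open>Graded modules\<close>

type_synonym ('r, 'a) gmodule = "int \<Rightarrow> ('r, 'a) module"
type_synonym ('r, 'a) tens = "int list \<Rightarrow> ('a list \<Rightarrow> 'r) set"

definition graded_module :: "('r, 'c) ring_scheme \<Rightarrow> ('r, 'a) gmodule \<Rightarrow> bool" where
  "graded_module R V \<longleftrightarrow> (\<forall>i. module R (V i))"

definition graded_projective :: "('r, 'c) ring_scheme \<Rightarrow> ('r, 'a) gmodule \<Rightarrow> bool" where
  "graded_projective R V \<longleftrightarrow> (\<forall>i. projective R (V i))"

definition gHom :: "('r, 'c) ring_scheme \<Rightarrow> ('r, 'a) gmodule \<Rightarrow> ('r, 'b) gmodule \<Rightarrow> int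
    \<Rightarrow> ('r, int \<Rightarrow> 'a \<Rightarrow> 'b) module" where
  "gHom R C D i = \<lparr>
     carrier = {f. \<forall>n. f n \<in> mod_hom R (C n) (D (n + i))},
     monoid.mult = undefined, one = undefined,
     zero = (\<lambda>n. \<lambda>x\<in>carrier (C n). \<zero>\<^bsub>D (n + i)\<^esub>),
     add = (\<lambda>f g n. \<lambda>x\<in>carrier (C n). f n x \<oplus>\<^bsub>D (n + i)\<^esub> g n x),
     smult = (\<lambda>a f n. \<lambda>x\<in>carrier (C n). a \<odot>\<^bsub>D (n + i)\<^esub> f n x)\<rparr>"

text \<open>The \<open>n\<close>-fold tensor power in degree \<open>d\<close>: the direct sum of the modules
  \<open>V i\<^sub>1 \<otimes> \<dots> \<otimes> V i\<^sub>n\<close> over all \<open>i\<^sub>1 + \<dots> + i\<^sub>n = d\<close>.\<close>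

definition tensor_power ::
  "('r, 'c) ring_scheme \<Rightarrow> ('r, 'a) gmodule \<Rightarrow> nat \<Rightarrow> ('r, ('r, 'a) tens) gmodule" where
  "tensor_power R V n d =
     direct_sum {is. length is = n \<and> sum_list is = d} (\<lambda>is. tensor_module R (map V is))"

text \<open>The element \<open>x\<^sub>1 \<otimes> \<dots> \<otimes> x\<^sub>n\<close> of the tensor power, where \<open>x\<^sub>k\<close> is homogeneous of degree \<open>i\<^sub>k\<close>.
  The degrees have to be given along with the elements.\<close>

definition elem_tensor ::
  "('r, 'c) ring_scheme \<Rightarrow> ('r, 'a) gmodule \<Rightarrow> int list \<Rightarrow> 'a list \<Rightarrow> ('r, 'a) tens" where
  "elem_tensor R V is xs = (\<lambda>js\<in>{js. length js = length is \<and> sum_list js = sum_list is}.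
     if js = is then pure_tensor R (map V is) xs else \<zero>\<^bsub>tensor_module R (map V js)\<^esub>)"

text \<open>The homomorphism of degree \<open>j\<close> on \<open>V\<^bsup>\<otimes>n\<^esup>\<close> with the values \<open>\<phi>\<close> on elementary tensors.
  It is unique because these generate, and it exists if \<open>\<phi>\<close> is multilinear.\<close>

definition tensor_lift :: "('r, 'c) ring_scheme \<Rightarrow> ('r, 'a) gmodule \<Rightarrow> nat \<Rightarrow> int
    \<Rightarrow> ('r, 'b) gmodule \<Rightarrow> (int list \<Rightarrow> 'a list \<Rightarrow> 'b) \<Rightarrow> int \<Rightarrow> ('r, 'a) tens \<Rightarrow> 'b" where
  "tensor_lift R V n j W \<phi> = (THE h. h \<in> carrier (gHom R (tensor_power R V n) W j) \<and>
     (\<forall>is xs. length is = n \<and> xs \<in> tuples (map V is) \<longrightarrow>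
        h (sum_list is) (elem_tensor R V is xs) = \<phi> is xs))"

text \<open>Multiplication by \<open>(-1)\<^bsup>k\<^esup>\<close>.\<close>

definition signed :: "('r, 'a) module \<Rightarrow> int \<Rightarrow> 'a \<Rightarrow> 'a" where
  "signed M k x = (if even k then x else \<ominus>\<^bsub>M\<^esub> x)"


section \<open>Dgmodules\<close>

definition dgmodule ::
  "('r, 'c) ring_scheme \<Rightarrow> ('r, 'a) gmodule \<Rightarrow> (int \<Rightarrow> 'a \<Rightarrow> 'a) \<Rightarrow> bool" where
  "dgmodule R C d \<longleftrightarrow> graded_module R C \<and> d \<in> carrier (gHom R C C (-1)) \<and>
     (\<forall>i. \<forall>x\<in>carrier (C i). d (i - 1) (d i x) = \<zero>\<^bsub>C (i - 2)\<^esub>)"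

definition cycles :: "('r, 'a) gmodule \<Rightarrow> (int \<Rightarrow> 'a \<Rightarrow> 'a) \<Rightarrow> ('r, 'a) gmodule" where
  "cycles C d i = ker_module (C i) (C (i - 1)) (d i)"

definition boundaries :: "('r, 'a) gmodule \<Rightarrow> (int \<Rightarrow> 'a \<Rightarrow> 'a) \<Rightarrow> int \<Rightarrow> 'a set" where
  "boundaries C d i = d (i + 1) ` carrier (C (i + 1))"

definition homology :: "('r, 'a) gmodule \<Rightarrow> (int \<Rightarrow> 'a \<Rightarrow> 'a) \<Rightarrow> ('r, 'a set) gmodule" where
  "homology C d i = quot_module (cycles C d i) (boundaries C d i)"

definition hom_class :: "('r, 'a) gmodule \<Rightarrow> (int \<Rightarrow> 'a \<Rightarrow> 'a) \<Rightarrow> int \<Rightarrow> 'a \<Rightarrow> 'a set" where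
  "hom_class C d i x = boundaries C d i +>\<^bsub>cycles C d i\<^esub> x"

text \<open>The differential of \<open>C\<^bsup>\<otimes>n\<^esup>\<close> obtained by iterating the rule for two factors:
  \<open>x\<^sub>1 \<otimes> \<dots> \<otimes> x\<^sub>n\<close> is mapped to the sum over \<open>k\<close> of
  \<open>(-1)\<^bsup>|x\<^sub>1| + \<dots> + |x\<^sub>k\<^sub>-\<^sub>1|\<^esup> x\<^sub>1 \<otimes> \<dots> \<otimes> \<partial>x\<^sub>k \<otimes> \<dots> \<otimes> x\<^sub>n\<close>. Here \<open>k\<close> counts from 0.\<close>

definition tensor_diff :: "('r, 'c) ring_scheme \<Rightarrow> ('r, 'a) gmodule \<Rightarrow> (int \<Rightarrow> 'a \<Rightarrow> 'a)
    \<Rightarrow> nat \<Rightarrow> int \<Rightarrow> ('r, 'a) tens \<Rightarrow> ('r, 'a) tens" where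
  "tensor_diff R C d n = tensor_lift R C n (-1) (tensor_power R C n) (\<lambda>is xs.
     \<Oplus>\<^bsub>tensor_power R C n (sum_list is - 1)\<^esub> k\<in>{..<n}.
       signed (tensor_power R C n (sum_list is - 1)) (sum_list (take k is))
         (elem_tensor R C (is[k := is ! k - 1]) (xs[k := d (is ! k) (xs ! k)])))"

text \<open>The differential \<open>\<partial>f = \<partial>\<^sub>D f - (-1)\<^sup>i f \<partial>\<^sub>C\<close> for \<open>f\<close> of degree \<open>i\<close>.\<close>

definition hom_diff :: "('r, 'a) gmodule \<Rightarrow> (int \<Rightarrow> 'a \<Rightarrow> 'a) \<Rightarrow> ('r, 'b) gmodule
    \<Rightarrow> (int \<Rightarrow> 'b \<Rightarrow> 'b) \<Rightarrow> int \<Rightarrow> (int \<Rightarrow> 'a \<Rightarrow> 'b) \<Rightarrow> int \<Rightarrow> 'a \<Rightarrow> 'b" where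
  "hom_diff C dC D dD i f = (\<lambda>n. \<lambda>x\<in>carrier (C n).
     dD (n + i) (f n x) \<ominus>\<^bsub>D (n + i - 1)\<^esub> signed (D (n + i - 1)) i (f (n - 1) (dC n x)))"


section \<open>The operations on multilinear endomorphisms\<close>

definition gEnd :: "('r, 'c) ring_scheme \<Rightarrow> ('r, 'a) gmodule \<Rightarrow> nat \<Rightarrow> int
    \<Rightarrow> ('r, int \<Rightarrow> ('r, 'a) tens \<Rightarrow> 'a) module" where
  "gEnd R V n i = gHom R (tensor_power R V n) V i"

definition end_diff :: "('r, 'c) ring_scheme \<Rightarrow> ('r, 'a) gmodule \<Rightarrow> (int \<Rightarrow> 'a \<Rightarrow> 'a) \<Rightarrow> nat \<Rightarrow> int
    \<Rightarrow> (int \<Rightarrow> ('r, 'a) tens \<Rightarrow> 'a) \<Rightarrow> int \<Rightarrow> ('r, 'a) tens \<Rightarrow> 'a" where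
  "end_diff R C d n i f = hom_diff (tensor_power R C n) (tensor_diff R C d n) C d i f"

definition weight :: "nat \<Rightarrow> int \<Rightarrow> int" where
  "weight n i = i + int n - 1"

text \<open>\<open>id\<^bsup>\<otimes>k-1\<^esup> \<otimes> g \<otimes> id\<^bsup>\<otimes>n-k\<^esup> : V\<^bsup>\<otimes>n+m-1\<^esup> \<rightarrow> V\<^bsup>\<otimes>n\<^esup>\<close> for \<open>1 \<le> k \<le> n\<close> and \<open>g\<close> in \<open>End\<^sup>m\<^sub>j(V)\<close>,
  with the Koszul sign \<open>(-1)\<^bsup>j(|x\<^sub>1| + \<dots> + |x\<^sub>k\<^sub>-\<^sub>1|)\<^esup>\<close>.\<close>

definition insert_at :: "('r, 'c) ring_scheme \<Rightarrow> ('r, 'a) gmodule \<Rightarrow> nat \<Rightarrow> nat \<Rightarrow> int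
    \<Rightarrow> (int \<Rightarrow> ('r, 'a) tens \<Rightarrow> 'a) \<Rightarrow> nat \<Rightarrow> int \<Rightarrow> ('r, 'a) tens \<Rightarrow> ('r, 'a) tens" where
  "insert_at R V n m j g k = tensor_lift R V (n + m - 1) j (tensor_power R V n) (\<lambda>is xs.
     let is1 = take (k - 1) is; is2 = take m (drop (k - 1) is); is3 = drop (k - 1 + m) is;
         xs1 = take (k - 1) xs; xs2 = take m (drop (k - 1) xs); xs3 = drop (k - 1 + m) xs
     in signed (tensor_power R V n (sum_list is + j)) (j * sum_list is1)
          (elem_tensor R V (is1 @ [sum_list is2 + j] @ is3)
             (xs1 @ [g (sum_list is2) (elem_tensor R V is2 xs2)] @ xs3)))"

definition circ :: "('r, 'c) ring_scheme \<Rightarrow> ('r, 'a) gmodule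
    \<Rightarrow> nat \<Rightarrow> int \<Rightarrow> (int \<Rightarrow> ('r, 'a) tens \<Rightarrow> 'a)
    \<Rightarrow> nat \<Rightarrow> int \<Rightarrow> (int \<Rightarrow> ('r, 'a) tens \<Rightarrow> 'a) \<Rightarrow> int \<Rightarrow> ('r, 'a) tens \<Rightarrow> 'a" where
  "circ R V n i f m j g = (\<lambda>d. \<lambda>t\<in>carrier (tensor_power R V (n + m - 1) d).
     signed (V (d + (i + j))) (weight m j * (int n - 1))
       (\<Oplus>\<^bsub>V (d + (i + j))\<^esub> k\<in>{1..n}. signed (V (d + (i + j))) ((int m - 1) * (int k - 1))
          (f (d + j) (insert_at R V n m j g k d t))))"

definition bracket :: "('r, 'c) ring_scheme \<Rightarrow> ('r, 'a) gmodule
    \<Rightarrow> nat \<Rightarrow> int \<Rightarrow> (int \<Rightarrow> ('r, 'a) tens \<Rightarrow> 'a)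
    \<Rightarrow> nat \<Rightarrow> int \<Rightarrow> (int \<Rightarrow> ('r, 'a) tens \<Rightarrow> 'a) \<Rightarrow> int \<Rightarrow> ('r, 'a) tens \<Rightarrow> 'a" where
  "bracket R V n i f m j g =
     circ R V n i f m j g \<ominus>\<^bsub>gEnd R V (n + m - 1) (i + j)\<^esub>
       signed (gEnd R V (n + m - 1) (i + j)) (weight n i * weight m j) (circ R V m j g n i f)"


section \<open>\<open>A\<^sub>\<infinity>\<close>-algebras, algebras up to homotopy and Hochschild cohomology\<close>

definition A_infinity_structure :: "('r, 'c) ring_scheme \<Rightarrow> ('r, 'a) gmodule
    \<Rightarrow> (nat \<Rightarrow> int \<Rightarrow> ('r, 'a) tens \<Rightarrow> 'a) \<Rightarrow> bool" where
  "A_infinity_structure R V m \<longleftrightarrow>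
     (\<forall>i\<ge>1. m i \<in> carrier (gEnd R V i (int i - 2))) \<and>
     (\<forall>n\<ge>1. finsum (gEnd R V n (int n - 3))
        (\<lambda>(i, j). circ R V i (int i - 2) (m i) j (int j - 2) (m j))
        {(i, j). i \<ge> 1 \<and> j \<ge> 1 \<and> i + j = n + 1} = \<zero>\<^bsub>gEnd R V n (int n - 3)\<^esub>)"

text \<open>A differential as an element of \<open>End\<^sup>1\<^sub>-\<^sub>1(C)\<close>, via \<open>C\<^bsup>\<otimes>1\<^esup> = C\<close>.\<close>

definition unary_op :: "('r, 'c) ring_scheme \<Rightarrow> ('r, 'a) gmodule \<Rightarrow> (int \<Rightarrow> 'a \<Rightarrow> 'a)
    \<Rightarrow> int \<Rightarrow> ('r, 'a) tens \<Rightarrow> 'a" where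
  "unary_op R C d = tensor_lift R C 1 (-1) C (\<lambda>is xs. d (hd is) (hd xs))"

definition homotopy_assoc_algebra :: "('r, 'c) ring_scheme \<Rightarrow> ('r, 'a) gmodule
    \<Rightarrow> (int \<Rightarrow> 'a \<Rightarrow> 'a) \<Rightarrow> (int \<Rightarrow> ('r, 'a) tens \<Rightarrow> 'a) \<Rightarrow> bool" where
  "homotopy_assoc_algebra R A d m2 \<longleftrightarrow>
     dgmodule R A d \<and> m2 \<in> carrier (gEnd R A 2 0) \<and>
     end_diff R A d 2 0 m2 = \<zero>\<^bsub>gEnd R A 2 (-1)\<^esub> \<and>
     (\<exists>m3 \<in> carrier (gEnd R A 3 1).
        end_diff R A d 3 1 m3 = \<ominus>\<^bsub>gEnd R A 3 0\<^esub> circ R A 2 0 m2 2 0 m2)"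

definition homology_product :: "('r, 'c) ring_scheme \<Rightarrow> ('r, 'a) gmodule \<Rightarrow> (int \<Rightarrow> 'a \<Rightarrow> 'a)
    \<Rightarrow> (int \<Rightarrow> ('r, 'a) tens \<Rightarrow> 'a) \<Rightarrow> int \<Rightarrow> ('r, 'a set) tens \<Rightarrow> 'a set" where
  "homology_product R A d m2 = (THE \<mu>. \<mu> \<in> carrier (gEnd R (homology A d) 2 0) \<and>
     (\<forall>p q. \<forall>x\<in>carrier (cycles A d p). \<forall>y\<in>carrier (cycles A d q).
        \<mu> (p + q) (elem_tensor R (homology A d) [p, q] [hom_class A d p x, hom_class A d q y])
          = hom_class A d (p + q) (m2 (p + q) (elem_tensor R A [p, q] [x, y]))))"

definition hochschild_diff :: "('r, 'c) ring_scheme \<Rightarrow> ('r, 'a) gmodule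
    \<Rightarrow> (int \<Rightarrow> ('r, 'a) tens \<Rightarrow> 'a) \<Rightarrow> nat \<Rightarrow> int
    \<Rightarrow> (int \<Rightarrow> ('r, 'a) tens \<Rightarrow> 'a) \<Rightarrow> int \<Rightarrow> ('r, 'a) tens \<Rightarrow> 'a" where
  "hochschild_diff R B \<mu> n i f = bracket R B 2 0 \<mu> n i f"

text \<open>\<open>HH\<^sup>0\<close> is the kernel alone, since \<open>End\<^sup>-\<^sup>1 = 0\<close>.\<close>

definition HH :: "('r, 'c) ring_scheme \<Rightarrow> ('r, 'a) gmodule \<Rightarrow> (int \<Rightarrow> ('r, 'a) tens \<Rightarrow> 'a)
    \<Rightarrow> nat \<Rightarrow> int \<Rightarrow> ('r, (int \<Rightarrow> ('r, 'a) tens \<Rightarrow> 'a) set) module" where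
  "HH R B \<mu> n i = quot_module
     (ker_module (gEnd R B n i) (gEnd R B (n + 1) i) (hochschild_diff R B \<mu> n i))
     (if n = 0 then {\<zero>\<^bsub>gEnd R B 0 i\<^esub>}
      else hochschild_diff R B \<mu> (n - 1) i ` carrier (gEnd R B (n - 1) i))"

end

theory Submission
  imports Defs
begin

text \<open>
  All operations are moved to the suspension of \<open>A\<close>. Multiplying a map of arity \<open>n\<close> by a sign that
  depends on the degrees of its arguments turns \<^const>\<open>circ\<close> into insertion with the Koszul sign alone
  (\<open>twist_circ\<close>). The operations of an \<open>A\<^sub>\<infinity>\<close>-algebra all get degree \<open>-1\<close>, together they form a single family \<open>b\<close>
  of multilinear maps, and the defining equations become \<open>b \<circ> b = 0\<close>. The identity
  \<open>(\<phi> \<circ> b) \<circ> b = \<phi> \<circ> (b \<circ> b)\<close> (\<open>icomp_icomp\<close>) holds over every commutative ring, because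
  two copies of \<open>b\<close> inserted side by side occur twice, with opposite signs.

  The operations are constructed one arity at a time. Suppose that \<open>b\<close> has components up to arity \<open>r\<close> and that
  \<open>b \<circ> b\<close> is zero up to arity \<open>r\<close>; let \<open>P\<close> be the component of \<open>b \<circ> b\<close> of arity \<open>r + 1\<close>. A further operation exists if
  \<open>P\<close> is a boundary in \<open>End(A)\<close>. Read in arities \<open>r + 1\<close> and \<open>r + 2\<close>, the identity
  \<open>(b \<circ> b) \<circ> b = b \<circ> (b \<circ> b)\<close> says that \<open>P\<close> is a cycle, and that it commutes with the product up to a boundary
  (\<open>obstruction\<close>). So \<open>P\<close> induces a Hochschild cocycle of \<open>H(A)\<close>, of arity \<open>r + 1\<close> and degree \<open>r - 2\<close>.

  Projectivity makes \<open>H(A)\<close> a deformation retract of \<open>A\<close> (\<open>homology_retract\<close>): projectivity of \<open>H(A)\<close> gives a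
  section of \<open>Z(A) \<rightarrow> H(A)\<close>, and projectivity of \<open>Z(A)\<close> a homotopy. It follows that every multilinear map of
  \<open>H(A)\<close> is induced by a cycle of \<open>End(A)\<close>, and that a cycle of \<open>End(A)\<close> which induces zero is a boundary
  (\<open>push_zero_imp_bdry\<close>).

  Since the Hochschild cohomology group is zero, the cocycle induced by \<open>P\<close> has a primitive. Adding a
  cycle that induces the negative of the primitive to the operation of arity \<open>r\<close> leaves \<open>b \<circ> b\<close> unchanged up to
  arity \<open>r\<close>, and changes \<open>P\<close> into a cycle that induces zero (\<open>perturb\<close>). The new \<open>P\<close> is then a boundary, and the
  negative of a primitive of it is the operation of arity \<open>r + 1\<close> (\<open>extend_structure\<close>). The operation of each
  arity is corrected only once, so that the sequence of partial structures has a limit (\<open>limit_structure\<close>). It starts with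
  the homotopy for associativity as the operation of arity 3 (\<open>initial_structure\<close>).
\<close>


section \<open>Modules and their homomorphisms\<close>

lemma mod_homI:
  assumes "f \<in> extensional (carrier M)" "\<And>x. x \<in> carrier M \<Longrightarrow> f x \<in> carrier N"
    and "\<And>x y. x \<in> carrier M \<Longrightarrow> y \<in> carrier M \<Longrightarrow> f (x \<oplus>\<^bsub>M\<^esub> y) = f x \<oplus>\<^bsub>N\<^esub> f y"
    and "\<And>a x. a \<in> carrier R \<Longrightarrow> x \<in> carrier M \<Longrightarrow> f (a \<odot>\<^bsub>M\<^esub> x) = a \<odot>\<^bsub>N\<^esub> f x"
  shows "f \<in> mod_hom R M N"
  using assms by (auto simp: mod_hom_def PiE_def)

lemma mod_hom_closed: "f \<in> mod_hom R M N \<Longrightarrow> x \<in> carrier M \<Longrightarrow> f x \<in> carrier N"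
  by (auto simp: mod_hom_def)

lemma mod_hom_add: "f \<in> mod_hom R M N \<Longrightarrow> x \<in> carrier M \<Longrightarrow> y \<in> carrier M \<Longrightarrow>
    f (x \<oplus>\<^bsub>M\<^esub> y) = f x \<oplus>\<^bsub>N\<^esub> f y"
  by (auto simp: mod_hom_def)

lemma mod_hom_smult: "f \<in> mod_hom R M N \<Longrightarrow> a \<in> carrier R \<Longrightarrow> x \<in> carrier M \<Longrightarrow>
    f (a \<odot>\<^bsub>M\<^esub> x) = a \<odot>\<^bsub>N\<^esub> f x"
  by (auto simp: mod_hom_def)

lemma mod_hom_ext:
  assumes "f \<in> mod_hom R M N" "g \<in> mod_hom R M N'" "\<And>x. x \<in> carrier M \<Longrightarrow> f x = g x"
  shows "f = g"
  using assms by (auto simp: mod_hom_def PiE_def intro: extensionalityI)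

lemma module_minus_zero:
  assumes "module R M"
  shows "\<ominus>\<^bsub>M\<^esub> \<zero>\<^bsub>M\<^esub> = \<zero>\<^bsub>M\<^esub>"
proof -
  interpret M: module R M by fact
  show ?thesis using M.minus_equality[of "\<zero>\<^bsub>M\<^esub>" "\<zero>\<^bsub>M\<^esub>"] by simp
qed

lemma mod_hom_zero:
  assumes "module R M" "module R N" "f \<in> mod_hom R M N"
  shows "f \<zero>\<^bsub>M\<^esub> = \<zero>\<^bsub>N\<^esub>"
proof -
  interpret M: module R M by fact
  interpret N: module R N by fact
  have "f \<zero>\<^bsub>M\<^esub> \<oplus>\<^bsub>N\<^esub> f \<zero>\<^bsub>M\<^esub> = f \<zero>\<^bsub>M\<^esub>"
    using mod_hom_add[OF assms(3), of "\<zero>\<^bsub>M\<^esub>" "\<zero>\<^bsub>M\<^esub>"] by simp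
  thus ?thesis using mod_hom_closed[OF assms(3), of "\<zero>\<^bsub>M\<^esub>"] by simp
qed

lemma mod_hom_neg:
  assumes "module R M" "module R N" "f \<in> mod_hom R M N" "x \<in> carrier M"
  shows "f (\<ominus>\<^bsub>M\<^esub> x) = \<ominus>\<^bsub>N\<^esub> f x"
proof -
  interpret M: module R M by fact
  interpret N: module R N by fact
  have "f (\<ominus>\<^bsub>M\<^esub> x) \<oplus>\<^bsub>N\<^esub> f x = \<zero>\<^bsub>N\<^esub>"
    using mod_hom_add[OF assms(3), of "\<ominus>\<^bsub>M\<^esub> x" x] mod_hom_zero[OF assms(1-3)] assms(4)
    by (simp add: M.l_neg)
  thus ?thesis using mod_hom_closed[OF assms(3)] assms(4) N.minus_equality by (metis M.a_inv_closed)
qed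

lemma mod_hom_minus:
  assumes "module R M" "module R N" "f \<in> mod_hom R M N" "x \<in> carrier M" "y \<in> carrier M"
  shows "f (x \<ominus>\<^bsub>M\<^esub> y) = f x \<ominus>\<^bsub>N\<^esub> f y"
proof -
  interpret M: module R M by fact
  interpret N: module R N by fact
  show ?thesis using assms by (simp add: a_minus_def mod_hom_add mod_hom_neg)
qed

lemma mod_hom_signed:
  assumes "module R M" "module R N" "f \<in> mod_hom R M N" "x \<in> carrier M"
  shows "f (signed M k x) = signed N k (f x)"
  using assms by (simp add: signed_def mod_hom_neg)

lemma mod_hom_finsum:
  assumes "module R M" "module R N" "f \<in> mod_hom R M N" "g \<in> I \<rightarrow> carrier M"
  shows "f (finsum M g I) = finsum N (\<lambda>i. f (g i)) I"
proof -
  interpret M: module R M by fact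
  interpret N: module R N by fact
  show ?thesis using assms(4)
  proof (induct I rule: infinite_finite_induct)
    case (insert x F)
    hence "f (finsum M g (insert x F)) = f (g x \<oplus>\<^bsub>M\<^esub> finsum M g F)" by (simp add: Pi_def)
    also have "\<dots> = f (g x) \<oplus>\<^bsub>N\<^esub> f (finsum M g F)"
      using insert by (intro mod_hom_add[OF assms(3)]) (auto intro!: M.finsum_closed)
    also have "\<dots> = finsum N (\<lambda>i. f (g i)) (insert x F)"
      using insert mod_hom_closed[OF assms(3)] by (subst N.finsum_insert) (auto simp: Pi_def)
    finally show ?case .
  qed (simp_all add: mod_hom_zero[OF assms(1-3)])
qed

lemma mod_hom_comp:
  assumes "f \<in> mod_hom R L M" "g \<in> mod_hom R M N" "module R L"
  shows "(\<lambda>x\<in>carrier L. g (f x)) \<in> mod_hom R L N"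
proof -
  interpret module R L by fact
  show ?thesis
    using assms by (intro mod_homI) (auto simp: mod_hom_closed mod_hom_add mod_hom_smult)
qed

lemma mod_hom_kernel_submodule:
  assumes "module R M" "module R N" "f \<in> mod_hom R M N"
  shows "submodule {x \<in> carrier M. f x = \<zero>\<^bsub>N\<^esub>} R M"
proof -
  interpret M: module R M by fact
  interpret N: module R N by fact
  show ?thesis using assms
    by (intro M.submoduleI) (auto simp: mod_hom_zero mod_hom_add mod_hom_neg mod_hom_smult)
qed

lemma ker_module_module:
  assumes "module R M" "module R N" "f \<in> mod_hom R M N"
  shows "module R (ker_module M N f)"
  unfolding ker_module_def
  by (rule submodule.submodule_is_module[OF mod_hom_kernel_submodule[OF assms] assms(1)])


subsection \<open>Signs\<close>

text \<open>\<^const>\<open>signed\<close> is typed for module records without further fields, which \<^locale>\<open>module\<close> is not.\<close>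

locale plain_module = module R M
  for R :: "('r, 'c) ring_scheme" (structure) and M :: "('r, 'a) module" (structure)
begin

lemma signed_closed [simp, intro]: "x \<in> carrier M \<Longrightarrow> signed M k x \<in> carrier M"
  by (simp add: signed_def)

lemma signed_zero [simp]: "signed M k \<zero>\<^bsub>M\<^esub> = \<zero>\<^bsub>M\<^esub>"
  by (simp add: signed_def)

lemma signed_add: "x \<in> carrier M \<Longrightarrow> y \<in> carrier M \<Longrightarrow>
    signed M k (x \<oplus>\<^bsub>M\<^esub> y) = signed M k x \<oplus>\<^bsub>M\<^esub> signed M k y"
  by (simp add: signed_def M.minus_add)

lemma signed_signed [simp]: "x \<in> carrier M \<Longrightarrow> signed M k (signed M l x) = signed M (k + l) x"
  by (simp add: signed_def)

lemma signed_neg: "x \<in> carrier M \<Longrightarrow> signed M k (\<ominus>\<^bsub>M\<^esub> x) = \<ominus>\<^bsub>M\<^esub> signed M k x"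
  by (simp add: signed_def)

lemma signed_cancel: "x \<in> carrier M \<Longrightarrow> odd (k + l) \<Longrightarrow> signed M k x \<oplus>\<^bsub>M\<^esub> signed M l x = \<zero>\<^bsub>M\<^esub>"
  by (auto simp: signed_def M.r_neg M.l_neg)

lemma minus_eq_zero_iff: "x \<in> carrier M \<Longrightarrow> y \<in> carrier M \<Longrightarrow> x \<ominus>\<^bsub>M\<^esub> y = \<zero>\<^bsub>M\<^esub> \<longleftrightarrow> x = y"
  by (metis M.a_inv_closed M.minus_equality M.minus_minus M.r_neg a_minus_def)

lemma signed_finsum: "f \<in> I \<rightarrow> carrier M \<Longrightarrow>
    signed M k (finsum M f I) = finsum M (\<lambda>i. signed M k (f i)) I"
proof (induct I rule: infinite_finite_induct)
  case (insert x F)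
  thus ?case by (simp add: signed_add Pi_def)
qed simp_all

end

lemma signed_even [simp]: "even k \<Longrightarrow> signed M k x = x"
  by (simp add: signed_def)

lemma signed_odd [simp]: "odd k \<Longrightarrow> signed M k x = \<ominus>\<^bsub>M\<^esub> x"
  by (simp add: signed_def)

lemma signed_cong: "even (k - l) \<Longrightarrow> signed M k x = signed M l x"
  by (auto simp: signed_def)

lemma (in plain_module) signed_smult: "a \<in> carrier R \<Longrightarrow> x \<in> carrier M \<Longrightarrow>
    signed M k (a \<odot>\<^bsub>M\<^esub> x) = a \<odot>\<^bsub>M\<^esub> signed M k x"
  by (simp add: signed_def smult_r_minus)


subsection \<open>Quotients\<close>

lemma submodule_additive:
  assumes "module R M" "submodule N R M"
  shows "abelian_subgroup N M"
proof -
  interpret M: module R M by fact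
  show ?thesis using assms(2)
    by (intro abelian_subgroupI3 additive_subgroup.intro M.abelian_group_axioms)
       (auto simp: submodule_def)
qed

context
  fixes R :: "('r, 'c) ring_scheme" and M :: "('r, 'a) module" and N
  assumes M: "module R M" and N: "submodule N R M"
begin

interpretation M: plain_module R M by (rule plain_module.intro[OF M])
interpretation N: abelian_subgroup N M by (rule submodule_additive[OF M N])

lemma quot_simps:
  "carrier (quot_module M N) = (\<lambda>x. N +>\<^bsub>M\<^esub> x) ` carrier M" "zero (quot_module M N) = N"
  "add (quot_module M N) X Y = X <+>\<^bsub>M\<^esub> Y"
  by (auto simp: quot_module_def A_RCOSETS_def')

lemma quot_coset_eq_iff:
  assumes "x \<in> carrier M" "y \<in> carrier M"
  shows "N +>\<^bsub>M\<^esub> x = N +>\<^bsub>M\<^esub> y \<longleftrightarrow> x \<ominus>\<^bsub>M\<^esub> y \<in> N"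
proof
  assume "N +>\<^bsub>M\<^esub> x = N +>\<^bsub>M\<^esub> y"
  hence "N +>\<^bsub>M\<^esub> (x \<oplus>\<^bsub>M\<^esub> \<ominus>\<^bsub>M\<^esub> y) = N" using assms M.a_coset_add_inv2 N.a_subset by blast
  thus "x \<ominus>\<^bsub>M\<^esub> y \<in> N" using assms M.a_coset_join1[OF _ _ N.a_subgroup] by (simp add: a_minus_def)
next
  assume "x \<ominus>\<^bsub>M\<^esub> y \<in> N"
  hence "N +>\<^bsub>M\<^esub> (x \<oplus>\<^bsub>M\<^esub> \<ominus>\<^bsub>M\<^esub> y) = N" using assms
    by (intro M.a_coset_join2) (auto simp: a_minus_def N.a_subgroup)
  thus "N +>\<^bsub>M\<^esub> x = N +>\<^bsub>M\<^esub> y" using assms M.a_coset_add_inv1 N.a_subset by blast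
qed

lemma quot_coset_zero_iff: "x \<in> carrier M \<Longrightarrow> N +>\<^bsub>M\<^esub> x = N \<longleftrightarrow> x \<in> N"
  using quot_coset_eq_iff[of x "\<zero>\<^bsub>M\<^esub>"] N.a_subset by (simp add: a_minus_def module_minus_zero[OF M])

lemma quot_add: "x \<in> carrier M \<Longrightarrow> y \<in> carrier M \<Longrightarrow>
    add (quot_module M N) (N +>\<^bsub>M\<^esub> x) (N +>\<^bsub>M\<^esub> y) = N +>\<^bsub>M\<^esub> (x \<oplus>\<^bsub>M\<^esub> y)"
  by (simp add: quot_simps N.a_rcos_sum)

lemma quot_smult:
  assumes "a \<in> carrier R" "x \<in> carrier M"
  shows "smult (quot_module M N) a (N +>\<^bsub>M\<^esub> x) = N +>\<^bsub>M\<^esub> (a \<odot>\<^bsub>M\<^esub> x)"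
proof -
  have *: "N +>\<^bsub>M\<^esub> (a \<odot>\<^bsub>M\<^esub> y) = N +>\<^bsub>M\<^esub> (a \<odot>\<^bsub>M\<^esub> x)" if y: "y \<in> N +>\<^bsub>M\<^esub> x" for y
  proof -
    obtain n where n: "n \<in> N" "y = n \<oplus>\<^bsub>M\<^esub> x" using y by (auto simp: a_r_coset_def')
    have [simp]: "n \<in> carrier M" using n N.a_subset by auto
    have "a \<odot>\<^bsub>M\<^esub> y \<ominus>\<^bsub>M\<^esub> a \<odot>\<^bsub>M\<^esub> x = a \<odot>\<^bsub>M\<^esub> n"
      using assms n by (simp add: M.smult_r_distr a_minus_def M.a_assoc M.r_neg)
    also have "\<dots> \<in> N" using submodule.smult_closed[OF N] assms n by blast
    finally show ?thesis using assms n by (subst quot_coset_eq_iff) auto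
  qed
  have "x \<in> N +>\<^bsub>M\<^esub> x" using assms N.a_rcos_self by simp
  hence "(\<Union>y\<in>N +>\<^bsub>M\<^esub> x. N +>\<^bsub>M\<^esub> (a \<odot>\<^bsub>M\<^esub> y)) = N +>\<^bsub>M\<^esub> (a \<odot>\<^bsub>M\<^esub> x)"
    using * by (intro SUP_eq_const) blast+
  thus ?thesis by (simp add: quot_module_def)
qed

lemma quot_module_module: "module R (quot_module M N)"
proof (rule moduleI)
  show "cring R" by (rule M.is_cring)
  show "abelian_group (quot_module M N)"
  proof (rule abelian_groupI)
    fix X assume "X \<in> carrier (quot_module M N)"
    then obtain x where x: "x \<in> carrier M" "X = N +>\<^bsub>M\<^esub> x" by (auto simp: quot_simps)
    show "\<exists>Y\<in>carrier (quot_module M N). add (quot_module M N) Y X = zero (quot_module M N)"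
      using x N.a_subset
      by (intro bexI[of _ "N +>\<^bsub>M\<^esub> (\<ominus>\<^bsub>M\<^esub> x)"]) (auto simp: quot_add M.l_neg, auto simp: quot_simps)
    have "N = N +>\<^bsub>M\<^esub> \<zero>\<^bsub>M\<^esub>" using N.a_subset by simp
    thus "add (quot_module M N) (zero (quot_module M N)) X = X"
      using quot_add[of "\<zero>\<^bsub>M\<^esub>" x] x by (simp add: quot_simps(2))
  next
    show "zero (quot_module M N) \<in> carrier (quot_module M N)"
      using M.a_coset_add_zero[OF N.a_subset] by (auto simp: quot_simps intro!: image_eqI[of _ _ "\<zero>\<^bsub>M\<^esub>"])
  qed (auto simp: quot_add M.a_ac quot_simps(1))
qed (auto simp: quot_add quot_smult quot_simps(1) M.smult_l_distr M.smult_r_distr M.smult_assoc1)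

lemma quot_proj_hom: "(\<lambda>x\<in>carrier M. N +>\<^bsub>M\<^esub> x) \<in> mod_hom R M (quot_module M N)"
  by (intro mod_homI) (auto simp: quot_add quot_smult, auto simp: quot_simps)

lemma quot_hom_exists:
  fixes P :: "('r, 'b) module"
  assumes P: "module R P" and f: "f \<in> mod_hom R M P" and fN: "\<And>x. x \<in> N \<Longrightarrow> f x = \<zero>\<^bsub>P\<^esub>"
  obtains h where "h \<in> mod_hom R (quot_module M N) P" "\<And>x. x \<in> carrier M \<Longrightarrow> h (N +>\<^bsub>M\<^esub> x) = f x"
proof -
  interpret P: plain_module R P by (rule plain_module.intro[OF P])
  interpret Q: module R "quot_module M N" by (rule quot_module_module)
  define h where "h = (\<lambda>X\<in>carrier (quot_module M N). f (SOME x. x \<in> carrier M \<and> X = N +>\<^bsub>M\<^esub> x))"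
  have h: "h (N +>\<^bsub>M\<^esub> x) = f x" if x: "x \<in> carrier M" for x
  proof -
    define y where "y = (SOME y. y \<in> carrier M \<and> N +>\<^bsub>M\<^esub> x = N +>\<^bsub>M\<^esub> y)"
    have y: "y \<in> carrier M" "N +>\<^bsub>M\<^esub> x = N +>\<^bsub>M\<^esub> y"
      using someI_ex[of "\<lambda>y. y \<in> carrier M \<and> N +>\<^bsub>M\<^esub> x = N +>\<^bsub>M\<^esub> y"] x unfolding y_def by blast+
    have "f (x \<ominus>\<^bsub>M\<^esub> y) = \<zero>\<^bsub>P\<^esub>" using x y by (intro fN) (simp add: quot_coset_eq_iff)
    hence "f x = f y" using x y f mod_hom_closed[OF f]
      by (simp add: mod_hom_minus[OF M P f] P.minus_eq_zero_iff)
    thus ?thesis using x by (auto simp: h_def y_def quot_simps)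
  qed
  have "h \<in> mod_hom R (quot_module M N) P"
  proof (rule mod_homI)
    show "h \<in> extensional (carrier (quot_module M N))" by (simp add: h_def)
  qed (auto simp: quot_simps(1) h quot_add quot_smult mod_hom_closed[OF f] mod_hom_add[OF f]
         mod_hom_smult[OF f])
  thus ?thesis using h that by blast
qed

end

lemma submodule_span_submodule:
  assumes "module R M" "S \<subseteq> carrier M"
  shows "submodule (submodule_span R M S) R M"
proof -
  interpret M: module R M by fact
  have c: "submodule (carrier M) R M" by (rule M.carrier_is_submodule)
  have z: "\<zero>\<^bsub>M\<^esub> \<in> N" if "submodule N R M" for N
    using that by (metis M.add.subgroupE(2) M.l_neg M.submoduleE subset_eq ex_in_conv)
  show ?thesis unfolding submodule_span_def
  proof (rule M.submoduleI)
    show "\<Inter>{N. submodule N R M \<and> S \<subseteq> N} \<subseteq> carrier M" using c assms(2) by blast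
  qed (auto simp: z M.submoduleE)
qed

lemma submodule_span_incl: "S \<subseteq> submodule_span R M S"
  by (auto simp: submodule_span_def)

lemma submodule_span_least: "submodule N R M \<Longrightarrow> S \<subseteq> N \<Longrightarrow> submodule_span R M S \<subseteq> N"
  by (auto simp: submodule_span_def)


subsection \<open>Direct sums and free modules\<close>

text \<open>The sum of a family with finite support. Summing over the support keeps the sum defined when
  the index set is infinite, where \<^const>\<open>finsum\<close> takes a default value.\<close>

definition supp_sum :: "('r, 'a) module \<Rightarrow> 'i set \<Rightarrow> ('i \<Rightarrow> 'a) \<Rightarrow> 'a" where
  "supp_sum N I f = finsum N f {i \<in> I. f i \<noteq> \<zero>\<^bsub>N\<^esub>}"

context plain_module
begin

lemma supp_sum_eq:
  assumes "finite J" "J \<subseteq> I" "\<And>i. i \<in> J \<Longrightarrow> f i \<in> carrier M" "\<And>i. i \<in> I - J \<Longrightarrow> f i = \<zero>\<^bsub>M\<^esub>"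
  shows "supp_sum M I f = finsum M f J"
  unfolding supp_sum_def using assms by (intro M.add.finprod_mono_neutral_cong_left) auto

lemma supp_sum_closed: "(\<And>i. i \<in> I \<Longrightarrow> f i \<in> carrier M) \<Longrightarrow> supp_sum M I f \<in> carrier M"
  unfolding supp_sum_def by (intro M.finsum_closed) auto

lemma supp_sum_add:
  assumes "finite {i \<in> I. f i \<noteq> \<zero>\<^bsub>M\<^esub>}" "finite {i \<in> I. g i \<noteq> \<zero>\<^bsub>M\<^esub>}"
    and "\<And>i. i \<in> I \<Longrightarrow> f i \<in> carrier M" "\<And>i. i \<in> I \<Longrightarrow> g i \<in> carrier M"
  shows "supp_sum M I (\<lambda>i. f i \<oplus>\<^bsub>M\<^esub> g i) = supp_sum M I f \<oplus>\<^bsub>M\<^esub> supp_sum M I g"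
proof -
  define J where "J = {i \<in> I. f i \<noteq> \<zero>\<^bsub>M\<^esub>} \<union> {i \<in> I. g i \<noteq> \<zero>\<^bsub>M\<^esub>}"
  have J: "finite J" "J \<subseteq> I" using assms by (auto simp: J_def)
  have "supp_sum M I f = finsum M f J" "supp_sum M I g = finsum M g J"
    "supp_sum M I (\<lambda>i. f i \<oplus>\<^bsub>M\<^esub> g i) = finsum M (\<lambda>i. f i \<oplus>\<^bsub>M\<^esub> g i) J"
    by (rule supp_sum_eq; use J assms(3,4) in \<open>auto simp: J_def\<close>)+
  moreover have "f \<in> J \<rightarrow> carrier M" "g \<in> J \<rightarrow> carrier M" using J assms(3,4) by auto
  ultimately show ?thesis by (simp add: M.finsum_addf)
qed

lemma supp_sum_smult:
  assumes "finite {i \<in> I. f i \<noteq> \<zero>\<^bsub>M\<^esub>}" "\<And>i. i \<in> I \<Longrightarrow> f i \<in> carrier M" "a \<in> carrier R"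
  shows "supp_sum M I (\<lambda>i. a \<odot>\<^bsub>M\<^esub> f i) = a \<odot>\<^bsub>M\<^esub> supp_sum M I f"
proof -
  have "supp_sum M I (\<lambda>i. a \<odot>\<^bsub>M\<^esub> f i) = finsum M (\<lambda>i. a \<odot>\<^bsub>M\<^esub> f i) {i \<in> I. f i \<noteq> \<zero>\<^bsub>M\<^esub>}"
    using assms by (intro supp_sum_eq) auto
  thus ?thesis using assms unfolding supp_sum_def by (subst finsum_smult_ldistr) auto
qed

lemma supp_sum_cong: "(\<And>i. i \<in> I \<Longrightarrow> f i = g i) \<Longrightarrow> (\<And>i. i \<in> I \<Longrightarrow> g i \<in> carrier M) \<Longrightarrow>
    supp_sum M I f = supp_sum M I g"
  unfolding supp_sum_def by (intro M.finsum_cong') auto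

lemma supp_sum_single:
  assumes "j \<in> I" "f j \<in> carrier M" "\<And>i. i \<in> I \<Longrightarrow> i \<noteq> j \<Longrightarrow> f i = \<zero>\<^bsub>M\<^esub>"
  shows "supp_sum M I f = f j"
  using supp_sum_eq[of "{j}" I f] assms by auto

end

lemma direct_sum_simps:
  "carrier (direct_sum I M) = {t \<in> \<Pi>\<^sub>E i\<in>I. carrier (M i). finite {i \<in> I. t i \<noteq> \<zero>\<^bsub>M i\<^esub>}}"
  "zero (direct_sum I M) = (\<lambda>i\<in>I. \<zero>\<^bsub>M i\<^esub>)"
  "add (direct_sum I M) s t = (\<lambda>i\<in>I. s i \<oplus>\<^bsub>M i\<^esub> t i)"
  "smult (direct_sum I M) a t = (\<lambda>i\<in>I. a \<odot>\<^bsub>M i\<^esub> t i)"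
  by (simp_all add: direct_sum_def)

definition direct_sum_single :: "'i set \<Rightarrow> ('i \<Rightarrow> ('r, 'a) module) \<Rightarrow> 'i \<Rightarrow> 'a \<Rightarrow> 'i \<Rightarrow> 'a" where
  "direct_sum_single I M i x = (\<lambda>j\<in>I. if j = i then x else \<zero>\<^bsub>M j\<^esub>)"

context
  fixes R :: "('r, 'c) ring_scheme" and M :: "'i \<Rightarrow> ('r, 'a) module" and I
  assumes R: "cring R" and M: "\<And>i. i \<in> I \<Longrightarrow> module R (M i)"
begin

lemma direct_sum_add_closed:
  assumes "s \<in> carrier (direct_sum I M)" "t \<in> carrier (direct_sum I M)"
  shows "add (direct_sum I M) s t \<in> carrier (direct_sum I M)"
proof -
  have "{i \<in> I. s i \<oplus>\<^bsub>M i\<^esub> t i \<noteq> \<zero>\<^bsub>M i\<^esub>} \<subseteq> {i \<in> I. s i \<noteq> \<zero>\<^bsub>M i\<^esub>} \<union> {i \<in> I. t i \<noteq> \<zero>\<^bsub>M i\<^esub>}"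
  proof -
    have "\<zero>\<^bsub>M i\<^esub> \<oplus>\<^bsub>M i\<^esub> \<zero>\<^bsub>M i\<^esub> = \<zero>\<^bsub>M i\<^esub>" if "i \<in> I" for i
    proof -
      interpret module R "M i" using M that by blast
      show ?thesis by simp
    qed
    thus ?thesis by auto
  qed
  moreover have "finite ({i \<in> I. s i \<noteq> \<zero>\<^bsub>M i\<^esub>} \<union> {i \<in> I. t i \<noteq> \<zero>\<^bsub>M i\<^esub>})"
    using assms by (auto simp: direct_sum_simps)
  ultimately have "finite {i \<in> I. s i \<oplus>\<^bsub>M i\<^esub> t i \<noteq> \<zero>\<^bsub>M i\<^esub>}" by (rule finite_subset)
  moreover have "s i \<oplus>\<^bsub>M i\<^esub> t i \<in> carrier (M i)" if "i \<in> I" for i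
  proof -
    interpret module R "M i" using M that by blast
    show ?thesis using assms that by (auto simp: direct_sum_simps)
  qed
  ultimately show ?thesis by (auto simp: direct_sum_simps cong: conj_cong)
qed

lemma direct_sum_smult_closed:
  assumes "a \<in> carrier R" "t \<in> carrier (direct_sum I M)"
  shows "smult (direct_sum I M) a t \<in> carrier (direct_sum I M)"
proof -
  have "{i \<in> I. a \<odot>\<^bsub>M i\<^esub> t i \<noteq> \<zero>\<^bsub>M i\<^esub>} \<subseteq> {i \<in> I. t i \<noteq> \<zero>\<^bsub>M i\<^esub>}"
    using module.smult_r_null[OF M assms(1)] by auto
  moreover have "finite {i \<in> I. t i \<noteq> \<zero>\<^bsub>M i\<^esub>}"
    using assms by (auto simp: direct_sum_simps)
  ultimately have "finite {i \<in> I. a \<odot>\<^bsub>M i\<^esub> t i \<noteq> \<zero>\<^bsub>M i\<^esub>}" by (rule finite_subset)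
  moreover have "a \<odot>\<^bsub>M i\<^esub> t i \<in> carrier (M i)" if "i \<in> I" for i
    using assms that module.smult_closed[OF M[OF that]] by (auto simp: direct_sum_simps)
  ultimately show ?thesis by (auto simp: direct_sum_simps cong: conj_cong)
qed

lemma direct_sum_module: "module R (direct_sum I M)"
proof (rule moduleI)
  show "cring R" by (rule R)
  have g: "abelian_group (M i)" if "i \<in> I" for i using M[OF that] by (auto simp: module_def)
  have c: "t i \<in> carrier (M i)" if "i \<in> I" "t \<in> carrier (direct_sum I M)" for t i
    using that by (auto simp: direct_sum_simps)
  have e: "s = t" if "s \<in> carrier (direct_sum I M)" "t \<in> carrier (direct_sum I M)"
      "\<And>i. i \<in> I \<Longrightarrow> s i = t i" for s t
    using that by (auto simp: direct_sum_simps PiE_def intro: extensionalityI)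
  have z: "zero (direct_sum I M) \<in> carrier (direct_sum I M)"
    using g abelian_monoid.zero_closed[OF abelian_group.axioms(1)]
    by (auto simp: direct_sum_simps cong: conj_cong)
  show "abelian_group (direct_sum I M)"
  proof (rule abelian_groupI)
    fix t assume t: "t \<in> carrier (direct_sum I M)"
    let ?s = "\<lambda>i\<in>I. \<ominus>\<^bsub>M i\<^esub> t i"
    have "{i \<in> I. ?s i \<noteq> \<zero>\<^bsub>M i\<^esub>} \<subseteq> {i \<in> I. t i \<noteq> \<zero>\<^bsub>M i\<^esub>}"
      using module_minus_zero[OF M] by auto
    moreover have "finite {i \<in> I. t i \<noteq> \<zero>\<^bsub>M i\<^esub>}" using t by (simp add: direct_sum_simps)
    ultimately have "finite {i \<in> I. ?s i \<noteq> \<zero>\<^bsub>M i\<^esub>}" by (rule finite_subset)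
    moreover have "?s \<in> (\<Pi>\<^sub>E i\<in>I. carrier (M i))"
      using c[OF _ t] abelian_group.a_inv_closed[OF g] by auto
    ultimately have s: "?s \<in> carrier (direct_sum I M)" unfolding direct_sum_simps by blast
    have "add (direct_sum I M) ?s t = zero (direct_sum I M)"
      using t g c by (intro e direct_sum_add_closed s z)
        (auto simp: direct_sum_simps abelian_group.l_neg)
    thus "\<exists>y\<in>carrier (direct_sum I M). add (direct_sum I M) y t = zero (direct_sum I M)"
      using s by blast
  next
    fix x y z assume xyz: "x \<in> carrier (direct_sum I M)" "y \<in> carrier (direct_sum I M)"
      "z \<in> carrier (direct_sum I M)"
    show "add (direct_sum I M) (add (direct_sum I M) x y) z
        = add (direct_sum I M) x (add (direct_sum I M) y z)"
      using xyz c abelian_monoid.a_assoc[OF abelian_group.axioms(1)[OF g]]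
      by (intro e direct_sum_add_closed) (auto simp: direct_sum_simps(3))
  next
    fix x y assume xy: "x \<in> carrier (direct_sum I M)" "y \<in> carrier (direct_sum I M)"
    show "add (direct_sum I M) x y = add (direct_sum I M) y x"
      using xy c abelian_monoid.a_comm[OF abelian_group.axioms(1)[OF g]]
      by (intro e direct_sum_add_closed) (auto simp: direct_sum_simps(3))
  next
    fix x assume x: "x \<in> carrier (direct_sum I M)"
    show "add (direct_sum I M) (zero (direct_sum I M)) x = x"
      using x c abelian_monoid.l_zero[OF abelian_group.axioms(1)[OF g]]
      by (intro e direct_sum_add_closed z) (auto simp: direct_sum_simps(2,3))
  qed (auto simp: direct_sum_add_closed z)
  interpret R: cring R by (rule R)
  show "smult (direct_sum I M) (a \<oplus>\<^bsub>R\<^esub> b) x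
      = add (direct_sum I M) (smult (direct_sum I M) a x) (smult (direct_sum I M) b x)"
    if "a \<in> carrier R" "b \<in> carrier R" "x \<in> carrier (direct_sum I M)" for a b x
    using that c by (intro e direct_sum_add_closed direct_sum_smult_closed)
      (auto simp: direct_sum_simps(3,4) module.smult_l_distr[OF M])
  show "smult (direct_sum I M) a (add (direct_sum I M) x y)
      = add (direct_sum I M) (smult (direct_sum I M) a x) (smult (direct_sum I M) a y)"
    if "a \<in> carrier R" "x \<in> carrier (direct_sum I M)" "y \<in> carrier (direct_sum I M)" for a x y
    using that c by (intro e direct_sum_add_closed direct_sum_smult_closed)
      (auto simp: direct_sum_simps(3,4) module.smult_r_distr[OF M])
  show "smult (direct_sum I M) (a \<otimes>\<^bsub>R\<^esub> b) x
      = smult (direct_sum I M) a (smult (direct_sum I M) b x)"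
    if "a \<in> carrier R" "b \<in> carrier R" "x \<in> carrier (direct_sum I M)" for a b x
    using that c by (intro e direct_sum_add_closed direct_sum_smult_closed)
      (auto simp: direct_sum_simps(3,4) module.smult_assoc1[OF M])
  show "smult (direct_sum I M) \<one>\<^bsub>R\<^esub> x = x" if "x \<in> carrier (direct_sum I M)" for x
    using that c by (intro e direct_sum_add_closed direct_sum_smult_closed)
      (auto simp: direct_sum_simps(3,4) module.smult_one[OF M])
qed (auto simp: direct_sum_smult_closed)

lemma direct_sum_single_hom:
  assumes i: "i \<in> I"
  shows "(\<lambda>x\<in>carrier (M i). direct_sum_single I M i x) \<in> mod_hom R (M i) (direct_sum I M)"
proof -
  have z: "\<zero>\<^bsub>M j\<^esub> \<in> carrier (M j)" "\<zero>\<^bsub>M j\<^esub> \<oplus>\<^bsub>M j\<^esub> \<zero>\<^bsub>M j\<^esub> = \<zero>\<^bsub>M j\<^esub>"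
    "a \<in> carrier R \<Longrightarrow> a \<odot>\<^bsub>M j\<^esub> \<zero>\<^bsub>M j\<^esub> = \<zero>\<^bsub>M j\<^esub>" if "j \<in> I" for j a
  proof -
    interpret module R "M j" using M that by blast
    show "\<zero>\<^bsub>M j\<^esub> \<in> carrier (M j)" "\<zero>\<^bsub>M j\<^esub> \<oplus>\<^bsub>M j\<^esub> \<zero>\<^bsub>M j\<^esub> = \<zero>\<^bsub>M j\<^esub>"
      "a \<in> carrier R \<Longrightarrow> a \<odot>\<^bsub>M j\<^esub> \<zero>\<^bsub>M j\<^esub> = \<zero>\<^bsub>M j\<^esub>" by simp_all
  qed
  interpret Mi: module R "M i" by (rule M[OF i])
  show ?thesis
  proof (rule mod_homI)
    fix x assume "x \<in> carrier (M i)"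
    moreover have "finite {j \<in> I. direct_sum_single I M i x j \<noteq> \<zero>\<^bsub>M j\<^esub>}"
      by (rule finite_subset[of _ "{i}"]) (auto simp: direct_sum_single_def)
    ultimately show "(\<lambda>x\<in>carrier (M i). direct_sum_single I M i x) x \<in> carrier (direct_sum I M)"
      using z by (auto simp: direct_sum_simps direct_sum_single_def)
  qed (use i z in \<open>auto simp: direct_sum_simps direct_sum_single_def fun_eq_iff\<close>)
qed

lemma direct_sum_hom_exists:
  fixes N :: "('r, 'b) module"
  assumes N: "module R N" and h: "\<And>i. i \<in> I \<Longrightarrow> h i \<in> mod_hom R (M i) N"
  obtains k where "k \<in> mod_hom R (direct_sum I M) N"
    "\<And>i x. i \<in> I \<Longrightarrow> x \<in> carrier (M i) \<Longrightarrow> k (direct_sum_single I M i x) = h i x"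
proof -
  interpret N: plain_module R N by (rule plain_module.intro[OF N])
  interpret D: module R "direct_sum I M" by (rule direct_sum_module)
  define k where "k = (\<lambda>t\<in>carrier (direct_sum I M). supp_sum N I (\<lambda>i. h i (t i)))"
  have c: "t i \<in> carrier (M i)" if "i \<in> I" "t \<in> carrier (direct_sum I M)" for t i
    using that by (auto simp: direct_sum_simps)
  have hz: "h i \<zero>\<^bsub>M i\<^esub> = \<zero>\<^bsub>N\<^esub>" if "i \<in> I" for i
    using that by (intro mod_hom_zero[OF M N h])
  have hc: "h i (t i) \<in> carrier N" if "i \<in> I" "t \<in> carrier (direct_sum I M)" for t i
    using that c h mod_hom_closed by metis
  have fin: "finite {i \<in> I. h i (t i) \<noteq> \<zero>\<^bsub>N\<^esub>}" if "t \<in> carrier (direct_sum I M)" for t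
    using that hz by (auto simp: direct_sum_simps intro: rev_finite_subset)
  have "k \<in> mod_hom R (direct_sum I M) N"
  proof (rule mod_homI)
    fix s t assume st: "s \<in> carrier (direct_sum I M)" "t \<in> carrier (direct_sum I M)"
    have "supp_sum N I (\<lambda>i. h i (add (direct_sum I M) s t i))
        = supp_sum N I (\<lambda>i. h i (s i) \<oplus>\<^bsub>N\<^esub> h i (t i))"
      using st c hc by (intro N.supp_sum_cong) (auto simp: direct_sum_simps(3) mod_hom_add[OF h])
    thus "k (add (direct_sum I M) s t) = k s \<oplus>\<^bsub>N\<^esub> k t"
      using st hc fin by (simp add: k_def N.supp_sum_add)
  next
    fix a t assume t: "a \<in> carrier R" "t \<in> carrier (direct_sum I M)"
    have "supp_sum N I (\<lambda>i. h i (smult (direct_sum I M) a t i))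
        = supp_sum N I (\<lambda>i. a \<odot>\<^bsub>N\<^esub> h i (t i))"
      using t c hc by (intro N.supp_sum_cong) (auto simp: direct_sum_simps(4) mod_hom_smult[OF h])
    thus "k (smult (direct_sum I M) a t) = a \<odot>\<^bsub>N\<^esub> k t"
      using t hc fin by (simp add: k_def N.supp_sum_smult)
  qed (auto simp: k_def intro!: N.supp_sum_closed hc)
  moreover have "k (direct_sum_single I M i x) = h i x" if i: "i \<in> I" "x \<in> carrier (M i)" for i x
  proof -
    have "direct_sum_single I M i x \<in> carrier (direct_sum I M)"
      using mod_hom_closed[OF direct_sum_single_hom] i by fastforce
    moreover have "supp_sum N I (\<lambda>j. h j (direct_sum_single I M i x j))
        = h i (direct_sum_single I M i x i)"
      using i hz mod_hom_closed[OF h] by (intro N.supp_sum_single) (auto simp: direct_sum_single_def)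
    ultimately show ?thesis using i by (simp add: k_def direct_sum_single_def)
  qed
  ultimately show ?thesis by (rule that)
qed

lemma direct_sum_hom_ext:
  fixes N :: "('r, 'b) module"
  assumes N: "module R N" and h: "h \<in> mod_hom R (direct_sum I M) N" "k \<in> mod_hom R (direct_sum I M) N"
    and eq: "\<And>i x. i \<in> I \<Longrightarrow> x \<in> carrier (M i) \<Longrightarrow>
      h (direct_sum_single I M i x) = k (direct_sum_single I M i x)"
  shows "h = k"
proof (rule mod_hom_ext[OF h])
  interpret D: module R "direct_sum I M" by (rule direct_sum_module)
  fix t
  have "t \<in> carrier (direct_sum I M) \<Longrightarrow> {i \<in> I. t i \<noteq> \<zero>\<^bsub>M i\<^esub>} \<subseteq> T \<Longrightarrow> h t = k t" if "finite T" for T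
    using that
  proof (induct T arbitrary: t rule: finite_induct)
    case empty
    hence "t = zero (direct_sum I M)"
      by (auto simp: direct_sum_simps PiE_def intro!: extensionalityI[of t I])
    thus ?case using mod_hom_zero[OF direct_sum_module N h(1)] mod_hom_zero[OF direct_sum_module N h(2)]
      by simp
  next
    case (insert i T)
    show ?case
    proof (cases "i \<in> I")
      case False
      thus ?thesis using insert by auto
    next
      case i: True
      define t' where "t' = (\<lambda>j\<in>I. if j = i then \<zero>\<^bsub>M j\<^esub> else t j)"
      interpret Mi: module R "M i" by (rule M[OF i])
      have "{j \<in> I. t' j \<noteq> \<zero>\<^bsub>M j\<^esub>} \<subseteq> {j \<in> I. t j \<noteq> \<zero>\<^bsub>M j\<^esub>}" by (auto simp: t'_def)
      moreover have "finite {j \<in> I. t j \<noteq> \<zero>\<^bsub>M j\<^esub>}" using insert(4) by (simp add: direct_sum_simps)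
      ultimately have "finite {j \<in> I. t' j \<noteq> \<zero>\<^bsub>M j\<^esub>}" by (rule finite_subset)
      moreover have "t' \<in> (\<Pi>\<^sub>E i\<in>I. carrier (M i))"
        using insert(4) by (auto simp: direct_sum_simps t'_def)
      ultimately have t': "t' \<in> carrier (direct_sum I M)" unfolding direct_sum_simps by blast
      have ti: "t i \<in> carrier (M i)" using insert(4) i by (auto simp: direct_sum_simps)
      have s: "direct_sum_single I M i (t i) \<in> carrier (direct_sum I M)"
        using mod_hom_closed[OF direct_sum_single_hom[OF i] ti] ti by simp
      have "t j = \<zero>\<^bsub>M j\<^esub> \<oplus>\<^bsub>M j\<^esub> t j \<and> t j \<oplus>\<^bsub>M j\<^esub> \<zero>\<^bsub>M j\<^esub> = t j" if "j \<in> I" for j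
      proof -
        interpret module R "M j" by (rule M[OF that])
        have "t j \<in> carrier (M j)" using insert(4) that by (auto simp: direct_sum_simps)
        thus ?thesis by simp
      qed
      hence t: "t = add (direct_sum I M) t' (direct_sum_single I M i (t i))"
        using insert(4) by (auto simp: direct_sum_simps t'_def direct_sum_single_def PiE_def
            intro!: extensionalityI[of t I])
      have "{j \<in> I. t' j \<noteq> \<zero>\<^bsub>M j\<^esub>} \<subseteq> T" using insert(5) by (auto simp: t'_def)
      hence "h t' = k t'" using insert(3) t' by blast
      thus ?thesis using mod_hom_add[OF h(1) t' s] mod_hom_add[OF h(2) t' s] eq[OF i ti] t by metis
    qed
  qed
  moreover assume "t \<in> carrier (direct_sum I M)"
  ultimately show "h t = k t" by (auto simp: direct_sum_simps)
qed

end

text \<open>The free module on \<open>S\<close> is the direct sum of copies of \<open>R\<close>, up to functions being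
  extended by zero rather than by the default value outside \<open>S\<close>.\<close>

lemma free_module_simps:
  "carrier (free_module R S) =
     {u. (\<forall>s. u s \<in> carrier R) \<and> (\<forall>s. s \<notin> S \<longrightarrow> u s = \<zero>\<^bsub>R\<^esub>) \<and> finite {s. u s \<noteq> \<zero>\<^bsub>R\<^esub>}}"
  "zero (free_module R S) = (\<lambda>_. \<zero>\<^bsub>R\<^esub>)"
  "add (free_module R S) u v = (\<lambda>s. u s \<oplus>\<^bsub>R\<^esub> v s)"
  "smult (free_module R S) a u = (\<lambda>s. a \<otimes>\<^bsub>R\<^esub> u s)"
  by (simp_all add: free_module_def)

context
  fixes R :: "('r, 'c) ring_scheme" and S :: "'s set"
  assumes R: "cring R"
begin

interpretation R: cring R by (rule R)

lemma free_module_module: "module R (free_module R S)"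
proof (rule moduleI)
  show "cring R" by (rule R)
  show "abelian_group (free_module R S)"
  proof (rule abelian_groupI)
    fix u v assume uv: "u \<in> carrier (free_module R S)" "v \<in> carrier (free_module R S)"
    have "finite {s. u s \<oplus>\<^bsub>R\<^esub> v s \<noteq> \<zero>\<^bsub>R\<^esub>}"
      by (rule finite_subset[of _ "{s. u s \<noteq> \<zero>\<^bsub>R\<^esub>} \<union> {s. v s \<noteq> \<zero>\<^bsub>R\<^esub>}"])
         (use uv in \<open>auto simp: free_module_simps\<close>)
    thus "add (free_module R S) u v \<in> carrier (free_module R S)"
      using uv by (auto simp: free_module_simps)
  next
    fix u assume u: "u \<in> carrier (free_module R S)"
    have "finite {s. \<ominus>\<^bsub>R\<^esub> u s \<noteq> \<zero>\<^bsub>R\<^esub>}"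
      by (rule finite_subset[of _ "{s. u s \<noteq> \<zero>\<^bsub>R\<^esub>}"]) (use u in \<open>auto simp: free_module_simps\<close>)
    thus "\<exists>v\<in>carrier (free_module R S). add (free_module R S) v u = zero (free_module R S)"
      using u by (intro bexI[of _ "\<lambda>s. \<ominus>\<^bsub>R\<^esub> u s"]) (auto simp: free_module_simps R.l_neg)
  qed (auto simp: free_module_simps R.a_ac)
  fix a u assume au: "a \<in> carrier R" "u \<in> carrier (free_module R S)"
  have "finite {s. a \<otimes>\<^bsub>R\<^esub> u s \<noteq> \<zero>\<^bsub>R\<^esub>}"
    by (rule finite_subset[of _ "{s. u s \<noteq> \<zero>\<^bsub>R\<^esub>}"]) (use au in \<open>auto simp: free_module_simps\<close>)
  thus "smult (free_module R S) a u \<in> carrier (free_module R S)"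
    using au by (auto simp: free_module_simps)
qed (auto simp: free_module_simps R.l_distr R.r_distr R.m_assoc)

lemma basis_vec_closed: "s \<in> S \<Longrightarrow> basis_vec R s \<in> carrier (free_module R S)"
  by (auto simp: free_module_simps basis_vec_def)

lemma free_hom_exists:
  fixes N :: "('r, 'b) module"
  assumes N: "module R N" and \<phi>: "\<And>s. s \<in> S \<Longrightarrow> \<phi> s \<in> carrier N"
  obtains k where "k \<in> mod_hom R (free_module R S) N" "\<And>s. s \<in> S \<Longrightarrow> k (basis_vec R s) = \<phi> s"
proof -
  interpret N: plain_module R N by (rule plain_module.intro[OF N])
  interpret F: module R "free_module R S" by (rule free_module_module)
  define k where "k = (\<lambda>u\<in>carrier (free_module R S). supp_sum N S (\<lambda>s. u s \<odot>\<^bsub>N\<^esub> \<phi> s))"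
  have c: "u s \<odot>\<^bsub>N\<^esub> \<phi> s \<in> carrier N" if "s \<in> S" "u \<in> carrier (free_module R S)" for u s
    using that \<phi> by (auto simp: free_module_simps)
  have cR: "u s \<in> carrier R" if "u \<in> carrier (free_module R S)" for u s
    using that by (auto simp: free_module_simps)
  have fin: "finite {s \<in> S. u s \<odot>\<^bsub>N\<^esub> \<phi> s \<noteq> \<zero>\<^bsub>N\<^esub>}" if "u \<in> carrier (free_module R S)" for u
    by (rule finite_subset[of _ "{s. u s \<noteq> \<zero>\<^bsub>R\<^esub>}"])
       (use that \<phi> in \<open>auto simp: free_module_simps\<close>)
  have "k \<in> mod_hom R (free_module R S) N"
  proof (rule mod_homI)
    fix s t assume st: "s \<in> carrier (free_module R S)" "t \<in> carrier (free_module R S)"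
    have "supp_sum N S (\<lambda>i. add (free_module R S) s t i \<odot>\<^bsub>N\<^esub> \<phi> i)
        = supp_sum N S (\<lambda>i. s i \<odot>\<^bsub>N\<^esub> \<phi> i \<oplus>\<^bsub>N\<^esub> t i \<odot>\<^bsub>N\<^esub> \<phi> i)"
      using st c cR \<phi> by (intro N.supp_sum_cong) (auto simp: free_module_simps(3) N.smult_l_distr)
    thus "k (add (free_module R S) s t) = k s \<oplus>\<^bsub>N\<^esub> k t"
      using st c fin by (simp add: k_def N.supp_sum_add)
  next
    fix a t assume t: "a \<in> carrier R" "t \<in> carrier (free_module R S)"
    have "supp_sum N S (\<lambda>i. smult (free_module R S) a t i \<odot>\<^bsub>N\<^esub> \<phi> i)
        = supp_sum N S (\<lambda>i. a \<odot>\<^bsub>N\<^esub> (t i \<odot>\<^bsub>N\<^esub> \<phi> i))"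
      using t c cR \<phi> by (intro N.supp_sum_cong) (auto simp: free_module_simps(4) N.smult_assoc1)
    thus "k (smult (free_module R S) a t) = a \<odot>\<^bsub>N\<^esub> k t"
      using t c fin by (simp add: k_def N.supp_sum_smult)
  qed (auto simp: k_def intro!: N.supp_sum_closed c)
  moreover have "k (basis_vec R s) = \<phi> s" if s: "s \<in> S" for s
  proof -
    have "supp_sum N S (\<lambda>j. basis_vec R s j \<odot>\<^bsub>N\<^esub> \<phi> j) = basis_vec R s s \<odot>\<^bsub>N\<^esub> \<phi> s"
      using s \<phi> by (intro N.supp_sum_single) (auto simp: basis_vec_def)
    thus ?thesis using s \<phi> basis_vec_closed by (simp add: k_def) (simp add: basis_vec_def)
  qed
  ultimately show ?thesis by (rule that)
qed

lemma free_hom_ext: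
  fixes N :: "('r, 'b) module"
  assumes N: "module R N" and h: "h \<in> mod_hom R (free_module R S) N" "k \<in> mod_hom R (free_module R S) N"
    and eq: "\<And>s. s \<in> S \<Longrightarrow> h (basis_vec R s) = k (basis_vec R s)"
  shows "h = k"
proof (rule mod_hom_ext[OF h])
  interpret F: module R "free_module R S" by (rule free_module_module)
  fix u
  have "u \<in> carrier (free_module R S) \<Longrightarrow> {s. u s \<noteq> \<zero>\<^bsub>R\<^esub>} \<subseteq> T \<Longrightarrow> h u = k u" if "finite T" for T
    using that
  proof (induct T arbitrary: u rule: finite_induct)
    case empty
    hence "u = zero (free_module R S)" by (auto simp: free_module_simps)
    thus ?case using mod_hom_zero[OF free_module_module N h(1)] mod_hom_zero[OF free_module_module N h(2)]
      by simp
  next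
    case (insert s T)
    show ?case
    proof (cases "s \<in> S")
      case False
      hence "{s. u s \<noteq> \<zero>\<^bsub>R\<^esub>} \<subseteq> T" using insert by (auto simp: free_module_simps)
      thus ?thesis using insert by auto
    next
      case s: True
      define u' where "u' = u(s := \<zero>\<^bsub>R\<^esub>)"
      have "{t. u' t \<noteq> \<zero>\<^bsub>R\<^esub>} \<subseteq> {t. u t \<noteq> \<zero>\<^bsub>R\<^esub>}" by (auto simp: u'_def)
      moreover have "finite {t. u t \<noteq> \<zero>\<^bsub>R\<^esub>}" using insert(4) by (simp add: free_module_simps)
      ultimately have "finite {t. u' t \<noteq> \<zero>\<^bsub>R\<^esub>}" by (rule finite_subset)
      hence u': "u' \<in> carrier (free_module R S)"
        using insert(4) by (auto simp: free_module_simps u'_def)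
      have us: "u s \<in> carrier R" using insert(4) by (auto simp: free_module_simps)
      let ?b = "smult (free_module R S) (u s) (basis_vec R s)"
      have b: "?b \<in> carrier (free_module R S)" using us basis_vec_closed[OF s] by simp
      have "u = add (free_module R S) u' ?b"
        using insert(4) us by (auto simp: free_module_simps u'_def basis_vec_def)
      moreover have "{t. u' t \<noteq> \<zero>\<^bsub>R\<^esub>} \<subseteq> T" using insert(5) by (auto simp: u'_def)
      hence "h u' = k u'" using insert(3) u' by blast
      moreover have "h ?b = k ?b"
        using mod_hom_smult[OF h(1) us basis_vec_closed[OF s]]
          mod_hom_smult[OF h(2) us basis_vec_closed[OF s]] eq[OF s] by simp
      ultimately show ?thesis using mod_hom_add[OF h(1) u' b] mod_hom_add[OF h(2) u' b] by metis
    qed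
  qed
  moreover assume "u \<in> carrier (free_module R S)"
  ultimately show "h u = k u" by (auto simp: free_module_simps)
qed

end


subsection \<open>Lifting from projective modules\<close>

text \<open>The definition of projectivity quantifies over modules of two types only. A projective
  module is nevertheless a retract of the free module on its carrier, and maps out of a free module
  lift against arbitrary surjections.\<close>

lemma projective_lift:
  fixes P :: "('r, 'p) module" and M :: "('r, 'a) module" and N :: "('r, 'b) module"
  assumes P: "projective R P" and M: "module R M" and N: "module R N"
    and g: "g \<in> mod_hom R M N" and f: "f \<in> mod_hom R P N" and im: "f ` carrier P \<subseteq> g ` carrier M"
  obtains h where "h \<in> mod_hom R P M" "\<And>x. x \<in> carrier P \<Longrightarrow> g (h x) = f x"
proof -
  let ?F = "free_module R (carrier P)"
  have mP: "module R P" using P by (simp add: projective_def)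
  have R: "cring R" using mP by (simp add: module_def)
  have mF: "module R ?F" by (rule free_module_module[OF R])
  interpret P: module R P by (rule mP)
  obtain ev where ev: "ev \<in> mod_hom R ?F P" "\<And>x. x \<in> carrier P \<Longrightarrow> ev (basis_vec R x) = x"
    using free_hom_exists[OF R mP, of "carrier P" "\<lambda>x. x"] by auto
  have "ev ` carrier ?F = carrier P"
    using ev(2) mod_hom_closed[OF ev(1)] basis_vec_closed[OF R] by (force simp: image_iff)
  moreover have "(\<lambda>x\<in>carrier P. x) \<in> mod_hom R P P" by (rule mod_homI) auto
  ultimately have "\<exists>s\<in>mod_hom R P ?F. \<forall>x\<in>carrier P. ev (s x) = (\<lambda>x\<in>carrier P. x) x"
    using P mF mP ev(1) unfolding projective_def by blast
  then obtain s where s: "s \<in> mod_hom R P ?F" "\<And>x. x \<in> carrier P \<Longrightarrow> ev (s x) = x" by auto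
  have "\<forall>x\<in>carrier P. \<exists>y\<in>carrier M. g y = f x" using im by fastforce
  then obtain r where r: "\<And>x. x \<in> carrier P \<Longrightarrow> r x \<in> carrier M \<and> g (r x) = f x" by metis
  then obtain k where k: "k \<in> mod_hom R ?F M" "\<And>x. x \<in> carrier P \<Longrightarrow> k (basis_vec R x) = r x"
    using free_hom_exists[OF R M, of "carrier P" r] by metis
  have *: "(\<lambda>u\<in>carrier ?F. g (k u)) = (\<lambda>u\<in>carrier ?F. f (ev u))"
    by (rule free_hom_ext[OF R N mod_hom_comp[OF k(1) g mF] mod_hom_comp[OF ev(1) f mF]])
       (simp add: basis_vec_closed[OF R] k(2) r ev(2))
  have gk: "g (k u) = f (ev u)" if "u \<in> carrier ?F" for u
    using arg_cong[OF *, of "\<lambda>f. f u"] by (simp only: restrict_apply'[OF that])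
  show ?thesis
  proof (rule that)
    show "(\<lambda>x\<in>carrier P. k (s x)) \<in> mod_hom R P M" by (rule mod_hom_comp[OF s(1) k(1) mP])
    fix x assume x: "x \<in> carrier P"
    thus "g ((\<lambda>x\<in>carrier P. k (s x)) x) = f x"
      using gk[OF mod_hom_closed[OF s(1) x]] s(2)[OF x] by simp
  qed
qed

section \<open>The universal property of tensor powers\<close>

lemma tuples_update: "xs \<in> tuples Ms \<Longrightarrow> k < length Ms \<Longrightarrow> x \<in> carrier (Ms ! k) \<Longrightarrow> xs[k := x] \<in> tuples Ms"
  by (auto simp: tuples_def nth_list_update)

context
  fixes R :: "('r, 'c) ring_scheme" and Ms :: "('r, 'a) module list"
  assumes R: "cring R" and Ms: "\<And>k. k < length Ms \<Longrightarrow> module R (Ms ! k)"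
begin

abbreviation (input) "FM \<equiv> free_module R (tuples Ms)"
abbreviation (input) "SP \<equiv> submodule_span R (free_module R (tuples Ms)) (tensor_relations R Ms)"

interpretation F: plain_module R FM
  by (rule plain_module.intro[OF free_module_module[OF R]])

lemma tuples_update_closed:
  assumes "xs \<in> tuples Ms" "k < length Ms" "x \<in> carrier (Ms ! k)" "y \<in> carrier (Ms ! k)" "a \<in> carrier R"
  shows "xs[k := x \<oplus>\<^bsub>Ms ! k\<^esub> y] \<in> tuples Ms" "xs[k := a \<odot>\<^bsub>Ms ! k\<^esub> x] \<in> tuples Ms"
proof -
  interpret module R "Ms ! k" by (rule Ms[OF assms(2)])
  show "xs[k := x \<oplus>\<^bsub>Ms ! k\<^esub> y] \<in> tuples Ms" "xs[k := a \<odot>\<^bsub>Ms ! k\<^esub> x] \<in> tuples Ms"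
    using assms by (auto intro!: tuples_update)
qed

lemma tensor_relations_closed: "tensor_relations R Ms \<subseteq> carrier FM"
  using tuples_update_closed(1)[OF _ _ _ _ F.R.one_closed] tuples_update_closed(2)
  by (auto simp: tensor_relations_def tuples_update
      intro!: F.minus_closed F.smult_closed F.M.a_closed basis_vec_closed[OF R])

lemmas span_submodule = submodule_span_submodule[OF free_module_module[OF R] tensor_relations_closed]

lemma tensor_module_module: "module R (tensor_module R Ms)"
  unfolding tensor_module_def
  by (rule quot_module_module[OF free_module_module[OF R] span_submodule])

lemma pure_tensor_closed: "xs \<in> tuples Ms \<Longrightarrow> pure_tensor R Ms xs \<in> carrier (tensor_module R Ms)"
  unfolding tensor_module_def pure_tensor_def
  by (simp add: quot_simps[OF free_module_module[OF R] span_submodule] basis_vec_closed[OF R])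

lemma pure_tensor_add:
  assumes "xs \<in> tuples Ms" "k < length Ms" "x \<in> carrier (Ms ! k)" "y \<in> carrier (Ms ! k)"
  shows "pure_tensor R Ms (xs[k := x \<oplus>\<^bsub>Ms ! k\<^esub> y]) =
    pure_tensor R Ms (xs[k := x]) \<oplus>\<^bsub>tensor_module R Ms\<^esub> pure_tensor R Ms (xs[k := y])"
proof -
  note c = basis_vec_closed[OF R, of _ "tuples Ms"] tuples_update_closed(1)[OF _ _ _ _ F.R.one_closed]
    tuples_update
  have "basis_vec R (xs[k := x \<oplus>\<^bsub>Ms ! k\<^esub> y])
        \<ominus>\<^bsub>FM\<^esub> (basis_vec R (xs[k := x]) \<oplus>\<^bsub>FM\<^esub> basis_vec R (xs[k := y])) \<in> SP"
    by (rule subsetD[OF submodule_span_incl]) (use assms in \<open>auto simp: tensor_relations_def\<close>)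
  thus ?thesis unfolding tensor_module_def pure_tensor_def
    using assms by (simp add: quot_add[OF free_module_module[OF R] span_submodule] c
        quot_coset_eq_iff[OF free_module_module[OF R] span_submodule])
qed

lemma pure_tensor_smult:
  assumes "xs \<in> tuples Ms" "k < length Ms" "x \<in> carrier (Ms ! k)" "a \<in> carrier R"
  shows "pure_tensor R Ms (xs[k := a \<odot>\<^bsub>Ms ! k\<^esub> x]) =
    a \<odot>\<^bsub>tensor_module R Ms\<^esub> pure_tensor R Ms (xs[k := x])"
proof -
  note c = basis_vec_closed[OF R, of _ "tuples Ms"] tuples_update_closed(2) tuples_update
  have "basis_vec R (xs[k := a \<odot>\<^bsub>Ms ! k\<^esub> x]) \<ominus>\<^bsub>FM\<^esub> (a \<odot>\<^bsub>FM\<^esub> basis_vec R (xs[k := x])) \<in> SP"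
    by (rule subsetD[OF submodule_span_incl]) (use assms in \<open>auto simp: tensor_relations_def\<close>)
  thus ?thesis unfolding tensor_module_def pure_tensor_def
    using assms by (simp add: quot_smult[OF free_module_module[OF R] span_submodule] c
        quot_coset_eq_iff[OF free_module_module[OF R] span_submodule])
qed

lemma tensor_hom_exists:
  fixes N :: "('r, 'b) module"
  assumes N: "module R N" and c: "\<And>xs. xs \<in> tuples Ms \<Longrightarrow> \<phi> xs \<in> carrier N"
    and add: "\<And>xs k x y. xs \<in> tuples Ms \<Longrightarrow> k < length Ms \<Longrightarrow> x \<in> carrier (Ms ! k) \<Longrightarrow>
      y \<in> carrier (Ms ! k) \<Longrightarrow> \<phi> (xs[k := x \<oplus>\<^bsub>Ms ! k\<^esub> y]) = \<phi> (xs[k := x]) \<oplus>\<^bsub>N\<^esub> \<phi> (xs[k := y])"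
    and smult: "\<And>xs k x a. xs \<in> tuples Ms \<Longrightarrow> k < length Ms \<Longrightarrow> x \<in> carrier (Ms ! k) \<Longrightarrow>
      a \<in> carrier R \<Longrightarrow> \<phi> (xs[k := a \<odot>\<^bsub>Ms ! k\<^esub> x]) = a \<odot>\<^bsub>N\<^esub> \<phi> (xs[k := x])"
  obtains h where "h \<in> mod_hom R (tensor_module R Ms) N"
    "\<And>xs. xs \<in> tuples Ms \<Longrightarrow> h (pure_tensor R Ms xs) = \<phi> xs"
proof -
  interpret N: plain_module R N by (rule plain_module.intro[OF N])
  have mF: "module R FM" by (rule free_module_module[OF R])
  obtain f where f: "f \<in> mod_hom R FM N" "\<And>xs. xs \<in> tuples Ms \<Longrightarrow> f (basis_vec R xs) = \<phi> xs"
    using free_hom_exists[OF R N, of "tuples Ms" \<phi>] c by metis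
  note b = basis_vec_closed[OF R, of _ "tuples Ms"] tuples_update_closed(2)
    tuples_update_closed(1)[OF _ _ _ _ F.R.one_closed] tuples_update
  have "tensor_relations R Ms \<subseteq> {u \<in> carrier FM. f u = \<zero>\<^bsub>N\<^esub>}"
  proof
    fix u assume u: "u \<in> tensor_relations R Ms"
    have "f u = \<zero>\<^bsub>N\<^esub>" using u unfolding tensor_relations_def
    proof (elim UnE CollectE exE conjE, goal_cases)
      case (1 xs k x y)
      thus ?case
        by (simp add: mod_hom_minus[OF mF N f(1)] mod_hom_add[OF f(1)] b f(2) N.minus_eq_zero_iff c add)
    next
      case (2 xs k a x)
      thus ?case
        by (simp add: mod_hom_minus[OF mF N f(1)] mod_hom_smult[OF f(1)] b f(2) N.minus_eq_zero_iff c smult)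
    qed
    thus "u \<in> {u \<in> carrier FM. f u = \<zero>\<^bsub>N\<^esub>}" using u tensor_relations_closed by auto
  qed
  hence "SP \<subseteq> {u \<in> carrier FM. f u = \<zero>\<^bsub>N\<^esub>}"
    by (rule submodule_span_least[OF mod_hom_kernel_submodule[OF mF N f(1)]])
  then obtain h where h: "h \<in> mod_hom R (quot_module FM SP) N"
      "\<And>x. x \<in> carrier FM \<Longrightarrow> h (SP +>\<^bsub>FM\<^esub> x) = f x"
    using quot_hom_exists[OF mF span_submodule N f(1)] by blast
  show ?thesis
    by (rule that[of h]) (use h f(2) b in \<open>auto simp: tensor_module_def pure_tensor_def\<close>)
qed

lemma tensor_hom_ext:
  fixes N :: "('r, 'b) module"
  assumes N: "module R N" and h: "h \<in> mod_hom R (tensor_module R Ms) N" "k \<in> mod_hom R (tensor_module R Ms) N"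
    and eq: "\<And>xs. xs \<in> tuples Ms \<Longrightarrow> h (pure_tensor R Ms xs) = k (pure_tensor R Ms xs)"
  shows "h = k"
proof (rule mod_hom_ext[OF h])
  have mF: "module R FM" by (rule free_module_module[OF R])
  let ?p = "\<lambda>u\<in>carrier FM. SP +>\<^bsub>FM\<^esub> u"
  have p: "?p \<in> mod_hom R FM (tensor_module R Ms)"
    unfolding tensor_module_def by (rule quot_proj_hom[OF mF span_submodule])
  have *: "(\<lambda>u\<in>carrier FM. h (?p u)) = (\<lambda>u\<in>carrier FM. k (?p u))"
    by (rule free_hom_ext[OF R N mod_hom_comp[OF p h(1) mF] mod_hom_comp[OF p h(2) mF]])
       (use eq in \<open>simp add: basis_vec_closed[OF R] pure_tensor_def\<close>)
  fix X assume "X \<in> carrier (tensor_module R Ms)"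
  then obtain u where u: "u \<in> carrier FM" "X = SP +>\<^bsub>FM\<^esub> u"
    unfolding tensor_module_def quot_simps[OF mF span_submodule] by blast
  show "h X = k X" using arg_cong[OF *, of "\<lambda>f. f u"] u by (simp only: restrict_apply'[OF u(1)])
qed

end


subsection \<open>Words of homogeneous elements\<close>

text \<open>A word is a list of homogeneous elements, each given with its degree. Multilinear families
  are functions of words, because sums over decompositions of a list are easier to manipulate than
  sums over positions in two lists of equal length.\<close>

definition words :: "('r, 'a) gmodule \<Rightarrow> (int \<times> 'a) list set" where
  "words V = {ws. \<forall>w\<in>set ws. snd w \<in> carrier (V (fst w))}"

definition wdeg :: "(int \<times> 'a) list \<Rightarrow> int" where
  "wdeg ws = sum_list (map fst ws)"

lemma words_simps [simp]:
  "[] \<in> words V" "w # ws \<in> words V \<longleftrightarrow> snd w \<in> carrier (V (fst w)) \<and> ws \<in> words V"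
  "us @ ws \<in> words V \<longleftrightarrow> us \<in> words V \<and> ws \<in> words V"
  by (auto simp: words_def)

lemma words_take_drop [simp, intro]: "ws \<in> words V \<Longrightarrow> take k ws \<in> words V" "ws \<in> words V \<Longrightarrow> drop k ws \<in> words V"
  by (auto simp: words_def dest: in_set_takeD in_set_dropD)

lemma wdeg_simps [simp]: "wdeg [] = 0" "wdeg (w # ws) = fst w + wdeg ws" "wdeg (us @ ws) = wdeg us + wdeg ws"
  by (simp_all add: wdeg_def)

definition etens :: "('r, 'c) ring_scheme \<Rightarrow> ('r, 'a) gmodule \<Rightarrow> (int \<times> 'a) list \<Rightarrow> ('r, 'a) tens" where
  "etens R V ws = elem_tensor R V (map fst ws) (map snd ws)"

text \<open>Nothing is required on words of other lengths than \<open>n\<close>. A slot is given by the words before and after it.\<close>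

definition mlin :: "('r, 'c) ring_scheme \<Rightarrow> ('r, 'a) gmodule \<Rightarrow> nat \<Rightarrow> ('r, 'b) gmodule \<Rightarrow> int
    \<Rightarrow> ((int \<times> 'a) list \<Rightarrow> 'b) \<Rightarrow> bool" where
  "mlin R V n W j \<phi> \<longleftrightarrow>
     (\<forall>ws\<in>words V. length ws = n \<longrightarrow> \<phi> ws \<in> carrier (W (wdeg ws + j))) \<and>
     (\<forall>us i x y ws. us \<in> words V \<and> ws \<in> words V \<and> x \<in> carrier (V i) \<and> y \<in> carrier (V i) \<and>
        length us + length ws + 1 = n \<longrightarrow>
        \<phi> (us @ (i, x \<oplus>\<^bsub>V i\<^esub> y) # ws) =
          \<phi> (us @ (i, x) # ws) \<oplus>\<^bsub>W (wdeg us + i + wdeg ws + j)\<^esub> \<phi> (us @ (i, y) # ws)) \<and>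
     (\<forall>us i x a ws. us \<in> words V \<and> ws \<in> words V \<and> x \<in> carrier (V i) \<and> a \<in> carrier R \<and>
        length us + length ws + 1 = n \<longrightarrow>
        \<phi> (us @ (i, a \<odot>\<^bsub>V i\<^esub> x) # ws) = a \<odot>\<^bsub>W (wdeg us + i + wdeg ws + j)\<^esub> \<phi> (us @ (i, x) # ws))"

lemma mlinI:
  assumes "\<And>ws. ws \<in> words V \<Longrightarrow> length ws = n \<Longrightarrow> \<phi> ws \<in> carrier (W (wdeg ws + j))"
    and "\<And>us i x y ws. us \<in> words V \<Longrightarrow> ws \<in> words V \<Longrightarrow> x \<in> carrier (V i) \<Longrightarrow> y \<in> carrier (V i) \<Longrightarrow>
        length us + length ws + 1 = n \<Longrightarrow> \<phi> (us @ (i, x \<oplus>\<^bsub>V i\<^esub> y) # ws) =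
          \<phi> (us @ (i, x) # ws) \<oplus>\<^bsub>W (wdeg us + i + wdeg ws + j)\<^esub> \<phi> (us @ (i, y) # ws)"
    and "\<And>us i x a ws. us \<in> words V \<Longrightarrow> ws \<in> words V \<Longrightarrow> x \<in> carrier (V i) \<Longrightarrow> a \<in> carrier R \<Longrightarrow>
        length us + length ws + 1 = n \<Longrightarrow> \<phi> (us @ (i, a \<odot>\<^bsub>V i\<^esub> x) # ws) =
          a \<odot>\<^bsub>W (wdeg us + i + wdeg ws + j)\<^esub> \<phi> (us @ (i, x) # ws)"
  shows "mlin R V n W j \<phi>"
  using assms by (auto simp: mlin_def)

lemma mlin_closed: "mlin R V n W j \<phi> \<Longrightarrow> ws \<in> words V \<Longrightarrow> length ws = n \<Longrightarrow> d = wdeg ws + j \<Longrightarrow>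
    \<phi> ws \<in> carrier (W d)"
  by (auto simp: mlin_def)

lemma mlin_add: "mlin R V n W j \<phi> \<Longrightarrow> us \<in> words V \<Longrightarrow> ws \<in> words V \<Longrightarrow> x \<in> carrier (V i) \<Longrightarrow>
    y \<in> carrier (V i) \<Longrightarrow> n = length us + length ws + 1 \<Longrightarrow> d = wdeg us + i + wdeg ws + j \<Longrightarrow>
    \<phi> (us @ (i, x \<oplus>\<^bsub>V i\<^esub> y) # ws) = \<phi> (us @ (i, x) # ws) \<oplus>\<^bsub>W d\<^esub> \<phi> (us @ (i, y) # ws)"
  by (auto simp: mlin_def)

lemma mlin_smult: "mlin R V n W j \<phi> \<Longrightarrow> us \<in> words V \<Longrightarrow> ws \<in> words V \<Longrightarrow> x \<in> carrier (V i) \<Longrightarrow>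
    a \<in> carrier R \<Longrightarrow> n = length us + length ws + 1 \<Longrightarrow> d = wdeg us + i + wdeg ws + j \<Longrightarrow>
    \<phi> (us @ (i, a \<odot>\<^bsub>V i\<^esub> x) # ws) = a \<odot>\<^bsub>W d\<^esub> \<phi> (us @ (i, x) # ws)"
  by (auto simp: mlin_def)

lemma tuples_words: "xs \<in> tuples (map V is) \<longleftrightarrow> length xs = length is \<and> zip is xs \<in> words V"
  by (auto simp: tuples_def words_def set_zip) blast

lemma words_tuples: "ws \<in> words V \<Longrightarrow> map snd ws \<in> tuples (map V (map fst ws))"
  unfolding tuples_words by (simp add: zip_map_fst_snd)

lemma zip_update_split:
  assumes "length is = length xs" "k < length xs"
  shows "zip is (xs[k := x]) = take k (zip is xs) @ (is ! k, x) # drop (Suc k) (zip is xs)"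
  using assms
  by (subst upd_conv_take_nth_drop[symmetric]) (auto simp: list_eq_iff_nth_eq nth_list_update)

context
  fixes R :: "('r, 'c) ring_scheme" and V :: "('r, 'a) gmodule"
  assumes V: "graded_module R V"
begin

lemma gmod: "module R (V i)"
  using V by (simp add: graded_module_def)

lemma gring: "cring R"
  using gmod[of 0] by (simp add: module_def)

lemma mmod: "k < length (map V is) \<Longrightarrow> module R (map V is ! k)"
  by (simp add: gmod)

lemma tmod: "module R (tensor_module R (map V is))"
  by (rule tensor_module_module[OF gring mmod])

lemma tensor_power_module: "module R (tensor_power R V n d)"
  unfolding tensor_power_def by (intro direct_sum_module gring tensor_module_module mmod)

lemma graded_tensor_power: "graded_module R (tensor_power R V n)"
  by (simp add: graded_module_def tensor_power_module)

lemma elem_tensor_single: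
  assumes "length is = n" "sum_list is = d"
  shows "elem_tensor R V is xs = direct_sum_single {is. length is = n \<and> sum_list is = d}
    (\<lambda>is. tensor_module R (map V is)) is (pure_tensor R (map V is) xs)"
  using assms by (auto simp: elem_tensor_def direct_sum_single_def fun_eq_iff)

lemma gHom_tensor_ext:
  fixes W :: "('r, 'b) gmodule"
  assumes W: "graded_module R W" and h: "h \<in> carrier (gHom R (tensor_power R V n) W j)"
      "k \<in> carrier (gHom R (tensor_power R V n) W j)"
    and eq: "\<And>ws. ws \<in> words V \<Longrightarrow> length ws = n \<Longrightarrow> h (wdeg ws) (etens R V ws) = k (wdeg ws) (etens R V ws)"
  shows "h = k"
proof (rule ext)
  fix d :: int
  let ?I = "{is. length is = n \<and> sum_list is = d}"
  let ?M = "\<lambda>is. tensor_module R (map V is)"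
  have mW: "module R (W (d + j))" using W by (simp add: graded_module_def)
  have hd: "h d \<in> mod_hom R (direct_sum ?I ?M) (W (d + j))" "k d \<in> mod_hom R (direct_sum ?I ?M) (W (d + j))"
    using h by (auto simp: gHom_def tensor_power_def)
  have mM: "module R (?M is)" for "is" by (intro tensor_module_module gring mmod)
  show "h d = k d"
  proof (rule direct_sum_hom_ext[OF gring mM mW hd])
    fix "is" X assume i: "is \<in> ?I" and X: "X \<in> carrier (?M is)"
    let ?s = "\<lambda>X\<in>carrier (?M is). direct_sum_single ?I ?M is X"
    have s: "?s \<in> mod_hom R (?M is) (direct_sum ?I ?M)"
      by (rule direct_sum_single_hom[OF gring mM i])
    have *: "(\<lambda>X\<in>carrier (?M is). h d (?s X)) = (\<lambda>X\<in>carrier (?M is). k d (?s X))"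
    proof (rule tensor_hom_ext[OF gring mmod mW mod_hom_comp[OF s hd(1) mM] mod_hom_comp[OF s hd(2) mM]])
      fix xs assume xs: "xs \<in> tuples (map V is)"
      have "h d (elem_tensor R V is xs) = k d (elem_tensor R V is xs)"
        using eq[of "zip is xs"] xs i by (simp add: tuples_words etens_def wdeg_def)
      thus "(\<lambda>X\<in>carrier (?M is). h d (?s X)) (pure_tensor R (map V is) xs) =
          (\<lambda>X\<in>carrier (?M is). k d (?s X)) (pure_tensor R (map V is) xs)"
        using i pure_tensor_closed[OF gring mmod xs] elem_tensor_single[of "is" n d xs] by simp
    qed
    show "h d (direct_sum_single ?I ?M is X) = k d (direct_sum_single ?I ?M is X)"
      using arg_cong[OF *, of "\<lambda>f. f X"] by (simp only: restrict_apply'[OF X])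
  qed
qed

lemma gHom_tensor_exists:
  fixes W :: "('r, 'b) gmodule"
  assumes W: "graded_module R W" and \<phi>: "mlin R V n W j \<phi>"
  obtains h where "h \<in> carrier (gHom R (tensor_power R V n) W j)"
    "\<And>ws. ws \<in> words V \<Longrightarrow> length ws = n \<Longrightarrow> h (wdeg ws) (etens R V ws) = \<phi> ws"
proof -
  have "\<exists>h. h \<in> mod_hom R (tensor_power R V n d) (W (d + j)) \<and>
      (\<forall>ws\<in>words V. length ws = n \<and> wdeg ws = d \<longrightarrow> h (etens R V ws) = \<phi> ws)" for d
  proof -
    let ?I = "{is. length is = n \<and> sum_list is = d}"
    let ?M = "\<lambda>is. tensor_module R (map V is)"
    have mW: "module R (W (d + j))" using W by (simp add: graded_module_def)
    have mM: "module R (?M is)" for "is" by (intro tensor_module_module gring mmod)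
    have "\<exists>g. g \<in> mod_hom R (?M is) (W (d + j)) \<and>
        (\<forall>xs\<in>tuples (map V is). g (pure_tensor R (map V is) xs) = \<phi> (zip is xs))"
      if i: "is \<in> ?I" for "is"
    proof -
      have sum: "wdeg (take k (zip is xs)) + is ! k + wdeg (drop (Suc k) (zip is xs)) = d"
        if "k < length is" "length xs = length is" for k xs
      proof -
        have "zip is xs = take k (zip is xs) @ zip is xs ! k # drop (Suc k) (zip is xs)"
          using that by (intro id_take_nth_drop) simp
        hence "wdeg (zip is xs) = wdeg (take k (zip is xs)) + is ! k + wdeg (drop (Suc k) (zip is xs))"
          using that by (metis add.assoc fst_conv length_map length_zip min.idem nth_zip wdeg_simps(2,3))
        moreover have "wdeg (zip is xs) = d" using i that by (simp add: wdeg_def)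
        ultimately show ?thesis by simp
      qed
      show ?thesis
      proof (rule tensor_hom_exists[OF gring mmod mW, where \<phi> = "\<lambda>xs. \<phi> (zip is xs)"])
        fix xs assume xs: "xs \<in> tuples (map V is)"
        thus "\<phi> (zip is xs) \<in> carrier (W (d + j))"
          using i by (intro mlin_closed[OF \<phi>]) (auto simp: tuples_words wdeg_def)
        fix k x assume k: "k < length (map V is)" and x: "x \<in> carrier (map V is ! k)"
        show "\<phi> (zip is (xs[k := x \<oplus>\<^bsub>map V is ! k\<^esub> y])) =
            \<phi> (zip is (xs[k := x])) \<oplus>\<^bsub>W (d + j)\<^esub> \<phi> (zip is (xs[k := y]))"
          if y: "y \<in> carrier (map V is ! k)" for y
          using xs k x y sum[of k xs] i
          by (simp add: zip_update_split tuples_words) (intro mlin_add[OF \<phi>], auto)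
        show "\<phi> (zip is (xs[k := a \<odot>\<^bsub>map V is ! k\<^esub> x])) =
            a \<odot>\<^bsub>W (d + j)\<^esub> \<phi> (zip is (xs[k := x]))" if a: "a \<in> carrier R" for a
          using xs k x a sum[of k xs] i
          by (simp add: zip_update_split tuples_words) (intro mlin_smult[OF \<phi>], auto)
      qed auto
    qed
    hence "\<forall>is\<in>?I. \<exists>g. g \<in> mod_hom R (?M is) (W (d + j)) \<and>
        (\<forall>xs\<in>tuples (map V is). g (pure_tensor R (map V is) xs) = \<phi> (zip is xs))" by blast
    from bchoice[OF this] obtain g where g: "\<And>is. is \<in> ?I \<Longrightarrow> g is \<in> mod_hom R (?M is) (W (d + j))"
        "\<And>is xs. is \<in> ?I \<Longrightarrow> xs \<in> tuples (map V is) \<Longrightarrow> g is (pure_tensor R (map V is) xs) = \<phi> (zip is xs)"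
      by blast
    show ?thesis
    proof (rule direct_sum_hom_exists[OF gring mM mW g(1)])
      fix h assume h: "h \<in> mod_hom R (direct_sum ?I ?M) (W (d + j))"
        "\<And>is X. is \<in> ?I \<Longrightarrow> X \<in> carrier (?M is) \<Longrightarrow> h (direct_sum_single ?I ?M is X) = g is X"
      have "h (etens R V ws) = \<phi> ws" if ws: "ws \<in> words V" "length ws = n" "wdeg ws = d" for ws
      proof -
        have i: "map fst ws \<in> ?I" using ws by (simp add: wdeg_def)
        have "map snd ws \<in> tuples (map V (map fst ws))" using words_tuples[OF ws(1)] .
        thus ?thesis using g(2)[OF i] h(2)[OF i] i pure_tensor_closed[OF gring mmod]
          by (simp add: etens_def elem_tensor_single[of _ n d] zip_map_fst_snd del: map_map)
      qed
      thus ?thesis using h(1) by (auto simp: tensor_power_def)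
    qed
  qed
  hence "\<exists>h. \<forall>d. h d \<in> mod_hom R (tensor_power R V n d) (W (d + j)) \<and>
      (\<forall>ws\<in>words V. length ws = n \<and> wdeg ws = d \<longrightarrow> h d (etens R V ws) = \<phi> ws)" by (intro choice allI)
  then obtain h where h: "\<And>d. h d \<in> mod_hom R (tensor_power R V n d) (W (d + j))"
      "\<And>d ws. ws \<in> words V \<Longrightarrow> length ws = n \<Longrightarrow> wdeg ws = d \<Longrightarrow> h d (etens R V ws) = \<phi> ws" by blast
  show ?thesis by (rule that[of h]) (use h in \<open>auto simp: gHom_def\<close>)
qed

text \<open>The definite description in \<^const>\<open>tensor_lift\<close> denotes: existence is the universal property in
  each tuple of degrees, uniqueness holds because the elementary tensors generate.\<close>

lemma tensor_lift_spec:
  fixes W :: "('r, 'b) gmodule"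
  assumes W: "graded_module R W" and \<phi>: "mlin R V n W j \<phi>"
    and \<psi>: "\<And>is xs. length is = n \<Longrightarrow> length xs = n \<Longrightarrow> zip is xs \<in> words V \<Longrightarrow> \<psi> is xs = \<phi> (zip is xs)"
  shows "tensor_lift R V n j W \<psi> \<in> carrier (gHom R (tensor_power R V n) W j)"
    and "ws \<in> words V \<Longrightarrow> length ws = n \<Longrightarrow> tensor_lift R V n j W \<psi> (wdeg ws) (etens R V ws) = \<phi> ws"
proof -
  let ?P = "\<lambda>h. h \<in> carrier (gHom R (tensor_power R V n) W j) \<and>
     (\<forall>is xs. length is = n \<and> xs \<in> tuples (map V is) \<longrightarrow> h (sum_list is) (elem_tensor R V is xs) = \<psi> is xs)"
  have P: "h (wdeg ws) (etens R V ws) = \<phi> ws" if "?P h" "ws \<in> words V" "length ws = n" for h ws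
    using that words_tuples[of ws V] \<psi>[of "map fst ws" "map snd ws"]
    by (auto simp: etens_def wdeg_def zip_map_fst_snd simp del: map_map)
  obtain h where h: "h \<in> carrier (gHom R (tensor_power R V n) W j)"
    "\<And>ws. ws \<in> words V \<Longrightarrow> length ws = n \<Longrightarrow> h (wdeg ws) (etens R V ws) = \<phi> ws"
    using gHom_tensor_exists[OF W \<phi>] by blast
  have "?P h"
  proof (intro conjI allI impI, rule h(1))
    fix "is" xs assume i: "length is = n \<and> xs \<in> tuples (map V is)"
    thus "h (sum_list is) (elem_tensor R V is xs) = \<psi> is xs"
      using h(2)[of "zip is xs"] \<psi>[of "is" xs] by (simp add: etens_def wdeg_def tuples_words)
  qed
  moreover have "k = h" if "?P k" for k
    by (rule gHom_tensor_ext[OF W]) (use that P[OF that] h in auto)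
  ultimately have "?P (THE h. ?P h)" by (rule theI)
  hence "?P (tensor_lift R V n j W \<psi>)" unfolding tensor_lift_def .
  thus "tensor_lift R V n j W \<psi> \<in> carrier (gHom R (tensor_power R V n) W j)"
    "ws \<in> words V \<Longrightarrow> length ws = n \<Longrightarrow> tensor_lift R V n j W \<psi> (wdeg ws) (etens R V ws) = \<phi> ws"
    using P by blast+
qed

lemma etens_closed: "ws \<in> words V \<Longrightarrow> length ws = n \<Longrightarrow> d = wdeg ws \<Longrightarrow> etens R V ws \<in> carrier (tensor_power R V n d)"
proof -
  assume ws: "ws \<in> words V" "length ws = n" "d = wdeg ws"
  have i: "map fst ws \<in> {is. length is = n \<and> sum_list is = d}" using ws by (simp add: wdeg_def)
  have p: "pure_tensor R (map V (map fst ws)) (map snd ws) \<in> carrier (tensor_module R (map V (map fst ws)))"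
    by (rule pure_tensor_closed[OF gring mmod words_tuples[OF ws(1)]])
  have "(\<lambda>X\<in>carrier (tensor_module R (map V (map fst ws))).
        direct_sum_single {is. length is = n \<and> sum_list is = d} (\<lambda>is. tensor_module R (map V is)) (map fst ws) X)
      \<in> mod_hom R (tensor_module R (map V (map fst ws))) (tensor_power R V n d)"
    unfolding tensor_power_def by (rule direct_sum_single_hom[OF gring tmod i])
  from mod_hom_closed[OF this p] show ?thesis
    using i p ws(2)
    by (simp add: etens_def elem_tensor_single[of _ n d] tensor_power_def del: map_map)
qed

lemma mlin_etens: "mlin R V n (tensor_power R V n) 0 (etens R V)"
proof (rule mlinI)
  show "etens R V ws \<in> carrier (tensor_power R V n (wdeg ws + 0))" if "ws \<in> words V" "length ws = n" for ws
    using that by (intro etens_closed) auto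
  fix us ws i x assume w: "us \<in> words V" "ws \<in> words V" and x: "x \<in> carrier (V i)"
    and n: "length us + length ws + 1 = n"
  define "is" where "is = map fst us @ i # map fst ws"
  define k where "k = length us"
  define d where "d = wdeg us + i + wdeg ws"
  define M where "M = tensor_module R (map V is)"
  define s where "s = direct_sum_single {is. length is = n \<and> sum_list is = d}
      (\<lambda>is. tensor_module R (map V is)) is"
  define p where "p = (\<lambda>y. pure_tensor R (map V is) (map snd us @ y # map snd ws))"
  have i: "is \<in> {is. length is = n \<and> sum_list is = d}" using n by (simp add: is_def d_def wdeg_def)
  have e: "etens R V (us @ (i, y) # ws) = s (p y)" for y
    using n by (simp add: etens_def elem_tensor_single[of _ n d] wdeg_def s_def p_def is_def d_def)
  interpret M: module R M unfolding M_def by (rule tensor_module_module[OF gring mmod])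
  have hs: "(\<lambda>X\<in>carrier M. s X) \<in> mod_hom R M (tensor_power R V n d)"
    unfolding tensor_power_def s_def M_def
    by (rule direct_sum_single_hom[OF gring tmod i])
  have s_add: "s (X \<oplus>\<^bsub>M\<^esub> Y) = s X \<oplus>\<^bsub>tensor_power R V n d\<^esub> s Y" if "X \<in> carrier M" "Y \<in> carrier M" for X Y
    using mod_hom_add[OF hs that] that by simp
  have s_smult: "s (a \<odot>\<^bsub>M\<^esub> X) = a \<odot>\<^bsub>tensor_power R V n d\<^esub> s X" if "a \<in> carrier R" "X \<in> carrier M" for X a
    using mod_hom_smult[OF hs that] that by simp
  have t: "map snd us @ y # map snd ws \<in> tuples (map V is)" if "y \<in> carrier (V i)" for y
    using words_tuples[of "us @ (i, y) # ws" V] w that by (simp add: is_def)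
  have p: "p y \<in> carrier M" if "y \<in> carrier (V i)" for y
    unfolding p_def M_def by (rule pure_tensor_closed[OF gring mmod t[OF that]])
  have ki: "map V is ! k = V i" "k < length (map V is)" by (simp_all add: is_def k_def nth_append)
  have u: "(map snd us @ x # map snd ws)[k := y] = map snd us @ y # map snd ws" for y
    by (simp add: k_def list_update_append)
  have d: "wdeg us + i + wdeg ws + 0 = d" by (simp add: d_def)
  show "etens R V (us @ (i, x \<oplus>\<^bsub>V i\<^esub> y) # ws) = etens R V (us @ (i, x) # ws)
      \<oplus>\<^bsub>tensor_power R V n (wdeg us + i + wdeg ws + 0)\<^esub> etens R V (us @ (i, y) # ws)"
    if y: "y \<in> carrier (V i)" for y
  proof -
    have "p (x \<oplus>\<^bsub>V i\<^esub> y) = p x \<oplus>\<^bsub>M\<^esub> p y"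
      using pure_tensor_add[OF gring mmod t[OF x] ki(2), of x y] x y
      unfolding ki(1) u p_def M_def by blast
    thus ?thesis unfolding e d using s_add[OF p[OF x] p[OF y]] by simp
  qed
  show "etens R V (us @ (i, a \<odot>\<^bsub>V i\<^esub> x) # ws) =
      a \<odot>\<^bsub>tensor_power R V n (wdeg us + i + wdeg ws + 0)\<^esub> etens R V (us @ (i, x) # ws)"
    if a: "a \<in> carrier R" for a
  proof -
    have "p (a \<odot>\<^bsub>V i\<^esub> x) = a \<odot>\<^bsub>M\<^esub> p x"
      using pure_tensor_smult[OF gring mmod t[OF x] ki(2), of x a] x a
      unfolding ki(1) u p_def M_def by blast
    thus ?thesis unfolding e d using s_smult[OF a p[OF x]] by simp
  qed
qed

end

section \<open>Sums over decompositions of a word\<close>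

text \<open>The sum of \<open>F u w\<close> over all decompositions \<open>xs = u @ w\<close>, and below the sum of \<open>F u x w\<close> over all
  \<open>xs = u @ x # w\<close>. Sums over decompositions into more pieces are iterated ones; their
  rearrangement is coassociativity of deconcatenation.\<close>

fun dsum :: "('r, 'b) module \<Rightarrow> ('x list \<Rightarrow> 'x list \<Rightarrow> 'b) \<Rightarrow> 'x list \<Rightarrow> 'b" where
  "dsum M F [] = F [] []"
| "dsum M F (x # xs) = F [] (x # xs) \<oplus>\<^bsub>M\<^esub> dsum M (\<lambda>u. F (x # u)) xs"

fun psum :: "('r, 'b) module \<Rightarrow> ('x list \<Rightarrow> 'x \<Rightarrow> 'x list \<Rightarrow> 'b) \<Rightarrow> 'x list \<Rightarrow> 'b" where
  "psum M F [] = \<zero>\<^bsub>M\<^esub>"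
| "psum M F (x # xs) = F [] x xs \<oplus>\<^bsub>M\<^esub> psum M (\<lambda>u. F (x # u)) xs"

lemma dsum_cong: "(\<And>u w. u @ w = xs \<Longrightarrow> F u w = G u w) \<Longrightarrow> dsum M F xs = dsum M G xs"
proof (induct xs arbitrary: F G)
  case (Cons x xs)
  show ?case using Cons.prems[of "[]"] Cons.hyps[of "\<lambda>u. F (x # u)" "\<lambda>u. G (x # u)"] Cons.prems by simp
qed simp

lemma psum_cong: "(\<And>u x w. u @ x # w = xs \<Longrightarrow> F u x w = G u x w) \<Longrightarrow> psum M F xs = psum M G xs"
proof (induct xs arbitrary: F G)
  case (Cons x xs)
  show ?case using Cons.prems[of "[]"] Cons.hyps[of "\<lambda>u. F (x # u)" "\<lambda>u. G (x # u)"] Cons.prems by simp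
qed simp

lemma dsum_rename: "dsum M F (map f xs) = dsum M (\<lambda>u w. F (map f u) (map f w)) xs"
  by (induct xs arbitrary: F) auto

context plain_module
begin

lemma dsum_closed [intro]: "(\<And>u w. u @ w = xs \<Longrightarrow> F u w \<in> carrier M) \<Longrightarrow> dsum M F xs \<in> carrier M"
proof (induct xs arbitrary: F)
  case (Cons x xs)
  show ?case using Cons.prems[of "[]"] Cons.hyps[of "\<lambda>u. F (x # u)"] Cons.prems by simp
qed simp

lemma psum_closed [intro]: "(\<And>u x w. u @ x # w = xs \<Longrightarrow> F u x w \<in> carrier M) \<Longrightarrow> psum M F xs \<in> carrier M"
proof (induct xs arbitrary: F)
  case (Cons x xs)
  show ?case using Cons.prems[of "[]"] Cons.hyps[of "\<lambda>u. F (x # u)"] Cons.prems by simp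
qed simp

lemma dsum_zero: "(\<And>u w. u @ w = xs \<Longrightarrow> F u w = \<zero>\<^bsub>M\<^esub>) \<Longrightarrow> dsum M F xs = \<zero>\<^bsub>M\<^esub>"
proof (induct xs arbitrary: F)
  case (Cons x xs)
  show ?case using Cons.prems[of "[]"] Cons.hyps[of "\<lambda>u. F (x # u)"] Cons.prems by simp
qed simp

lemma psum_zero: "(\<And>u x w. u @ x # w = xs \<Longrightarrow> F u x w = \<zero>\<^bsub>M\<^esub>) \<Longrightarrow> psum M F xs = \<zero>\<^bsub>M\<^esub>"
proof (induct xs arbitrary: F)
  case (Cons x xs)
  show ?case using Cons.prems[of "[]"] Cons.hyps[of "\<lambda>u. F (x # u)"] Cons.prems by simp
qed simp

lemma add_exchange:
  assumes "a \<in> carrier M" "b \<in> carrier M" "c \<in> carrier M" "e \<in> carrier M"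
  shows "(a \<oplus>\<^bsub>M\<^esub> b) \<oplus>\<^bsub>M\<^esub> (c \<oplus>\<^bsub>M\<^esub> e) = (a \<oplus>\<^bsub>M\<^esub> c) \<oplus>\<^bsub>M\<^esub> (b \<oplus>\<^bsub>M\<^esub> e)"
  using assms by (simp add: M.a_ac)

lemma dsum_add:
  assumes "\<And>u w. u @ w = xs \<Longrightarrow> F u w \<in> carrier M" "\<And>u w. u @ w = xs \<Longrightarrow> G u w \<in> carrier M"
  shows "dsum M (\<lambda>u w. F u w \<oplus>\<^bsub>M\<^esub> G u w) xs = dsum M F xs \<oplus>\<^bsub>M\<^esub> dsum M G xs"
  using assms
proof (induct xs arbitrary: F G)
  case (Cons x xs)
  have "dsum M (\<lambda>u w. F (x # u) w \<oplus>\<^bsub>M\<^esub> G (x # u) w) xs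
      = dsum M (\<lambda>u. F (x # u)) xs \<oplus>\<^bsub>M\<^esub> dsum M (\<lambda>u. G (x # u)) xs"
    by (rule Cons.hyps) (use Cons.prems in auto)
  moreover have "dsum M (\<lambda>u. F (x # u)) xs \<in> carrier M" "dsum M (\<lambda>u. G (x # u)) xs \<in> carrier M"
    using Cons.prems by auto
  ultimately show ?case using Cons.prems[of "[]"] by (simp add: add_exchange)
qed simp

lemma psum_add:
  assumes "\<And>u x w. u @ x # w = xs \<Longrightarrow> F u x w \<in> carrier M" "\<And>u x w. u @ x # w = xs \<Longrightarrow> G u x w \<in> carrier M"
  shows "psum M (\<lambda>u x w. F u x w \<oplus>\<^bsub>M\<^esub> G u x w) xs = psum M F xs \<oplus>\<^bsub>M\<^esub> psum M G xs"
  using assms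
proof (induct xs arbitrary: F G)
  case (Cons x xs)
  have "psum M (\<lambda>u y w. F (x # u) y w \<oplus>\<^bsub>M\<^esub> G (x # u) y w) xs
      = psum M (\<lambda>u. F (x # u)) xs \<oplus>\<^bsub>M\<^esub> psum M (\<lambda>u. G (x # u)) xs"
    by (rule Cons.hyps) (use Cons.prems in auto)
  moreover have "psum M (\<lambda>u. F (x # u)) xs \<in> carrier M" "psum M (\<lambda>u. G (x # u)) xs \<in> carrier M"
    using Cons.prems by auto
  ultimately show ?case using Cons.prems[of "[]"] by (simp add: add_exchange)
qed simp

lemma dsum_additive:
  assumes "\<And>x y. x \<in> carrier M \<Longrightarrow> y \<in> carrier M \<Longrightarrow> h (x \<oplus>\<^bsub>M\<^esub> y) = h x \<oplus>\<^bsub>N\<^esub> h y"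
    and "\<And>u w. u @ w = xs \<Longrightarrow> F u w \<in> carrier M"
  shows "h (dsum M F xs) = dsum N (\<lambda>u w. h (F u w)) xs"
  using assms(2)
proof (induct xs arbitrary: F)
  case (Cons x xs)
  have "dsum M (\<lambda>u. F (x # u)) xs \<in> carrier M" "F [] (x # xs) \<in> carrier M" using Cons.prems by auto
  thus ?case using Cons.hyps[of "\<lambda>u. F (x # u)"] Cons.prems by (simp add: assms(1))
qed simp

lemma psum_additive:
  assumes "\<And>x y. x \<in> carrier M \<Longrightarrow> y \<in> carrier M \<Longrightarrow> h (x \<oplus>\<^bsub>M\<^esub> y) = h x \<oplus>\<^bsub>N\<^esub> h y"
    and "h \<zero>\<^bsub>M\<^esub> = \<zero>\<^bsub>N\<^esub>" and "\<And>u x w. u @ x # w = xs \<Longrightarrow> F u x w \<in> carrier M"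
  shows "h (psum M F xs) = psum N (\<lambda>u x w. h (F u x w)) xs"
  using assms(3)
proof (induct xs arbitrary: F)
  case (Cons x xs)
  have "psum M (\<lambda>u. F (x # u)) xs \<in> carrier M" "F [] x xs \<in> carrier M" using Cons.prems by auto
  thus ?case using Cons.hyps[of "\<lambda>u. F (x # u)"] Cons.prems by (simp add: assms(1))
qed (simp add: assms(2))

lemma dsum_signed: "(\<And>u w. u @ w = xs \<Longrightarrow> F u w \<in> carrier M) \<Longrightarrow>
    signed M k (dsum M F xs) = dsum M (\<lambda>u w. signed M k (F u w)) xs"
  by (rule dsum_additive) (auto simp: signed_add)

lemma psum_signed: "(\<And>u x w. u @ x # w = xs \<Longrightarrow> F u x w \<in> carrier M) \<Longrightarrow>
    signed M k (psum M F xs) = psum M (\<lambda>u x w. signed M k (F u x w)) xs"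
  by (rule psum_additive) (auto simp: signed_add)

lemma dsum_smult: "a \<in> carrier R \<Longrightarrow> (\<And>u w. u @ w = xs \<Longrightarrow> F u w \<in> carrier M) \<Longrightarrow>
    a \<odot>\<^bsub>M\<^esub> dsum M F xs = dsum M (\<lambda>u w. a \<odot>\<^bsub>M\<^esub> F u w) xs"
  by (rule dsum_additive) (auto simp: smult_r_distr)

lemma dsum_append:
  assumes "\<And>u w. u @ w = us @ x # ws \<Longrightarrow> F u w \<in> carrier M"
  shows "dsum M F (us @ x # ws) =
    dsum M (\<lambda>p q. F p (q @ x # ws)) us \<oplus>\<^bsub>M\<^esub> dsum M (\<lambda>p q. F (us @ x # p) q) ws"
  using assms
proof (induct us arbitrary: F)
  case (Cons y us)
  have "dsum M (\<lambda>u. F (y # u)) (us @ x # ws) =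
    dsum M (\<lambda>p q. F (y # p) (q @ x # ws)) us \<oplus>\<^bsub>M\<^esub> dsum M (\<lambda>p q. F (y # us @ x # p) q) ws"
    by (rule Cons.hyps) (use Cons.prems in auto)
  moreover have "F [] (y # us @ x # ws) \<in> carrier M"
    "dsum M (\<lambda>p q. F (y # p) (q @ x # ws)) us \<in> carrier M"
    "dsum M (\<lambda>p q. F (y # us @ x # p) q) ws \<in> carrier M"
    using Cons.prems by auto
  ultimately show ?case by (simp add: M.a_assoc)
qed auto

lemma psum_append:
  assumes "\<And>u y w. u @ y # w = us @ x # ws \<Longrightarrow> F u y w \<in> carrier M"
  shows "psum M F (us @ x # ws) =
    psum M (\<lambda>p y q. F p y (q @ x # ws)) us \<oplus>\<^bsub>M\<^esub>
      (F us x ws \<oplus>\<^bsub>M\<^esub> psum M (\<lambda>p y q. F (us @ x # p) y q) ws)"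
  using assms
proof (induct us arbitrary: F)
  case Nil
  have "F [] x ws \<in> carrier M" "psum M (\<lambda>p y q. F (x # p) y q) ws \<in> carrier M" using Nil by auto
  thus ?case by simp
next
  case (Cons y us)
  have "psum M (\<lambda>u. F (y # u)) (us @ x # ws) =
    psum M (\<lambda>p z q. F (y # p) z (q @ x # ws)) us \<oplus>\<^bsub>M\<^esub>
      (F (y # us) x ws \<oplus>\<^bsub>M\<^esub> psum M (\<lambda>p z q. F (y # us @ x # p) z q) ws)"
    by (rule Cons.hyps) (use Cons.prems in auto)
  moreover have "F [] y (us @ x # ws) \<in> carrier M" "F (y # us) x ws \<in> carrier M"
    "psum M (\<lambda>p z q. F (y # p) z (q @ x # ws)) us \<in> carrier M"
    "psum M (\<lambda>p z q. F (y # us @ x # p) z q) ws \<in> carrier M"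
    using Cons.prems by auto
  ultimately show ?case by (simp add: M.a_assoc)
qed

lemma dsum_single:
  assumes "\<And>u w. u @ w = xs \<Longrightarrow> length u \<noteq> n \<Longrightarrow> F u w = \<zero>\<^bsub>M\<^esub>"
    and "n \<le> length xs \<Longrightarrow> F (take n xs) (drop n xs) \<in> carrier M"
  shows "dsum M F xs = (if n \<le> length xs then F (take n xs) (drop n xs) else \<zero>\<^bsub>M\<^esub>)"
  using assms
proof (induct xs arbitrary: F n)
  case (Cons x xs)
  show ?case
  proof (cases n)
    case 0
    have "dsum M (\<lambda>u. F (x # u)) xs = \<zero>\<^bsub>M\<^esub>" using Cons.prems 0 by (intro dsum_zero) auto
    thus ?thesis using Cons.prems(2) 0 by simp
  next
    case (Suc m)
    have "dsum M (\<lambda>u. F (x # u)) xs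
        = (if m \<le> length xs then F (x # take m xs) (drop m xs) else \<zero>\<^bsub>M\<^esub>)"
      by (rule Cons.hyps) (use Cons.prems Suc in auto)
    moreover have "F [] (x # xs) = \<zero>\<^bsub>M\<^esub>" using Cons.prems Suc by auto
    ultimately show ?thesis using Cons.prems(2) Suc by simp
  qed
qed auto

lemma dsum_finsum:
  assumes "\<And>u w. u @ w = xs \<Longrightarrow> F u w \<in> carrier M"
  shows "dsum M F xs = finsum M (\<lambda>k. F (take k xs) (drop k xs)) {..length xs}"
  using assms
proof (induct xs arbitrary: F)
  case (Cons x xs)
  have "dsum M (\<lambda>u. F (x # u)) xs = finsum M (\<lambda>k. F (x # take k xs) (drop k xs)) {..length xs}"
    by (rule Cons.hyps) (use Cons.prems in auto)
  moreover have c: "F (take k (x # xs)) (drop k (x # xs)) \<in> carrier M" for k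
    by (rule Cons.prems) simp
  moreover have "finsum M (\<lambda>k. F (take (Suc k) (x # xs)) (drop (Suc k) (x # xs))) {..length xs} \<in> carrier M"
    using c[of "Suc _"] by (intro M.finsum_closed) auto
  ultimately show ?case using c[of 0] M.finsum_Suc2[of "\<lambda>k. F (take k (x # xs)) (drop k (x # xs))" "length xs"]
    by (simp add: Pi_def M.a_comm)
qed simp

lemma dsum_of_finsum:
  assumes "\<And>i u w. i \<in> I \<Longrightarrow> u @ w = xs \<Longrightarrow> F i u w \<in> carrier M"
  shows "dsum M (\<lambda>u w. finsum M (\<lambda>i. F i u w) I) xs = finsum M (\<lambda>i. dsum M (F i) xs) I"
  using assms
proof (induct xs arbitrary: F)
  case (Cons x xs)
  have "dsum M (\<lambda>u w. finsum M (\<lambda>i. F i (x # u) w) I) xs = finsum M (\<lambda>i. dsum M (\<lambda>u. F i (x # u)) xs) I"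
    by (rule Cons.hyps) (use Cons.prems in auto)
  moreover have "(\<lambda>i. F i [] (x # xs)) \<in> I \<rightarrow> carrier M" "(\<lambda>i. dsum M (\<lambda>u. F i (x # u)) xs) \<in> I \<rightarrow> carrier M"
    using Cons.prems by auto
  ultimately show ?case by (simp add: M.finsum_addf)
qed simp

lemma dsum_swap:
  assumes "\<And>u w p q. u @ w = xs \<Longrightarrow> p @ q = ys \<Longrightarrow> F u w p q \<in> carrier M"
  shows "dsum M (\<lambda>u w. dsum M (\<lambda>p q. F u w p q) ys) xs = dsum M (\<lambda>p q. dsum M (\<lambda>u w. F u w p q) xs) ys"
  using assms
proof (induct xs arbitrary: F)
  case (Cons x xs)
  have "dsum M (\<lambda>u w. dsum M (\<lambda>p q. F (x # u) w p q) ys) xs = dsum M (\<lambda>p q. dsum M (\<lambda>u w. F (x # u) w p q) xs) ys"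
    by (rule Cons.hyps) (use Cons.prems in auto)
  thus ?case using Cons.prems by simp (rule dsum_add[symmetric]; auto)
qed simp

lemma dsum_assoc:
  assumes "\<And>u v w. u @ v @ w = xs \<Longrightarrow> F u v w \<in> carrier M"
  shows "dsum M (\<lambda>y w. dsum M (\<lambda>u v. F u v w) y) xs = dsum M (\<lambda>u y. dsum M (\<lambda>v w. F u v w) y) xs"
  using assms
proof (induct xs arbitrary: F)
  case (Cons x xs)
  have "dsum M (\<lambda>y w. F [] (x # y) w \<oplus>\<^bsub>M\<^esub> dsum M (\<lambda>u v. F (x # u) v w) y) xs
      = dsum M (\<lambda>y w. F [] (x # y) w) xs \<oplus>\<^bsub>M\<^esub> dsum M (\<lambda>y w. dsum M (\<lambda>u v. F (x # u) v w) y) xs"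
    by (rule dsum_add) (use Cons.prems in auto)
  also have "dsum M (\<lambda>y w. dsum M (\<lambda>u v. F (x # u) v w) y) xs
      = dsum M (\<lambda>u y. dsum M (\<lambda>v w. F (x # u) v w) y) xs"
    by (rule Cons.hyps) (use Cons.prems in auto)
  finally have 1: "dsum M (\<lambda>y w. F [] (x # y) w \<oplus>\<^bsub>M\<^esub> dsum M (\<lambda>u v. F (x # u) v w) y) xs
      = dsum M (\<lambda>y w. F [] (x # y) w) xs \<oplus>\<^bsub>M\<^esub> dsum M (\<lambda>u y. dsum M (\<lambda>v w. F (x # u) v w) y) xs" .
  have "F [] [] (x # xs) \<in> carrier M" "dsum M (\<lambda>y w. F [] (x # y) w) xs \<in> carrier M"
    "dsum M (\<lambda>u y. dsum M (\<lambda>v w. F (x # u) v w) y) xs \<in> carrier M"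
    using Cons.prems by (auto intro!: dsum_closed)
  thus ?case by (simp add: 1 M.a_assoc)
qed simp

lemma dsum_dsum_psum:
  assumes "\<And>u v w. u @ v @ w = xs \<Longrightarrow> length v \<noteq> 1 \<Longrightarrow> F u v w = \<zero>\<^bsub>M\<^esub>"
    and "\<And>u x w. u @ x # w = xs \<Longrightarrow> F u [x] w \<in> carrier M"
  shows "dsum M (\<lambda>u y. dsum M (\<lambda>v w. F u v w) y) xs = psum M (\<lambda>u x w. F u [x] w) xs"
  using assms
proof (induct xs arbitrary: F)
  case (Cons x xs)
  have "dsum M (\<lambda>u y. dsum M (\<lambda>v w. F (x # u) v w) y) xs = psum M (\<lambda>u y w. F (x # u) [y] w) xs"
    by (rule Cons.hyps) (use Cons.prems in auto)
  moreover have "dsum M (\<lambda>v w. F [] v w) (x # xs) = F [] [x] xs"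
    using dsum_single[of "x # xs" 1 "F []"] Cons.prems by auto
  ultimately show ?case by simp
qed auto

text \<open>The left-hand sides are the forms in which double insertions occur: the second insertion is to the
  left of the first, around it, or inside it.\<close>

lemma dsum5:
  assumes "\<And>p q r v w. p @ q @ r @ v @ w = xs \<Longrightarrow> H p q r v w \<in> carrier M"
  shows "dsum M (\<lambda>u y. dsum M (\<lambda>v w. dsum M (\<lambda>p q'. dsum M (\<lambda>q r. H p q r v w) q') u) y) xs =
      dsum M (\<lambda>p y. dsum M (\<lambda>q y. dsum M (\<lambda>r y. dsum M (\<lambda>v w. H p q r v w) y) y) y) xs" (is "?A = ?D")
    and "dsum M (\<lambda>u y. dsum M (\<lambda>v w'. dsum M (\<lambda>p q. dsum M (\<lambda>r w. H p q v r w) w') u) y) xs =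
      dsum M (\<lambda>p y. dsum M (\<lambda>q y. dsum M (\<lambda>r y. dsum M (\<lambda>v w. H p q r v w) y) y) y) xs" (is "?B = _")
    and "dsum M (\<lambda>p y. dsum M (\<lambda>t w. dsum M (\<lambda>q y. dsum M (\<lambda>r v. H p q r v w) y) t) y) xs =
      dsum M (\<lambda>p y. dsum M (\<lambda>q y. dsum M (\<lambda>r y. dsum M (\<lambda>v w. H p q r v w) y) y) y) xs" (is "?C = _")
proof -
  have "?A = dsum M (\<lambda>u y. dsum M (\<lambda>p q'. dsum M (\<lambda>v w. dsum M (\<lambda>q r. H p q r v w) q') y) u) xs"
    by (intro dsum_cong dsum_swap dsum_closed assms) auto
  also have "\<dots> = dsum M (\<lambda>p y. dsum M (\<lambda>q' y. dsum M (\<lambda>v w. dsum M (\<lambda>q r. H p q r v w) q') y) y) xs"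
    by (intro dsum_assoc dsum_closed assms) auto
  also have "\<dots> = dsum M (\<lambda>p y. dsum M (\<lambda>q' y. dsum M (\<lambda>q r. dsum M (\<lambda>v w. H p q r v w) y) q') y) xs"
    by (intro dsum_cong dsum_swap dsum_closed assms) auto
  also have "\<dots> = ?D"
    by (intro dsum_cong dsum_assoc dsum_closed assms) auto
  finally show "?A = ?D" .
  have "?B = dsum M (\<lambda>u y. dsum M (\<lambda>p q. dsum M (\<lambda>v w'. dsum M (\<lambda>r w. H p q v r w) w') y) u) xs"
    by (intro dsum_cong dsum_swap dsum_closed assms) auto
  also have "\<dots> = ?D"
    by (intro dsum_assoc dsum_closed assms) auto
  finally show "?B = ?D" .
  have "?C = dsum M (\<lambda>p y. dsum M (\<lambda>q t. dsum M (\<lambda>y w. dsum M (\<lambda>r v. H p q r v w) y) t) y) xs"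
    by (intro dsum_cong dsum_assoc dsum_closed assms) auto
  also have "\<dots> = ?D"
    by (intro dsum_cong dsum_assoc dsum_closed assms) auto
  finally show "?C = ?D" .
qed

end


section \<open>Multilinear families and their composition\<close>

text \<open>The degree of a word in the suspension, where a letter of degree \<open>i\<close> has degree \<open>i + 1\<close>.\<close>

definition sdeg :: "(int \<times> 'a) list \<Rightarrow> int" where
  "sdeg ws = wdeg ws + int (length ws)"

lemma sdeg_simps [simp]: "sdeg [] = 0" "sdeg (w # ws) = fst w + 1 + sdeg ws" "sdeg (us @ ws) = sdeg us + sdeg ws"
  by (simp_all add: sdeg_def)

locale graded_mod =
  fixes R :: "('r, 'c) ring_scheme" and V :: "('r, 'a) gmodule"
  assumes graded: "graded_module R V"

sublocale graded_mod \<subseteq> V: plain_module R "V i" for i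
  using graded by (simp add: graded_module_def plain_module_def)

text \<open>A multilinear map in each arity. The one of arity \<open>n\<close> has degree \<open>n - 1 + s\<close>, which is \<open>s\<close> in terms
  of the suspension; the operations of an \<open>A\<^sub>\<infinity>\<close>-algebra form a family with \<open>s = -1\<close>.\<close>

definition mfam :: "('r, 'c) ring_scheme \<Rightarrow> ('r, 'a) gmodule \<Rightarrow> int \<Rightarrow> ((int \<times> 'a) list \<Rightarrow> 'a) \<Rightarrow> bool" where
  "mfam R V s \<phi> \<longleftrightarrow> (\<forall>n. mlin R V n V (int n - 1 + s) \<phi>)"

text \<open>The sum of all insertions of \<open>\<psi>\<close> into \<open>\<phi>\<close>. The sign is the Koszul sign for moving \<open>\<psi>\<close>, of degree \<open>t\<close>, past
  \<open>u\<close> in the suspension, and \<open>sdeg v + t - 1\<close> is the degree of \<open>\<psi> v\<close> before suspension.\<close>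

definition icomp :: "('r, 'a) gmodule \<Rightarrow> int \<Rightarrow> int \<Rightarrow> ((int \<times> 'a) list \<Rightarrow> 'a) \<Rightarrow> ((int \<times> 'a) list \<Rightarrow> 'a)
    \<Rightarrow> (int \<times> 'a) list \<Rightarrow> 'a" where
  "icomp V s t \<phi> \<psi> ws =
    dsum (V (sdeg ws + s + t - 1)) (\<lambda>u y. dsum (V (sdeg ws + s + t - 1)) (\<lambda>v w.
      signed (V (sdeg ws + s + t - 1)) (t * sdeg u) (\<phi> (u @ (sdeg v + t - 1, \<psi> v) # w))) y) ws"

lemma mfam_closed: "mfam R V s \<phi> \<Longrightarrow> ws \<in> words V \<Longrightarrow> d = sdeg ws + s - 1 \<Longrightarrow> \<phi> ws \<in> carrier (V d)"
  unfolding mfam_def sdeg_def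
  by (rule mlin_closed[where R = R and n = "length ws" and j = "int (length ws) - 1 + s"]) auto

context graded_mod
begin

lemma mfamI:
  assumes "\<And>ws. ws \<in> words V \<Longrightarrow> \<phi> ws \<in> carrier (V (sdeg ws + s - 1))"
    and "\<And>us i x y ws. us \<in> words V \<Longrightarrow> ws \<in> words V \<Longrightarrow> x \<in> carrier (V i) \<Longrightarrow> y \<in> carrier (V i) \<Longrightarrow>
        \<phi> (us @ (i, x \<oplus>\<^bsub>V i\<^esub> y) # ws) =
          \<phi> (us @ (i, x) # ws) \<oplus>\<^bsub>V (sdeg us + i + sdeg ws + s)\<^esub> \<phi> (us @ (i, y) # ws)"
    and "\<And>us i x a ws. us \<in> words V \<Longrightarrow> ws \<in> words V \<Longrightarrow> x \<in> carrier (V i) \<Longrightarrow> a \<in> carrier R \<Longrightarrow>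
        \<phi> (us @ (i, a \<odot>\<^bsub>V i\<^esub> x) # ws) =
          a \<odot>\<^bsub>V (sdeg us + i + sdeg ws + s)\<^esub> \<phi> (us @ (i, x) # ws)"
  shows "mfam R V s \<phi>"
proof -
  have e: "wdeg us + i + wdeg ws + (int n - 1 + s) = sdeg us + i + sdeg ws + s"
    if "length us + length ws + 1 = n" for us ws :: "(int \<times> 'a) list" and i n
    using that by (auto simp: sdeg_def)
  have e': "wdeg ws + (int (length ws) - 1 + s) = sdeg ws + s - 1" for ws :: "(int \<times> 'a) list"
    by (simp add: sdeg_def)
  show ?thesis
    unfolding mfam_def
  proof (intro allI mlinI, goal_cases)
    case (1 n ws)
    show ?case unfolding 1(2)[symmetric] e' by (rule assms(1)[OF 1(1)])
  next
    case (2 n us i x y ws)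
    show ?case unfolding e[OF 2(5)] using assms(2) 2 by blast
  next
    case (3 n us i x a ws)
    show ?case unfolding e[OF 3(5)] using assms(3) 3 by blast
  qed
qed

lemma mfam_slot:
  assumes "mfam R V s \<phi>" "us \<in> words V" "ws \<in> words V" "d = sdeg us + i + sdeg ws + s"
  shows "(\<lambda>x\<in>carrier (V i). \<phi> (us @ (i, x) # ws)) \<in> mod_hom R (V i) (V d)"
proof (rule mod_homI)
  let ?n = "length us + length ws + 1"
  have m: "mlin R V ?n V (int ?n - 1 + s) \<phi>" using assms(1) unfolding mfam_def by blast
  have d: "d = wdeg us + i + wdeg ws + (int ?n - 1 + s)" using assms(4) by (simp add: sdeg_def)
  fix x assume x: "x \<in> carrier (V i)"
  show "(\<lambda>x\<in>carrier (V i). \<phi> (us @ (i, x) # ws)) x \<in> carrier (V d)"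
    using x assms by (auto intro!: mfam_closed[OF assms(1)])
  show "(\<lambda>x\<in>carrier (V i). \<phi> (us @ (i, x) # ws)) (a \<odot>\<^bsub>V i\<^esub> x) =
      a \<odot>\<^bsub>V d\<^esub> (\<lambda>x\<in>carrier (V i). \<phi> (us @ (i, x) # ws)) x" if "a \<in> carrier R" for a
    using that x mlin_smult[OF m assms(2,3) x that _ d] by simp
  show "(\<lambda>x\<in>carrier (V i). \<phi> (us @ (i, x) # ws)) (x \<oplus>\<^bsub>V i\<^esub> y) =
      (\<lambda>x\<in>carrier (V i). \<phi> (us @ (i, x) # ws)) x \<oplus>\<^bsub>V d\<^esub> (\<lambda>x\<in>carrier (V i). \<phi> (us @ (i, x) # ws)) y"
    if "y \<in> carrier (V i)" for y
    using that x mlin_add[OF m assms(2,3) x that _ d] by simp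
qed simp

lemma mfam_add:
  assumes "mfam R V s \<phi>" "us \<in> words V" "ws \<in> words V" "x \<in> carrier (V i)" "y \<in> carrier (V i)"
    and "d = sdeg us + i + sdeg ws + s"
  shows "\<phi> (us @ (i, x \<oplus>\<^bsub>V i\<^esub> y) # ws) = \<phi> (us @ (i, x) # ws) \<oplus>\<^bsub>V d\<^esub> \<phi> (us @ (i, y) # ws)"
  using mod_hom_add[OF mfam_slot[OF assms(1-3,6)] assms(4,5)] assms by simp

lemma mfam_smult:
  assumes "mfam R V s \<phi>" "us \<in> words V" "ws \<in> words V" "x \<in> carrier (V i)" "a \<in> carrier R"
    and "d = sdeg us + i + sdeg ws + s"
  shows "\<phi> (us @ (i, a \<odot>\<^bsub>V i\<^esub> x) # ws) = a \<odot>\<^bsub>V d\<^esub> \<phi> (us @ (i, x) # ws)"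
  using mod_hom_smult[OF mfam_slot[OF assms(1-3,6)] assms(5,4)] assms by simp

lemma mfam_zero:
  assumes "mfam R V s \<phi>" "us \<in> words V" "ws \<in> words V" "d = sdeg us + i + sdeg ws + s"
  shows "\<phi> (us @ (i, \<zero>\<^bsub>V i\<^esub>) # ws) = \<zero>\<^bsub>V d\<^esub>"
  using mod_hom_zero[OF V.module_axioms V.module_axioms mfam_slot[OF assms]] assms by simp

lemma mfam_minus:
  assumes "mfam R V s \<phi>" "us \<in> words V" "ws \<in> words V" "x \<in> carrier (V i)" "y \<in> carrier (V i)"
    and "d = sdeg us + i + sdeg ws + s"
  shows "\<phi> (us @ (i, x \<ominus>\<^bsub>V i\<^esub> y) # ws) = \<phi> (us @ (i, x) # ws) \<ominus>\<^bsub>V d\<^esub> \<phi> (us @ (i, y) # ws)"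
  using mod_hom_minus[OF V.module_axioms V.module_axioms mfam_slot[OF assms(1-3,6)] assms(4,5)] assms by simp

lemma mfam_signed:
  assumes "mfam R V s \<phi>" "us \<in> words V" "ws \<in> words V" "x \<in> carrier (V i)"
    and "d = sdeg us + i + sdeg ws + s"
  shows "\<phi> (us @ (i, signed (V i) k x) # ws) = signed (V d) k (\<phi> (us @ (i, x) # ws))"
  using mod_hom_signed[OF V.module_axioms V.module_axioms mfam_slot[OF assms(1-3,5)] assms(4)] assms by simp

lemma mfam_dsum:
  assumes "mfam R V s \<phi>" "us \<in> words V" "ws \<in> words V" "\<And>u w. u @ w = xs \<Longrightarrow> F u w \<in> carrier (V i)"
    and "d = sdeg us + i + sdeg ws + s"
  shows "\<phi> (us @ (i, dsum (V i) F xs) # ws) = dsum (V d) (\<lambda>u w. \<phi> (us @ (i, F u w) # ws)) xs"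
  by (rule V.dsum_additive) (use mfam_add[OF assms(1-3) _ _ assms(5)] assms(4) in auto)

lemma icomp_term_closed:
  assumes "mfam R V s \<phi>" "mfam R V t \<psi>" "u \<in> words V" "v \<in> words V" "w \<in> words V"
    and "d = sdeg u + sdeg v + sdeg w + s + t - 1"
  shows "\<phi> (u @ (sdeg v + t - 1, \<psi> v) # w) \<in> carrier (V d)"
  using assms by (intro mfam_closed[OF assms(1)]) (auto intro: mfam_closed[OF assms(2)])

text \<open>The inserted word lies before the letter \<open>z\<close>, contains it, or lies after it.\<close>

lemma icomp_append:
  assumes \<phi>: "mfam R V s \<phi>" and \<psi>: "mfam R V t \<psi>" and w: "us \<in> words V" "ws \<in> words V" "z \<in> carrier (V i)"
    and d: "d = sdeg us + i + sdeg ws + s + t"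
  shows "icomp V s t \<phi> \<psi> (us @ (i, z) # ws) =
    dsum (V d) (\<lambda>p y. dsum (V d) (\<lambda>q r.
        signed (V d) (t * sdeg p) (\<phi> (p @ (sdeg q + t - 1, \<psi> q) # r @ (i, z) # ws))) y) us \<oplus>\<^bsub>V d\<^esub>
    dsum (V d) (\<lambda>p q. dsum (V d) (\<lambda>r y.
        signed (V d) (t * sdeg p) (\<phi> (p @ (sdeg q + i + sdeg r + t, \<psi> (q @ (i, z) # r)) # y))) ws) us \<oplus>\<^bsub>V d\<^esub>
    dsum (V d) (\<lambda>p y. dsum (V d) (\<lambda>q r.
        signed (V d) (t * (sdeg us + i + 1 + sdeg p)) (\<phi> (us @ (i, z) # p @ (sdeg q + t - 1, \<psi> q) # r))) y) ws"
proof -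
  let ?D = "dsum (V d)"
  define T where "T = (\<lambda>p q r. signed (V d) (t * sdeg p) (\<phi> (p @ (sdeg q + t - 1, \<psi> q) # r)))"
  have dd: "sdeg (us @ (i, z) # ws) + s + t - 1 = d" using d by simp
  have Tc: "T p q r \<in> carrier (V d)" if "p @ q @ r = us @ (i, z) # ws" for p q r
  proof -
    have "p @ q @ r \<in> words V" unfolding that using w by simp
    moreover have "sdeg (p @ q @ r) = sdeg (us @ (i, z) # ws)" by (simp only: that)
    ultimately show ?thesis unfolding T_def using d
      by (intro V.signed_closed icomp_term_closed[OF \<phi> \<psi>]) auto
  qed
  have "icomp V s t \<phi> \<psi> (us @ (i, z) # ws) = ?D (\<lambda>p y. ?D (\<lambda>q r. T p q r) y) (us @ (i, z) # ws)"
    unfolding icomp_def dd T_def ..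
  also have "\<dots> = ?D (\<lambda>p y. ?D (\<lambda>q r. T p q r) (y @ (i, z) # ws)) us \<oplus>\<^bsub>V d\<^esub>
      ?D (\<lambda>p y. ?D (\<lambda>q r. T (us @ (i, z) # p) q r) y) ws"
    by (rule V.dsum_append) (auto intro!: V.dsum_closed Tc)
  also have "?D (\<lambda>p y. ?D (\<lambda>q r. T p q r) (y @ (i, z) # ws)) us =
      ?D (\<lambda>p y. ?D (\<lambda>q r. T p q (r @ (i, z) # ws)) y \<oplus>\<^bsub>V d\<^esub> ?D (\<lambda>r y'. T p (y @ (i, z) # r) y') ws) us"
    by (intro dsum_cong V.dsum_append) (auto intro!: Tc)
  also have "\<dots> = ?D (\<lambda>p y. ?D (\<lambda>q r. T p q (r @ (i, z) # ws)) y) us \<oplus>\<^bsub>V d\<^esub>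
      ?D (\<lambda>p y. ?D (\<lambda>r y'. T p (y @ (i, z) # r) y') ws) us"
    by (rule V.dsum_add) (auto intro!: Tc V.dsum_closed)
  finally show ?thesis by (simp add: T_def algebra_simps)
qed

lemma mfam_icomp:
  assumes \<phi>: "mfam R V s \<phi>" and \<psi>: "mfam R V t \<psi>"
  shows "mfam R V (s + t) (icomp V s t \<phi> \<psi>)"
proof (rule mfamI)
  fix ws assume "ws \<in> words V"
  thus "icomp V s t \<phi> \<psi> ws \<in> carrier (V (sdeg ws + (s + t) - 1))"
    unfolding icomp_def by (auto intro!: V.dsum_closed V.signed_closed icomp_term_closed[OF \<phi> \<psi>] simp: add.assoc[symmetric])
next
  fix us i x ws assume w: "us \<in> words V" "ws \<in> words V" "x \<in> carrier (V i)"
  define d where "d = sdeg us + i + sdeg ws + s + t"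
  note split = icomp_append[OF \<phi> \<psi> w(1,2) _ d_def]
  define X1 where "X1 = (\<lambda>z. dsum (V d) (\<lambda>p y. dsum (V d) (\<lambda>q r.
        signed (V d) (t * sdeg p) (\<phi> (p @ (sdeg q + t - 1, \<psi> q) # r @ (i, z) # ws))) y) us)"
  define X2 where "X2 = (\<lambda>z. dsum (V d) (\<lambda>p q. dsum (V d) (\<lambda>r y.
        signed (V d) (t * sdeg p) (\<phi> (p @ (sdeg q + i + sdeg r + t, \<psi> (q @ (i, z) # r)) # y))) ws) us)"
  define X3 where "X3 = (\<lambda>z. dsum (V d) (\<lambda>p y. dsum (V d) (\<lambda>q r.
        signed (V d) (t * (sdeg us + i + 1 + sdeg p)) (\<phi> (us @ (i, z) # p @ (sdeg q + t - 1, \<psi> q) # r))) y) ws)"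
  have s: "icomp V s t \<phi> \<psi> (us @ (i, z) # ws) = X1 z \<oplus>\<^bsub>V d\<^esub> X2 z \<oplus>\<^bsub>V d\<^esub> X3 z" if "z \<in> carrier (V i)" for z
    unfolding X1_def X2_def X3_def by (rule split[OF that])
  have lin: "X z \<in> carrier (V d)" "z' \<in> carrier (V i) \<Longrightarrow> X (z \<oplus>\<^bsub>V i\<^esub> z') = X z \<oplus>\<^bsub>V d\<^esub> X z'"
    "a \<in> carrier R \<Longrightarrow> X (a \<odot>\<^bsub>V i\<^esub> z) = a \<odot>\<^bsub>V d\<^esub> X z"
    if X: "X = (\<lambda>z. dsum (V d) (\<lambda>p y. dsum (V d) (\<lambda>q r. signed (V d) (k p q y r) (F p q y r z)) (ys y)) xs)"
      and F: "\<And>p q y r. p @ y = xs \<Longrightarrow> q @ r = ys y \<Longrightarrow>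
        (\<lambda>z\<in>carrier (V i). F p q y r z) \<in> mod_hom R (V i) (V d)"
      and z: "z \<in> carrier (V i)" for X F ys xs and k :: "_ \<Rightarrow> _ \<Rightarrow> _ \<Rightarrow> _ \<Rightarrow> int" and z z' a
  proof -
    have c: "F p q y r z \<in> carrier (V d)" if "p @ y = xs" "q @ r = ys y" "z \<in> carrier (V i)" for p q y r z
      using mod_hom_closed[OF F[OF that(1,2)] that(3)] that by simp
    show "X z \<in> carrier (V d)" unfolding X using z by (intro V.dsum_closed V.signed_closed c)
    show "X (z \<oplus>\<^bsub>V i\<^esub> z') = X z \<oplus>\<^bsub>V d\<^esub> X z'" if z': "z' \<in> carrier (V i)"
    proof -
      have "F p q y r (z \<oplus>\<^bsub>V i\<^esub> z') = F p q y r z \<oplus>\<^bsub>V d\<^esub> F p q y r z'" if "p @ y = xs" "q @ r = ys y" for p q y r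
        using mod_hom_add[OF F[OF that] z z'] z z' by simp
      hence "X (z \<oplus>\<^bsub>V i\<^esub> z') = dsum (V d) (\<lambda>p y. dsum (V d) (\<lambda>q r.
          signed (V d) (k p q y r) (F p q y r z) \<oplus>\<^bsub>V d\<^esub> signed (V d) (k p q y r) (F p q y r z')) (ys y)) xs"
        unfolding X using z z' c by (intro dsum_cong) (simp add: V.signed_add)
      also have "\<dots> = dsum (V d) (\<lambda>p y. dsum (V d) (\<lambda>q r. signed (V d) (k p q y r) (F p q y r z)) (ys y) \<oplus>\<^bsub>V d\<^esub>
          dsum (V d) (\<lambda>q r. signed (V d) (k p q y r) (F p q y r z')) (ys y)) xs"
        using z z' c by (intro dsum_cong V.dsum_add) auto
      also have "\<dots> = X z \<oplus>\<^bsub>V d\<^esub> X z'" unfolding X using z z' c by (intro V.dsum_add) (auto intro!: V.dsum_closed)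
      finally show ?thesis .
    qed
    show "X (a \<odot>\<^bsub>V i\<^esub> z) = a \<odot>\<^bsub>V d\<^esub> X z" if a: "a \<in> carrier R"
    proof -
      have "F p q y r (a \<odot>\<^bsub>V i\<^esub> z) = a \<odot>\<^bsub>V d\<^esub> F p q y r z" if "p @ y = xs" "q @ r = ys y" for p q y r
        using mod_hom_smult[OF F[OF that] a z] z a by simp
      hence "X (a \<odot>\<^bsub>V i\<^esub> z) = dsum (V d) (\<lambda>p y. dsum (V d) (\<lambda>q r.
          a \<odot>\<^bsub>V d\<^esub> signed (V d) (k p q y r) (F p q y r z)) (ys y)) xs"
        unfolding X using z a c by (intro dsum_cong) (simp add: V.signed_smult)
      also have "\<dots> = dsum (V d) (\<lambda>p y. a \<odot>\<^bsub>V d\<^esub> dsum (V d) (\<lambda>q r. signed (V d) (k p q y r) (F p q y r z)) (ys y)) xs"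
        using z a c by (intro dsum_cong V.dsum_smult[symmetric]) auto
      also have "\<dots> = a \<odot>\<^bsub>V d\<^esub> X z" unfolding X using z a c by (intro V.dsum_smult[symmetric]) (auto intro!: V.dsum_closed)
      finally show ?thesis .
    qed
  qed
  have d': "sdeg us + i + sdeg ws + (s + t) = d" by (simp add: d_def)
  have F1: "(\<lambda>z\<in>carrier (V i). \<phi> (p @ (sdeg q + t - 1, \<psi> q) # r @ (i, z) # ws)) \<in> mod_hom R (V i) (V d)"
    if "p @ y = us" "q @ r = y" for p q y r
  proof -
    have "p \<in> words V" "q \<in> words V" "r \<in> words V" using that w by auto
    moreover have "\<psi> q \<in> carrier (V (sdeg q + t - 1))"
      using \<open>q \<in> words V\<close> by (intro mfam_closed[OF \<psi>]) auto
    ultimately show ?thesis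
      using mfam_slot[OF \<phi>, of "p @ (sdeg q + t - 1, \<psi> q) # r" ws d i] that w by (auto simp: d_def add_ac)
  qed
  have F3: "(\<lambda>z\<in>carrier (V i). \<phi> (us @ (i, z) # p @ (sdeg q + t - 1, \<psi> q) # r)) \<in> mod_hom R (V i) (V d)"
    if "p @ y = ws" "q @ r = y" for p q y r
  proof -
    have "p \<in> words V" "q \<in> words V" "r \<in> words V" using that w by auto
    moreover have "\<psi> q \<in> carrier (V (sdeg q + t - 1))"
      using \<open>q \<in> words V\<close> by (intro mfam_closed[OF \<psi>]) auto
    ultimately show ?thesis
      using mfam_slot[OF \<phi>, of us "p @ (sdeg q + t - 1, \<psi> q) # r" d i] that w by (auto simp: d_def add_ac)
  qed
  have F2: "(\<lambda>z\<in>carrier (V i). \<phi> (p @ (sdeg q + i + sdeg r + t, \<psi> (q @ (i, z) # r)) # y)) \<in> mod_hom R (V i) (V d)"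
    if "p @ q = us" "r @ y = ws" for p q y r
  proof -
    have m: "(\<lambda>z\<in>carrier (V i). \<psi> (q @ (i, z) # r)) \<in> mod_hom R (V i) (V (sdeg q + i + sdeg r + t))"
      by (rule mfam_slot[OF \<psi>]) (use that w in auto)
    have "(\<lambda>x\<in>carrier (V (sdeg q + i + sdeg r + t)). \<phi> (p @ (sdeg q + i + sdeg r + t, x) # y))
        \<in> mod_hom R (V (sdeg q + i + sdeg r + t)) (V d)"
      by (rule mfam_slot[OF \<phi>]) (use that w in \<open>auto simp: d_def\<close>)
    from mod_hom_comp[OF m this V.module_axioms] show ?thesis
      using mod_hom_closed[OF m] by (simp cong: restrict_cong)
  qed
  have l1: "X1 z \<in> carrier (V d)" "z' \<in> carrier (V i) \<Longrightarrow> X1 (z \<oplus>\<^bsub>V i\<^esub> z') = X1 z \<oplus>\<^bsub>V d\<^esub> X1 z'"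
    "a \<in> carrier R \<Longrightarrow> X1 (a \<odot>\<^bsub>V i\<^esub> z) = a \<odot>\<^bsub>V d\<^esub> X1 z"
    if "z \<in> carrier (V i)" for z z' a
    by ((rule lin[OF X1_def _ that]; (rule F1; assumption)?; assumption?)+)
  have l2: "X2 z \<in> carrier (V d)" "z' \<in> carrier (V i) \<Longrightarrow> X2 (z \<oplus>\<^bsub>V i\<^esub> z') = X2 z \<oplus>\<^bsub>V d\<^esub> X2 z'"
    "a \<in> carrier R \<Longrightarrow> X2 (a \<odot>\<^bsub>V i\<^esub> z) = a \<odot>\<^bsub>V d\<^esub> X2 z"
    if "z \<in> carrier (V i)" for z z' a
    by ((rule lin[OF X2_def _ that]; (rule F2; assumption)?; assumption?)+)
  have l3: "X3 z \<in> carrier (V d)" "z' \<in> carrier (V i) \<Longrightarrow> X3 (z \<oplus>\<^bsub>V i\<^esub> z') = X3 z \<oplus>\<^bsub>V d\<^esub> X3 z'"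
    "a \<in> carrier R \<Longrightarrow> X3 (a \<odot>\<^bsub>V i\<^esub> z) = a \<odot>\<^bsub>V d\<^esub> X3 z"
    if "z \<in> carrier (V i)" for z z' a
    by ((rule lin[OF X3_def _ that]; (rule F3; assumption)?; assumption?)+)
  show "icomp V s t \<phi> \<psi> (us @ (i, x \<oplus>\<^bsub>V i\<^esub> y) # ws) = icomp V s t \<phi> \<psi> (us @ (i, x) # ws)
      \<oplus>\<^bsub>V (sdeg us + i + sdeg ws + (s + t))\<^esub> icomp V s t \<phi> \<psi> (us @ (i, y) # ws)"
    if y: "y \<in> carrier (V i)" for y
  proof -
    have xy: "x \<oplus>\<^bsub>V i\<^esub> y \<in> carrier (V i)" using w y by simp
    show ?thesis unfolding d' s[OF w(3)] s[OF y] s[OF xy] l1(2)[OF w(3) y] l2(2)[OF w(3) y] l3(2)[OF w(3) y]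
      using l1(1)[OF w(3)] l2(1)[OF w(3)] l3(1)[OF w(3)] l1(1)[OF y] l2(1)[OF y] l3(1)[OF y]
      by (simp add: V.M.a_ac)
  qed
  show "icomp V s t \<phi> \<psi> (us @ (i, a \<odot>\<^bsub>V i\<^esub> x) # ws) =
      a \<odot>\<^bsub>V (sdeg us + i + sdeg ws + (s + t))\<^esub> icomp V s t \<phi> \<psi> (us @ (i, x) # ws)"
    if a: "a \<in> carrier R" for a
  proof -
    have ax: "a \<odot>\<^bsub>V i\<^esub> x \<in> carrier (V i)" using w a by simp
    show ?thesis unfolding d' s[OF w(3)] s[OF ax] l1(3)[OF w(3) a] l2(3)[OF w(3) a] l3(3)[OF w(3) a]
      using l1(1)[OF w(3)] l2(1)[OF w(3)] l3(1)[OF w(3)] a by (simp add: V.smult_r_distr)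
  qed
qed

text \<open>For \<open>b\<close> of odd degree the composite of \<open>\<phi>\<close> with two copies of \<open>b\<close> in different slots occurs twice,
  once for each order of insertion, and the two signs are opposite. What remains are the nested
  insertions. If 2 is not invertible, this does not follow from the graded Jacobi identity.\<close>

theorem icomp_icomp:
  assumes \<phi>: "mfam R V s \<phi>" and b: "mfam R V (- 1) b" and ws: "ws \<in> words V"
  shows "icomp V (s - 1) (- 1) (icomp V s (- 1) \<phi> b) b ws = icomp V s (- 2) \<phi> (icomp V (- 1) (- 1) b b) ws"
proof -
  define d where "d = sdeg ws + s - 3"
  let ?D = "dsum (V d)"
  define B where "B = (\<lambda>v. (sdeg v - 2, b v))"
  have Bw: "snd (B v) \<in> carrier (V (sdeg v - 2))" if "v \<in> words V" for v
    using that by (auto simp: B_def intro!: mfam_closed[OF b])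
  have fB: "fst (B v) = sdeg v - 2" for v by (simp add: B_def)
  \<comment> \<open>The word is cut into five pieces. \<open>b\<close> is inserted at \<open>q\<close> and \<open>v\<close> in \<open>H1\<close> and \<open>H3\<close>, in the two orders, and
    at \<open>v\<close> and around it in \<open>H2\<close>.\<close>
  define H1 where "H1 = (\<lambda>p q r v w. signed (V d) (sdeg q + sdeg r) (\<phi> (p @ B q # r @ B v # w)))"
  define H2 where "H2 = (\<lambda>p q v r w. signed (V d) (sdeg q)
      (\<phi> (p @ (sdeg q + sdeg v + sdeg r - 3, b (q @ B v # r)) # w)))"
  define H3 where "H3 = (\<lambda>p q r v w. signed (V d) (sdeg q + sdeg r + 1) (\<phi> (p @ B q # r @ B v # w)))"
  have split: "p \<in> words V \<and> q \<in> words V \<and> r \<in> words V \<and> v \<in> words V \<and> w \<in> words V \<and>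
      d = sdeg p + sdeg q + sdeg r + sdeg v + sdeg w + s - 3" if "p @ q @ r @ v @ w = ws" for p q r v w
  proof -
    have "p @ q @ r @ v @ w \<in> words V" unfolding that by (rule ws)
    moreover have "sdeg (p @ q @ r @ v @ w) = sdeg ws" by (simp only: that)
    ultimately show ?thesis by (auto simp: d_def)
  qed
  have c1: "\<phi> (p @ B q # r @ B v # w) \<in> carrier (V d)" if "p @ q @ r @ v @ w = ws" for p q r v w
    using split[OF that] by (intro mfam_closed[OF \<phi>]) (auto simp: Bw fB)
  have H1: "H1 p q r v w \<in> carrier (V d)" if "p @ q @ r @ v @ w = ws" for p q r v w
    unfolding H1_def using c1[OF that] by simp
  have H3: "H3 p q r v w \<in> carrier (V d)" if "p @ q @ r @ v @ w = ws" for p q r v w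
    unfolding H3_def using c1[OF that] by simp
  have bc: "b (q @ B v # r) \<in> carrier (V (sdeg q + sdeg v + sdeg r - 3))"
    if "q \<in> words V" "v \<in> words V" "r \<in> words V" for q v r
    using that by (intro mfam_closed[OF b]) (auto simp: Bw fB)
  have H2: "H2 p q v r w \<in> carrier (V d)" if "p @ q @ v @ r @ w = ws" for p q r v w
    unfolding H2_def using split[OF that] bc[of q v r]
    by (intro V.signed_closed mfam_closed[OF \<phi>]) auto
  have X: "signed (V d) (- sdeg u) (icomp V s (- 1) \<phi> b (u @ B v # w)) =
      ?D (\<lambda>p q'. ?D (\<lambda>q r. H1 p q r v w) q') u \<oplus>\<^bsub>V d\<^esub> ?D (\<lambda>p q. ?D (\<lambda>r y. H2 p q v r y) w) u \<oplus>\<^bsub>V d\<^esub>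
      ?D (\<lambda>p y. ?D (\<lambda>q r. H3 u v p q r) y) w"
    if uvw: "u @ v @ w = ws" for u v w
  proof -
    have W: "u \<in> words V" "w \<in> words V" "v \<in> words V" "b v \<in> carrier (V (sdeg v - 2))"
      and d: "d = sdeg u + (sdeg v - 2) + sdeg w + s + - 1"
      using split[of u "[]" "[]" v w] uvw by (auto intro!: mfam_closed[OF b])
    note e = icomp_append[OF \<phi> b W(1,2,4) d]
    define Y1 where "Y1 = ?D (\<lambda>p y. ?D (\<lambda>q r.
        signed (V d) (- 1 * sdeg p) (\<phi> (p @ (sdeg q + - 1 - 1, b q) # r @ (sdeg v - 2, b v) # w))) y) u"
    define Y2 where "Y2 = ?D (\<lambda>p q. ?D (\<lambda>r y.
        signed (V d) (- 1 * sdeg p) (\<phi> (p @ (sdeg q + (sdeg v - 2) + sdeg r + - 1, b (q @ (sdeg v - 2, b v) # r)) # y))) w) u"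
    define Y3 where "Y3 = ?D (\<lambda>p y. ?D (\<lambda>q r.
        signed (V d) (- 1 * (sdeg u + (sdeg v - 2) + 1 + sdeg p)) (\<phi> (u @ (sdeg v - 2, b v) # p @ (sdeg q + - 1 - 1, b q) # r))) y) w"
    have B1: "(sdeg q + - 1 - 1, b q) = B q" for q by (simp add: B_def)
    have B2: "(sdeg q - 2, b q) = B q" for q by (simp add: B_def)
    have i2: "sdeg q + (sdeg v - 2) + sdeg r + - 1 = sdeg q + sdeg v + sdeg r - 3" for q r by simp
    have y1: "signed (V d) (- sdeg u) Y1 = ?D (\<lambda>p q'. ?D (\<lambda>q r. H1 p q r v w) q') u"
    proof -
      have "signed (V d) (- sdeg u) Y1 = ?D (\<lambda>p y. signed (V d) (- sdeg u) (?D (\<lambda>q r.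
          signed (V d) (- 1 * sdeg p) (\<phi> (p @ B q # r @ B v # w))) y)) u"
        unfolding Y1_def B1 B2 using uvw by (intro V.dsum_signed V.dsum_closed V.signed_closed c1) auto
      also have "\<dots> = ?D (\<lambda>p y. ?D (\<lambda>q r. signed (V d) (- sdeg u)
          (signed (V d) (- 1 * sdeg p) (\<phi> (p @ B q # r @ B v # w)))) y) u"
        using uvw by (intro dsum_cong V.dsum_signed V.signed_closed c1) auto
      also have "\<dots> = ?D (\<lambda>p q'. ?D (\<lambda>q r. H1 p q r v w) q') u"
      proof (intro dsum_cong)
        fix p y q r assume *: "p @ y = u" "q @ r = y"
        have "sdeg u = sdeg p + sdeg q + sdeg r" using * by auto
        hence ev: "even ((- sdeg u + - 1 * sdeg p) - (sdeg q + sdeg r))" by simp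
        have "p @ q @ r @ v @ w = ws" using * uvw by auto
        from c1[OF this] show "signed (V d) (- sdeg u) (signed (V d) (- 1 * sdeg p) (\<phi> (p @ B q # r @ B v # w))) = H1 p q r v w"
          unfolding H1_def by (simp only: V.signed_signed signed_cong[OF ev])
      qed
      finally show ?thesis .
    qed
    have y2: "signed (V d) (- sdeg u) Y2 = ?D (\<lambda>p q. ?D (\<lambda>r y. H2 p q v r y) w) u"
    proof -
      have c: "\<phi> (p @ (sdeg q + sdeg v + sdeg r - 3, b (q @ B v # r)) # y) \<in> carrier (V d)"
        if "p @ q = u" "r @ y = w" for p q r y
        using split[of p q v r y] bc[of q v r] that uvw by (intro mfam_closed[OF \<phi>]) auto
      have "signed (V d) (- sdeg u) Y2 = ?D (\<lambda>p q. signed (V d) (- sdeg u) (?D (\<lambda>r y.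
          signed (V d) (- 1 * sdeg p) (\<phi> (p @ (sdeg q + sdeg v + sdeg r - 3, b (q @ B v # r)) # y))) w)) u"
        unfolding Y2_def i2 B2 by (intro V.dsum_signed V.dsum_closed V.signed_closed c) auto
      also have "\<dots> = ?D (\<lambda>p q. ?D (\<lambda>r y. signed (V d) (- sdeg u)
          (signed (V d) (- 1 * sdeg p) (\<phi> (p @ (sdeg q + sdeg v + sdeg r - 3, b (q @ B v # r)) # y)))) w) u"
        by (intro dsum_cong V.dsum_signed V.signed_closed c) auto
      also have "\<dots> = ?D (\<lambda>p q. ?D (\<lambda>r y. H2 p q v r y) w) u"
      proof (intro dsum_cong)
        fix p q r y assume *: "p @ q = u" "r @ y = w"
        have ev: "even ((- sdeg u + - 1 * sdeg p) - sdeg q)" using * by auto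
        from c[OF *] show "signed (V d) (- sdeg u)
          (signed (V d) (- 1 * sdeg p) (\<phi> (p @ (sdeg q + sdeg v + sdeg r - 3, b (q @ B v # r)) # y))) = H2 p q v r y"
          unfolding H2_def by (simp only: V.signed_signed signed_cong[OF ev])
      qed
      finally show ?thesis .
    qed
    have y3: "signed (V d) (- sdeg u) Y3 = ?D (\<lambda>p y. ?D (\<lambda>q r. H3 u v p q r) y) w"
    proof -
      have "signed (V d) (- sdeg u) Y3 = ?D (\<lambda>p y. signed (V d) (- sdeg u) (?D (\<lambda>q r.
          signed (V d) (- 1 * (sdeg u + (sdeg v - 2) + 1 + sdeg p)) (\<phi> (u @ B v # p @ B q # r))) y)) w"
        unfolding Y3_def B1 B2 using uvw by (intro V.dsum_signed V.dsum_closed V.signed_closed c1) auto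
      also have "\<dots> = ?D (\<lambda>p y. ?D (\<lambda>q r. signed (V d) (- sdeg u)
          (signed (V d) (- 1 * (sdeg u + (sdeg v - 2) + 1 + sdeg p)) (\<phi> (u @ B v # p @ B q # r)))) y) w"
        using uvw by (intro dsum_cong V.dsum_signed V.signed_closed c1) auto
      also have "\<dots> = ?D (\<lambda>p y. ?D (\<lambda>q r. H3 u v p q r) y) w"
      proof (intro dsum_cong)
        fix p y q r assume *: "p @ y = w" "q @ r = y"
        have ev: "even ((- sdeg u + - 1 * (sdeg u + (sdeg v - 2) + 1 + sdeg p)) - (sdeg v + sdeg p + 1))" by simp
        have "u @ v @ p @ q @ r = ws" using * uvw by auto
        from c1[OF this] show "signed (V d) (- sdeg u)
          (signed (V d) (- 1 * (sdeg u + (sdeg v - 2) + 1 + sdeg p)) (\<phi> (u @ B v # p @ B q # r))) = H3 u v p q r"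
          unfolding H3_def by (simp only: V.signed_signed signed_cong[OF ev])
      qed
      finally show ?thesis .
    qed
    have Yc: "Y1 \<in> carrier (V d)" "Y2 \<in> carrier (V d)" "Y3 \<in> carrier (V d)"
      unfolding Y1_def Y2_def Y3_def B1 B2 i2 using uvw split bc
      by (auto intro!: V.dsum_closed V.signed_closed c1 mfam_closed[OF \<phi>])
    have "icomp V s (- 1) \<phi> b (u @ B v # w) = Y1 \<oplus>\<^bsub>V d\<^esub> Y2 \<oplus>\<^bsub>V d\<^esub> Y3"
      unfolding Y1_def Y2_def Y3_def B_def by (rule e)
    thus ?thesis using Yc by (simp add: V.signed_add y1 y2 y3)
  qed
  define S where "S = (\<lambda>H. ?D (\<lambda>p y. ?D (\<lambda>q y. ?D (\<lambda>r y. ?D (\<lambda>v w. H p q r v w) y) y) y) ws)"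
  have dd: "sdeg ws + (s - 1) + - 1 - 1 = d" "sdeg ws + s + - 2 - 1 = d" by (simp_all add: d_def)
  have "icomp V (s - 1) (- 1) (icomp V s (- 1) \<phi> b) b ws =
      ?D (\<lambda>u y. ?D (\<lambda>v w. signed (V d) (- sdeg u) (icomp V s (- 1) \<phi> b (u @ B v # w))) y) ws"
    unfolding icomp_def[of V "s - 1"] dd B_def by simp
  also have "\<dots> = ?D (\<lambda>u y. ?D (\<lambda>v w. ?D (\<lambda>p q'. ?D (\<lambda>q r. H1 p q r v w) q') u \<oplus>\<^bsub>V d\<^esub>
      ?D (\<lambda>p q. ?D (\<lambda>r y. H2 p q v r y) w) u \<oplus>\<^bsub>V d\<^esub> ?D (\<lambda>p y. ?D (\<lambda>q r. H3 u v p q r) y) w) y) ws"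
    by (intro dsum_cong X) auto
  also have "\<dots> = ?D (\<lambda>u y. ?D (\<lambda>v w. ?D (\<lambda>p q'. ?D (\<lambda>q r. H1 p q r v w) q') u \<oplus>\<^bsub>V d\<^esub>
      ?D (\<lambda>p q. ?D (\<lambda>r y. H2 p q v r y) w) u) y \<oplus>\<^bsub>V d\<^esub>
      ?D (\<lambda>v w. ?D (\<lambda>p y. ?D (\<lambda>q r. H3 u v p q r) y) w) y) ws"
    by (intro dsum_cong V.dsum_add V.M.a_closed V.dsum_closed H1 H2 H3) auto
  also have "\<dots> = ?D (\<lambda>u y. ?D (\<lambda>v w. ?D (\<lambda>p q'. ?D (\<lambda>q r. H1 p q r v w) q') u) y \<oplus>\<^bsub>V d\<^esub>
      ?D (\<lambda>v w. ?D (\<lambda>p q. ?D (\<lambda>r y. H2 p q v r y) w) u) y \<oplus>\<^bsub>V d\<^esub>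
      ?D (\<lambda>v w. ?D (\<lambda>p y. ?D (\<lambda>q r. H3 u v p q r) y) w) y) ws"
    by (intro dsum_cong arg_cong2[where f = "add (V d)"] V.dsum_add V.M.a_closed V.dsum_closed H1 H2 H3 refl) auto
  also have "\<dots> = ?D (\<lambda>u y. ?D (\<lambda>v w. ?D (\<lambda>p q'. ?D (\<lambda>q r. H1 p q r v w) q') u) y \<oplus>\<^bsub>V d\<^esub>
      ?D (\<lambda>v w. ?D (\<lambda>p q. ?D (\<lambda>r y. H2 p q v r y) w) u) y) ws \<oplus>\<^bsub>V d\<^esub> S H3"
    unfolding S_def by (intro V.dsum_add V.M.a_closed V.dsum_closed H1 H2 H3) auto
  also have "?D (\<lambda>u y. ?D (\<lambda>v w. ?D (\<lambda>p q'. ?D (\<lambda>q r. H1 p q r v w) q') u) y \<oplus>\<^bsub>V d\<^esub>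
      ?D (\<lambda>v w. ?D (\<lambda>p q. ?D (\<lambda>r y. H2 p q v r y) w) u) y) ws =
      ?D (\<lambda>u y. ?D (\<lambda>v w. ?D (\<lambda>p q'. ?D (\<lambda>q r. H1 p q r v w) q') u) y) ws \<oplus>\<^bsub>V d\<^esub>
      ?D (\<lambda>u y. ?D (\<lambda>v w. ?D (\<lambda>p q. ?D (\<lambda>r y. H2 p q v r y) w) u) y) ws"
    by (intro V.dsum_add V.M.a_closed V.dsum_closed H1 H2) auto
  also have "?D (\<lambda>u y. ?D (\<lambda>v w. ?D (\<lambda>p q'. ?D (\<lambda>q r. H1 p q r v w) q') u) y) ws = S H1"
    unfolding S_def by (rule V.dsum5(1)) (rule H1)
  also have "?D (\<lambda>u y. ?D (\<lambda>v w. ?D (\<lambda>p q. ?D (\<lambda>r y. H2 p q v r y) w) u) y) ws = S H2"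
    unfolding S_def by (rule V.dsum5(2)) (rule H2)
  finally have L: "icomp V (s - 1) (- 1) (icomp V s (- 1) \<phi> b) b ws = S H1 \<oplus>\<^bsub>V d\<^esub> S H2 \<oplus>\<^bsub>V d\<^esub> S H3" .
  have "S H1 \<oplus>\<^bsub>V d\<^esub> S H3 = S (\<lambda>p q r v w. H1 p q r v w \<oplus>\<^bsub>V d\<^esub> H3 p q r v w)"
  proof -
    have "S (\<lambda>p q r v w. H1 p q r v w \<oplus>\<^bsub>V d\<^esub> H3 p q r v w) =
       ?D (\<lambda>p y. ?D (\<lambda>q y. ?D (\<lambda>r y. ?D (\<lambda>v w. H1 p q r v w) y \<oplus>\<^bsub>V d\<^esub> ?D (\<lambda>v w. H3 p q r v w) y) y) y) ws"
      unfolding S_def by (intro dsum_cong V.dsum_add H1 H3) auto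
    also have "\<dots> = ?D (\<lambda>p y. ?D (\<lambda>q y. ?D (\<lambda>r y. ?D (\<lambda>v w. H1 p q r v w) y) y \<oplus>\<^bsub>V d\<^esub> ?D (\<lambda>r y. ?D (\<lambda>v w. H3 p q r v w) y) y) y) ws"
      by (intro dsum_cong V.dsum_add V.dsum_closed H1 H3) auto
    also have "\<dots> = ?D (\<lambda>p y. ?D (\<lambda>q y. ?D (\<lambda>r y. ?D (\<lambda>v w. H1 p q r v w) y) y) y \<oplus>\<^bsub>V d\<^esub> ?D (\<lambda>q y. ?D (\<lambda>r y. ?D (\<lambda>v w. H3 p q r v w) y) y) y) ws"
      by (intro dsum_cong V.dsum_add V.dsum_closed H1 H3) auto
    also have "\<dots> = S H1 \<oplus>\<^bsub>V d\<^esub> S H3"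
      unfolding S_def by (intro V.dsum_add V.dsum_closed H1 H3) auto
    finally show ?thesis ..
  qed
  also have "\<dots> = \<zero>\<^bsub>V d\<^esub>"
    unfolding S_def H1_def H3_def by (intro V.dsum_zero V.signed_cancel c1) auto
  finally have z: "S H1 \<oplus>\<^bsub>V d\<^esub> S H3 = \<zero>\<^bsub>V d\<^esub>" .
  have Sc: "S H1 \<in> carrier (V d)" "S H2 \<in> carrier (V d)" "S H3 \<in> carrier (V d)"
    unfolding S_def by (intro V.dsum_closed H1 H2 H3; auto)+
  have "S H1 \<oplus>\<^bsub>V d\<^esub> S H2 \<oplus>\<^bsub>V d\<^esub> S H3 = S H2 \<oplus>\<^bsub>V d\<^esub> (S H1 \<oplus>\<^bsub>V d\<^esub> S H3)"
    using Sc by (simp add: V.M.a_ac)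
  hence L: "icomp V (s - 1) (- 1) (icomp V s (- 1) \<phi> b) b ws = S H2" using L z Sc by simp
  have "icomp V s (- 2) \<phi> (icomp V (- 1) (- 1) b b) ws =
      ?D (\<lambda>p y. ?D (\<lambda>t w. ?D (\<lambda>q y. ?D (\<lambda>v r. H2 p q v r w) y) t) y) ws"
    unfolding icomp_def[of V s] dd
  proof (intro dsum_cong)
    fix p y t w assume *: "p @ y = ws" "t @ w = y"
    define e where "e = sdeg t - 3"
    have ee: "sdeg t + - 2 - 1 = e" "sdeg t + - 1 + - 1 - 1 = e" by (simp_all add: e_def)
    have W: "p \<in> words V" "w \<in> words V" "t \<in> words V" and de: "d = sdeg p + e + sdeg w + s"
      using split[of p t "[]" "[]" w] * by (auto simp: e_def)
    have tc: "signed (V e) (- 1 * sdeg q) (b (q @ B v # r)) \<in> carrier (V e)"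
      if "q @ v @ r = t" for q v r
      using that W bc[of q v r] by (auto simp: e_def add.assoc[symmetric])
    have Bv: "(sdeg v + - 1 - 1, b v) = B v" for v by (simp add: B_def)
    have "\<phi> (p @ (e, icomp V (- 1) (- 1) b b t) # w) =
        ?D (\<lambda>q y. \<phi> (p @ (e, dsum (V e) (\<lambda>v r. signed (V e) (- 1 * sdeg q) (b (q @ B v # r))) y) # w)) t"
      unfolding icomp_def ee Bv by (rule mfam_dsum[OF \<phi> W(1,2) _ de]) (intro V.dsum_closed tc, auto)
    also have "\<dots> = ?D (\<lambda>q y. ?D (\<lambda>v r. \<phi> (p @ (e, signed (V e) (- 1 * sdeg q) (b (q @ B v # r))) # w)) y) t"
      by (intro dsum_cong mfam_dsum[OF \<phi> W(1,2) _ de] tc) auto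
    also have "\<dots> = ?D (\<lambda>q y. ?D (\<lambda>v r. H2 p q v r w) y) t"
    proof (intro dsum_cong)
      fix q y v r assume qy: "q @ y = t" "v @ r = y"
      hence e': "e = sdeg q + sdeg v + sdeg r - 3" by (auto simp: e_def)
      have "b (q @ B v # r) \<in> carrier (V e)" unfolding e' by (rule bc) (use qy W in auto)
      from mfam_signed[OF \<phi> W(1,2) this de]
      show "\<phi> (p @ (e, signed (V e) (- 1 * sdeg q) (b (q @ B v # r))) # w) = H2 p q v r w"
        unfolding H2_def e'[symmetric] using signed_cong[of "- sdeg q" "sdeg q" "V d"] by simp
    qed
    finally show "signed (V d) (- 2 * sdeg p) (\<phi> (p @ (sdeg t + - 2 - 1, icomp V (- 1) (- 1) b b t) # w)) =
        ?D (\<lambda>q y. ?D (\<lambda>v r. H2 p q v r w) y) t" unfolding ee by simp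
  qed
  also have "\<dots> = S H2" unfolding S_def by (rule V.dsum5(3)) (rule H2)
  finally show ?thesis using L by simp
qed

end

section \<open>Graded homomorphisms and multilinear families\<close>

lemma gHom_simps:
  "f \<in> carrier (gHom R C D i) \<longleftrightarrow> (\<forall>n. f n \<in> mod_hom R (C n) (D (n + i)))"
  "x \<in> carrier (C n) \<Longrightarrow> zero (gHom R C D i) n x = \<zero>\<^bsub>D (n + i)\<^esub>"
  "x \<in> carrier (C n) \<Longrightarrow> add (gHom R C D i) f g n x = f n x \<oplus>\<^bsub>D (n + i)\<^esub> g n x"
  "x \<in> carrier (C n) \<Longrightarrow> smult (gHom R C D i) a f n x = a \<odot>\<^bsub>D (n + i)\<^esub> f n x"
  by (auto simp: gHom_def)

lemma gHom_closed: "f \<in> carrier (gHom R C D i) \<Longrightarrow> x \<in> carrier (C n) \<Longrightarrow> f n x \<in> carrier (D (n + i))"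
  unfolding gHom_simps(1) by (rule mod_hom_closed[of "f n" R "C n"]) auto

lemma mod_hom_fun_add:
  assumes "module R M" "module R N" "f \<in> mod_hom R M N" "g \<in> mod_hom R M N"
  shows "(\<lambda>x\<in>carrier M. f x \<oplus>\<^bsub>N\<^esub> g x) \<in> mod_hom R M N"
proof -
  interpret M: module R M by fact
  interpret N: module R N by fact
  note c = mod_hom_closed[OF assms(3)] mod_hom_closed[OF assms(4)]
  show ?thesis
    by (rule mod_homI) (auto simp: c mod_hom_add[OF assms(3)] mod_hom_add[OF assms(4)] N.a_ac N.smult_r_distr
        mod_hom_smult[OF assms(3)] mod_hom_smult[OF assms(4)])
qed

lemma mod_hom_fun_zero:
  assumes "module R M" "module R N"
  shows "(\<lambda>x\<in>carrier M. \<zero>\<^bsub>N\<^esub>) \<in> mod_hom R M N"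
proof -
  interpret M: module R M by fact
  interpret N: module R N by fact
  show ?thesis by (rule mod_homI) auto
qed

lemma mod_hom_fun_smult:
  assumes "module R M" "module R N" "f \<in> mod_hom R M N" "a \<in> carrier R"
  shows "(\<lambda>x\<in>carrier M. a \<odot>\<^bsub>N\<^esub> f x) \<in> mod_hom R M N"
proof -
  interpret M: module R M by fact
  interpret N: module R N by fact
  note c = mod_hom_closed[OF assms(3)]
  have "a \<odot>\<^bsub>N\<^esub> (b \<odot>\<^bsub>N\<^esub> y) = b \<odot>\<^bsub>N\<^esub> (a \<odot>\<^bsub>N\<^esub> y)" if "b \<in> carrier R" "y \<in> carrier N" for b y
    using that assms(4) by (simp add: N.smult_assoc1[symmetric] M.R.m_comm)
  thus ?thesis using assms(4)
    by (intro mod_homI) (auto simp: c mod_hom_add[OF assms(3)] N.smult_r_distr mod_hom_smult[OF assms(3)])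
qed

lemma mod_hom_fun_signed:
  assumes "module R M" "module R N" "f \<in> mod_hom R M N"
  shows "(\<lambda>x\<in>carrier M. signed N k (f x)) \<in> mod_hom R M N"
proof -
  interpret M: module R M by fact
  interpret N: plain_module R N by (rule plain_module.intro) fact
  note c = mod_hom_closed[OF assms(3)]
  show ?thesis
    by (intro mod_homI) (auto simp: c mod_hom_add[OF assms(3)] mod_hom_smult[OF assms(3)] N.signed_add N.signed_smult)
qed

lemma mod_hom_fun_finsum:
  assumes "module R M" "module R N" "\<And>i. i \<in> I \<Longrightarrow> f i \<in> mod_hom R M N"
  shows "(\<lambda>x\<in>carrier M. finsum N (\<lambda>i. f i x) I) \<in> mod_hom R M N"
proof -
  interpret M: module R M by fact
  interpret N: module R N by fact
  have c: "(\<lambda>i. f i x) \<in> I \<rightarrow> carrier N" if "x \<in> carrier M" for x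
    using that mod_hom_closed[OF assms(3)] by auto
  show ?thesis
  proof (rule mod_homI)
    show "(\<lambda>x\<in>carrier M. finsum N (\<lambda>i. f i x) I) x \<in> carrier N" if "x \<in> carrier M" for x
      using that c by simp
    show "(\<lambda>x\<in>carrier M. finsum N (\<lambda>i. f i x) I) (x \<oplus>\<^bsub>M\<^esub> y) =
        (\<lambda>x\<in>carrier M. finsum N (\<lambda>i. f i x) I) x \<oplus>\<^bsub>N\<^esub> (\<lambda>x\<in>carrier M. finsum N (\<lambda>i. f i x) I) y"
      if xy: "x \<in> carrier M" "y \<in> carrier M" for x y
    proof -
      have "finsum N (\<lambda>i. f i (x \<oplus>\<^bsub>M\<^esub> y)) I = finsum N (\<lambda>i. f i x \<oplus>\<^bsub>N\<^esub> f i y) I"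
        using xy c[of x] c[of y] by (intro N.finsum_cong') (auto simp: mod_hom_add[OF assms(3)] Pi_def)
      thus ?thesis using xy c by (simp add: N.finsum_addf)
    qed
    show "(\<lambda>x\<in>carrier M. finsum N (\<lambda>i. f i x) I) (a \<odot>\<^bsub>M\<^esub> x) =
        a \<odot>\<^bsub>N\<^esub> (\<lambda>x\<in>carrier M. finsum N (\<lambda>i. f i x) I) x"
      if ax: "a \<in> carrier R" "x \<in> carrier M" for a x
    proof -
      have "finsum N (\<lambda>i. f i (a \<odot>\<^bsub>M\<^esub> x)) I = finsum N (\<lambda>i. a \<odot>\<^bsub>N\<^esub> f i x) I"
        using ax c[of x] by (intro N.finsum_cong') (auto simp: mod_hom_smult[OF assms(3)] Pi_def)
      also have "\<dots> = a \<odot>\<^bsub>N\<^esub> finsum N (\<lambda>i. f i x) I"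
      proof (cases "finite I")
        case True
        thus ?thesis using ax c[of x] by (simp add: N.finsum_smult_ldistr)
      next
        case False
        thus ?thesis using ax by (simp add: N.finsum_infinite)
      qed
      finally show ?thesis using ax by simp
    qed
  qed simp
qed

context
  fixes R :: "('r, 'c) ring_scheme" and C :: "('r, 'a) gmodule" and D :: "('r, 'b) gmodule"
  assumes C: "graded_module R C" and D: "graded_module R D"
begin

lemma Cm: "module R (C n)" and Dm: "module R (D n)"
  using C D by (auto simp: graded_module_def)

lemma gHom_ext:
  assumes "f \<in> carrier (gHom R C D i)" "g \<in> carrier (gHom R C D i)"
    and "\<And>n x. x \<in> carrier (C n) \<Longrightarrow> f n x = g n x"
  shows "f = g"
proof (rule ext)
  show "f n = g n" for n
    using assms unfolding gHom_simps by (intro mod_hom_ext[of "f n" R "C n" "D (n + i)" "g n" "D (n + i)"]) auto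
qed

lemma gHom_add_closed: "f \<in> carrier (gHom R C D i) \<Longrightarrow> g \<in> carrier (gHom R C D i) \<Longrightarrow>
    add (gHom R C D i) f g \<in> carrier (gHom R C D i)"
  using mod_hom_fun_add[OF Cm Dm] by (simp add: gHom_def)

lemma gHom_zero_closed: "zero (gHom R C D i) \<in> carrier (gHom R C D i)"
  using mod_hom_fun_zero[OF Cm Dm] by (simp add: gHom_def)

lemma gHom_smult_closed: "a \<in> carrier R \<Longrightarrow> f \<in> carrier (gHom R C D i) \<Longrightarrow>
    smult (gHom R C D i) a f \<in> carrier (gHom R C D i)"
  using mod_hom_fun_smult[OF Cm Dm] by (simp add: gHom_def)

lemma gHom_module: "module R (gHom R C D i)"
proof (rule moduleI)
  show cR: "cring R" using Cm[of 0] by (simp add: module_def)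
  interpret R: cring R by (rule cR)
  have c: "f n x \<in> carrier (D (n + i))" if "f \<in> carrier (gHom R C D i)" "x \<in> carrier (C n)" for f n x
    by (rule gHom_closed[OF that])
  have g: "abelian_group (D n)" for n using Dm by (simp add: module_def)
  note m = abelian_group.axioms(1)[OF g]
  note ac = gHom_add_closed gHom_zero_closed gHom_smult_closed
  show "abelian_group (gHom R C D i)"
  proof (rule abelian_groupI)
    fix f assume f: "f \<in> carrier (gHom R C D i)"
    let ?f = "smult (gHom R C D i) (\<ominus>\<^bsub>R\<^esub> \<one>\<^bsub>R\<^esub>) f"
    have *: "(\<ominus>\<^bsub>R\<^esub> \<one>\<^bsub>R\<^esub>) \<odot>\<^bsub>D n\<^esub> y \<oplus>\<^bsub>D n\<^esub> y = \<zero>\<^bsub>D n\<^esub>" if "y \<in> carrier (D n)" for n y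
    proof -
      interpret D: module R "D n" by (rule Dm)
      show ?thesis using that by (simp add: D.smult_l_minus D.M.l_neg)
    qed
    have "add (gHom R C D i) ?f f = zero (gHom R C D i)"
      using f by (intro gHom_ext[of _ i] ac) (auto simp: gHom_simps(2-4) c *)
    thus "\<exists>g\<in>carrier (gHom R C D i). add (gHom R C D i) g f = zero (gHom R C D i)"
      using f ac by (intro bexI[of _ ?f]) auto
  next
    show "add (gHom R C D i) (add (gHom R C D i) x y) z = add (gHom R C D i) x (add (gHom R C D i) y z)"
      if "x \<in> carrier (gHom R C D i)" "y \<in> carrier (gHom R C D i)" "z \<in> carrier (gHom R C D i)" for x y z
      using that by (intro gHom_ext[of _ i] ac) (auto simp: gHom_simps(2-4) c abelian_monoid.a_assoc[OF m])
    show "add (gHom R C D i) x y = add (gHom R C D i) y x"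
      if "x \<in> carrier (gHom R C D i)" "y \<in> carrier (gHom R C D i)" for x y
      using that by (intro gHom_ext[of _ i] ac) (auto simp: gHom_simps(2-4) c abelian_monoid.a_comm[OF m])
    show "add (gHom R C D i) (zero (gHom R C D i)) x = x" if "x \<in> carrier (gHom R C D i)" for x
      using that by (intro gHom_ext[of _ i] ac) (auto simp: gHom_simps(2-4) c abelian_monoid.l_zero[OF m])
  qed (auto intro: ac)
  show "smult (gHom R C D i) (a \<oplus>\<^bsub>R\<^esub> b) x =
      add (gHom R C D i) (smult (gHom R C D i) a x) (smult (gHom R C D i) b x)"
    if "a \<in> carrier R" "b \<in> carrier R" "x \<in> carrier (gHom R C D i)" for a b x
    using that by (intro gHom_ext[of _ i] ac) (auto simp: gHom_simps(2-4) c module.smult_l_distr[OF Dm])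
  show "smult (gHom R C D i) a (add (gHom R C D i) x y) =
      add (gHom R C D i) (smult (gHom R C D i) a x) (smult (gHom R C D i) a y)"
    if "a \<in> carrier R" "x \<in> carrier (gHom R C D i)" "y \<in> carrier (gHom R C D i)" for a x y
    using that by (intro gHom_ext[of _ i] ac) (auto simp: gHom_simps(2-4) c module.smult_r_distr[OF Dm])
  show "smult (gHom R C D i) (a \<otimes>\<^bsub>R\<^esub> b) x = smult (gHom R C D i) a (smult (gHom R C D i) b x)"
    if "a \<in> carrier R" "b \<in> carrier R" "x \<in> carrier (gHom R C D i)" for a b x
    using that by (intro gHom_ext[of _ i] ac) (auto simp: gHom_simps(2-4) c module.smult_assoc1[OF Dm])
  show "smult (gHom R C D i) \<one>\<^bsub>R\<^esub> x = x" if "x \<in> carrier (gHom R C D i)" for x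
    using that by (intro gHom_ext[of _ i] ac) (auto simp: gHom_simps(2-4) c module.smult_one[OF Dm])
qed (rule gHom_smult_closed)

lemma gHom_neg_eval:
  assumes "f \<in> carrier (gHom R C D i)" "x \<in> carrier (C n)"
  shows "(\<ominus>\<^bsub>gHom R C D i\<^esub> f) n x = \<ominus>\<^bsub>D (n + i)\<^esub> f n x"
proof -
  interpret H: module R "gHom R C D i" by (rule gHom_module)
  interpret D: module R "D (n + i)" by (rule Dm)
  have c: "f n x \<in> carrier (D (n + i))" "(\<ominus>\<^bsub>gHom R C D i\<^esub> f) n x \<in> carrier (D (n + i))"
    by (rule gHom_closed[OF assms] gHom_closed[OF H.a_inv_closed[OF assms(1)] assms(2)])+
  have "(\<ominus>\<^bsub>gHom R C D i\<^esub> f) n x \<oplus>\<^bsub>D (n + i)\<^esub> f n x = \<zero>\<^bsub>D (n + i)\<^esub>"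
    using arg_cong[OF H.l_neg[OF assms(1)], of "\<lambda>h. h n x"] assms(2) by (simp add: gHom_simps(2,3))
  thus ?thesis using c D.minus_equality by metis
qed

lemma gHom_signed_eval:
  assumes "f \<in> carrier (gHom R C D i)" "x \<in> carrier (C n)"
  shows "signed (gHom R C D i) k f n x = signed (D (n + i)) k (f n x)"
  using assms by (simp add: signed_def gHom_neg_eval)

lemma gHom_minus_eval:
  assumes "f \<in> carrier (gHom R C D i)" "g \<in> carrier (gHom R C D i)" "x \<in> carrier (C n)"
  shows "(f \<ominus>\<^bsub>gHom R C D i\<^esub> g) n x = f n x \<ominus>\<^bsub>D (n + i)\<^esub> g n x"
  using assms by (simp add: a_minus_def gHom_neg_eval gHom_simps(3))

lemma gHom_finsum_eval:
  assumes "F \<in> I \<rightarrow> carrier (gHom R C D i)" "x \<in> carrier (C n)"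
  shows "finsum (gHom R C D i) F I n x = finsum (D (n + i)) (\<lambda>k. F k n x) I"
proof -
  interpret H: module R "gHom R C D i" by (rule gHom_module)
  interpret D: module R "D (n + i)" by (rule Dm)
  show ?thesis using assms(1)
  proof (induct I rule: infinite_finite_induct)
    case (insert k I)
    have "(\<lambda>k. F k n x) \<in> insert k I \<rightarrow> carrier (D (n + i))"
      using insert(4) by (auto intro!: gHom_closed[where C = C and n = n] assms(2))
    thus ?case using insert assms(2) by (simp add: gHom_simps(3) Pi_def)
  qed (use assms(2) in \<open>auto simp: gHom_simps(2)\<close>)
qed

end


subsection \<open>Multilinear maps inserted into multilinear maps\<close>

lemma mlin_slot:
  assumes \<phi>: "mlin R V n W j \<phi>" and "us \<in> words V" "ws \<in> words V" "length us + length ws + 1 = n"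
    and d: "d = wdeg us + i + wdeg ws + j" and V: "module R (V i)"
  shows "(\<lambda>x\<in>carrier (V i). \<phi> (us @ (i, x) # ws)) \<in> mod_hom R (V i) (W d)"
proof -
  interpret module R "V i" by (rule V)
  show ?thesis
    using assms by (intro mod_homI) (auto simp: mlin_add[OF \<phi>] mlin_smult[OF \<phi>] intro!: mlin_closed[OF \<phi>])
qed

lemma mlinI_slot:
  assumes V: "\<And>i. module R (V i)"
    and "\<And>ws. ws \<in> words V \<Longrightarrow> length ws = n \<Longrightarrow> \<phi> ws \<in> carrier (W (wdeg ws + j))"
    and slot: "\<And>us i ws. us \<in> words V \<Longrightarrow> ws \<in> words V \<Longrightarrow> length us + length ws + 1 = n \<Longrightarrow>
      (\<lambda>x\<in>carrier (V i). \<phi> (us @ (i, x) # ws)) \<in> mod_hom R (V i) (W (wdeg us + i + wdeg ws + j))"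
  shows "mlin R V n W j \<phi>"
proof (rule mlinI)
  fix us i x ws assume 1: "us \<in> words V" "ws \<in> words V" "x \<in> carrier (V i)" "length us + length ws + 1 = n"
  interpret module R "V i" by (rule V)
  show "\<phi> (us @ (i, x \<oplus>\<^bsub>V i\<^esub> y) # ws) =
      \<phi> (us @ (i, x) # ws) \<oplus>\<^bsub>W (wdeg us + i + wdeg ws + j)\<^esub> \<phi> (us @ (i, y) # ws)" if "y \<in> carrier (V i)" for y
    using mod_hom_add[OF slot[OF 1(1,2,4)] 1(3) that] 1(3) that by simp
  show "\<phi> (us @ (i, a \<odot>\<^bsub>V i\<^esub> x) # ws) = a \<odot>\<^bsub>W (wdeg us + i + wdeg ws + j)\<^esub> \<phi> (us @ (i, x) # ws)"
    if "a \<in> carrier R" for a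
    using mod_hom_smult[OF slot[OF 1(1,2,4)] that 1(3)] 1(3) that by simp
qed (rule assms(2))

lemma mlin_signed:
  assumes V: "\<And>i. module R (V i)" and W: "\<And>i. module R (W i)" and \<phi>: "mlin R V n W j \<phi>"
  shows "mlin R V n W j (\<lambda>ws. signed (W (wdeg ws + j)) (k (map fst ws)) (\<phi> ws))"
proof (rule mlinI_slot[OF V])
  show "signed (W (wdeg ws + j)) (k (map fst ws)) (\<phi> ws) \<in> carrier (W (wdeg ws + j))"
    if "ws \<in> words V" "length ws = n" for ws
    using that mlin_closed[OF \<phi>] W by (intro plain_module.signed_closed plain_module.intro) auto
  fix us i ws assume "us \<in> words V" "ws \<in> words V" "length us + length ws + 1 = n"
  from mod_hom_fun_signed[OF V W mlin_slot[OF \<phi> this refl V], of i "k (map fst us @ i # map fst ws)"]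
  show "(\<lambda>x\<in>carrier (V i). signed (W (wdeg (us @ (i, x) # ws) + j)) (k (map fst (us @ (i, x) # ws)))
      (\<phi> (us @ (i, x) # ws))) \<in> mod_hom R (V i) (W (wdeg us + i + wdeg ws + j))"
    by (simp add: add_ac cong: restrict_cong)
qed

lemma mlin_finsum:
  assumes V: "\<And>i. module R (V i)" and W: "\<And>i. module R (W i)" and \<phi>: "\<And>k. k \<in> K \<Longrightarrow> mlin R V n W j (\<phi> k)"
  shows "mlin R V n W j (\<lambda>ws. finsum (W (wdeg ws + j)) (\<lambda>k. \<phi> k ws) K)"
proof (rule mlinI_slot[OF V])
  show "finsum (W (wdeg ws + j)) (\<lambda>k. \<phi> k ws) K \<in> carrier (W (wdeg ws + j))"
    if "ws \<in> words V" "length ws = n" for ws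
  proof -
    interpret module R "W (wdeg ws + j)" by (rule W)
    show ?thesis using that mlin_closed[OF \<phi>] by (intro M.finsum_closed) auto
  qed
  fix us i ws assume *: "us \<in> words V" "ws \<in> words V" "length us + length ws + 1 = n"
  have "(\<lambda>x\<in>carrier (V i). finsum (W (wdeg us + i + wdeg ws + j))
      (\<lambda>k. (\<lambda>x\<in>carrier (V i). \<phi> k (us @ (i, x) # ws)) x) K) \<in> mod_hom R (V i) (W (wdeg us + i + wdeg ws + j))"
    by (rule mod_hom_fun_finsum[OF V W]) (rule mlin_slot[OF \<phi> * refl V])
  thus "(\<lambda>x\<in>carrier (V i). finsum (W (wdeg (us @ (i, x) # ws) + j)) (\<lambda>k. \<phi> k (us @ (i, x) # ws)) K)
      \<in> mod_hom R (V i) (W (wdeg us + i + wdeg ws + j))"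
    by (simp add: add_ac cong: restrict_cong)
qed

text \<open>The word that results from applying \<open>\<gamma>\<close>, of degree \<open>j\<close>, to the \<open>m\<close> letters after the first \<open>a\<close>.\<close>

definition ins :: "nat \<Rightarrow> nat \<Rightarrow> int \<Rightarrow> ((int \<times> 'a) list \<Rightarrow> 'a) \<Rightarrow> (int \<times> 'a) list \<Rightarrow> (int \<times> 'a) list" where
  "ins a m j \<gamma> ws = take a ws @ (wdeg (take m (drop a ws)) + j, \<gamma> (take m (drop a ws))) # drop (a + m) ws"

lemma ins_split: "length u = a \<Longrightarrow> length v = m \<Longrightarrow> ins a m j \<gamma> (u @ v @ w) = u @ (wdeg v + j, \<gamma> v) # w"
  by (simp add: ins_def)

lemma list_split3: "a + m \<le> length ws \<Longrightarrow> \<exists>u v w. ws = u @ v @ w \<and> length u = a \<and> length v = m"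
  by (rule exI[of _ "take a ws"], rule exI[of _ "take m (drop a ws)"], rule exI[of _ "drop m (drop a ws)"])
     (simp del: drop_drop)

lemma take_take_drop: "take a ws @ take m (drop a ws) @ drop (a + m) ws = ws"
  by (metis add.commute append_take_drop_id drop_drop)

text \<open>A slot of the long word lies before the inserted word, in it, or after it. In the second case linearity
  of \<open>\<gamma>\<close> is followed by that of \<open>\<theta>\<close>.\<close>

lemma mlin_ins:
  assumes V: "\<And>i. module R (V i)" and \<theta>: "mlin R V n W e \<theta>" and \<gamma>: "mlin R V m V j \<gamma>" and a: "a < n"
  shows "mlin R V (n + m - 1) W (e + j) (\<lambda>ws. \<theta> (ins a m j \<gamma> ws))"
proof (rule mlinI_slot[OF V])
  have g: "\<gamma> v \<in> carrier (V (wdeg v + j))" if "v \<in> words V" "length v = m" for v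
    using that by (intro mlin_closed[OF \<gamma>]) auto
  fix ws assume ws: "ws \<in> words V" "length ws = n + m - 1"
  hence "a + m \<le> length ws" using a by linarith
  then obtain u v w where *: "ws = u @ v @ w" "length u = a" "length v = m"
    using list_split3 by blast
  show "\<theta> (ins a m j \<gamma> ws) \<in> carrier (W (wdeg ws + (e + j)))"
    unfolding *(1) ins_split[OF *(2,3)]
    by (rule mlin_closed[OF \<theta>]) (use ws * a g in auto)
next
  have g: "\<gamma> v \<in> carrier (V (wdeg v + j))" if "v \<in> words V" "length v = m" for v
    using that by (intro mlin_closed[OF \<gamma>]) auto
  fix us i ws assume w: "us \<in> words V" "ws \<in> words V" "length us + length ws + 1 = n + m - 1"
  consider "length us < a" | "a \<le> length us" "length us < a + m" | "a + m \<le> length us" by linarith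
  thus "(\<lambda>x\<in>carrier (V i). \<theta> (ins a m j \<gamma> (us @ (i, x) # ws))) \<in> mod_hom R (V i) (W (wdeg us + i + wdeg ws + (e + j)))"
  proof cases
    case 1
    have "(a - length us - 1) + m \<le> length ws" using 1 w a by linarith
    then obtain w1 v w2 where *: "ws = w1 @ v @ w2" "length w1 = a - length us - 1" "length v = m"
      using list_split3 by blast
    have "ins a m j \<gamma> (us @ (i, x) # ws) = us @ (i, x) # w1 @ (wdeg v + j, \<gamma> v) # w2" for x
      using ins_split[of "us @ (i, x) # w1" a v m j \<gamma> w2] * 1 by simp
    moreover have "(\<lambda>x\<in>carrier (V i). \<theta> (us @ (i, x) # w1 @ (wdeg v + j, \<gamma> v) # w2))
        \<in> mod_hom R (V i) (W (wdeg us + i + wdeg ws + (e + j)))"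
      by (rule mlin_slot[OF \<theta>]) (use w * 1 a g V in auto)
    ultimately show ?thesis by simp
  next
    case 3
    then obtain u v u2 where *: "us = u @ v @ u2" "length u = a" "length v = m"
      using list_split3 by blast
    have "ins a m j \<gamma> (us @ (i, x) # ws) = (u @ (wdeg v + j, \<gamma> v) # u2) @ (i, x) # ws" for x
      using ins_split[of u a v m j \<gamma> "u2 @ (i, x) # ws"] * by simp
    moreover have "(\<lambda>x\<in>carrier (V i). \<theta> ((u @ (wdeg v + j, \<gamma> v) # u2) @ (i, x) # ws))
        \<in> mod_hom R (V i) (W (wdeg us + i + wdeg ws + (e + j)))"
      by (rule mlin_slot[OF \<theta>]) (use w * 3 a g V in auto)
    ultimately show ?thesis by simp
  next
    case 2
    define u where "u = take a us"
    define v1 where "v1 = drop a us"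
    define v2 where "v2 = take (m - length v1 - 1) ws"
    define w2 where "w2 = drop (m - length v1 - 1) ws"
    have *: "us = u @ v1" "ws = v2 @ w2" "length u = a" "length v1 + length v2 + 1 = m"
      using 2 w a by (auto simp: u_def v1_def v2_def w2_def)
    have e: "ins a m j \<gamma> (us @ (i, x) # ws) = u @ (wdeg v1 + i + wdeg v2 + j, \<gamma> (v1 @ (i, x) # v2)) # w2" for x
      using ins_split[of u a "v1 @ (i, x) # v2" m j \<gamma> w2] * by (simp add: add_ac)
    have m: "(\<lambda>x\<in>carrier (V i). \<gamma> (v1 @ (i, x) # v2)) \<in> mod_hom R (V i) (V (wdeg v1 + i + wdeg v2 + j))"
      by (rule mlin_slot[OF \<gamma>]) (use w * V in auto)
    have "(\<lambda>y\<in>carrier (V (wdeg v1 + i + wdeg v2 + j)). \<theta> (u @ (wdeg v1 + i + wdeg v2 + j, y) # w2))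
        \<in> mod_hom R (V (wdeg v1 + i + wdeg v2 + j)) (W (wdeg us + i + wdeg ws + (e + j)))"
      by (rule mlin_slot[OF \<theta>]) (use w * V in auto)
    from mod_hom_comp[OF m this V] show ?thesis
      unfolding e using mod_hom_closed[OF m] by (simp cong: restrict_cong)
  qed
qed


subsection \<open>The sign twist\<close>

text \<open>Up to the sign \<open>eps\<close>, which realises the suspension \<open>V \<rightarrow> V[1]\<close> on each factor, the
  product \<^const>\<open>circ\<close> is insertion with the Koszul sign for the shifted degree \<open>|x| + 1\<close>. All
  operations of an \<open>A\<^sub>\<infinity>\<close>-structure then have the same degree, \<open>-1\<close>, and no sign depends on arities.\<close>

fun eps :: "int list \<Rightarrow> int" where
  "eps [] = 0"
| "eps (i # is) = int (length is) * (i + 1) + eps is"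

lemma eps_append: "eps (xs @ ys) = eps xs + int (length ys) * (sum_list xs + int (length xs)) + eps ys"
  by (induct xs) (auto simp: algebra_simps)

definition twist :: "('r, 'c) ring_scheme \<Rightarrow> ('r, 'a) gmodule \<Rightarrow> nat \<Rightarrow> int
    \<Rightarrow> (int \<Rightarrow> ('r, 'a) tens \<Rightarrow> 'a) \<Rightarrow> (int \<times> 'a) list \<Rightarrow> 'a" where
  "twist R V n s f ws = (if length ws = n
     then signed (V (sdeg ws + s - 1)) (eps (map fst ws)) (f (wdeg ws) (etens R V ws))
     else \<zero>\<^bsub>V (sdeg ws + s - 1)\<^esub>)"

lemma finsum_lessThan_Suc_shift:
  assumes "abelian_monoid G" "F \<in> {1..n} \<rightarrow> carrier G"
  shows "finsum G F {1..n} = finsum G (\<lambda>a. F (Suc a)) {..<n}"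
proof -
  interpret abelian_monoid G by fact
  have "Suc ` {..<n} = {1..n}" using image_Suc_atLeastLessThan[of 0 n] by (simp add: atLeast0LessThan atLeastLessThanSuc_atLeastAtMost)
  thus ?thesis using finsum_reindex[of F Suc "{..<n}"] assms(2) by simp
qed

lemma (in plain_module) psum_finsum:
  assumes "\<And>u x w. u @ x # w = xs \<Longrightarrow> F u x w \<in> carrier M"
  shows "psum M F xs = finsum M (\<lambda>k. F (take k xs) (xs ! k) (drop (Suc k) xs)) {..<length xs}"
  using assms
proof (induct xs arbitrary: F)
  case (Cons x xs)
  define G where "G = (\<lambda>k. F (take k (x # xs)) ((x # xs) ! k) (drop (Suc k) (x # xs)))"
  have c: "G k \<in> carrier M" if "k < length (x # xs)" for k
    unfolding G_def using that id_take_nth_drop[OF that] by (intro Cons.prems) simp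
  have "{..<length (x # xs)} = insert 0 (Suc ` {..<length xs})" by (simp add: lessThan_Suc_eq_insert_0)
  hence "finsum M G {..<length (x # xs)} = finsum M G (insert 0 (Suc ` {..<length xs}))" by simp
  also have "\<dots> = G 0 \<oplus>\<^bsub>M\<^esub> finsum M G (Suc ` {..<length xs})"
    using c by (intro M.finsum_insert) auto
  also have "finsum M G (Suc ` {..<length xs}) = finsum M (\<lambda>k. G (Suc k)) {..<length xs}"
    using c by (intro M.finsum_reindex) auto
  also have "\<dots> = psum M (\<lambda>u. F (x # u)) xs"
    using Cons.hyps[of "\<lambda>u. F (x # u)"] Cons.prems by (simp add: G_def)
  finally show ?case unfolding G_def by simp
qed simp

context graded_mod
begin

lemma gEnd_hom: "f \<in> carrier (gEnd R V n i) \<Longrightarrow> f d \<in> mod_hom R (tensor_power R V n d) (V (d + i))"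
  unfolding gEnd_def gHom_simps by blast

lemma gEnd_module: "module R (gEnd R V n i)"
  unfolding gEnd_def by (rule gHom_module[OF graded_tensor_power[OF graded] graded])

lemma etens_carrier [simp]: "ws \<in> words V \<Longrightarrow> etens R V ws \<in> carrier (tensor_power R V (length ws) (wdeg ws))"
  by (rule etens_closed[OF graded]) auto

lemma gEnd_eval_mlin:
  assumes f: "f \<in> carrier (gEnd R V n i)"
  shows "mlin R V n V i (\<lambda>ws. f (wdeg ws) (etens R V ws))"
proof (rule mlinI)
  note e = mlin_etens[OF graded, of n]
  show "f (wdeg ws) (etens R V ws) \<in> carrier (V (wdeg ws + i))" if "ws \<in> words V" "length ws = n" for ws
    using mod_hom_closed[OF gEnd_hom[OF f]] etens_carrier[OF that(1)] that(2) by simp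
  fix us k x ws assume w: "us \<in> words V" "ws \<in> words V" "x \<in> carrier (V k)" "length us + length ws + 1 = n"
  have c: "etens R V (us @ (k, z) # ws) \<in> carrier (tensor_power R V n (wdeg us + (k + wdeg ws)))" if "z \<in> carrier (V k)" for z
    using w that by (intro etens_closed[OF graded]) auto
  show "f (wdeg (us @ (k, x \<oplus>\<^bsub>V k\<^esub> y) # ws)) (etens R V (us @ (k, x \<oplus>\<^bsub>V k\<^esub> y) # ws)) =
      f (wdeg (us @ (k, x) # ws)) (etens R V (us @ (k, x) # ws)) \<oplus>\<^bsub>V (wdeg us + k + wdeg ws + i)\<^esub>
      f (wdeg (us @ (k, y) # ws)) (etens R V (us @ (k, y) # ws))" if y: "y \<in> carrier (V k)" for y
    using mlin_add[OF e w(1-3) y _ refl] w mod_hom_add[OF gEnd_hom[OF f] c[OF w(3)] c[OF y]] by (simp add: add.assoc)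
  show "f (wdeg (us @ (k, a \<odot>\<^bsub>V k\<^esub> x) # ws)) (etens R V (us @ (k, a \<odot>\<^bsub>V k\<^esub> x) # ws)) =
      a \<odot>\<^bsub>V (wdeg us + k + wdeg ws + i)\<^esub> f (wdeg (us @ (k, x) # ws)) (etens R V (us @ (k, x) # ws))"
    if a: "a \<in> carrier R" for a
    using mlin_smult[OF e w(1-3) a _ refl] w mod_hom_smult[OF gEnd_hom[OF f] a c[OF w(3)]] by (simp add: add.assoc)
qed

lemma gEnd_ext:
  assumes "f \<in> carrier (gEnd R V n i)" "g \<in> carrier (gEnd R V n i)"
    and "\<And>ws. ws \<in> words V \<Longrightarrow> length ws = n \<Longrightarrow> f (wdeg ws) (etens R V ws) = g (wdeg ws) (etens R V ws)"
  shows "f = g"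
  using gHom_tensor_ext[OF graded graded, of f n i g] assms unfolding gEnd_def by blast

lemma twist_length: "length ws \<noteq> n \<Longrightarrow> twist R V n s f ws = \<zero>\<^bsub>V (sdeg ws + s - 1)\<^esub>"
  by (simp add: twist_def)

lemma twist_eval: "length ws = n \<Longrightarrow> twist R V n s f ws =
    signed (V (wdeg ws + (int n - 1 + s))) (eps (map fst ws)) (f (wdeg ws) (etens R V ws))"
  unfolding twist_def by (simp add: sdeg_def add_ac) (simp add: algebra_simps)

lemma mfam_restrict:
  assumes m: "mlin R V n V (int n - 1 + s) \<phi>"
  shows "mfam R V s (\<lambda>ws. if length ws = n then \<phi> ws else \<zero>\<^bsub>V (sdeg ws + s - 1)\<^esub>)"
proof -
  have e: "wdeg ws + (int (length ws) - 1 + s) = sdeg ws + s - 1" for ws :: "(int \<times> 'a) list"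
    by (simp add: sdeg_def)
  have e2: "sdeg us + i + sdeg ws + s = wdeg us + i + wdeg ws + (int n - 1 + s)" if "length us + length ws + 1 = n"
    for us ws :: "(int \<times> 'a) list" and i
    using that by (auto simp: sdeg_def)
  show ?thesis
  proof (rule mfamI, goal_cases)
    case (1 ws)
    have "\<phi> ws \<in> carrier (V (sdeg ws + s - 1))" if "length ws = n"
      using mlin_closed[OF m 1 that refl] unfolding that[symmetric] e .
    thus ?case by simp
  next
    case (2 us i x y ws)
    show ?case
    proof (cases "length us + length ws + 1 = n")
      case True
      thus ?thesis using mlin_add[OF m 2 True[symmetric] refl] by (simp add: e2)
    next
      case False
      hence "length (us @ (i, z) # ws) \<noteq> n" for z by simp
      thus ?thesis by (simp add: algebra_simps)
    qed
  next
    case (3 us i x a ws)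
    show ?case
    proof (cases "length us + length ws + 1 = n")
      case True
      thus ?thesis using mlin_smult[OF m 3 True[symmetric] refl] by (simp add: e2)
    next
      case False
      hence "length (us @ (i, z) # ws) \<noteq> n" for z by simp
      thus ?thesis using 3 by (simp add: algebra_simps)
    qed
  qed
qed

lemma mfam_twist:
  assumes f: "f \<in> carrier (gEnd R V n (int n - 1 + s))"
  shows "mfam R V s (twist R V n s f)"
proof -
  have "mlin R V n V (int n - 1 + s) (\<lambda>ws. signed (V (wdeg ws + (int n - 1 + s))) (eps (map fst ws))
      (f (wdeg ws) (etens R V ws)))"
    by (rule mlin_signed[OF V.module_axioms V.module_axioms gEnd_eval_mlin[OF f]])
  moreover have "twist R V n s f = (\<lambda>ws. if length ws = n then signed (V (wdeg ws + (int n - 1 + s)))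
      (eps (map fst ws)) (f (wdeg ws) (etens R V ws)) else \<zero>\<^bsub>V (sdeg ws + s - 1)\<^esub>)"
    by (rule ext) (simp add: twist_length twist_eval)
  ultimately show ?thesis using mfam_restrict by simp
qed

lemma twist_inj:
  assumes "f \<in> carrier (gEnd R V n (int n - 1 + s))" "g \<in> carrier (gEnd R V n (int n - 1 + s))"
    and "\<And>ws. ws \<in> words V \<Longrightarrow> length ws = n \<Longrightarrow> twist R V n s f ws = twist R V n s g ws"
  shows "f = g"
proof (rule gEnd_ext[OF assms(1,2)])
  fix ws assume ws: "ws \<in> words V" "length ws = n"
  have c: "h (wdeg ws) (etens R V ws) \<in> carrier (V (wdeg ws + (int n - 1 + s)))"
    if "h \<in> carrier (gEnd R V n (int n - 1 + s))" for h
    by (rule mlin_closed[OF gEnd_eval_mlin[OF that] ws refl])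
  have "signed (V (wdeg ws + (int n - 1 + s))) (eps (map fst ws)) (twist R V n s f ws) =
      signed (V (wdeg ws + (int n - 1 + s))) (eps (map fst ws)) (twist R V n s g ws)"
    using assms(3)[OF ws] by simp
  thus "f (wdeg ws) (etens R V ws) = g (wdeg ws) (etens R V ws)"
    using c[OF assms(1)] c[OF assms(2)] by (simp add: twist_eval[OF ws(2)])
qed

lemma twist_surj:
  assumes \<phi>: "mfam R V s \<phi>"
  obtains f where "f \<in> carrier (gEnd R V n (int n - 1 + s))"
    "\<And>ws. ws \<in> words V \<Longrightarrow> length ws = n \<Longrightarrow> twist R V n s f ws = \<phi> ws"
proof -
  have m: "mlin R V n V (int n - 1 + s) \<phi>" using \<phi> by (simp add: mfam_def)
  have "mlin R V n V (int n - 1 + s) (\<lambda>ws. signed (V (wdeg ws + (int n - 1 + s))) (eps (map fst ws)) (\<phi> ws))"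
    by (rule mlin_signed[OF V.module_axioms V.module_axioms m])
  from gHom_tensor_exists[OF graded graded this] obtain f where
    f: "f \<in> carrier (gEnd R V n (int n - 1 + s))" "\<And>ws. ws \<in> words V \<Longrightarrow> length ws = n \<Longrightarrow>
      f (wdeg ws) (etens R V ws) = signed (V (wdeg ws + (int n - 1 + s))) (eps (map fst ws)) (\<phi> ws)"
    unfolding gEnd_def by blast
  show ?thesis
    by (rule that[OF f(1)]) (use f(2) mlin_closed[OF m] in \<open>simp add: twist_eval\<close>)
qed

lemma twist_zero: "ws \<in> words V \<Longrightarrow> i = int n - 1 + s \<Longrightarrow>
    twist R V n s (zero (gEnd R V n i)) ws = \<zero>\<^bsub>V (sdeg ws + s - 1)\<^esub>"
proof (cases "length ws = n")
  case True
  assume *: "ws \<in> words V" "i = int n - 1 + s"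
  have "sdeg ws + s - 1 = wdeg ws + i" using *(2) True by (simp add: sdeg_def)
  thus ?thesis using etens_carrier[OF *(1)] True by (auto simp: twist_def gEnd_def gHom_simps(2))
qed (simp add: twist_def)

lemma twist_signed:
  assumes "f \<in> carrier (gEnd R V n i)" "i = int n - 1 + s" "ws \<in> words V"
  shows "twist R V n s (signed (gEnd R V n i) k f) ws = signed (V (sdeg ws + s - 1)) k (twist R V n s f ws)"
proof (cases "length ws = n")
  case True
  have e: "signed (gEnd R V n i) k f (wdeg ws) (etens R V ws) =
      signed (V (wdeg ws + i)) k (f (wdeg ws) (etens R V ws))"
    using assms True etens_carrier[of ws] unfolding gEnd_def
    by (intro gHom_signed_eval[OF graded_tensor_power[OF graded] graded]) auto
  have "f (wdeg ws) (etens R V ws) \<in> carrier (V (wdeg ws + i))"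
    by (rule mlin_closed[OF gEnd_eval_mlin[OF assms(1)] assms(3) True refl])
  moreover have "sdeg ws + s - 1 = wdeg ws + i" using assms(2) True by (simp add: sdeg_def)
  ultimately show ?thesis using True by (simp add: twist_def e add.commute)
qed (simp add: twist_def)

lemma twist_minus:
  assumes "f \<in> carrier (gEnd R V n i)" "g \<in> carrier (gEnd R V n i)" "i = int n - 1 + s" "ws \<in> words V"
  shows "twist R V n s (f \<ominus>\<^bsub>gEnd R V n i\<^esub> g) ws = twist R V n s f ws \<ominus>\<^bsub>V (sdeg ws + s - 1)\<^esub> twist R V n s g ws"
proof (cases "length ws = n")
  case True
  have e: "(f \<ominus>\<^bsub>gEnd R V n i\<^esub> g) (wdeg ws) (etens R V ws) =
      f (wdeg ws) (etens R V ws) \<ominus>\<^bsub>V (wdeg ws + i)\<^esub> g (wdeg ws) (etens R V ws)"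
    using assms True etens_carrier[of ws] unfolding gEnd_def
    by (intro gHom_minus_eval[OF graded_tensor_power[OF graded] graded]) auto
  have "h (wdeg ws) (etens R V ws) \<in> carrier (V (wdeg ws + i))" if "h \<in> carrier (gEnd R V n i)" for h
    by (rule mlin_closed[OF gEnd_eval_mlin[OF that] assms(4) True refl])
  moreover have "sdeg ws + s - 1 = wdeg ws + i" using assms(3) True by (simp add: sdeg_def)
  ultimately show ?thesis using True assms(1,2)
    by (simp add: twist_def e) (simp add: a_minus_def V.signed_add V.signed_neg)
qed (simp add: twist_def a_minus_def module_minus_zero[OF V.module_axioms])

lemma twist_finsum:
  assumes "F \<in> I \<rightarrow> carrier (gEnd R V n i)" "i = int n - 1 + s" "ws \<in> words V"
  shows "twist R V n s (finsum (gEnd R V n i) F I) ws = finsum (V (sdeg ws + s - 1)) (\<lambda>k. twist R V n s (F k) ws) I"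
proof (cases "length ws = n")
  case True
  have e: "finsum (gEnd R V n i) F I (wdeg ws) (etens R V ws) =
      finsum (V (wdeg ws + i)) (\<lambda>k. F k (wdeg ws) (etens R V ws)) I"
    using assms True etens_carrier[of ws] unfolding gEnd_def
    by (intro gHom_finsum_eval[OF graded_tensor_power[OF graded] graded]) auto
  have "h (wdeg ws) (etens R V ws) \<in> carrier (V (wdeg ws + i))" if "h \<in> carrier (gEnd R V n i)" for h
    by (rule mlin_closed[OF gEnd_eval_mlin[OF that] assms(3) True refl])
  moreover have "sdeg ws + s - 1 = wdeg ws + i" using assms(2) True by (simp add: sdeg_def)
  ultimately show ?thesis using True assms(1)
    by (simp add: twist_def e) (subst V.signed_finsum, auto simp: Pi_def)
qed (simp add: twist_def)

lemma insert_at_spec: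
  assumes g: "g \<in> carrier (gEnd R V m j)" and k: "1 \<le> k" "k \<le> n"
  shows "insert_at R V n m j g k \<in> carrier (gHom R (tensor_power R V (n + m - 1)) (tensor_power R V n) j)"
    and "ws \<in> words V \<Longrightarrow> length ws = n + m - 1 \<Longrightarrow> insert_at R V n m j g k (wdeg ws) (etens R V ws) =
      signed (tensor_power R V n (wdeg ws + j)) (j * wdeg (take (k - 1) ws))
        (etens R V (ins (k - 1) m j (\<lambda>v. g (wdeg v) (etens R V v)) ws))"
proof -
  let ?\<gamma> = "\<lambda>v. g (wdeg v) (etens R V v)"
  let ?\<phi> = "\<lambda>ws. signed (tensor_power R V n (wdeg ws + j)) (j * sum_list (take (k - 1) (map fst ws)))
        (etens R V (ins (k - 1) m j ?\<gamma> ws))"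
  have "mlin R V (n + m - 1) (tensor_power R V n) (0 + j) (\<lambda>ws. etens R V (ins (k - 1) m j ?\<gamma> ws))"
    by (rule mlin_ins[OF V.module_axioms mlin_etens[OF graded] gEnd_eval_mlin[OF g]]) (use k in auto)
  hence "mlin R V (n + m - 1) (tensor_power R V n) j (\<lambda>ws. etens R V (ins (k - 1) m j ?\<gamma> ws))" by simp
  from mlin_signed[OF V.module_axioms tensor_power_module[OF graded] this,
      of "\<lambda>is. j * sum_list (take (k - 1) is)"]
  have m: "mlin R V (n + m - 1) (tensor_power R V n) j ?\<phi>" .
  note s = tensor_lift_spec[OF graded graded_tensor_power[OF graded] m, where \<psi> = "\<lambda>is xs.
     let is1 = take (k - 1) is; is2 = take m (drop (k - 1) is); is3 = drop (k - 1 + m) is;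
         xs1 = take (k - 1) xs; xs2 = take m (drop (k - 1) xs); xs3 = drop (k - 1 + m) xs
     in signed (tensor_power R V n (sum_list is + j)) (j * sum_list is1)
          (elem_tensor R V (is1 @ [sum_list is2 + j] @ is3)
             (xs1 @ [g (sum_list is2) (elem_tensor R V is2 xs2)] @ xs3))"]
  have eq: "(let is1 = take (k - 1) is; is2 = take m (drop (k - 1) is); is3 = drop (k - 1 + m) is;
         xs1 = take (k - 1) xs; xs2 = take m (drop (k - 1) xs); xs3 = drop (k - 1 + m) xs
     in signed (tensor_power R V n (sum_list is + j)) (j * sum_list is1)
          (elem_tensor R V (is1 @ [sum_list is2 + j] @ is3)
             (xs1 @ [g (sum_list is2) (elem_tensor R V is2 xs2)] @ xs3))) = ?\<phi> (zip is xs)"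
    if "length is = n + m - 1" "length xs = n + m - 1" for "is" xs
    using that by (simp add: Let_def ins_def etens_def wdeg_def take_map[symmetric] drop_map[symmetric] take_zip drop_zip)
  show "insert_at R V n m j g k \<in> carrier (gHom R (tensor_power R V (n + m - 1)) (tensor_power R V n) j)"
    unfolding insert_at_def by (rule s(1)) (rule eq)
  show "insert_at R V n m j g k (wdeg ws) (etens R V ws) =
      signed (tensor_power R V n (wdeg ws + j)) (j * wdeg (take (k - 1) ws))
        (etens R V (ins (k - 1) m j ?\<gamma> ws))" if "ws \<in> words V" "length ws = n + m - 1"
    using s(2)[OF eq that] unfolding insert_at_def by (simp add: wdeg_def take_map)
qed

lemma circ_closed:
  assumes f: "f \<in> carrier (gEnd R V n i)" and g: "g \<in> carrier (gEnd R V m j)"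
  shows "circ R V n i f m j g \<in> carrier (gEnd R V (n + m - 1) (i + j))"
proof -
  have "circ R V n i f m j g d \<in> mod_hom R (tensor_power R V (n + m - 1) d) (V (d + (i + j)))" for d
  proof -
    let ?T = "tensor_power R V (n + m - 1) d"
    let ?W = "V (d + (i + j))"
    have T: "module R ?T" by (rule tensor_power_module[OF graded])
    have h: "(\<lambda>t\<in>carrier ?T. f (d + j) (insert_at R V n m j g k d t)) \<in> mod_hom R ?T ?W" if "k \<in> {1..n}" for k
    proof -
      have "insert_at R V n m j g k d \<in> mod_hom R ?T (tensor_power R V n (d + j))"
        using insert_at_spec(1)[OF g, of k n] that unfolding gHom_simps by auto
      moreover have "f (d + j) \<in> mod_hom R (tensor_power R V n (d + j)) ?W"
        using gEnd_hom[OF f, of "d + j"] by (simp add: add_ac)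
      ultimately show ?thesis using mod_hom_comp T by blast
    qed
    have h2: "(\<lambda>t\<in>carrier ?T. signed ?W ((int m - 1) * (int k - 1)) ((\<lambda>t\<in>carrier ?T. f (d + j) (insert_at R V n m j g k d t)) t))
        \<in> mod_hom R ?T ?W" if "k \<in> {1..n}" for k
      by (rule mod_hom_fun_signed[OF T V.module_axioms h[OF that]])
    have h3: "(\<lambda>t\<in>carrier ?T. finsum ?W (\<lambda>k. (\<lambda>t\<in>carrier ?T. signed ?W ((int m - 1) * (int k - 1))
        ((\<lambda>t\<in>carrier ?T. f (d + j) (insert_at R V n m j g k d t)) t)) t) {1..n}) \<in> mod_hom R ?T ?W"
      by (rule mod_hom_fun_finsum[OF T V.module_axioms h2])
    from mod_hom_fun_signed[OF T V.module_axioms h3, of "weight m j * (int n - 1)"]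
    show ?thesis unfolding circ_def by (simp cong: restrict_cong)
  qed
  thus ?thesis by (simp add: gEnd_def gHom_simps)
qed

text \<open>The signs in \<^const>\<open>circ\<close> are those of moving the suspensions of the factors past \<open>g\<close> and past
  each other. In the \<open>k\<close>-th summand the two exponents differ by an even number.\<close>

theorem twist_circ:
  assumes n: "n \<ge> 1" and f: "f \<in> carrier (gEnd R V n i)" and g: "g \<in> carrier (gEnd R V m j)"
    and i: "i = int n - 1 + s" and j: "j = int m - 1 + t" and ws: "ws \<in> words V"
  shows "twist R V (n + m - 1) (s + t) (circ R V n i f m j g) ws = icomp V s t (twist R V n s f) (twist R V m t g) ws"
proof -
  define d where "d = sdeg ws + s + t - 1"
  let ?\<phi> = "twist R V n s f"
  let ?\<psi> = "twist R V m t g"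
  let ?D = "dsum (V d)"
  have \<phi>: "mfam R V s ?\<phi>" using mfam_twist f i by simp
  have \<psi>: "mfam R V t ?\<psi>" using mfam_twist g j by simp
  define G where "G = (\<lambda>u v w. signed (V d) (t * sdeg u) (?\<phi> (u @ (sdeg v + t - 1, ?\<psi> v) # w)))"
  have W: "u \<in> words V \<and> v \<in> words V \<and> w \<in> words V \<and> d = sdeg u + sdeg v + sdeg w + s + t - 1"
    if "u @ v @ w = ws" for u v w
    using ws that[symmetric] by (auto simp: d_def)
  have Gc: "G u v w \<in> carrier (V d)" if "u @ v @ w = ws" for u v w
    unfolding G_def using W[OF that] by (intro V.signed_closed icomp_term_closed[OF \<phi> \<psi>]) auto
  have Gz: "G u v w = \<zero>\<^bsub>V d\<^esub>" if "u @ v @ w = ws" "length v \<noteq> m \<or> length ws \<noteq> n + m - 1" for u v w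
  proof -
    have "?\<phi> (u @ (sdeg v + t - 1, ?\<psi> v) # w) = \<zero>\<^bsub>V d\<^esub>"
    proof (cases "length v = m")
      case True
      have "length u + length v + length w = length ws" using that(1)[symmetric] by simp
      hence "length (u @ (sdeg v + t - 1, ?\<psi> v) # w) \<noteq> n" using that(2) True n by auto
      moreover have "sdeg (u @ (sdeg v + t - 1, ?\<psi> v) # w) + s - 1 = d" using W[OF that(1)] by simp
      ultimately show ?thesis using twist_length by metis
    next
      case False
      show ?thesis unfolding twist_length[OF False]
        by (rule mfam_zero[OF \<phi>]) (use W[OF that(1)] in auto)
    qed
    thus ?thesis unfolding G_def by simp
  qed
  have e: "icomp V s t ?\<phi> ?\<psi> ws = ?D (\<lambda>u y. ?D (\<lambda>v w. G u v w) y) ws"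
    unfolding icomp_def d_def[symmetric] G_def ..
  show ?thesis
  proof (cases "length ws = n + m - 1")
    case False
    hence "?D (\<lambda>u y. ?D (\<lambda>v w. G u v w) y) ws = \<zero>\<^bsub>V d\<^esub>"
      by (intro V.dsum_zero Gz) auto
    thus ?thesis using False e by (simp add: twist_length d_def add_ac)
  next
    case len: True
    have inner: "?D (\<lambda>v w. G u v w) y = (if m \<le> length y then G u (take m y) (drop m y) else \<zero>\<^bsub>V d\<^esub>)"
      if "u @ y = ws" for u y
      using that by (intro V.dsum_single Gz Gc) auto
    define F where "F = (\<lambda>a. G (take a ws) (take m (drop a ws)) (drop (a + m) ws))"
    have Fc: "F a \<in> carrier (V d)" for a unfolding F_def
      by (rule Gc) (rule take_take_drop)
    have "?D (\<lambda>u y. ?D (\<lambda>v w. G u v w) y) ws = ?D (\<lambda>u y. if m \<le> length y then G u (take m y) (drop m y) else \<zero>\<^bsub>V d\<^esub>) ws"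
      by (intro dsum_cong inner)
    also have "\<dots> = finsum (V d) (\<lambda>a. if m \<le> length (drop a ws) then G (take a ws) (take m (drop a ws)) (drop m (drop a ws)) else \<zero>\<^bsub>V d\<^esub>) {..length ws}"
      by (rule V.dsum_finsum) (auto intro!: Gc)
    also have "\<dots> = finsum (V d) F {..<n}"
      using len n by (intro V.M.add.finprod_mono_neutral_cong_right)
        (auto simp: F_def add.commute[of m] take_take_drop intro!: Gc)
    also have "\<dots> = finsum (V d) (\<lambda>k. F (k - 1)) {1..n}"
      using finsum_lessThan_Suc_shift[OF V.M.abelian_monoid_axioms, of "\<lambda>k. F (k - 1)" n] Fc by simp
    finally have icomp_eq: "icomp V s t ?\<phi> ?\<psi> ws = finsum (V d) (\<lambda>k. F (k - 1)) {1..n}" using e by simp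
    let ?\<gamma> = "\<lambda>v. g (wdeg v) (etens R V v)"
    have wd: "wdeg ws + (i + j) = d" using i j len n by (simp add: d_def sdeg_def)
    define E where "E = (\<lambda>k. f (wdeg ws + j) (etens R V (ins (k - 1) m j ?\<gamma> ws)))"
    have split: "\<exists>u v w. ws = u @ v @ w \<and> length u = k - 1 \<and> length v = m" if "k \<in> {1..n}" for k
      by (rule list_split3) (use that len in auto)
    have ev: "E k \<in> carrier (V d) \<and> F (k - 1) = signed (V d) (eps (map fst ws) + weight m j * (int n - 1) +
        (int m - 1) * (int k - 1) + j * wdeg (take (k - 1) ws)) (E k)" if k: "k \<in> {1..n}" for k
    proof -
      obtain u v w where uvw: "ws = u @ v @ w" "length u = k - 1" "length v = m" using split[OF k] by blast
      have w: "u \<in> words V" "v \<in> words V" "w \<in> words V" using W[OF uvw(1)[symmetric]] by auto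
      have gv: "?\<gamma> v \<in> carrier (V (wdeg v + j))"
        by (rule mlin_closed[OF gEnd_eval_mlin[OF g] w(2) uvw(3) refl])
      have lw: "length u + 1 + length w = n" using uvw len k n by auto
      have ii: "ins (k - 1) m j ?\<gamma> ws = u @ (wdeg v + j, ?\<gamma> v) # w"
        unfolding uvw(1) by (rule ins_split[OF uvw(2,3)])
      have dd: "wdeg (u @ (wdeg v + j, ?\<gamma> v) # w) = wdeg ws + j" using uvw by simp
      have E: "E k = (\<lambda>ws. f (wdeg ws) (etens R V ws)) (u @ (wdeg v + j, ?\<gamma> v) # w)"
        unfolding E_def ii dd[symmetric] by (rule refl)
      have Ec: "E k \<in> carrier (V d)" unfolding E
        by (rule mlin_closed[OF gEnd_eval_mlin[OF f]]) (use w gv lw uvw(1) wd in auto)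
      have sv: "sdeg v + t - 1 = wdeg v + j" using j uvw(3) by (simp add: sdeg_def)
      have psi: "?\<psi> v = signed (V (wdeg v + j)) (eps (map fst v)) (?\<gamma> v)"
        using twist_eval[OF uvw(3), of t g] j by (simp add: add_ac)
      have dw: "d = sdeg u + (wdeg v + j) + sdeg w + s" using W[OF uvw(1)[symmetric]] sv by simp
      have phi: "?\<phi> (u @ (wdeg v + j, ?\<gamma> v) # w) = signed (V d) (eps (map fst u @ (wdeg v + j) # map fst w)) (E k)"
      proof -
        have "wdeg (u @ (wdeg v + j, ?\<gamma> v) # w) + (int n - 1 + s) = d" unfolding dd using wd i by simp
        thus ?thesis using twist_eval[of "u @ (wdeg v + j, ?\<gamma> v) # w" n s f] lw unfolding E by simp
      qed
      have ta: "take (k - 1) ws = u" "take m (drop (k - 1) ws) = v" "drop (k - 1 + m) ws = w"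
        using uvw by auto
      have "F (k - 1) = signed (V d) (t * sdeg u) (?\<phi> (u @ (wdeg v + j, signed (V (wdeg v + j)) (eps (map fst v)) (?\<gamma> v)) # w))"
        unfolding F_def ta G_def sv psi ..
      also have "\<dots> = signed (V d) (t * sdeg u + (eps (map fst v) + eps (map fst u @ (wdeg v + j) # map fst w))) (E k)"
        unfolding mfam_signed[OF \<phi> w(1,3) gv dw] phi using Ec by simp
      also have "\<dots> = signed (V d) (eps (map fst ws) + weight m j * (int n - 1) +
        (int m - 1) * (int k - 1) + j * wdeg (take (k - 1) ws)) (E k)"
      proof (rule signed_cong)
        have len': "int n = int (length u) + 1 + int (length w)" "int k = int (length u) + 1" "length v = m"
          using lw uvw k by auto
        have "(t * sdeg u + (eps (map fst v) + eps (map fst u @ (wdeg v + j) # map fst w))) -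
           (eps (map fst ws) + weight m j * (int n - 1) + (int m - 1) * (int k - 1) + j * wdeg (take (k - 1) ws))
          = - 2 * ((int m - 1) * sdeg u + (int m - 1) * (int (length u) + int (length w)))"
          unfolding ta(1) unfolding uvw(1) len'(1,2) unfolding j
          by (simp add: len'(3) eps_append weight_def sdeg_def wdeg_def[symmetric] algebra_simps)
        thus "even ((t * sdeg u + (eps (map fst v) + eps (map fst u @ (wdeg v + j) # map fst w))) -
           (eps (map fst ws) + weight m j * (int n - 1) + (int m - 1) * (int k - 1) + j * wdeg (take (k - 1) ws)))"
          by simp
      qed
      finally show ?thesis using Ec by simp
    qed
    have fi: "f (wdeg ws + j) (insert_at R V n m j g k (wdeg ws) (etens R V ws)) =
        signed (V d) (j * wdeg (take (k - 1) ws)) (E k)" if k: "k \<in> {1..n}" for k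
    proof -
      obtain u v w where uvw: "ws = u @ v @ w" "length u = k - 1" "length v = m" using split[OF k] by blast
      have w: "u \<in> words V" "v \<in> words V" "w \<in> words V" using W[OF uvw(1)[symmetric]] by auto
      have gv: "?\<gamma> v \<in> carrier (V (wdeg v + j))"
        by (rule mlin_closed[OF gEnd_eval_mlin[OF g] w(2) uvw(3) refl])
      have ii: "ins (k - 1) m j ?\<gamma> ws = u @ (wdeg v + j, ?\<gamma> v) # w"
        unfolding uvw(1) by (rule ins_split[OF uvw(2,3)])
      have "etens R V (ins (k - 1) m j ?\<gamma> ws) \<in> carrier (tensor_power R V n (wdeg ws + j))"
        unfolding ii by (rule etens_closed[OF graded]) (use w gv uvw len k n in auto)
      moreover have "f (wdeg ws + j) \<in> mod_hom R (tensor_power R V n (wdeg ws + j)) (V d)"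
        using gEnd_hom[OF f, of "wdeg ws + j"] wd by (simp add: add_ac)
      ultimately show ?thesis
        unfolding insert_at_spec(2)[OF g _ _ ws len, of k] using k insert_at_spec(2)[OF g _ _ ws len, of k]
        by (simp add: mod_hom_signed[OF tensor_power_module[OF graded] V.module_axioms] E_def)
    qed
    have et: "etens R V ws \<in> carrier (tensor_power R V (n + m - 1) (wdeg ws))"
      using etens_carrier[OF ws] len by simp
    have "circ R V n i f m j g (wdeg ws) (etens R V ws) = signed (V d) (weight m j * (int n - 1))
       (finsum (V d) (\<lambda>k. signed (V d) ((int m - 1) * (int k - 1))
          (signed (V d) (j * wdeg (take (k - 1) ws)) (E k))) {1..n})"
      unfolding circ_def using et
      by (simp add: wd) (intro arg_cong[where f = "signed (V d) _"] V.M.finsum_cong', auto simp: fi ev)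
    hence "twist R V (n + m - 1) (s + t) (circ R V n i f m j g) ws = signed (V d) (eps (map fst ws))
       (signed (V d) (weight m j * (int n - 1))
       (finsum (V d) (\<lambda>k. signed (V d) ((int m - 1) * (int k - 1))
          (signed (V d) (j * wdeg (take (k - 1) ws)) (E k))) {1..n}))"
      using len by (simp add: twist_def d_def add_ac)
    also have "\<dots> = finsum (V d) (\<lambda>k. F (k - 1)) {1..n}"
      using ev by (simp add: V.signed_finsum Pi_def) (intro V.M.finsum_cong', auto simp: add_ac)
    finally show ?thesis using icomp_eq by simp
  qed
qed

end

section \<open>The differential on multilinear families\<close>

definition wmap :: "(int \<Rightarrow> 'a \<Rightarrow> 'b) \<Rightarrow> (int \<times> 'a) list \<Rightarrow> (int \<times> 'b) list" where
  "wmap f ws = map (\<lambda>w. (fst w, f (fst w) (snd w))) ws"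

lemma wmap_simps [simp]: "wmap f [] = []" "wmap f (w # ws) = (fst w, f (fst w) (snd w)) # wmap f ws"
  "wmap f (us @ ws) = wmap f us @ wmap f ws" "length (wmap f ws) = length ws" "wdeg (wmap f ws) = wdeg ws"
  "sdeg (wmap f ws) = sdeg ws"
  by (simp_all add: wmap_def wdeg_def sdeg_def comp_def)

lemma wmap_words: "(\<And>i x. x \<in> carrier (V i) \<Longrightarrow> f i x \<in> carrier (W i)) \<Longrightarrow> ws \<in> words V \<Longrightarrow> wmap f ws \<in> words W"
  by (induct ws) auto

lemma wmap_id: "(\<And>i x. x \<in> carrier (V i) \<Longrightarrow> f i x = x) \<Longrightarrow> ws \<in> words V \<Longrightarrow> wmap f ws = ws"
  by (induct ws) auto

lemma wmap_wmap: "wmap f (wmap g ws) = wmap (\<lambda>i x. f i (g i x)) ws"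
  by (induct ws) auto

lemma (in plain_module) add_minus_cancel: "a \<in> carrier M \<Longrightarrow> b \<in> carrier M \<Longrightarrow> (a \<oplus>\<^bsub>M\<^esub> b) \<ominus>\<^bsub>M\<^esub> a = b"
  unfolding a_minus_def by (subst M.a_comm) (simp_all add: M.a_assoc M.r_neg)

lemma word_split: "k < length ws \<Longrightarrow> \<exists>u i x w. ws = u @ (i, x) # w \<and> length u = k"
  using id_take_nth_drop[of k ws]
  by (intro exI[of _ "take k ws"] exI[of _ "fst (ws ! k)"] exI[of _ "snd (ws ! k)"] exI[of _ "drop (Suc k) ws"]) simp

lemma dsum_wmap: "dsum M F (wmap f xs) = dsum M (\<lambda>u w. F (wmap f u) (wmap f w)) xs"
  unfolding wmap_def by (rule dsum_rename)

lemma (in graded_mod) mfam_conj: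
  assumes W: "graded_module R W" and \<phi>: "mfam R W s \<phi>"
    and f: "\<And>i. f i \<in> mod_hom R (V i) (W i)" and g: "\<And>i. g i \<in> mod_hom R (W i) (V i)"
  shows "mfam R V s (\<lambda>ws. g (sdeg ws + s - 1) (\<phi> (wmap f ws)))"
proof (rule mfamI)
  interpret W: graded_mod R W by (rule graded_mod.intro[OF W])
  have fw: "wmap f ws \<in> words W" if "ws \<in> words V" for ws
    by (rule wmap_words[OF _ that]) (rule mod_hom_closed[OF f])
  show "g (sdeg ws + s - 1) (\<phi> (wmap f ws)) \<in> carrier (V (sdeg ws + s - 1))" if "ws \<in> words V" for ws
    by (rule mod_hom_closed[OF g mfam_closed[OF \<phi> fw[OF that]]]) simp
  fix us i x ws assume w: "us \<in> words V" "ws \<in> words V" "x \<in> carrier (V i)"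
  define d where "d = sdeg us + i + sdeg ws + s"
  have d: "sdeg (us @ (i, z) # ws) + s - 1 = d" for z :: 'a by (simp add: d_def)
  have c: "\<phi> (wmap f us @ (i, f i z) # wmap f ws) \<in> carrier (W d)" if "z \<in> carrier (V i)" for z
    by (rule mfam_closed[OF \<phi>]) (use w that fw mod_hom_closed[OF f] in \<open>auto simp: d_def\<close>)
  show "g (sdeg (us @ (i, x \<oplus>\<^bsub>V i\<^esub> y) # ws) + s - 1) (\<phi> (wmap f (us @ (i, x \<oplus>\<^bsub>V i\<^esub> y) # ws))) =
      g (sdeg (us @ (i, x) # ws) + s - 1) (\<phi> (wmap f (us @ (i, x) # ws))) \<oplus>\<^bsub>V (sdeg us + i + sdeg ws + s)\<^esub>
      g (sdeg (us @ (i, y) # ws) + s - 1) (\<phi> (wmap f (us @ (i, y) # ws)))" if y: "y \<in> carrier (V i)" for y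
  proof -
    have "\<phi> (wmap f us @ (i, f i (x \<oplus>\<^bsub>V i\<^esub> y)) # wmap f ws) =
        \<phi> (wmap f us @ (i, f i x) # wmap f ws) \<oplus>\<^bsub>W d\<^esub> \<phi> (wmap f us @ (i, f i y) # wmap f ws)"
      unfolding mod_hom_add[OF f w(3) y]
      by (rule W.mfam_add[OF \<phi>]) (use w y fw mod_hom_closed[OF f] in \<open>auto simp: d_def\<close>)
    thus ?thesis unfolding d d_def[symmetric]
      using mod_hom_add[OF g c[OF w(3)] c[OF y]] by simp
  qed
  show "g (sdeg (us @ (i, a \<odot>\<^bsub>V i\<^esub> x) # ws) + s - 1) (\<phi> (wmap f (us @ (i, a \<odot>\<^bsub>V i\<^esub> x) # ws))) =
      a \<odot>\<^bsub>V (sdeg us + i + sdeg ws + s)\<^esub> g (sdeg (us @ (i, x) # ws) + s - 1) (\<phi> (wmap f (us @ (i, x) # ws)))"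
    if a: "a \<in> carrier R" for a
  proof -
    have "\<phi> (wmap f us @ (i, f i (a \<odot>\<^bsub>V i\<^esub> x)) # wmap f ws) = a \<odot>\<^bsub>W d\<^esub> \<phi> (wmap f us @ (i, f i x) # wmap f ws)"
      unfolding mod_hom_smult[OF f a w(3)]
      by (rule W.mfam_smult[OF \<phi>]) (use w a fw mod_hom_closed[OF f] in \<open>auto simp: d_def\<close>)
    thus ?thesis unfolding d d_def[symmetric]
      using mod_hom_smult[OF g a c[OF w(3)]] by simp
  qed
qed

locale dg_mod = graded_mod R A for R :: "('r, 'c) ring_scheme" and A :: "('r, 'a) gmodule" +
  fixes d :: "int \<Rightarrow> 'a \<Rightarrow> 'a"
  assumes dg: "dgmodule R A d"
begin

lemma d_hom: "j = i - 1 \<Longrightarrow> d i \<in> mod_hom R (A i) (A j)"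
  using dg by (simp add: dgmodule_def gHom_simps)

lemma d_closed: "x \<in> carrier (A i) \<Longrightarrow> j = i - 1 \<Longrightarrow> d i x \<in> carrier (A j)"
  using mod_hom_closed[OF d_hom] by blast

lemma d_d: "x \<in> carrier (A i) \<Longrightarrow> j = i - 1 \<Longrightarrow> k = i - 2 \<Longrightarrow> d j (d i x) = \<zero>\<^bsub>A k\<^esub>"
  using dg by (simp add: dgmodule_def)

lemma d_zero: "j = i - 1 \<Longrightarrow> d i \<zero>\<^bsub>A i\<^esub> = \<zero>\<^bsub>A j\<^esub>"
  by (rule mod_hom_zero[OF V.module_axioms V.module_axioms d_hom])

lemma d_add: "x \<in> carrier (A i) \<Longrightarrow> y \<in> carrier (A i) \<Longrightarrow> j = i - 1 \<Longrightarrow>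
    d i (x \<oplus>\<^bsub>A i\<^esub> y) = d i x \<oplus>\<^bsub>A j\<^esub> d i y"
  using mod_hom_add[OF d_hom] by blast

lemma d_signed: "x \<in> carrier (A i) \<Longrightarrow> j = i - 1 \<Longrightarrow> d i (signed (A i) k x) = signed (A j) k (d i x)"
  using mod_hom_signed[OF V.module_axioms V.module_axioms d_hom] by blast

definition dfam :: "(int \<times> 'a) list \<Rightarrow> 'a" where
  "dfam ws = (if length ws = 1 then d (fst (hd ws)) (snd (hd ws)) else \<zero>\<^bsub>A (sdeg ws - 2)\<^esub>)"

text \<open>\<open>\<phi>\<close> preceded by the differential of the tensor power of the suspension.\<close>

definition dpre :: "int \<Rightarrow> ((int \<times> 'a) list \<Rightarrow> 'a) \<Rightarrow> (int \<times> 'a) list \<Rightarrow> 'a" where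
  "dpre s \<phi> ws = psum (A (sdeg ws + s - 2)) (\<lambda>u x w.
     signed (A (sdeg ws + s - 2)) (sdeg u) (\<phi> (u @ (fst x - 1, d (fst x) (snd x)) # w))) ws"

definition bdry :: "int \<Rightarrow> ((int \<times> 'a) list \<Rightarrow> 'a) \<Rightarrow> (int \<times> 'a) list \<Rightarrow> 'a" where
  "bdry s \<phi> ws = d (sdeg ws + s - 1) (\<phi> ws) \<ominus>\<^bsub>A (sdeg ws + s - 2)\<^esub>
     signed (A (sdeg ws + s - 2)) s (dpre s \<phi> ws)"

definition cyc :: "int \<Rightarrow> ((int \<times> 'a) list \<Rightarrow> 'a) \<Rightarrow> bool" where
  "cyc s \<phi> \<longleftrightarrow> (\<forall>ws\<in>words A. bdry s \<phi> ws = \<zero>\<^bsub>A (sdeg ws + s - 2)\<^esub>)"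

lemma mfam_dfam: "mfam R A (- 1) dfam"
proof (rule mfamI)
  show "dfam ws \<in> carrier (A (sdeg ws + - 1 - 1))" if "ws \<in> words A" for ws
    using that by (cases ws) (auto simp: dfam_def intro!: d_closed)
  fix us i x ws assume w: "us \<in> words A" "ws \<in> words A" "x \<in> carrier (A i)"
  show "dfam (us @ (i, x \<oplus>\<^bsub>A i\<^esub> y) # ws) = dfam (us @ (i, x) # ws) \<oplus>\<^bsub>A (sdeg us + i + sdeg ws + - 1)\<^esub> dfam (us @ (i, y) # ws)"
    if "y \<in> carrier (A i)" for y
    using w that by (cases "us = [] \<and> ws = []") (auto simp: dfam_def d_add algebra_simps)
  show "dfam (us @ (i, a \<odot>\<^bsub>A i\<^esub> x) # ws) = a \<odot>\<^bsub>A (sdeg us + i + sdeg ws + - 1)\<^esub> dfam (us @ (i, x) # ws)"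
    if "a \<in> carrier R" for a
    using w that mod_hom_smult[OF d_hom[OF refl]]
    by (cases "us = [] \<and> ws = []") (auto simp: dfam_def algebra_simps)
qed

lemma dpre_term_closed:
  assumes "mfam R A s \<phi>" "u \<in> words A" "x \<in> carrier (A i)" "w \<in> words A" "e = sdeg u + i + sdeg w + s - 1"
  shows "\<phi> (u @ (i - 1, d i x) # w) \<in> carrier (A e)"
  using assms by (intro mfam_closed[OF assms(1)]) (auto intro: d_closed)

lemma dpre_closed: "mfam R A s \<phi> \<Longrightarrow> ws \<in> words A \<Longrightarrow> e = sdeg ws + s - 2 \<Longrightarrow> dpre s \<phi> ws \<in> carrier (A e)"
proof -
  assume *: "mfam R A s \<phi>" "ws \<in> words A" "e = sdeg ws + s - 2"
  show ?thesis unfolding dpre_def *(3)[symmetric]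
  proof (rule V.psum_closed)
    fix u x w assume "u @ x # w = ws"
    thus "signed (A e) (sdeg u) (\<phi> (u @ (fst x - 1, d (fst x) (snd x)) # w)) \<in> carrier (A e)"
      using *(2,3) by (intro V.signed_closed dpre_term_closed[OF *(1)]) auto
  qed
qed

lemma bdry_closed: "mfam R A s \<phi> \<Longrightarrow> ws \<in> words A \<Longrightarrow> e = sdeg ws + s - 2 \<Longrightarrow> bdry s \<phi> ws \<in> carrier (A e)"
  unfolding bdry_def by (auto intro!: V.minus_closed V.signed_closed dpre_closed d_closed mfam_closed[of R A s \<phi>])

lemma cyc_iff:
  assumes "mfam R A s \<phi>"
  shows "cyc s \<phi> \<longleftrightarrow> (\<forall>ws\<in>words A. d (sdeg ws + s - 1) (\<phi> ws) = signed (A (sdeg ws + s - 2)) s (dpre s \<phi> ws))"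
proof -
  have "d (sdeg ws + s - 1) (\<phi> ws) \<in> carrier (A (sdeg ws + s - 2))" "dpre s \<phi> ws \<in> carrier (A (sdeg ws + s - 2))"
    if "ws \<in> words A" for ws
    by (rule d_closed[OF mfam_closed[OF assms that refl]], simp) (rule dpre_closed[OF assms that refl])
  thus ?thesis unfolding cyc_def bdry_def by (auto simp: V.minus_eq_zero_iff)
qed

text \<open>The next two lemmas identify \<^const>\<open>bdry\<close> with the graded commutator of the differential and \<open>\<phi>\<close>.\<close>

lemma icomp_dfam_left:
  assumes \<phi>: "mfam R A s \<phi>" and ws: "ws \<in> words A" and e: "e = sdeg ws + s - 1"
  shows "icomp A (- 1) s dfam \<phi> ws = d e (\<phi> ws)"
proof -
  define k where "k = sdeg ws + s - 2"
  have k: "sdeg ws + - 1 + s - 1 = k" by (simp add: k_def)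
  let ?G = "\<lambda>u v w. signed (A k) (s * sdeg u) (dfam (u @ (sdeg v + s - 1, \<phi> v) # w))"
  have c: "?G u v w \<in> carrier (A k)" if "u @ v @ w = ws" for u v w
    using that ws by (intro V.signed_closed icomp_term_closed[OF mfam_dfam \<phi>]) (auto simp: k_def)
  have z: "?G u v w = \<zero>\<^bsub>A k\<^esub>" if "u @ v @ w = ws" "u \<noteq> [] \<or> w \<noteq> []" for u v w
  proof -
    have "sdeg (u @ (sdeg v + s - 1, \<phi> v) # w) - 2 = k" using that(1)[symmetric] by (simp add: k_def)
    moreover have "length (u @ (sdeg v + s - 1, \<phi> v) # w) \<noteq> 1" using that(2) by auto
    ultimately show ?thesis by (simp only: dfam_def if_False V.signed_zero)
  qed
  have inner: "dsum (A k) (?G u) y = (if length ws \<le> length y then ?G u (take (length ws) y) (drop (length ws) y) else \<zero>\<^bsub>A k\<^esub>)"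
    if "u @ y = ws" for u y
    by (rule V.dsum_single) (use that z c in auto)
  have "icomp A (- 1) s dfam \<phi> ws = dsum (A k) (\<lambda>u y. dsum (A k) (?G u) y) ws"
    unfolding icomp_def k ..
  also have "\<dots> = (if 0 \<le> length ws then dsum (A k) (?G (take 0 ws)) (drop 0 ws) else \<zero>\<^bsub>A k\<^esub>)"
  proof (rule V.dsum_single)
    show "dsum (A k) (?G u) y = \<zero>\<^bsub>A k\<^esub>" if "u @ y = ws" "length u \<noteq> 0" for u y
      using that by (intro V.dsum_zero z) auto
    show "dsum (A k) (?G (take 0 ws)) (drop 0 ws) \<in> carrier (A k)"
      by (intro V.dsum_closed c) auto
  qed
  also have "\<dots> = dfam [(sdeg ws + s - 1, \<phi> ws)]" using inner[of "[]" ws] by simp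
  finally show ?thesis by (simp add: dfam_def e)
qed

lemma icomp_dfam_right:
  assumes \<phi>: "mfam R A s \<phi>" and ws: "ws \<in> words A"
  shows "icomp A s (- 1) \<phi> dfam ws = dpre s \<phi> ws"
proof -
  define k where "k = sdeg ws + s - 2"
  have k: "sdeg ws + s + - 1 - 1 = k" by (simp add: k_def)
  let ?G = "\<lambda>u v w. signed (A k) (- 1 * sdeg u) (\<phi> (u @ (sdeg v + - 1 - 1, dfam v) # w))"
  have c: "?G u v w \<in> carrier (A k)" if "u @ v @ w = ws" for u v w
    using that ws by (intro V.signed_closed icomp_term_closed[OF \<phi> mfam_dfam]) (auto simp: k_def)
  have z: "?G u v w = \<zero>\<^bsub>A k\<^esub>" if "u @ v @ w = ws" "length v \<noteq> 1" for u v w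
  proof -
    have "dfam v = \<zero>\<^bsub>A (sdeg v + - 1 - 1)\<^esub>" using that by (simp add: dfam_def)
    hence "\<phi> (u @ (sdeg v + - 1 - 1, dfam v) # w) = \<zero>\<^bsub>A k\<^esub>"
      by (simp only:) (rule mfam_zero[OF \<phi>], use that ws in \<open>auto simp: k_def\<close>)
    thus ?thesis by simp
  qed
  have "icomp A s (- 1) \<phi> dfam ws = dsum (A k) (\<lambda>u y. dsum (A k) (\<lambda>v w. ?G u v w) y) ws"
    unfolding icomp_def k ..
  also have "\<dots> = psum (A k) (\<lambda>u x w. ?G u [x] w) ws"
    by (rule V.dsum_dsum_psum) (rule z, assumption+, rule c, simp)
  also have "\<dots> = dpre s \<phi> ws"
    unfolding dpre_def k_def[symmetric]
    by (intro psum_cong) (simp add: dfam_def signed_cong[of "- sdeg _" "sdeg _"])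
  finally show ?thesis .
qed

definition fam_add :: "int \<Rightarrow> ((int \<times> 'a) list \<Rightarrow> 'a) \<Rightarrow> ((int \<times> 'a) list \<Rightarrow> 'a) \<Rightarrow> (int \<times> 'a) list \<Rightarrow> 'a" where
  "fam_add s \<phi> \<psi> ws = \<phi> ws \<oplus>\<^bsub>A (sdeg ws + s - 1)\<^esub> \<psi> ws"

lemma mfam_fam_add:
  assumes \<phi>: "mfam R A s \<phi>" and \<psi>: "mfam R A s \<psi>"
  shows "mfam R A s (fam_add s \<phi> \<psi>)"
proof (rule mfamI)
  show "fam_add s \<phi> \<psi> ws \<in> carrier (A (sdeg ws + s - 1))" if "ws \<in> words A" for ws
    using that mfam_closed[OF \<phi>] mfam_closed[OF \<psi>] by (auto simp: fam_add_def)
  fix us i x ws assume w: "us \<in> words A" "ws \<in> words A" "x \<in> carrier (A i)"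
  define e where "e = sdeg us + i + sdeg ws + s"
  have e: "sdeg (us @ (i, z) # ws) + s - 1 = e" for z :: 'a by (simp add: e_def)
  have c: "\<phi> (us @ (i, z) # ws) \<in> carrier (A e)" "\<psi> (us @ (i, z) # ws) \<in> carrier (A e)" if "z \<in> carrier (A i)" for z
    using w that by (auto intro!: mfam_closed[OF \<phi>] mfam_closed[OF \<psi>] simp: e_def)
  show "fam_add s \<phi> \<psi> (us @ (i, x \<oplus>\<^bsub>A i\<^esub> y) # ws) =
      fam_add s \<phi> \<psi> (us @ (i, x) # ws) \<oplus>\<^bsub>A (sdeg us + i + sdeg ws + s)\<^esub> fam_add s \<phi> \<psi> (us @ (i, y) # ws)"
    if y: "y \<in> carrier (A i)" for y
    unfolding fam_add_def e e_def[symmetric] mfam_add[OF \<phi> w y e_def] mfam_add[OF \<psi> w y e_def]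
    using c[OF w(3)] c[OF y] by (rule_tac V.add_exchange)
  show "fam_add s \<phi> \<psi> (us @ (i, a \<odot>\<^bsub>A i\<^esub> x) # ws) =
      a \<odot>\<^bsub>A (sdeg us + i + sdeg ws + s)\<^esub> fam_add s \<phi> \<psi> (us @ (i, x) # ws)" if a: "a \<in> carrier R" for a
    unfolding fam_add_def e e_def[symmetric] mfam_smult[OF \<phi> w a e_def] mfam_smult[OF \<psi> w a e_def]
    using c[OF w(3)] a by (simp add: V.smult_r_distr)
qed

lemma dpre_fam_add:
  assumes \<phi>: "mfam R A s \<phi>" and \<psi>: "mfam R A s \<psi>" and ws: "ws \<in> words A" and e: "e = sdeg ws + s - 2"
  shows "dpre s (fam_add s \<phi> \<psi>) ws = dpre s \<phi> ws \<oplus>\<^bsub>A e\<^esub> dpre s \<psi> ws"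
proof -
  have c: "\<theta> (u @ (fst x - 1, d (fst x) (snd x)) # w) \<in> carrier (A e)"
    if "u @ x # w = ws" "mfam R A s \<theta>" for u x w \<theta>
    using that(1) ws e by (intro dpre_term_closed[OF that(2)]) auto
  have "psum (A e) (\<lambda>u x w. signed (A e) (sdeg u) (fam_add s \<phi> \<psi> (u @ (fst x - 1, d (fst x) (snd x)) # w))) ws =
      psum (A e) (\<lambda>u x w. signed (A e) (sdeg u) (\<phi> (u @ (fst x - 1, d (fst x) (snd x)) # w)) \<oplus>\<^bsub>A e\<^esub>
        signed (A e) (sdeg u) (\<psi> (u @ (fst x - 1, d (fst x) (snd x)) # w))) ws"
  proof (rule psum_cong)
    fix u x w assume uxw: "u @ x # w = ws"
    have "sdeg (u @ (fst x - 1, d (fst x) (snd x)) # w) + s - 1 = e" using uxw[symmetric] e by simp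
    thus "signed (A e) (sdeg u) (fam_add s \<phi> \<psi> (u @ (fst x - 1, d (fst x) (snd x)) # w)) =
        signed (A e) (sdeg u) (\<phi> (u @ (fst x - 1, d (fst x) (snd x)) # w)) \<oplus>\<^bsub>A e\<^esub>
        signed (A e) (sdeg u) (\<psi> (u @ (fst x - 1, d (fst x) (snd x)) # w))"
      unfolding fam_add_def using c[OF uxw \<phi>] c[OF uxw \<psi>] by (simp add: V.signed_add)
  qed
  also have "\<dots> = dpre s \<phi> ws \<oplus>\<^bsub>A e\<^esub> dpre s \<psi> ws"
    unfolding dpre_def e[symmetric] by (rule V.psum_add) (auto intro!: V.signed_closed c \<phi> \<psi>)
  finally show ?thesis unfolding dpre_def e[symmetric] .
qed

lemma bdry_fam_add:
  assumes \<phi>: "mfam R A s \<phi>" and \<psi>: "mfam R A s \<psi>" and ws: "ws \<in> words A" and e: "e = sdeg ws + s - 2"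
  shows "bdry s (fam_add s \<phi> \<psi>) ws = bdry s \<phi> ws \<oplus>\<^bsub>A e\<^esub> bdry s \<psi> ws"
proof -
  have c: "d (sdeg ws + s - 1) (\<phi> ws) \<in> carrier (A e)" "d (sdeg ws + s - 1) (\<psi> ws) \<in> carrier (A e)"
    "dpre s \<phi> ws \<in> carrier (A e)" "dpre s \<psi> ws \<in> carrier (A e)"
    using ws e by (auto intro!: d_closed mfam_closed[OF \<phi>] mfam_closed[OF \<psi>] dpre_closed \<phi> \<psi>)
  have a: "d (sdeg ws + s - 1) (fam_add s \<phi> \<psi> ws) = d (sdeg ws + s - 1) (\<phi> ws) \<oplus>\<^bsub>A e\<^esub> d (sdeg ws + s - 1) (\<psi> ws)"
    unfolding fam_add_def using ws e by (intro d_add mfam_closed[OF \<phi>] mfam_closed[OF \<psi>]) auto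
  show ?thesis
    unfolding bdry_def e[symmetric] dpre_fam_add[OF assms] a using c
    by (simp add: a_minus_def V.signed_add V.M.minus_add V.add_exchange)
qed

text \<open>A map of letters as a family of arity 1.\<close>

definition letter :: "(int \<Rightarrow> 'a \<Rightarrow> 'a) \<Rightarrow> (int \<times> 'a) list \<Rightarrow> 'a" where
  "letter f v = f (fst (hd v)) (snd (hd v))"

lemma ins_letter: "length u = k \<Longrightarrow> ins k 1 c (letter f) (u @ (i, x) # w) = u @ (i + c, f i x) # w"
  using ins_split[of u k "[(i, x)]" 1 c "letter f" w] by (simp add: letter_def)

lemma mlin_letter:
  assumes f: "\<And>i. f i \<in> mod_hom R (A i) (A (i + c))"
  shows "mlin R A 1 A c (letter f)"
proof (rule mlinI)
  show "letter f ws \<in> carrier (A (wdeg ws + c))" if "ws \<in> words A" "length ws = 1" for ws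
    using that mod_hom_closed[OF f] by (cases ws) (auto simp: letter_def)
qed (auto simp: letter_def mod_hom_add[OF f] mod_hom_smult[OF f])

lemma mlin_slot_letter:
  assumes \<phi>: "mfam R A s \<phi>" and f: "\<And>i. f i \<in> mod_hom R (A i) (A (i + c))" and k: "k < n"
  shows "mlin R A n A (int n - 1 + (s + c)) (\<lambda>ws. \<phi> (ins k 1 c (letter f) ws))"
proof -
  have "mlin R A (n + 1 - 1) A (int n - 1 + s + c) (\<lambda>ws. \<phi> (ins k 1 c (letter f) ws))"
    by (rule mlin_ins[OF V.module_axioms _ mlin_letter[OF f] k]) (use \<phi> in \<open>simp add: mfam_def\<close>)
  thus ?thesis by (simp add: add.assoc)
qed

lemma mfam_post:
  assumes \<phi>: "mfam R A s \<phi>" and f: "\<And>i. f i \<in> mod_hom R (A i) (A (i + c))"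
  shows "mfam R A (s + c) (\<lambda>ws. f (sdeg ws + s - 1) (\<phi> ws))"
proof (rule mfamI)
  show "f (sdeg ws + s - 1) (\<phi> ws) \<in> carrier (A (sdeg ws + (s + c) - 1))" if "ws \<in> words A" for ws
    using mod_hom_closed[OF f mfam_closed[OF \<phi> that refl]] by (simp add: algebra_simps)
  fix us i x ws assume w: "us \<in> words A" "ws \<in> words A" "x \<in> carrier (A i)"
  define e where "e = sdeg us + i + sdeg ws + s"
  have e: "sdeg (us @ (i, z) # ws) + s - 1 = e" "sdeg us + i + sdeg ws + (s + c) = e + c" for z :: 'a
    by (simp_all add: e_def)
  have c: "\<phi> (us @ (i, z) # ws) \<in> carrier (A e)" if "z \<in> carrier (A i)" for z
    using w that by (auto intro!: mfam_closed[OF \<phi>] simp: e_def)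
  show "f (sdeg (us @ (i, x \<oplus>\<^bsub>A i\<^esub> y) # ws) + s - 1) (\<phi> (us @ (i, x \<oplus>\<^bsub>A i\<^esub> y) # ws)) =
      f (sdeg (us @ (i, x) # ws) + s - 1) (\<phi> (us @ (i, x) # ws)) \<oplus>\<^bsub>A (sdeg us + i + sdeg ws + (s + c))\<^esub>
      f (sdeg (us @ (i, y) # ws) + s - 1) (\<phi> (us @ (i, y) # ws))" if y: "y \<in> carrier (A i)" for y
    unfolding e mfam_add[OF \<phi> w y e_def] by (rule mod_hom_add[OF f c[OF w(3)] c[OF y]])
  show "f (sdeg (us @ (i, a \<odot>\<^bsub>A i\<^esub> x) # ws) + s - 1) (\<phi> (us @ (i, a \<odot>\<^bsub>A i\<^esub> x) # ws)) =
      a \<odot>\<^bsub>A (sdeg us + i + sdeg ws + (s + c))\<^esub> f (sdeg (us @ (i, x) # ws) + s - 1) (\<phi> (us @ (i, x) # ws))"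
    if a: "a \<in> carrier R" for a
    unfolding e mfam_smult[OF \<phi> w a e_def] by (rule mod_hom_smult[OF f a c[OF w(3)]])
qed

end


section \<open>Transfer along a deformation retract\<close>

text \<open>A deformation retract of \<open>A\<close> onto \<open>H\<close> with zero differential, whence the conditions \<open>d_inc\<close> and \<open>prj_d\<close>.\<close>

locale dg_retract = dg_mod R A d + H: graded_mod R H
  for R :: "('r, 'c) ring_scheme" and A :: "('r, 'a) gmodule" and d and H :: "('r, 'h) gmodule" +
  fixes inc :: "int \<Rightarrow> 'h \<Rightarrow> 'a" and prj :: "int \<Rightarrow> 'a \<Rightarrow> 'h" and hot :: "int \<Rightarrow> 'a \<Rightarrow> 'a"
  assumes inc: "\<And>i. inc i \<in> mod_hom R (H i) (A i)" and prj: "\<And>i. prj i \<in> mod_hom R (A i) (H i)"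
    and hot: "\<And>i. hot i \<in> mod_hom R (A i) (A (i + 1))"
    and prj_inc: "\<And>i x. x \<in> carrier (H i) \<Longrightarrow> prj i (inc i x) = x"
    and d_inc: "\<And>i x. x \<in> carrier (H i) \<Longrightarrow> d i (inc i x) = \<zero>\<^bsub>A (i - 1)\<^esub>"
    and prj_d: "\<And>i x. x \<in> carrier (A i) \<Longrightarrow> prj (i - 1) (d i x) = \<zero>\<^bsub>H (i - 1)\<^esub>"
    and homotopy: "\<And>i x. x \<in> carrier (A i) \<Longrightarrow>
      x = inc i (prj i x) \<oplus>\<^bsub>A i\<^esub> (d (i + 1) (hot i x) \<oplus>\<^bsub>A i\<^esub> hot (i - 1) (d i x))"
begin

lemmas inc_closed = mod_hom_closed[OF inc] and prj_closed = mod_hom_closed[OF prj]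

lemma hot_closed: "x \<in> carrier (A i) \<Longrightarrow> j = i + 1 \<Longrightarrow> hot i x \<in> carrier (A j)"
  using mod_hom_closed[OF hot] by blast

lemmas inc_zero = mod_hom_zero[OF H.V.module_axioms V.module_axioms inc]
  and prj_zero = mod_hom_zero[OF V.module_axioms H.V.module_axioms prj]

lemma hot_zero: "j = i + 1 \<Longrightarrow> hot i \<zero>\<^bsub>A i\<^esub> = \<zero>\<^bsub>A j\<^esub>"
  using mod_hom_zero[OF V.module_axioms V.module_axioms hot] by blast

lemma inc_words: "ws \<in> words H \<Longrightarrow> wmap inc ws \<in> words A"
  by (rule wmap_words[where V = H]) (rule inc_closed)

lemma prj_words: "ws \<in> words A \<Longrightarrow> wmap prj ws \<in> words H"
  by (rule wmap_words[where V = A]) (rule prj_closed)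

text \<open>For a cycle \<open>\<phi>\<close> this is the map that \<open>\<phi>\<close> induces on homology.\<close>

definition push :: "int \<Rightarrow> ((int \<times> 'a) list \<Rightarrow> 'a) \<Rightarrow> (int \<times> 'h) list \<Rightarrow> 'h" where
  "push s \<phi> ws = prj (sdeg ws + s - 1) (\<phi> (wmap inc ws))"

definition pull :: "int \<Rightarrow> ((int \<times> 'h) list \<Rightarrow> 'h) \<Rightarrow> (int \<times> 'a) list \<Rightarrow> 'a" where
  "pull s \<gamma> ws = inc (sdeg ws + s - 1) (\<gamma> (wmap prj ws))"

lemma mfam_push: "mfam R A s \<phi> \<Longrightarrow> mfam R H s (push s \<phi>)"
  unfolding push_def by (rule H.mfam_conj[OF graded _ inc prj])

lemma mfam_pull: "mfam R H s \<gamma> \<Longrightarrow> mfam R A s (pull s \<gamma>)"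
  unfolding pull_def by (rule mfam_conj[OF H.graded _ prj inc])

lemma push_pull:
  assumes "mfam R H s \<gamma>" "ws \<in> words H"
  shows "push s (pull s \<gamma>) ws = \<gamma> ws"
proof -
  have "wmap prj (wmap inc ws) = ws"
    unfolding wmap_wmap using assms(2) by (intro wmap_id[where V = H]) (simp add: prj_inc)
  thus ?thesis using mfam_closed[OF assms refl] by (simp add: push_def pull_def prj_inc)
qed

text \<open>Both terms of the differential are zero: \<open>inc\<close> has values in cycles, and \<open>prj\<close> is zero on boundaries.\<close>

lemma cyc_pull:
  assumes \<gamma>: "mfam R H s \<gamma>"
  shows "cyc s (pull s \<gamma>)"
  unfolding cyc_iff[OF mfam_pull[OF \<gamma>]]
proof
  fix ws assume ws: "ws \<in> words A"
  define e where "e = sdeg ws + s - 2"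
  have "pull s \<gamma> (u @ (fst x - 1, d (fst x) (snd x)) # w) = \<zero>\<^bsub>A e\<^esub>" if uxw: "u @ x # w = ws" for u x w
  proof -
    have w: "u \<in> words A" "w \<in> words A" "snd x \<in> carrier (A (fst x))" using ws uxw by auto
    have e': "e = sdeg u + (fst x - 1) + sdeg w + s" using uxw[symmetric] by (simp add: e_def)
    have "\<gamma> (wmap prj u @ (fst x - 1, \<zero>\<^bsub>H (fst x - 1)\<^esub>) # wmap prj w) = \<zero>\<^bsub>H e\<^esub>"
      by (rule H.mfam_zero[OF \<gamma>]) (use w e' prj_words in auto)
    moreover have "sdeg (u @ (fst x - 1, d (fst x) (snd x)) # w) + s - 1 = e" using e' by simp
    ultimately show ?thesis unfolding pull_def by (simp add: prj_d[OF w(3)] inc_zero)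
  qed
  hence "dpre s (pull s \<gamma>) ws = \<zero>\<^bsub>A e\<^esub>"
    unfolding dpre_def e_def[symmetric] by (intro V.psum_zero) simp
  moreover have "\<gamma> (wmap prj ws) \<in> carrier (H (sdeg ws + s - 1))"
    by (rule mfam_closed[OF \<gamma> prj_words[OF ws]]) simp
  ultimately show "d (sdeg ws + s - 1) (pull s \<gamma> ws) = signed (A (sdeg ws + s - 2)) s (dpre s (pull s \<gamma>) ws)"
    by (simp add: pull_def d_inc e_def[symmetric])
qed

definition cycle_words :: "(int \<times> 'a) list set" where
  "cycle_words = {ws \<in> words A. \<forall>w\<in>set ws. d (fst w) (snd w) = \<zero>\<^bsub>A (fst w - 1)\<^esub>}"

lemma inc_cycle_words: "ws \<in> words H \<Longrightarrow> wmap inc ws \<in> cycle_words"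
  using inc_words[of ws] by (auto simp: cycle_words_def wmap_def words_def d_inc)

lemma dpre_cycle_words:
  assumes \<phi>: "mfam R A s \<phi>" and ws: "ws \<in> cycle_words" and e: "e = sdeg ws + s - 2"
  shows "dpre s \<phi> ws = \<zero>\<^bsub>A e\<^esub>"
  unfolding dpre_def e[symmetric]
proof (rule V.psum_zero)
  fix u x w assume uxw: "u @ x # w = ws"
  have "d (fst x) (snd x) = \<zero>\<^bsub>A (fst x - 1)\<^esub>" using ws uxw by (auto simp: cycle_words_def)
  moreover have "\<phi> (u @ (fst x - 1, \<zero>\<^bsub>A (fst x - 1)\<^esub>) # w) = \<zero>\<^bsub>A e\<^esub>"
    by (rule mfam_zero[OF \<phi>]) (use ws uxw e in \<open>auto simp: cycle_words_def\<close>)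
  ultimately show "signed (A e) (sdeg u) (\<phi> (u @ (fst x - 1, d (fst x) (snd x)) # w)) = \<zero>\<^bsub>A e\<^esub>" by simp
qed

lemma cyc_cycle_words:
  assumes \<phi>: "mfam R A s \<phi>" "cyc s \<phi>" and ws: "ws \<in> cycle_words" and e: "e = sdeg ws + s - 1"
  shows "d e (\<phi> ws) = \<zero>\<^bsub>A (e - 1)\<^esub>"
proof -
  have "ws \<in> words A" using ws by (simp add: cycle_words_def)
  thus ?thesis using \<phi>(2) dpre_cycle_words[OF \<phi>(1) ws refl] unfolding cyc_iff[OF \<phi>(1)] e
    by (simp add: algebra_simps)
qed

text \<open>The two arguments differ by a boundary \<open>d y\<close>. As all other letters are cycles and \<open>\<phi>\<close> is a cycle,
  the value of \<open>\<phi>\<close> on the word with \<open>d y\<close> is, up to sign, the boundary of its value on the word with \<open>y\<close>.\<close>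

lemma prj_slot:
  assumes \<phi>: "mfam R A s \<phi>" "cyc s \<phi>" and us: "us \<in> cycle_words" and ws: "ws \<in> cycle_words"
    and z: "z \<in> carrier (A i)" "d i z = \<zero>\<^bsub>A (i - 1)\<^esub>" and e: "e = sdeg us + i + sdeg ws + s"
  shows "prj e (\<phi> (us @ (i, z) # ws)) = prj e (\<phi> (us @ (i, inc i (prj i z)) # ws))"
proof -
  have w: "us \<in> words A" "ws \<in> words A" using us ws by (auto simp: cycle_words_def)
  define y where "y = hot i z"
  have y: "y \<in> carrier (A (i + 1))" unfolding y_def using z by (intro hot_closed) auto
  have dy: "d (i + 1) y \<in> carrier (A i)" using y by (intro d_closed) auto
  have ez: "inc i (prj i z) \<in> carrier (A i)" using z by (intro inc_closed prj_closed)
  have "z = inc i (prj i z) \<oplus>\<^bsub>A i\<^esub> d (i + 1) y"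
    using homotopy[OF z(1)] z dy hot_zero[of i "i - 1"] by (simp add: y_def)
  hence "\<phi> (us @ (i, z) # ws) = \<phi> (us @ (i, inc i (prj i z)) # ws) \<oplus>\<^bsub>A e\<^esub> \<phi> (us @ (i, d (i + 1) y) # ws)"
    using mfam_add[OF \<phi>(1) w ez dy e] by simp
  moreover have c: "\<phi> (us @ (i, x) # ws) \<in> carrier (A e)" if "x \<in> carrier (A i)" for x
    using w that e by (intro mfam_closed[OF \<phi>(1)]) auto
  moreover have "prj e (\<phi> (us @ (i, d (i + 1) y) # ws)) = \<zero>\<^bsub>H e\<^esub>"
  proof -
    let ?x = "us @ (i + 1, y) # ws"
    have x: "?x \<in> words A" using w y by simp
    have e': "sdeg ?x + s - 2 = e" "sdeg ?x + s - 1 = e + 1" using e by auto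
    have xc: "\<phi> ?x \<in> carrier (A (e + 1))" by (rule mfam_closed[OF \<phi>(1) x]) (simp add: e)
    have tc: "signed (A e) (sdeg p) (\<phi> (p @ (fst x - 1, d (fst x) (snd x)) # q)) \<in> carrier (A e)"
      if "p @ x # q = ?x" for p x q
    proof -
      have "p @ x # q \<in> words A" unfolding that by (rule x)
      moreover have "sdeg (p @ x # q) = sdeg ?x" by (simp only: that)
      ultimately show ?thesis using e by (intro V.signed_closed dpre_term_closed[OF \<phi>(1)]) auto
    qed
    have zl: "signed (A e) k (\<phi> (p @ (fst x - 1, d (fst x) (snd x)) # q @ (i + 1, y) # ws)) = \<zero>\<^bsub>A e\<^esub>"
      if "p @ x # q = us" for p x q k
    proof -
      have "d (fst x) (snd x) = \<zero>\<^bsub>A (fst x - 1)\<^esub>" using us that by (auto simp: cycle_words_def)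
      moreover have "\<phi> (p @ (fst x - 1, \<zero>\<^bsub>A (fst x - 1)\<^esub>) # q @ (i + 1, y) # ws) = \<zero>\<^bsub>A e\<^esub>"
        by (rule mfam_zero[OF \<phi>(1)]) (use w y that e in auto)
      ultimately show ?thesis by simp
    qed
    have zr: "signed (A e) k (\<phi> ((us @ (i + 1, y) # p) @ (fst x - 1, d (fst x) (snd x)) # q)) = \<zero>\<^bsub>A e\<^esub>"
      if "p @ x # q = ws" for p x q k
    proof -
      have "d (fst x) (snd x) = \<zero>\<^bsub>A (fst x - 1)\<^esub>" using ws that by (auto simp: cycle_words_def)
      moreover have "\<phi> ((us @ (i + 1, y) # p) @ (fst x - 1, \<zero>\<^bsub>A (fst x - 1)\<^esub>) # q) = \<zero>\<^bsub>A e\<^esub>"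
        by (rule mfam_zero[OF \<phi>(1)]) (use w y that e in auto)
      ultimately show ?thesis by simp
    qed
    have "dpre s \<phi> ?x = signed (A e) (sdeg us) (\<phi> (us @ (i, d (i + 1) y) # ws))"
      unfolding dpre_def e' using tc zl zr c[OF dy]
      by (subst V.psum_append) (simp_all add: V.psum_zero)
    hence "d (e + 1) (\<phi> ?x) = signed (A e) (s + sdeg us) (\<phi> (us @ (i, d (i + 1) y) # ws))"
      using \<phi>(2) x c[OF dy] unfolding cyc_iff[OF \<phi>(1)] by (metis e' V.signed_signed)
    hence "\<phi> (us @ (i, d (i + 1) y) # ws) = signed (A e) (s + sdeg us) (d (e + 1) (\<phi> ?x))"
      using c[OF dy] by simp
    moreover have "prj e (d (e + 1) (\<phi> ?x)) = \<zero>\<^bsub>H e\<^esub>" using prj_d[OF xc] by simp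
    ultimately show ?thesis
      using mod_hom_signed[OF V.module_axioms H.V.module_axioms prj d_closed[OF xc, of e]] by simp
  qed
  ultimately show ?thesis
    using mod_hom_add[OF prj c[OF ez] c[OF dy]] prj_closed[OF c[OF ez]] by simp
qed

text \<open>On homology only the classes of the intermediate results matter, so that passing to induced
  maps is compatible with composition.\<close>

lemma push_icomp:
  assumes \<phi>: "mfam R A s \<phi>" "cyc s \<phi>" and \<psi>: "mfam R A t \<psi>" "cyc t \<psi>" and ws: "ws \<in> words H"
  shows "push (s + t) (icomp A s t \<phi> \<psi>) ws = icomp H s t (push s \<phi>) (push t \<psi>) ws"
proof -
  define k where "k = sdeg ws + s + t - 1"
  let ?I = "wmap inc"
  have k: "sdeg ws + (s + t) - 1 = k" "sdeg (?I ws) + s + t - 1 = k" by (simp_all add: k_def)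
  let ?G = "\<lambda>u v w. signed (A k) (t * sdeg u) (\<phi> (u @ (sdeg v + t - 1, \<psi> v) # w))"
  have c: "?G (?I u) (?I v) (?I w) \<in> carrier (A k)" if "u @ v @ w = ws" for u v w
    using that ws inc_words by (intro V.signed_closed icomp_term_closed[OF \<phi>(1) \<psi>(1)]) (auto simp: k_def)
  have "icomp A s t \<phi> \<psi> (?I ws) = dsum (A k) (\<lambda>u y. dsum (A k) (\<lambda>v w. ?G (?I u) (?I v) (?I w)) y) ws"
    unfolding icomp_def k dsum_wmap ..
  hence "push (s + t) (icomp A s t \<phi> \<psi>) ws =
      prj k (dsum (A k) (\<lambda>u y. dsum (A k) (\<lambda>v w. ?G (?I u) (?I v) (?I w)) y) ws)"
    by (simp add: push_def k)
  also have "\<dots> = dsum (H k) (\<lambda>u y. prj k (dsum (A k) (\<lambda>v w. ?G (?I u) (?I v) (?I w)) y)) ws"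
    by (rule V.dsum_additive[OF mod_hom_add[OF prj]], assumption+, intro V.dsum_closed c, simp)
  also have "\<dots> = dsum (H k) (\<lambda>u y. dsum (H k) (\<lambda>v w. prj k (?G (?I u) (?I v) (?I w))) y) ws"
    by (intro dsum_cong V.dsum_additive[OF mod_hom_add[OF prj]] c) auto
  also have "\<dots> = dsum (H k) (\<lambda>u y. dsum (H k) (\<lambda>v w.
      signed (H k) (t * sdeg u) (push s \<phi> (u @ (sdeg v + t - 1, push t \<psi> v) # w))) y) ws"
  proof (intro dsum_cong)
    fix u y v w assume uvw: "u @ y = ws" "v @ w = y"
    have W: "u \<in> words H" "v \<in> words H" "w \<in> words H" using uvw ws by auto
    have kk: "k = sdeg (?I u) + (sdeg v + t - 1) + sdeg (?I w) + s" using uvw by (auto simp: k_def)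
    have z: "\<psi> (?I v) \<in> carrier (A (sdeg v + t - 1))"
      by (rule mfam_closed[OF \<psi>(1) inc_words[OF W(2)]]) simp
    have dz: "d (sdeg v + t - 1) (\<psi> (?I v)) = \<zero>\<^bsub>A (sdeg v + t - 1 - 1)\<^esub>"
      by (rule cyc_cycle_words[OF \<psi> inc_cycle_words[OF W(2)]]) simp
    have cc: "\<phi> (?I u @ (sdeg v + t - 1, \<psi> (?I v)) # ?I w) \<in> carrier (A k)"
      by (rule mfam_closed[OF \<phi>(1)]) (use W inc_words z kk in auto)
    have "prj k (?G (?I u) (?I v) (?I w)) =
        signed (H k) (t * sdeg u) (prj k (\<phi> (?I u @ (sdeg v + t - 1, \<psi> (?I v)) # ?I w)))"
      using mod_hom_signed[OF V.module_axioms H.V.module_axioms prj cc] by simp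
    also have "prj k (\<phi> (?I u @ (sdeg v + t - 1, \<psi> (?I v)) # ?I w)) =
        prj k (\<phi> (?I u @ (sdeg v + t - 1, inc (sdeg v + t - 1) (prj (sdeg v + t - 1) (\<psi> (?I v)))) # ?I w))"
      by (rule prj_slot[OF \<phi> inc_cycle_words[OF W(1)] inc_cycle_words[OF W(3)] z dz kk])
    also have "\<dots> = push s \<phi> (u @ (sdeg v + t - 1, push t \<psi> v) # w)"
    proof -
      have "sdeg (u @ (sdeg v + t - 1, push t \<psi> v) # w) + s - 1 = k" using kk by simp
      thus ?thesis unfolding push_def[of s] by (simp add: push_def)
    qed
    finally show "prj k (?G (?I u) (?I v) (?I w)) =
        signed (H k) (t * sdeg u) (push s \<phi> (u @ (sdeg v + t - 1, push t \<psi> v) # w))" .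
  qed
  also have "\<dots> = icomp H s t (push s \<phi>) (push t \<psi>) ws" unfolding icomp_def k_def ..
  finally show ?thesis .
qed


subsection \<open>A cycle that is zero on homology is a boundary\<close>

text \<open>Homomorphisms have the default value outside the carrier, which is why the composite is restricted.\<close>

definition idem :: "int \<Rightarrow> 'a \<Rightarrow> 'a" where
  "idem i x = (\<lambda>x\<in>carrier (A i). inc i (prj i x)) x"

lemma idem_hom: "idem i \<in> mod_hom R (A i) (A (i + 0))"
  using mod_hom_comp[OF prj inc V.module_axioms] unfolding idem_def by simp

lemma idem_eq: "x \<in> carrier (A i) \<Longrightarrow> idem i x = inc i (prj i x)"
  by (simp add: idem_def)

lemma idem_closed: "x \<in> carrier (A i) \<Longrightarrow> idem i x \<in> carrier (A i)"
  by (simp add: idem_eq inc_closed prj_closed)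

lemma idem_homotopy:
  assumes "x \<in> carrier (A i)"
  shows "d (i + 1) (hot i x) \<oplus>\<^bsub>A i\<^esub> hot (i - 1) (d i x) = x \<ominus>\<^bsub>A i\<^esub> idem i x"
proof -
  have c: "d (i + 1) (hot i x) \<in> carrier (A i)" "hot (i - 1) (d i x) \<in> carrier (A i)"
    using assms by (auto intro!: d_closed hot_closed)
  have "x = idem i x \<oplus>\<^bsub>A i\<^esub> (d (i + 1) (hot i x) \<oplus>\<^bsub>A i\<^esub> hot (i - 1) (d i x))"
    using homotopy[OF assms] assms by (simp add: idem_eq)
  hence "x \<ominus>\<^bsub>A i\<^esub> idem i x = (idem i x \<oplus>\<^bsub>A i\<^esub> (d (i + 1) (hot i x) \<oplus>\<^bsub>A i\<^esub> hot (i - 1) (d i x))) \<ominus>\<^bsub>A i\<^esub> idem i x"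
    by simp
  also have "\<dots> = d (i + 1) (hot i x) \<oplus>\<^bsub>A i\<^esub> hot (i - 1) (d i x)"
    using c idem_closed[OF assms] by (intro V.add_minus_cancel) auto
  finally show ?thesis ..
qed

text \<open>The homotopy, respectively \<open>inc \<circ> prj\<close>, is applied to the letter after the first \<open>k\<close> ones. The sign is that
  of moving the homotopy, of degree 1, past \<open>\<phi>\<close> and these \<open>k\<close> letters.\<close>

definition hot_slot :: "int \<Rightarrow> nat \<Rightarrow> nat \<Rightarrow> ((int \<times> 'a) list \<Rightarrow> 'a) \<Rightarrow> (int \<times> 'a) list \<Rightarrow> 'a" where
  "hot_slot s n k \<phi> ws = (if length ws = n
     then signed (A (wdeg ws + (int n - 1 + (s + 1)))) (sum_list (take k (map fst ws)) + int k + s)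
       (\<phi> (ins k 1 1 (letter hot) ws))
     else \<zero>\<^bsub>A (sdeg ws + (s + 1) - 1)\<^esub>)"

definition idem_slot :: "int \<Rightarrow> nat \<Rightarrow> nat \<Rightarrow> ((int \<times> 'a) list \<Rightarrow> 'a) \<Rightarrow> (int \<times> 'a) list \<Rightarrow> 'a" where
  "idem_slot s n k \<phi> ws = (if length ws = n then \<phi> (ins k 1 0 (letter idem) ws) else \<zero>\<^bsub>A (sdeg ws + s - 1)\<^esub>)"

lemma mfam_hot_slot:
  assumes "mfam R A s \<phi>" "k < n"
  shows "mfam R A (s + 1) (hot_slot s n k \<phi>)"
  unfolding hot_slot_def
  by (rule mfam_restrict[OF mlin_signed[OF V.module_axioms V.module_axioms mlin_slot_letter[OF assms(1) hot assms(2)],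
        where k = "\<lambda>is. sum_list (take k is) + int k + s"]])

lemma mfam_idem_slot:
  assumes "mfam R A s \<phi>" "k < n"
  shows "mfam R A s (idem_slot s n k \<phi>)"
proof -
  have "mlin R A n A (int n - 1 + s) (\<lambda>ws. \<phi> (ins k 1 0 (letter idem) ws))"
    using mlin_slot_letter[OF assms(1) idem_hom assms(2)] by (simp del: One_nat_def)
  from mfam_restrict[OF this] show ?thesis unfolding idem_slot_def .
qed

lemma hot_slot_eq:
  assumes "length u = k" "length u + length w + 1 = n" "e = sdeg u + i + sdeg w + s + 1"
  shows "hot_slot s n k \<phi> (u @ (i, x) # w) = signed (A e) (sdeg u + s) (\<phi> (u @ (i + 1, hot i x) # w))"
proof -
  have "wdeg (u @ (i, x) # w) + (int n - 1 + (s + 1)) = e" using assms by (auto simp: sdeg_def)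
  moreover have "sum_list (take k (map fst (u @ (i, x) # w))) + int k + s = sdeg u + s"
    using assms(1) by (simp add: sdeg_def wdeg_def)
  ultimately show ?thesis unfolding hot_slot_def ins_letter[OF assms(1)] using assms(2) by simp
qed

lemma idem_slot_eq:
  assumes "length u = k" "length u + length w + 1 = n"
  shows "idem_slot s n k \<phi> (u @ (i, x) # w) = \<phi> (u @ (i, idem i x) # w)"
  unfolding idem_slot_def ins_letter[OF assms(1)] using assms(2) by simp

lemma dpre_append:
  assumes \<phi>: "mfam R A s \<phi>" and w: "u \<in> words A" "w \<in> words A" "x \<in> carrier (A i)"
    and e: "e = sdeg u + i + sdeg w + s - 1"
  shows "dpre s \<phi> (u @ (i, x) # w) =
    psum (A e) (\<lambda>p y q. signed (A e) (sdeg p) (\<phi> (p @ (fst y - 1, d (fst y) (snd y)) # q @ (i, x) # w))) u \<oplus>\<^bsub>A e\<^esub>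
    (signed (A e) (sdeg u) (\<phi> (u @ (i - 1, d i x) # w)) \<oplus>\<^bsub>A e\<^esub>
     psum (A e) (\<lambda>p y q. signed (A e) (sdeg u + i + 1 + sdeg p)
       (\<phi> (u @ (i, x) # p @ (fst y - 1, d (fst y) (snd y)) # q))) w)"
proof -
  have e': "sdeg (u @ (i, x) # w) + s - 2 = e" using e by simp
  have tc: "signed (A e) (sdeg p) (\<phi> (p @ (fst y - 1, d (fst y) (snd y)) # q)) \<in> carrier (A e)"
    if "p @ y # q = u @ (i, x) # w" for p y q
  proof -
    have "p @ y # q \<in> words A" unfolding that using w by simp
    moreover have "sdeg (p @ y # q) = sdeg (u @ (i, x) # w)" by (simp only: that)
    ultimately show ?thesis using e by (intro V.signed_closed dpre_term_closed[OF \<phi>]) auto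
  qed
  show ?thesis unfolding dpre_def e' using tc
    by (subst V.psum_append) (simp_all add: add_ac)
qed

text \<open>The terms in which \<open>d\<close> acts on another letter than the \<open>k\<close>-th, counted from 0, cancel against terms of \<open>d \<circ> \<phi>\<close>, because
  \<open>\<phi>\<close> is a cycle in arity \<open>n\<close>. What remains is \<open>d hot + hot d\<close> applied to the \<open>k\<close>-th letter.\<close>

lemma slot_homotopy:
  assumes \<phi>: "mfam R A s \<phi>" and k: "k < n"
    and cyc: "\<And>ws. ws \<in> words A \<Longrightarrow> length ws = n \<Longrightarrow>
      d (sdeg ws + s - 1) (\<phi> ws) = signed (A (sdeg ws + s - 2)) s (dpre s \<phi> ws)"
    and ws: "ws \<in> words A" "length ws = n" and e: "e = sdeg ws + s - 1"
  shows "bdry (s + 1) (hot_slot s n k \<phi>) ws = \<phi> ws \<ominus>\<^bsub>A e\<^esub> idem_slot s n k \<phi> ws"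
    and "d e (idem_slot s n k \<phi> ws) = signed (A (e - 1)) s (dpre s (idem_slot s n k \<phi>) ws)"
proof -
  let ?\<psi> = "hot_slot s n k \<phi>"
  have m\<psi>: "mfam R A (s + 1) ?\<psi>" by (rule mfam_hot_slot[OF \<phi> k])
  obtain u i x w where uw0: "ws = u @ (i, x) # w" "length u = k" using word_split[of k ws] k ws(2) by auto
  hence uw: "ws = u @ (i, x) # w" "length u = k" "length u + length w + 1 = n" using ws(2) by auto
  have W: "u \<in> words A" "w \<in> words A" "x \<in> carrier (A i)" using ws(1) uw(1) by auto
  have e': "e = sdeg u + i + sdeg w + s" using e uw(1) by simp
  define y where "y = hot i x"
  have y: "y \<in> carrier (A (i + 1))" unfolding y_def using W by (intro hot_closed) auto
  have dx: "d i x \<in> carrier (A (i - 1))" using W by (intro d_closed) auto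
  have hdx: "hot (i - 1) (d i x) \<in> carrier (A i)" using dx by (intro hot_closed) auto
  have dy: "d (i + 1) y \<in> carrier (A i)" using y by (intro d_closed) auto
  \<comment> \<open>In \<open>F1\<close> and \<open>F3\<close> the differential acts before and after the \<open>k\<close>-th letter, in \<open>G1\<close> and \<open>G2\<close> on it.\<close>
  define F1 where "F1 = psum (A e) (\<lambda>p z q. signed (A e) (sdeg p) (\<phi> (p @ (fst z - 1, d (fst z) (snd z)) # q @ (i + 1, y) # w))) u"
  define F3 where "F3 = psum (A e) (\<lambda>p z q. signed (A e) (i + sdeg p) (\<phi> (u @ (i + 1, y) # p @ (fst z - 1, d (fst z) (snd z)) # q))) w"
  define G1 where "G1 = \<phi> (u @ (i, d (i + 1) y) # w)"
  define G2 where "G2 = \<phi> (u @ (i, hot (i - 1) (d i x)) # w)"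
  have t1: "\<phi> (p @ (fst z - 1, d (fst z) (snd z)) # q @ (i + 1, y) # w) \<in> carrier (A e)" if "p @ z # q = u" for p z q
    by (rule dpre_term_closed[OF \<phi>]) (use that W y e' in auto)
  have t3: "\<phi> (u @ (i + 1, y) # p @ (fst z - 1, d (fst z) (snd z)) # q) \<in> carrier (A e)" if "p @ z # q = w" for p z q
  proof -
    have "\<phi> ((u @ (i + 1, y) # p) @ (fst z - 1, d (fst z) (snd z)) # q) \<in> carrier (A e)"
      by (rule dpre_term_closed[OF \<phi>]) (use that W y e' in auto)
    thus ?thesis by simp
  qed
  have Gc: "G1 \<in> carrier (A e)" "G2 \<in> carrier (A e)"
    unfolding G1_def G2_def using W dy hdx e' by (auto intro!: mfam_closed[OF \<phi>])
  have Fc: "F1 \<in> carrier (A e)" "F3 \<in> carrier (A e)"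
    unfolding F1_def F3_def by (auto intro!: V.psum_closed V.signed_closed t1 t3)
  have F3s: "psum (A e) (\<lambda>p z q. signed (A e) (c p z q) (\<phi> (u @ (i + 1, y) # p @ (fst z - 1, d (fst z) (snd z)) # q))) w
      = signed (A e) k F3" if "\<And>p z q. p @ z # q = w \<Longrightarrow> even (c p z q - (k + (i + sdeg p)))" for c k
  proof -
    have "signed (A e) k F3 = psum (A e) (\<lambda>p z q. signed (A e) k (signed (A e) (i + sdeg p)
        (\<phi> (u @ (i + 1, y) # p @ (fst z - 1, d (fst z) (snd z)) # q)))) w"
      unfolding F3_def by (rule V.psum_signed) (auto intro!: V.signed_closed t3)
    also have "\<dots> = psum (A e) (\<lambda>p z q. signed (A e) (c p z q) (\<phi> (u @ (i + 1, y) # p @ (fst z - 1, d (fst z) (snd z)) # q))) w"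
      by (intro psum_cong) (subst signed_cong[OF that], auto simp: t3)
    finally show ?thesis ..
  qed
  have F1s: "psum (A e) (\<lambda>p z q. signed (A e) (c p z q) (\<phi> (p @ (fst z - 1, d (fst z) (snd z)) # q @ (i + 1, y) # w))) u
      = signed (A e) k F1" if "\<And>p z q. p @ z # q = u \<Longrightarrow> even (c p z q - (k + sdeg p))" for c k
  proof -
    have "signed (A e) k F1 = psum (A e) (\<lambda>p z q. signed (A e) k (signed (A e) (sdeg p)
        (\<phi> (p @ (fst z - 1, d (fst z) (snd z)) # q @ (i + 1, y) # w)))) u"
      unfolding F1_def by (rule V.psum_signed) (auto intro!: V.signed_closed t1)
    also have "\<dots> = psum (A e) (\<lambda>p z q. signed (A e) (c p z q) (\<phi> (p @ (fst z - 1, d (fst z) (snd z)) # q @ (i + 1, y) # w))) u"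
      by (intro psum_cong) (subst signed_cong[OF that], auto simp: t1)
    finally show ?thesis ..
  qed
  let ?X = "u @ (i + 1, y) # w"
  have X: "?X \<in> words A" "length ?X = n" "sdeg ?X + s - 1 = e + 1" "sdeg ?X + s - 2 = e"
    using W y uw e' by auto
  have Xc: "\<phi> ?X \<in> carrier (A (e + 1))" by (rule mfam_closed[OF \<phi> X(1)]) (use X in simp)
  have eX: "e = sdeg u + (i + 1) + sdeg w + s - 1" using e' by simp
  have F3X: "psum (A e) (\<lambda>p z q. signed (A e) (sdeg u + (i + 1) + 1 + sdeg p)
      (\<phi> (u @ (i + 1, y) # p @ (fst z - 1, d (fst z) (snd z)) # q))) w = signed (A e) (sdeg u) F3"
    by (rule F3s) simp
  have "dpre s \<phi> ?X = F1 \<oplus>\<^bsub>A e\<^esub> (signed (A e) (sdeg u) G1 \<oplus>\<^bsub>A e\<^esub> signed (A e) (sdeg u) F3)"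
    unfolding dpre_append[OF \<phi> W(1,2) y eX] F3X F1_def G1_def by simp
  hence "d (e + 1) (\<phi> ?X) = signed (A e) s (F1 \<oplus>\<^bsub>A e\<^esub> (signed (A e) (sdeg u) G1 \<oplus>\<^bsub>A e\<^esub> signed (A e) (sdeg u) F3))"
    using cyc[OF X(1,2)] unfolding X(3,4) by simp
  moreover have \<psi>ws: "?\<psi> ws = signed (A (e + 1)) (sdeg u + s) (\<phi> ?X)"
    unfolding uw(1) y_def by (rule hot_slot_eq[OF uw(2,3)]) (simp add: e')
  ultimately have "d (e + 1) (?\<psi> ws) = signed (A e) (sdeg u + s + s) (F1 \<oplus>\<^bsub>A e\<^esub> (signed (A e) (sdeg u) G1 \<oplus>\<^bsub>A e\<^esub> signed (A e) (sdeg u) F3))"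
    using d_signed[OF Xc, of e] Fc Gc by simp
  also have "\<dots> = signed (A e) (sdeg u) F1 \<oplus>\<^bsub>A e\<^esub> (G1 \<oplus>\<^bsub>A e\<^esub> F3)"
    using Fc Gc signed_cong[of "sdeg u + s + s" "sdeg u" "A e"] by (simp add: V.signed_add)
  finally have d\<psi>: "d (e + 1) (?\<psi> ws) = signed (A e) (sdeg u) F1 \<oplus>\<^bsub>A e\<^esub> (G1 \<oplus>\<^bsub>A e\<^esub> F3)" .
  have "dpre (s + 1) ?\<psi> ws = signed (A e) (sdeg u + s + 1) F1 \<oplus>\<^bsub>A e\<^esub> (signed (A e) s G2 \<oplus>\<^bsub>A e\<^esub> signed (A e) (s + 1) F3)"
  proof -
    have ee: "e = sdeg u + i + sdeg w + (s + 1) - 1" using e' by simp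
    have 1: "psum (A e) (\<lambda>p z q. signed (A e) (sdeg p) (?\<psi> (p @ (fst z - 1, d (fst z) (snd z)) # q @ (i, x) # w))) u
        = signed (A e) (sdeg u + s + 1) F1"
    proof -
      have "psum (A e) (\<lambda>p z q. signed (A e) (sdeg p) (?\<psi> (p @ (fst z - 1, d (fst z) (snd z)) # q @ (i, x) # w))) u
        = psum (A e) (\<lambda>p z q. signed (A e) (sdeg p + (sdeg u - 1 + s)) (\<phi> (p @ (fst z - 1, d (fst z) (snd z)) # q @ (i + 1, y) # w))) u"
      proof (rule psum_cong)
        fix p z q assume pq: "p @ z # q = u"
        have "?\<psi> ((p @ (fst z - 1, d (fst z) (snd z)) # q) @ (i, x) # w) =
            signed (A e) (sdeg (p @ (fst z - 1, d (fst z) (snd z)) # q) + s)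
              (\<phi> ((p @ (fst z - 1, d (fst z) (snd z)) # q) @ (i + 1, hot i x) # w))"
          by (rule hot_slot_eq) (use uw pq e' in auto)
        moreover have "sdeg (p @ (fst z - 1, d (fst z) (snd z)) # q) = sdeg u - 1" using pq[symmetric] by simp
        ultimately show "signed (A e) (sdeg p) (?\<psi> (p @ (fst z - 1, d (fst z) (snd z)) # q @ (i, x) # w)) =
            signed (A e) (sdeg p + (sdeg u - 1 + s)) (\<phi> (p @ (fst z - 1, d (fst z) (snd z)) # q @ (i + 1, y) # w))"
          using t1[OF pq] by (simp add: y_def)
      qed
      also have "\<dots> = signed (A e) (sdeg u + s + 1) F1" by (rule F1s) simp
      finally show ?thesis .
    qed
    have 2: "signed (A e) (sdeg u) (?\<psi> (u @ (i - 1, d i x) # w)) = signed (A e) s G2"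
    proof -
      have "?\<psi> (u @ (i - 1, d i x) # w) = signed (A e) (sdeg u + s) (\<phi> (u @ (i - 1 + 1, hot (i - 1) (d i x)) # w))"
        by (rule hot_slot_eq[OF uw(2,3)]) (simp add: e')
      thus ?thesis using Gc signed_cong[of "sdeg u + (sdeg u + s)" s "A e"] by (simp add: G2_def)
    qed
    have 3: "psum (A e) (\<lambda>p z q. signed (A e) (sdeg u + i + 1 + sdeg p) (?\<psi> (u @ (i, x) # p @ (fst z - 1, d (fst z) (snd z)) # q))) w
        = signed (A e) (s + 1) F3"
    proof -
      have "psum (A e) (\<lambda>p z q. signed (A e) (sdeg u + i + 1 + sdeg p) (?\<psi> (u @ (i, x) # p @ (fst z - 1, d (fst z) (snd z)) # q))) w
        = psum (A e) (\<lambda>p z q. signed (A e) (sdeg u + i + 1 + sdeg p + (sdeg u + s)) (\<phi> (u @ (i + 1, y) # p @ (fst z - 1, d (fst z) (snd z)) # q))) w"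
      proof (rule psum_cong)
        fix p z q assume pq: "p @ z # q = w"
        have "?\<psi> (u @ (i, x) # p @ (fst z - 1, d (fst z) (snd z)) # q) =
            signed (A e) (sdeg u + s) (\<phi> (u @ (i + 1, hot i x) # p @ (fst z - 1, d (fst z) (snd z)) # q))"
          by (rule hot_slot_eq[OF uw(2)]) (use uw pq e' in auto)
        thus "signed (A e) (sdeg u + i + 1 + sdeg p) (?\<psi> (u @ (i, x) # p @ (fst z - 1, d (fst z) (snd z)) # q)) =
            signed (A e) (sdeg u + i + 1 + sdeg p + (sdeg u + s)) (\<phi> (u @ (i + 1, y) # p @ (fst z - 1, d (fst z) (snd z)) # q))"
          using t3[OF pq] by (simp add: y_def)
      qed
      also have "\<dots> = signed (A e) (s + 1) F3" by (rule F3s) simp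
      finally show ?thesis .
    qed
    show ?thesis unfolding uw(1) dpre_append[OF m\<psi> W ee] 1 2 3 ..
  qed
  hence "\<ominus>\<^bsub>A e\<^esub> signed (A e) (s + 1) (dpre (s + 1) ?\<psi> ws) = signed (A e) s (signed (A e) (sdeg u + s + 1) F1 \<oplus>\<^bsub>A e\<^esub> (signed (A e) s G2 \<oplus>\<^bsub>A e\<^esub> signed (A e) (s + 1) F3))"
    using Fc Gc by (auto simp: signed_def)
  also have "\<dots> = \<ominus>\<^bsub>A e\<^esub> signed (A e) (sdeg u) F1 \<oplus>\<^bsub>A e\<^esub> (G2 \<oplus>\<^bsub>A e\<^esub> \<ominus>\<^bsub>A e\<^esub> F3)"
    using Fc Gc by (auto simp: V.signed_add) (auto simp: signed_def)
  finally have dp: "\<ominus>\<^bsub>A e\<^esub> signed (A e) (s + 1) (dpre (s + 1) ?\<psi> ws) =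
      \<ominus>\<^bsub>A e\<^esub> signed (A e) (sdeg u) F1 \<oplus>\<^bsub>A e\<^esub> (G2 \<oplus>\<^bsub>A e\<^esub> \<ominus>\<^bsub>A e\<^esub> F3)" .
  have ei: "sdeg ws + (s + 1) - 1 = e + 1" "sdeg ws + (s + 1) - 2 = e" using e by auto
  have "bdry (s + 1) ?\<psi> ws = (signed (A e) (sdeg u) F1 \<oplus>\<^bsub>A e\<^esub> (G1 \<oplus>\<^bsub>A e\<^esub> F3)) \<oplus>\<^bsub>A e\<^esub>
      (\<ominus>\<^bsub>A e\<^esub> signed (A e) (sdeg u) F1 \<oplus>\<^bsub>A e\<^esub> (G2 \<oplus>\<^bsub>A e\<^esub> \<ominus>\<^bsub>A e\<^esub> F3))"
    unfolding bdry_def ei a_minus_def d\<psi> dp ..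
  also have "\<dots> = (signed (A e) (sdeg u) F1 \<oplus>\<^bsub>A e\<^esub> \<ominus>\<^bsub>A e\<^esub> signed (A e) (sdeg u) F1) \<oplus>\<^bsub>A e\<^esub>
      ((G1 \<oplus>\<^bsub>A e\<^esub> G2) \<oplus>\<^bsub>A e\<^esub> (F3 \<oplus>\<^bsub>A e\<^esub> \<ominus>\<^bsub>A e\<^esub> F3))"
    using Fc Gc by (simp only: V.add_exchange V.M.a_closed V.M.a_inv_closed V.signed_closed)
  also have "\<dots> = G1 \<oplus>\<^bsub>A e\<^esub> G2" using Fc Gc by (simp add: V.M.r_neg)
  also have "\<dots> = \<phi> (u @ (i, d (i + 1) y \<oplus>\<^bsub>A i\<^esub> hot (i - 1) (d i x)) # w)"
    unfolding G1_def G2_def by (rule mfam_add[OF \<phi> W(1,2) dy hdx e', symmetric])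
  also have "\<dots> = \<phi> (u @ (i, x \<ominus>\<^bsub>A i\<^esub> idem i x) # w)"
    unfolding y_def idem_homotopy[OF W(3)] ..
  also have "\<dots> = \<phi> ws \<ominus>\<^bsub>A e\<^esub> idem_slot s n k \<phi> ws"
    unfolding uw(1) idem_slot_eq[OF uw(2,3)] by (rule mfam_minus[OF \<phi> W(1,2,3) idem_closed[OF W(3)] e'])
  finally show "bdry (s + 1) ?\<psi> ws = \<phi> ws \<ominus>\<^bsub>A e\<^esub> idem_slot s n k \<phi> ws" .

  let ?\<eta> = "idem_slot s n k \<phi>"
  have m\<eta>: "mfam R A s ?\<eta>" by (rule mfam_idem_slot[OF \<phi> k])
  let ?Y = "u @ (i, idem i x) # w"
  have Y: "?Y \<in> words A" "length ?Y = n" "sdeg ?Y + s - 1 = e" "sdeg ?Y + s - 2 = e - 1"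
    using W idem_closed[OF W(3)] uw e' by auto
  have \<eta>ws: "?\<eta> ws = \<phi> ?Y" unfolding uw(1) by (rule idem_slot_eq[OF uw(2,3)])
  have ee: "e - 1 = sdeg u + i + sdeg w + s - 1" using e' by simp
  have z1: "d i (idem i x) = \<zero>\<^bsub>A (i - 1)\<^esub>" using W(3) by (simp add: idem_eq d_inc prj_closed)
  have z2: "idem (i - 1) (d i x) = \<zero>\<^bsub>A (i - 1)\<^esub>" using dx W(3) by (simp add: idem_eq prj_d inc_zero)
  have z: "\<phi> (u @ (i - 1, \<zero>\<^bsub>A (i - 1)\<^esub>) # w) = \<zero>\<^bsub>A (e - 1)\<^esub>"
    by (rule mfam_zero[OF \<phi> W(1,2)]) (simp add: e')
  have "dpre s ?\<eta> ws = dpre s \<phi> ?Y"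
    unfolding uw(1) dpre_append[OF m\<eta> W ee] dpre_append[OF \<phi> W(1,2) idem_closed[OF W(3)] ee]
  proof (intro arg_cong2[where f = "add (A (e - 1))"] psum_cong arg_cong[where f = "signed (A (e - 1)) _"])
    fix p z q assume pq: "p @ z # q = u"
    have "?\<eta> ((p @ (fst z - 1, d (fst z) (snd z)) # q) @ (i, x) # w) =
        \<phi> ((p @ (fst z - 1, d (fst z) (snd z)) # q) @ (i, idem i x) # w)"
      by (rule idem_slot_eq) (use uw pq in auto)
    thus "?\<eta> (p @ (fst z - 1, d (fst z) (snd z)) # q @ (i, x) # w) =
        \<phi> (p @ (fst z - 1, d (fst z) (snd z)) # q @ (i, idem i x) # w)" by simp
  next
    show "?\<eta> (u @ (i - 1, d i x) # w) = \<phi> (u @ (i - 1, d i (idem i x)) # w)"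
      unfolding idem_slot_eq[OF uw(2,3)] z1 z2 ..
  next
    fix p z q assume pq: "p @ z # q = w"
    show "?\<eta> (u @ (i, x) # p @ (fst z - 1, d (fst z) (snd z)) # q) =
        \<phi> (u @ (i, idem i x) # p @ (fst z - 1, d (fst z) (snd z)) # q)"
      by (rule idem_slot_eq[OF uw(2)]) (use uw pq in auto)
  qed
  thus "d e (?\<eta> ws) = signed (A (e - 1)) s (dpre s ?\<eta> ws)"
    using cyc[OF Y(1,2)] unfolding \<eta>ws Y(3,4) by simp
qed

lemma post_homotopy:
  assumes \<phi>: "mfam R A s \<phi>"
    and cyc: "\<And>ws. ws \<in> words A \<Longrightarrow> length ws = n \<Longrightarrow>
      d (sdeg ws + s - 1) (\<phi> ws) = signed (A (sdeg ws + s - 2)) s (dpre s \<phi> ws)"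
    and ws: "ws \<in> words A" "length ws = n" and e: "e = sdeg ws + s - 1"
  shows "bdry (s + 1) (\<lambda>ws. hot (sdeg ws + s - 1) (\<phi> ws)) ws = \<phi> ws \<ominus>\<^bsub>A e\<^esub> idem e (\<phi> ws)"
proof -
  let ?\<psi> = "\<lambda>ws. hot (sdeg ws + s - 1) (\<phi> ws)"
  have c: "\<phi> ws \<in> carrier (A e)" by (rule mfam_closed[OF \<phi> ws(1) e])
  have dc: "d e (\<phi> ws) \<in> carrier (A (e - 1))" using c by (intro d_closed) auto
  have pc: "dpre s \<phi> ws \<in> carrier (A (e - 1))" by (rule dpre_closed[OF \<phi> ws(1)]) (simp add: e)
  have tc: "signed (A (e - 1)) (sdeg u) (\<phi> (u @ (fst x - 1, d (fst x) (snd x)) # w)) \<in> carrier (A (e - 1))"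
    "\<phi> (u @ (fst x - 1, d (fst x) (snd x)) # w) \<in> carrier (A (e - 1))"
    "sdeg (u @ (fst x - 1, d (fst x) (snd x)) # w) + s - 1 = e - 1"
    if "u @ x # w = ws" for u x w
    using that ws(1) e by (auto intro!: V.signed_closed dpre_term_closed[OF \<phi>])
  have hs: "hot (e - 1) (signed (A (e - 1)) k z) = signed (A e) k (hot (e - 1) z)" if "z \<in> carrier (A (e - 1))" for z k
    using mod_hom_signed[OF V.module_axioms V.module_axioms hot that] by simp
  have hc: "hot (e - 1) z \<in> carrier (A e)" if "z \<in> carrier (A (e - 1))" for z
    using that by (intro hot_closed) auto
  have ei: "sdeg ws + (s + 1) - 1 = e + 1" "sdeg ws + (s + 1) - 2 = e" "sdeg ws + s - 1 = e" "sdeg ws + s - 2 = e - 1"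
    using e by auto
  have "dpre (s + 1) ?\<psi> ws = psum (A e) (\<lambda>u x w. hot (e - 1) (signed (A (e - 1)) (sdeg u) (\<phi> (u @ (fst x - 1, d (fst x) (snd x)) # w)))) ws"
    unfolding dpre_def ei by (rule psum_cong) (simp add: tc(3) hs tc(2) del: sdeg_simps)
  also have "\<dots> = hot (e - 1) (dpre s \<phi> ws)"
    unfolding dpre_def ei
  proof (rule V.psum_additive[symmetric])
    show "hot (e - 1) (x \<oplus>\<^bsub>A (e - 1)\<^esub> y) = hot (e - 1) x \<oplus>\<^bsub>A e\<^esub> hot (e - 1) y"
      if "x \<in> carrier (A (e - 1))" "y \<in> carrier (A (e - 1))" for x y
      using mod_hom_add[OF hot that] by simp
  qed (auto simp: hot_zero intro!: tc(1))
  finally have "dpre (s + 1) ?\<psi> ws = hot (e - 1) (dpre s \<phi> ws)" .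
  moreover have "dpre s \<phi> ws = signed (A (e - 1)) s (d e (\<phi> ws))"
    using cyc[OF ws] pc by (simp add: ei)
  ultimately have "\<ominus>\<^bsub>A e\<^esub> signed (A e) (s + 1) (dpre (s + 1) ?\<psi> ws) = hot (e - 1) (d e (\<phi> ws))"
    using hs[OF dc] hc[OF dc] by (auto simp: signed_def)
  hence "bdry (s + 1) ?\<psi> ws = d (e + 1) (hot e (\<phi> ws)) \<oplus>\<^bsub>A e\<^esub> hot (e - 1) (d e (\<phi> ws))"
    unfolding bdry_def ei a_minus_def by simp
  thus ?thesis using idem_homotopy[OF c] by simp
qed

text \<open>Since \<open>inc \<circ> prj\<close> is homotopic to the identity, a cycle \<open>\<phi>\<close> differs by a boundary from the
  map that first applies \<open>inc \<circ> prj\<close> to every argument and finally to the value. That map factors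
  through \<open>push s \<phi>\<close>. The arguments are treated one after the other.\<close>

theorem push_zero_imp_bdry:
  assumes \<phi>: "mfam R A s \<phi>"
    and cyc: "\<And>ws. ws \<in> words A \<Longrightarrow> length ws = n \<Longrightarrow> bdry s \<phi> ws = \<zero>\<^bsub>A (sdeg ws + s - 2)\<^esub>"
    and zero: "\<And>ws. ws \<in> words H \<Longrightarrow> length ws = n \<Longrightarrow> push s \<phi> ws = \<zero>\<^bsub>H (sdeg ws + s - 1)\<^esub>"
  obtains \<psi> where "mfam R A (s + 1) \<psi>" "\<And>ws. ws \<in> words A \<Longrightarrow> length ws = n \<Longrightarrow> \<phi> ws = bdry (s + 1) \<psi> ws"
proof -
  let ?C = "\<lambda>\<theta>. \<forall>ws\<in>words A. length ws = n \<longrightarrow>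
    d (sdeg ws + s - 1) (\<theta> ws) = signed (A (sdeg ws + s - 2)) s (dpre s \<theta> ws)"
  have c0: "?C \<phi>"
  proof (intro ballI impI)
    fix ws assume ws: "ws \<in> words A" "length ws = n"
    have "d (sdeg ws + s - 1) (\<phi> ws) \<in> carrier (A (sdeg ws + s - 2))" "dpre s \<phi> ws \<in> carrier (A (sdeg ws + s - 2))"
      by (rule d_closed[OF mfam_closed[OF \<phi> ws(1) refl]], simp) (rule dpre_closed[OF \<phi> ws(1) refl])
    thus "d (sdeg ws + s - 1) (\<phi> ws) = signed (A (sdeg ws + s - 2)) s (dpre s \<phi> ws)"
      using cyc[OF ws] unfolding bdry_def by (simp add: V.minus_eq_zero_iff)
  qed
  let ?E = "wmap idem"
  have "\<exists>\<theta> \<psi>. mfam R A s \<theta> \<and> ?C \<theta> \<and> mfam R A (s + 1) \<psi> \<and> (\<forall>ws\<in>words A. length ws = n \<longrightarrow>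
      \<theta> ws = \<phi> (?E (take k ws) @ drop k ws) \<and> bdry (s + 1) \<psi> ws = \<phi> ws \<ominus>\<^bsub>A (sdeg ws + s - 1)\<^esub> \<theta> ws)" if "k \<le> n" for k
    using that
  proof (induct k)
    case 0
    let ?z = "\<lambda>ws. \<zero>\<^bsub>A (sdeg ws + (s + 1) - 1)\<^esub>"
    have mz: "mfam R A (s + 1) ?z" by (rule mfamI) (simp_all add: algebra_simps)
    have "bdry (s + 1) ?z ws = \<phi> ws \<ominus>\<^bsub>A (sdeg ws + s - 1)\<^esub> \<phi> ws" if "ws \<in> words A" for ws
    proof -
      have "dpre (s + 1) ?z ws = \<zero>\<^bsub>A (sdeg ws + (s + 1) - 2)\<^esub>"
        unfolding dpre_def
      proof (rule V.psum_zero)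
        fix u x w assume "u @ x # w = ws"
        hence "sdeg (u @ (fst x - 1, d (fst x) (snd x)) # w) + (s + 1) - 1 = sdeg ws + (s + 1) - 2" by auto
        thus "signed (A (sdeg ws + (s + 1) - 2)) (sdeg u) (?z (u @ (fst x - 1, d (fst x) (snd x)) # w)) =
            \<zero>\<^bsub>A (sdeg ws + (s + 1) - 2)\<^esub>" by (simp only: V.signed_zero)
      qed
      moreover have "d (sdeg ws + (s + 1) - 1) \<zero>\<^bsub>A (sdeg ws + (s + 1) - 1)\<^esub> = \<zero>\<^bsub>A (sdeg ws + (s + 1) - 2)\<^esub>"
        by (rule d_zero) simp
      moreover have "\<phi> ws \<ominus>\<^bsub>A (sdeg ws + s - 1)\<^esub> \<phi> ws = \<zero>\<^bsub>A (sdeg ws + s - 1)\<^esub>"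
        using mfam_closed[OF \<phi> that refl] by (simp add: V.minus_eq_zero_iff)
      moreover have "sdeg ws + (s + 1) - 2 = sdeg ws + s - 1" by simp
      ultimately show ?thesis unfolding bdry_def by (simp only: V.signed_zero a_minus_def module_minus_zero[OF V.module_axioms] V.M.r_zero V.M.zero_closed)
    qed
    thus ?case using \<phi> c0 mz by (intro exI[of _ \<phi>] exI[of _ ?z]) auto
  next
    case (Suc k)
    then obtain \<theta> \<psi> where IH: "mfam R A s \<theta>" "?C \<theta>" "mfam R A (s + 1) \<psi>"
      "\<And>ws. ws \<in> words A \<Longrightarrow> length ws = n \<Longrightarrow> \<theta> ws = \<phi> (?E (take k ws) @ drop k ws)"
      "\<And>ws. ws \<in> words A \<Longrightarrow> length ws = n \<Longrightarrow> bdry (s + 1) \<psi> ws = \<phi> ws \<ominus>\<^bsub>A (sdeg ws + s - 1)\<^esub> \<theta> ws"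
      by (auto simp: Suc_le_eq)
    have k: "k < n" using Suc by simp
    note h = slot_homotopy[OF IH(1) k IH(2)[rule_format]]
    note mh = mfam_hot_slot[OF IH(1) k] and mi = mfam_idem_slot[OF IH(1) k]
    show ?case
    proof (intro exI conjI ballI impI)
      show "mfam R A s (idem_slot s n k \<theta>)" by (rule mi)
      show "mfam R A (s + 1) (fam_add (s + 1) \<psi> (hot_slot s n k \<theta>))" by (rule mfam_fam_add[OF IH(3) mh])
      fix ws assume ws: "ws \<in> words A" "length ws = n"
      show "d (sdeg ws + s - 1) (idem_slot s n k \<theta> ws) = signed (A (sdeg ws + s - 2)) s (dpre s (idem_slot s n k \<theta>) ws)"
        using h(2)[OF _ _ ws refl] by simp
      obtain u x w where uw: "ws = u @ x # w" "length u = k"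
        using word_split[of k ws] k ws(2) by (metis surj_pair)
      have x: "snd x \<in> carrier (A (fst x))" and u: "u \<in> words A" "w \<in> words A" using uw ws by auto
      have "idem_slot s n k \<theta> (u @ (fst x, snd x) # w) = \<theta> (u @ (fst x, idem (fst x) (snd x)) # w)"
        by (rule idem_slot_eq) (use uw ws in auto)
      also have "\<dots> = \<phi> (?E u @ (fst x, idem (fst x) (snd x)) # w)"
        using IH(4)[of "u @ (fst x, idem (fst x) (snd x)) # w"] uw ws u idem_closed[OF x] by simp
      finally show "idem_slot s n k \<theta> ws = \<phi> (?E (take (Suc k) ws) @ drop (Suc k) ws)"
        using uw by (simp add: take_Suc_conv_app_nth)
      define e where "e = sdeg ws + s - 1"
      have c: "\<phi> ws \<in> carrier (A e)" "\<theta> ws \<in> carrier (A e)" "idem_slot s n k \<theta> ws \<in> carrier (A e)"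
        by (rule mfam_closed[OF \<phi> ws(1) e_def] mfam_closed[OF IH(1) ws(1) e_def] mfam_closed[OF mi ws(1) e_def])+
      have "bdry (s + 1) (fam_add (s + 1) \<psi> (hot_slot s n k \<theta>)) ws =
          (\<phi> ws \<ominus>\<^bsub>A e\<^esub> \<theta> ws) \<oplus>\<^bsub>A e\<^esub> (\<theta> ws \<ominus>\<^bsub>A e\<^esub> idem_slot s n k \<theta> ws)"
        using bdry_fam_add[OF IH(3) mh ws(1), of e] IH(5)[OF ws] h(1)[OF _ _ ws e_def] by (simp add: e_def)
      also have "\<dots> = \<phi> ws \<ominus>\<^bsub>A e\<^esub> idem_slot s n k \<theta> ws"
        using c by (simp add: a_minus_def V.M.a_assoc V.M.r_neg1)
      finally show "bdry (s + 1) (fam_add (s + 1) \<psi> (hot_slot s n k \<theta>)) ws =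
          \<phi> ws \<ominus>\<^bsub>A (sdeg ws + s - 1)\<^esub> idem_slot s n k \<theta> ws" by (simp add: e_def)
    qed
  qed
  from this[OF order_refl] obtain \<theta> \<psi> where \<theta>: "mfam R A s \<theta>" "?C \<theta>" "mfam R A (s + 1) \<psi>"
      "\<And>ws. ws \<in> words A \<Longrightarrow> length ws = n \<Longrightarrow> \<theta> ws = \<phi> (?E (take n ws) @ drop n ws)"
      "\<And>ws. ws \<in> words A \<Longrightarrow> length ws = n \<Longrightarrow> bdry (s + 1) \<psi> ws = \<phi> ws \<ominus>\<^bsub>A (sdeg ws + s - 1)\<^esub> \<theta> ws"
    by auto
  let ?h = "\<lambda>ws. hot (sdeg ws + s - 1) (\<theta> ws)"
  have mh: "mfam R A (s + 1) ?h" by (rule mfam_post[OF \<theta>(1) hot])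
  show ?thesis
  proof (rule that)
    show "mfam R A (s + 1) (fam_add (s + 1) \<psi> ?h)" by (rule mfam_fam_add[OF \<theta>(3) mh])
    fix ws assume ws: "ws \<in> words A" "length ws = n"
    define e where "e = sdeg ws + s - 1"
    have c: "\<phi> ws \<in> carrier (A e)" "\<theta> ws \<in> carrier (A e)"
      by (rule mfam_closed[OF \<phi> ws(1) e_def] mfam_closed[OF \<theta>(1) ws(1) e_def])+
    have "?E ws = wmap inc (wmap prj ws)"
      unfolding wmap_wmap using ws(1) by (induct ws) (auto simp: idem_eq)
    hence "\<theta> ws = \<phi> (wmap inc (wmap prj ws))" using \<theta>(4)[OF ws] ws by simp
    hence "prj e (\<theta> ws) = \<zero>\<^bsub>H e\<^esub>"
      using zero[OF prj_words[OF ws(1)]] ws(2) by (simp add: push_def e_def)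
    hence i0: "idem e (\<theta> ws) = \<zero>\<^bsub>A e\<^esub>" using c(2) by (simp add: idem_eq inc_zero)
    have "bdry (s + 1) (fam_add (s + 1) \<psi> ?h) ws = (\<phi> ws \<ominus>\<^bsub>A e\<^esub> \<theta> ws) \<oplus>\<^bsub>A e\<^esub> (\<theta> ws \<ominus>\<^bsub>A e\<^esub> \<zero>\<^bsub>A e\<^esub>)"
      using bdry_fam_add[OF \<theta>(3) mh ws(1), of e] \<theta>(5)[OF ws] post_homotopy[OF \<theta>(1) \<theta>(2)[rule_format] ws e_def] i0
      by (simp add: e_def)
    also have "\<dots> = \<phi> ws"
      using c by (simp add: a_minus_def V.M.a_assoc V.M.l_neg module_minus_zero[OF V.module_axioms])
    finally show "\<phi> ws = bdry (s + 1) (fam_add (s + 1) \<psi> ?h) ws" by simp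
  qed
qed

end

section \<open>The deformation retract onto homology\<close>

context dg_mod
begin

abbreviation "Z \<equiv> cycles A d"
abbreviation "B \<equiv> boundaries A d"
abbreviation "HA \<equiv> homology A d"

lemma cycles_simps [simp]:
  "carrier (Z i) = {x \<in> carrier (A i). d i x = \<zero>\<^bsub>A (i - 1)\<^esub>}" "zero (Z i) = zero (A i)"
  "add (Z i) = add (A i)" "smult (Z i) = smult (A i)"
  by (simp_all add: cycles_def ker_module_def)

lemma cycles_module: "module R (Z i)"
  unfolding cycles_def by (rule ker_module_module[OF V.module_axioms V.module_axioms d_hom[OF refl]])

lemma boundaries_submodule: "submodule (B i) R (Z i)"
proof -
  interpret Z: module R "Z i" by (rule cycles_module)
  have n: "\<ominus>\<^bsub>Z i\<^esub> z = \<ominus>\<^bsub>A i\<^esub> z" if z: "z \<in> carrier (Z i)" for z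
  proof -
    have "\<ominus>\<^bsub>A i\<^esub> z \<oplus>\<^bsub>Z i\<^esub> z = \<zero>\<^bsub>Z i\<^esub>" "\<ominus>\<^bsub>A i\<^esub> z \<in> carrier (Z i)"
      using z mod_hom_neg[OF V.module_axioms V.module_axioms d_hom[OF refl], of z i] module_minus_zero[OF V.module_axioms]
      by (auto simp: V.M.l_neg)
    thus ?thesis using Z.minus_equality z by blast
  qed
  have sub: "B i \<subseteq> carrier (Z i)"
    by (auto simp: boundaries_def d_closed d_d)
  show ?thesis
  proof (rule Z.submoduleI[OF sub])
    show "\<zero>\<^bsub>Z i\<^esub> \<in> B i" unfolding boundaries_def
      using d_zero[of i "i + 1"] by (auto intro!: image_eqI[of _ _ "\<zero>\<^bsub>A (i + 1)\<^esub>"])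
    show "\<ominus>\<^bsub>Z i\<^esub> z \<in> B i" if z: "z \<in> B i" for z
    proof -
      obtain y where y: "y \<in> carrier (A (i + 1))" "z = d (i + 1) y" using z by (auto simp: boundaries_def)
      have "\<ominus>\<^bsub>A i\<^esub> z = d (i + 1) (\<ominus>\<^bsub>A (i + 1)\<^esub> y)"
        using mod_hom_neg[OF V.module_axioms V.module_axioms d_hom[of i "i + 1"] y(1)] y(2) by simp
      thus ?thesis using n[of z] z sub y by (auto simp: boundaries_def)
    qed
    show "a \<oplus>\<^bsub>Z i\<^esub> b \<in> B i" if "a \<in> B i" "b \<in> B i" for a b
      using that d_add[of _ "i + 1" _ i] by (auto simp: boundaries_def) (metis V.M.a_closed image_eqI)
    show "a \<odot>\<^bsub>Z i\<^esub> b \<in> B i" if "a \<in> carrier R" "b \<in> B i" for a b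
      using that mod_hom_smult[OF d_hom[of i "i + 1"]] by (auto simp: boundaries_def) (metis V.smult_closed image_eqI)
  qed
qed

lemma homology_module: "module R (HA i)"
  unfolding homology_def by (rule quot_module_module[OF cycles_module boundaries_submodule])

lemma homology_graded: "graded_module R HA"
  by (simp add: graded_module_def homology_module)

lemma hom_class_hom: "(\<lambda>x\<in>carrier (Z i). hom_class A d i x) \<in> mod_hom R (Z i) (HA i)"
  unfolding homology_def hom_class_def by (rule quot_proj_hom[OF cycles_module boundaries_submodule])

lemma hom_class_surj: "carrier (HA i) = hom_class A d i ` carrier (Z i)"
  unfolding homology_def hom_class_def by (rule quot_simps(1)[OF cycles_module boundaries_submodule])

lemma hom_class_zero_iff: "x \<in> carrier (Z i) \<Longrightarrow> hom_class A d i x = zero (HA i) \<longleftrightarrow> x \<in> B i"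
  unfolding homology_def hom_class_def quot_simps(2)[OF cycles_module boundaries_submodule]
  by (rule quot_coset_zero_iff[OF cycles_module boundaries_submodule])

lemma Z_incl: "f \<in> mod_hom R M (Z i) \<Longrightarrow> f \<in> mod_hom R M (A i)"
  by (auto simp: mod_hom_def PiE_def Pi_def)

text \<open>As \<open>H(A)\<close> is projective, \<open>Z \<rightarrow> H(A)\<close> has a section \<open>\<sigma>\<close>. The map \<open>z \<mapsto> z - \<sigma>[z]\<close> from \<open>Z\<close> to the
  boundaries lifts along the differential to \<open>\<tau>\<close>, because \<open>Z\<close> is projective. Then \<open>x - \<tau>\<partial>x\<close> is a cycle for
  every \<open>x\<close>; its class is the projection of \<open>x\<close>, and \<open>\<tau>\<close> of it the homotopy.\<close>

theorem homology_retract: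
  assumes H: "graded_projective R HA" and Zp: "graded_projective R Z"
  obtains inc prj hot where "dg_retract R A d HA inc prj hot"
    "\<And>i x. x \<in> carrier (Z i) \<Longrightarrow> prj i x = hom_class A d i x"
proof -
  let ?q = "\<lambda>i. \<lambda>x\<in>carrier (Z i). hom_class A d i x"
  have "\<exists>\<sigma>. \<sigma> \<in> mod_hom R (HA i) (Z i) \<and> (\<forall>x\<in>carrier (HA i). hom_class A d i (\<sigma> x) = x)" for i
  proof -
    have pH: "projective R (HA i)" using H by (simp add: graded_projective_def)
    interpret HI: module R "HA i" by (rule homology_module)
    have "(\<lambda>x\<in>carrier (HA i). x) \<in> mod_hom R (HA i) (HA i)" by (rule mod_homI) auto
    moreover have "(\<lambda>x\<in>carrier (HA i). x) ` carrier (HA i) \<subseteq> ?q i ` carrier (Z i)"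
      using hom_class_surj[of i] by (auto simp: image_iff)
    ultimately obtain h where h: "h \<in> mod_hom R (HA i) (Z i)" "\<And>x. x \<in> carrier (HA i) \<Longrightarrow> ?q i (h x) = (\<lambda>x\<in>carrier (HA i). x) x"
      using projective_lift[OF pH cycles_module homology_module hom_class_hom] by blast
    have "hom_class A d i (h x) = x" if "x \<in> carrier (HA i)" for x
      using h(2)[OF that] mod_hom_closed[OF h(1) that] that by simp
    thus ?thesis using h(1) by blast
  qed
  hence "\<forall>i. \<exists>\<sigma>. \<sigma> \<in> mod_hom R (HA i) (Z i) \<and> (\<forall>x\<in>carrier (HA i). hom_class A d i (\<sigma> x) = x)" by blast
  from choice[OF this] obtain \<sigma> where \<sigma>: "\<And>i. \<sigma> i \<in> mod_hom R (HA i) (Z i)"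
      "\<And>i x. x \<in> carrier (HA i) \<Longrightarrow> hom_class A d i (\<sigma> i x) = x" by blast
  have qc: "hom_class A d i z \<in> carrier (HA i)" if "z \<in> carrier (Z i)" for i z
    using hom_class_surj that by blast
  have \<sigma>c: "\<sigma> i x \<in> carrier (A i)" "d i (\<sigma> i x) = \<zero>\<^bsub>A (i - 1)\<^esub>" if "x \<in> carrier (HA i)" for i x
    using mod_hom_closed[OF \<sigma>(1) that] by auto
  have "\<exists>\<tau>. \<tau> \<in> mod_hom R (Z i) (A (i + 1)) \<and>
      (\<forall>z\<in>carrier (Z i). d (i + 1) (\<tau> z) = z \<ominus>\<^bsub>A i\<^esub> \<sigma> i (hom_class A d i z))" for i
  proof -
    have pZ: "projective R (Z i)" using Zp by (simp add: graded_projective_def)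
    let ?f = "\<lambda>z\<in>carrier (Z i). z \<ominus>\<^bsub>A i\<^esub> \<sigma> i (hom_class A d i z)"
    interpret ZI: module R "Z i" by (rule cycles_module)
    have qa: "hom_class A d i (x \<oplus>\<^bsub>A i\<^esub> y) = add (HA i) (hom_class A d i x) (hom_class A d i y)"
      if "x \<in> carrier (Z i)" "y \<in> carrier (Z i)" for x y
      using mod_hom_add[OF hom_class_hom that] ZI.M.a_closed[OF that] that by simp
    have qs: "hom_class A d i (a \<odot>\<^bsub>A i\<^esub> x) = smult (HA i) a (hom_class A d i x)"
      if "a \<in> carrier R" "x \<in> carrier (Z i)" for a x
      using mod_hom_smult[OF hom_class_hom that] ZI.smult_closed[OF that] that by simp
    have f: "?f \<in> mod_hom R (Z i) (A i)"
    proof (rule mod_homI)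
      fix x assume x: "x \<in> carrier (Z i)"
      have xA: "x \<in> carrier (A i)" using x by simp
      show "?f x \<in> carrier (A i)" using x xA \<sigma>c(1)[OF qc[OF x]] by simp
      show "?f (x \<oplus>\<^bsub>Z i\<^esub> y) = ?f x \<oplus>\<^bsub>A i\<^esub> ?f y" if y: "y \<in> carrier (Z i)" for y
      proof -
        have yA: "y \<in> carrier (A i)" using y by simp
        have xy: "x \<oplus>\<^bsub>Z i\<^esub> y \<in> carrier (Z i)" by (rule ZI.M.a_closed[OF x y])
        have "\<sigma> i (hom_class A d i (x \<oplus>\<^bsub>A i\<^esub> y)) = \<sigma> i (hom_class A d i x) \<oplus>\<^bsub>A i\<^esub> \<sigma> i (hom_class A d i y)"
          unfolding qa[OF x y] using mod_hom_add[OF \<sigma>(1) qc[OF x] qc[OF y]] by simp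
        hence "?f (x \<oplus>\<^bsub>Z i\<^esub> y) = (x \<oplus>\<^bsub>A i\<^esub> y) \<ominus>\<^bsub>A i\<^esub> (\<sigma> i (hom_class A d i x) \<oplus>\<^bsub>A i\<^esub> \<sigma> i (hom_class A d i y))"
          using xy by simp
        thus ?thesis using x y xA yA \<sigma>c(1)[OF qc[OF x]] \<sigma>c(1)[OF qc[OF y]]
          by (simp add: a_minus_def V.M.minus_add V.add_exchange)
      qed
      show "?f (a \<odot>\<^bsub>Z i\<^esub> x) = a \<odot>\<^bsub>A i\<^esub> ?f x" if a: "a \<in> carrier R" for a
      proof -
        have ax: "a \<odot>\<^bsub>Z i\<^esub> x \<in> carrier (Z i)" by (rule ZI.smult_closed[OF a x])
        have "\<sigma> i (hom_class A d i (a \<odot>\<^bsub>A i\<^esub> x)) = a \<odot>\<^bsub>A i\<^esub> \<sigma> i (hom_class A d i x)"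
          unfolding qs[OF a x] using mod_hom_smult[OF \<sigma>(1) a qc[OF x]] by simp
        hence "?f (a \<odot>\<^bsub>Z i\<^esub> x) = (a \<odot>\<^bsub>A i\<^esub> x) \<ominus>\<^bsub>A i\<^esub> a \<odot>\<^bsub>A i\<^esub> \<sigma> i (hom_class A d i x)"
          using ax by simp
        thus ?thesis using x xA a \<sigma>c(1)[OF qc[OF x]]
          by (simp add: a_minus_def V.smult_r_distr V.smult_r_minus)
      qed
    qed simp
    have im: "?f ` carrier (Z i) \<subseteq> d (i + 1) ` carrier (A (i + 1))"
    proof
      fix b assume "b \<in> ?f ` carrier (Z i)"
      then obtain z where z: "z \<in> carrier (Z i)" "b = z \<ominus>\<^bsub>A i\<^esub> \<sigma> i (hom_class A d i z)" by auto
      have s: "\<sigma> i (hom_class A d i z) \<in> carrier (Z i)" by (rule mod_hom_closed[OF \<sigma>(1) qc[OF z(1)]])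
      have "hom_class A d i z = hom_class A d i (\<sigma> i (hom_class A d i z))" using \<sigma>(2)[OF qc[OF z(1)]] by simp
      hence "z \<ominus>\<^bsub>Z i\<^esub> \<sigma> i (hom_class A d i z) \<in> B i"
        unfolding hom_class_def using quot_coset_eq_iff[OF cycles_module boundaries_submodule] z s
        by (simp add: hom_class_def)
      moreover have "z \<ominus>\<^bsub>Z i\<^esub> \<sigma> i (hom_class A d i z) = b"
      proof -
        have "\<ominus>\<^bsub>Z i\<^esub> y = \<ominus>\<^bsub>A i\<^esub> y" if "y \<in> carrier (Z i)" for y
        proof -
          have "\<ominus>\<^bsub>Z i\<^esub> y \<oplus>\<^bsub>A i\<^esub> y = \<zero>\<^bsub>A i\<^esub>" "\<ominus>\<^bsub>Z i\<^esub> y \<in> carrier (A i)" "y \<in> carrier (A i)"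
            using that ZI.l_neg[OF that] ZI.a_inv_closed[OF that] by auto
          from V.M.minus_equality[OF this(1,3,2)] show ?thesis by simp
        qed
        thus ?thesis using s z by (simp add: a_minus_def)
      qed
      ultimately show "b \<in> d (i + 1) ` carrier (A (i + 1))" by (simp add: boundaries_def)
    qed
    obtain h where "h \<in> mod_hom R (Z i) (A (i + 1))" "\<And>z. z \<in> carrier (Z i) \<Longrightarrow> d (i + 1) (h z) = ?f z"
      using projective_lift[OF pZ V.module_axioms V.module_axioms d_hom f im] by auto
    thus ?thesis by (intro exI[of _ h]) auto
  qed
  hence "\<forall>i. \<exists>\<tau>. \<tau> \<in> mod_hom R (Z i) (A (i + 1)) \<and>
      (\<forall>z\<in>carrier (Z i). d (i + 1) (\<tau> z) = z \<ominus>\<^bsub>A i\<^esub> \<sigma> i (hom_class A d i z))" by blast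
  from choice[OF this] obtain \<tau> where \<tau>: "\<And>i. \<tau> i \<in> mod_hom R (Z i) (A (i + 1))"
      "\<And>i z. z \<in> carrier (Z i) \<Longrightarrow> d (i + 1) (\<tau> i z) = z \<ominus>\<^bsub>A i\<^esub> \<sigma> i (hom_class A d i z)" by blast
  have dZ: "d i x \<in> carrier (Z (i - 1))" if "x \<in> carrier (A i)" for i x
    using that by (simp add: d_closed d_d)
  have q0: "hom_class A d (i - 1) (d i x) = zero (HA (i - 1))" if "x \<in> carrier (A i)" for i x
    using that hom_class_zero_iff[OF dZ[OF that]] by (auto simp: boundaries_def)
  have \<sigma>0: "\<sigma> i (zero (HA i)) = \<zero>\<^bsub>A i\<^esub>" for i
    using mod_hom_zero[OF homology_module cycles_module \<sigma>(1)] by simp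
  have \<tau>0: "\<tau> i \<zero>\<^bsub>A i\<^esub> = \<zero>\<^bsub>A (i + 1)\<^esub>" for i
    using mod_hom_zero[OF cycles_module V.module_axioms \<tau>(1), of i] by simp
  have \<tau>c: "\<tau> (i - 1) (d i x) \<in> carrier (A i)" if "x \<in> carrier (A i)" for i x
    using mod_hom_closed[OF \<tau>(1) dZ[OF that]] by simp
  have d\<tau>: "d i (\<tau> (i - 1) (d i x)) = d i x" if "x \<in> carrier (A i)" for i x
    using \<tau>(2)[OF dZ[OF that]] q0[OF that] \<sigma>0 d_closed[OF that refl] module_minus_zero[OF V.module_axioms, of "i - 1"]
    by (simp add: a_minus_def)
  define \<pi> where "\<pi> = (\<lambda>i. \<lambda>x\<in>carrier (A i). x \<ominus>\<^bsub>A i\<^esub> \<tau> (i - 1) (d i x))"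
  have \<pi>: "\<pi> i \<in> mod_hom R (A i) (Z i)" for i
  proof (rule mod_homI)
    fix x assume x: "x \<in> carrier (A i)"
    have "d i (x \<ominus>\<^bsub>A i\<^esub> \<tau> (i - 1) (d i x)) = \<zero>\<^bsub>A (i - 1)\<^esub>"
      using mod_hom_minus[OF V.module_axioms V.module_axioms d_hom[OF refl] x \<tau>c[OF x]] d\<tau>[OF x] d_closed[OF x refl]
      by (simp add: V.minus_eq_zero_iff)
    thus "\<pi> i x \<in> carrier (Z i)" using x \<tau>c[OF x] by (simp add: \<pi>_def)
    show "\<pi> i (x \<oplus>\<^bsub>A i\<^esub> y) = \<pi> i x \<oplus>\<^bsub>Z i\<^esub> \<pi> i y" if y: "y \<in> carrier (A i)" for y
      using x y \<tau>c[OF x] \<tau>c[OF y] mod_hom_add[OF \<tau>(1) dZ[OF x] dZ[OF y]] d_add[OF x y refl]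
      by (simp add: \<pi>_def a_minus_def V.M.minus_add V.add_exchange)
    show "\<pi> i (a \<odot>\<^bsub>A i\<^esub> x) = a \<odot>\<^bsub>Z i\<^esub> \<pi> i x" if a: "a \<in> carrier R" for a
      using x a \<tau>c[OF x] mod_hom_smult[OF \<tau>(1) a dZ[OF x]] mod_hom_smult[OF d_hom[OF refl] a x]
      by (simp add: \<pi>_def a_minus_def V.smult_r_distr V.smult_r_minus)
  qed (simp add: \<pi>_def)
  have \<pi>Z: "\<pi> i z = z" if "z \<in> carrier (Z i)" for i z
    using that \<tau>0[of "i - 1"] module_minus_zero[OF V.module_axioms, of i] by (simp add: \<pi>_def a_minus_def)
  define prj where "prj = (\<lambda>i. \<lambda>x\<in>carrier (A i). ?q i (\<pi> i x))"
  define hot where "hot = (\<lambda>i. \<lambda>x\<in>carrier (A i). \<tau> i (\<pi> i x))"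
  have prj: "prj i \<in> mod_hom R (A i) (HA i)" for i
    unfolding prj_def by (rule mod_hom_comp[OF \<pi> hom_class_hom V.module_axioms])
  have prjZ: "prj i x = hom_class A d i x" if "x \<in> carrier (Z i)" for i x
    using that \<pi>Z[OF that] by (simp add: prj_def)
  have prj_eq: "prj i x = hom_class A d i (\<pi> i x)" if "x \<in> carrier (A i)" for i x
    using that mod_hom_closed[OF \<pi> that] by (simp add: prj_def)
  have "dg_retract R A d HA \<sigma> prj hot"
  proof (intro dg_retract.intro dg_mod_axioms graded_mod.intro homology_graded dg_retract_axioms.intro prj)
    show "\<sigma> i \<in> mod_hom R (HA i) (A i)" for i by (rule Z_incl[OF \<sigma>(1)])
    show "hot i \<in> mod_hom R (A i) (A (i + 1))" for i
      unfolding hot_def by (rule mod_hom_comp[OF \<pi> \<tau>(1) V.module_axioms])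
    show "prj i (\<sigma> i x) = x" if "x \<in> carrier (HA i)" for i x
      using prjZ[OF mod_hom_closed[OF \<sigma>(1) that]] \<sigma>(2)[OF that] by simp
    show "d i (\<sigma> i x) = \<zero>\<^bsub>A (i - 1)\<^esub>" if "x \<in> carrier (HA i)" for i x by (rule \<sigma>c(2)[OF that])
    show "prj (i - 1) (d i x) = zero (HA (i - 1))" if "x \<in> carrier (A i)" for i x
      using prjZ[OF dZ[OF that]] q0[OF that] by simp
    show "x = \<sigma> i (prj i x) \<oplus>\<^bsub>A i\<^esub> (d (i + 1) (hot i x) \<oplus>\<^bsub>A i\<^esub> hot (i - 1) (d i x))" if x: "x \<in> carrier (A i)" for i x
    proof -
      have pz: "\<pi> i x \<in> carrier (Z i)" by (rule mod_hom_closed[OF \<pi> x])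
      define s where "s = \<sigma> i (prj i x)"
      have s: "s \<in> carrier (A i)" unfolding s_def by (rule \<sigma>c(1)[OF mod_hom_closed[OF prj x]])
      have "d (i + 1) (hot i x) = \<pi> i x \<ominus>\<^bsub>A i\<^esub> s"
        using \<tau>(2)[OF pz] x by (simp add: hot_def s_def prj_eq)
      moreover have "hot (i - 1) (d i x) = \<tau> (i - 1) (d i x)"
        using \<pi>Z[OF dZ[OF x]] d_closed[OF x refl] by (simp add: hot_def)
      moreover have "x = s \<oplus>\<^bsub>A i\<^esub> ((\<pi> i x \<ominus>\<^bsub>A i\<^esub> s) \<oplus>\<^bsub>A i\<^esub> \<tau> (i - 1) (d i x))"
      proof -
        let ?t = "\<tau> (i - 1) (d i x)"
        have "s \<oplus>\<^bsub>A i\<^esub> ((\<pi> i x \<ominus>\<^bsub>A i\<^esub> s) \<oplus>\<^bsub>A i\<^esub> ?t) = (s \<oplus>\<^bsub>A i\<^esub> \<ominus>\<^bsub>A i\<^esub> s) \<oplus>\<^bsub>A i\<^esub> (\<pi> i x \<oplus>\<^bsub>A i\<^esub> ?t)"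
          using s pz \<tau>c[OF x] by (simp add: a_minus_def V.M.a_ac)
        also have "\<dots> = \<pi> i x \<oplus>\<^bsub>A i\<^esub> ?t" using s pz \<tau>c[OF x] by (simp add: V.M.r_neg)
        also have "\<dots> = x" using x \<tau>c[OF x] by (simp add: \<pi>_def a_minus_def V.M.a_assoc V.M.l_neg)
        finally show ?thesis ..
      qed
      ultimately show ?thesis unfolding s_def by simp
    qed
  qed
  thus ?thesis using prjZ by (rule that)
qed

end


section \<open>The obstruction to the next operation\<close>

context graded_mod
begin

lemma icomp_terms_cong:
  assumes "\<And>u v w. u @ v @ w = ws \<Longrightarrow> \<phi> (u @ (sdeg v + t - 1, \<psi> v) # w) = \<phi>' (u @ (sdeg v + t - 1, \<psi>' v) # w)"
  shows "icomp V s t \<phi> \<psi> ws = icomp V s t \<phi>' \<psi>' ws"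
  unfolding icomp_def by (intro dsum_cong) (use assms in auto)

lemma icomp_terms_add:
  assumes m: "mfam R V s \<phi>1" "mfam R V t \<psi>1" "mfam R V s \<phi>2" "mfam R V t \<psi>2" and ws: "ws \<in> words V"
    and e: "e = sdeg ws + s + t - 1"
    and eq: "\<And>u v w. u @ v @ w = ws \<Longrightarrow> \<phi> (u @ (sdeg v + t - 1, \<psi> v) # w) =
      \<phi>1 (u @ (sdeg v + t - 1, \<psi>1 v) # w) \<oplus>\<^bsub>V e\<^esub> \<phi>2 (u @ (sdeg v + t - 1, \<psi>2 v) # w)"
  shows "icomp V s t \<phi> \<psi> ws = icomp V s t \<phi>1 \<psi>1 ws \<oplus>\<^bsub>V e\<^esub> icomp V s t \<phi>2 \<psi>2 ws"
proof -
  have c1: "\<phi>1 (u @ (sdeg v + t - 1, \<psi>1 v) # w) \<in> carrier (V e)" and c2: "\<phi>2 (u @ (sdeg v + t - 1, \<psi>2 v) # w) \<in> carrier (V e)"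
    if "u @ v @ w = ws" for u v w
    using that ws e by (auto intro!: icomp_term_closed[OF m(1,2)] icomp_term_closed[OF m(3,4)])
  let ?T1 = "\<lambda>u v w. signed (V e) (t * sdeg u) (\<phi>1 (u @ (sdeg v + t - 1, \<psi>1 v) # w))"
  let ?T2 = "\<lambda>u v w. signed (V e) (t * sdeg u) (\<phi>2 (u @ (sdeg v + t - 1, \<psi>2 v) # w))"
  have "icomp V s t \<phi> \<psi> ws = dsum (V e) (\<lambda>u y. dsum (V e) (\<lambda>v w. ?T1 u v w \<oplus>\<^bsub>V e\<^esub> ?T2 u v w) y) ws"
    unfolding icomp_def e[symmetric] by (intro dsum_cong) (auto simp: eq V.signed_add c1 c2)
  also have "\<dots> = dsum (V e) (\<lambda>u y. dsum (V e) (\<lambda>v w. ?T1 u v w) y \<oplus>\<^bsub>V e\<^esub> dsum (V e) (\<lambda>v w. ?T2 u v w) y) ws"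
    by (intro dsum_cong V.dsum_add V.signed_closed c1 c2) auto
  also have "\<dots> = icomp V s t \<phi>1 \<psi>1 ws \<oplus>\<^bsub>V e\<^esub> icomp V s t \<phi>2 \<psi>2 ws"
    unfolding icomp_def e[symmetric] by (intro V.dsum_add V.dsum_closed V.signed_closed c1 c2) auto
  finally show ?thesis .
qed

lemma icomp_terms_zero:
  assumes "e = sdeg ws + s + t - 1"
    and "\<And>u v w. u @ v @ w = ws \<Longrightarrow> \<phi> (u @ (sdeg v + t - 1, \<psi> v) # w) = \<zero>\<^bsub>V e\<^esub>"
  shows "icomp V s t \<phi> \<psi> ws = \<zero>\<^bsub>V e\<^esub>"
  unfolding icomp_def assms(1)[symmetric] by (intro V.dsum_zero) (auto simp: assms(2))

lemma icomp_terms_neg: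
  assumes m: "mfam R V s \<phi>1" "mfam R V t \<psi>1" "mfam R V s \<phi>2" "mfam R V t \<psi>2" and ws: "ws \<in> words V"
    and e: "e = sdeg ws + s + t - 1"
    and eq: "\<And>u v w. u @ v @ w = ws \<Longrightarrow>
      \<phi>2 (u @ (sdeg v + t - 1, \<psi>2 v) # w) = \<ominus>\<^bsub>V e\<^esub> \<phi>1 (u @ (sdeg v + t - 1, \<psi>1 v) # w)"
  shows "icomp V s t \<phi>2 \<psi>2 ws = \<ominus>\<^bsub>V e\<^esub> icomp V s t \<phi>1 \<psi>1 ws"
proof -
  let ?z = "\<lambda>ws. \<zero>\<^bsub>V (sdeg ws + s - 1)\<^esub>"
  have c: "\<phi>1 (u @ (sdeg v + t - 1, \<psi>1 v) # w) \<in> carrier (V e)" if "u @ v @ w = ws" for u v w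
    using that ws e by (auto intro!: icomp_term_closed[OF m(1,2)])
  have z: "?z (u @ (sdeg v + t - 1, \<psi>1 v) # w) = \<zero>\<^bsub>V e\<^esub>" if "u @ v @ w = ws" for u v w
  proof -
    have "sdeg (u @ (sdeg v + t - 1, \<psi>1 v) # w) + s - 1 = e" using that e by auto
    thus ?thesis by (simp only:)
  qed
  have "icomp V s t ?z \<psi>1 ws = icomp V s t \<phi>1 \<psi>1 ws \<oplus>\<^bsub>V e\<^esub> icomp V s t \<phi>2 \<psi>2 ws"
  proof (rule icomp_terms_add[OF m ws e])
    fix u v w assume uvw: "u @ v @ w = ws"
    show "?z (u @ (sdeg v + t - 1, \<psi>1 v) # w) =
      \<phi>1 (u @ (sdeg v + t - 1, \<psi>1 v) # w) \<oplus>\<^bsub>V e\<^esub> \<phi>2 (u @ (sdeg v + t - 1, \<psi>2 v) # w)"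
      unfolding z[OF uvw] eq[OF uvw] using c[OF uvw] by (simp add: V.M.r_neg)
  qed
  moreover have "icomp V s t ?z \<psi>1 ws = \<zero>\<^bsub>V e\<^esub>" by (rule icomp_terms_zero[OF e]) (rule z)
  moreover have "icomp V s t \<phi>1 \<psi>1 ws \<in> carrier (V e)" "icomp V s t \<phi>2 \<psi>2 ws \<in> carrier (V e)"
    by (rule mfam_closed[OF mfam_icomp[OF m(1,2)] ws] mfam_closed[OF mfam_icomp[OF m(3,4)] ws], simp add: e)+
  ultimately show ?thesis
    by (metis V.M.a_comm V.M.minus_equality)
qed

definition res :: "int \<Rightarrow> nat \<Rightarrow> ((int \<times> 'a) list \<Rightarrow> 'a) \<Rightarrow> (int \<times> 'a) list \<Rightarrow> 'a" where
  "res s n \<phi> ws = (if length ws = n then \<phi> ws else \<zero>\<^bsub>V (sdeg ws + s - 1)\<^esub>)"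

lemma mfam_res: "mfam R V s \<phi> \<Longrightarrow> mfam R V s (res s n \<phi>)"
  unfolding res_def by (rule mfam_restrict) (simp add: mfam_def)

lemma res_eq [simp]: "length ws = n \<Longrightarrow> res s n \<phi> ws = \<phi> ws"
  by (simp add: res_def)

definition vanishes :: "int \<Rightarrow> (nat \<Rightarrow> bool) \<Rightarrow> ((int \<times> 'a) list \<Rightarrow> 'a) \<Rightarrow> bool" where
  "vanishes s N \<phi> \<longleftrightarrow> (\<forall>ws\<in>words V. N (length ws) \<longrightarrow> \<phi> ws = \<zero>\<^bsub>V (sdeg ws + s - 1)\<^esub>)"

lemma vanishesD: "vanishes s N \<phi> \<Longrightarrow> ws \<in> words V \<Longrightarrow> N (length ws) \<Longrightarrow> e = sdeg ws + s - 1 \<Longrightarrow> \<phi> ws = \<zero>\<^bsub>V e\<^esub>"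
  by (auto simp: vanishes_def)

lemma vanishes_res: "vanishes s (\<lambda>k. k \<noteq> n) (res s n \<phi>)"
  by (simp add: vanishes_def res_def)

text \<open>Two ways for a term of a composite to be zero.\<close>

lemma term_zero_outer:
  assumes "vanishes s N \<phi>" "mfam R V t \<psi>" "u \<in> words V" "v \<in> words V" "w \<in> words V"
    and "N (length u + length w + 1)" "e = sdeg u + sdeg v + sdeg w + s + t - 1"
  shows "\<phi> (u @ (sdeg v + t - 1, \<psi> v) # w) = \<zero>\<^bsub>V e\<^esub>"
  by (rule vanishesD[OF assms(1)]) (use assms mfam_closed[OF assms(2,4) refl] in auto)

lemma term_zero_inner:
  assumes "mfam R V s \<phi>" "vanishes t N \<psi>" "u \<in> words V" "v \<in> words V" "w \<in> words V"
    and "N (length v)" "e = sdeg u + sdeg v + sdeg w + s + t - 1"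
  shows "\<phi> (u @ (sdeg v + t - 1, \<psi> v) # w) = \<zero>\<^bsub>V e\<^esub>"
  unfolding vanishesD[OF assms(2,4,6) refl] by (rule mfam_zero[OF assms(1,3,5)]) (use assms(7) in simp)

end

context dg_mod
begin

lemma vanishes_dfam: "vanishes (- 1) (\<lambda>k. k \<noteq> 1) dfam"
  by (simp add: vanishes_def dfam_def)

lemma bdry_res:
  assumes "length ws = n"
  shows "bdry s (res s n \<phi>) ws = bdry s \<phi> ws"
proof -
  have "dpre s (res s n \<phi>) ws = dpre s \<phi> ws"
    unfolding dpre_def by (rule psum_cong) (use assms in \<open>auto simp: res_def\<close>)
  thus ?thesis using assms by (simp add: bdry_def)
qed

lemma bdry_eq_zero_iff:
  assumes \<phi>: "mfam R A s \<phi>" and ws: "ws \<in> words A"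
  shows "bdry s \<phi> ws = \<zero>\<^bsub>A (sdeg ws + s - 2)\<^esub> \<longleftrightarrow>
    d (sdeg ws + s - 1) (\<phi> ws) = signed (A (sdeg ws + s - 2)) s (dpre s \<phi> ws)"
proof -
  have "d (sdeg ws + s - 1) (\<phi> ws) \<in> carrier (A (sdeg ws + s - 2))" "dpre s \<phi> ws \<in> carrier (A (sdeg ws + s - 2))"
    by (rule d_closed[OF mfam_closed[OF \<phi> ws refl]], simp) (rule dpre_closed[OF \<phi> ws refl])
  thus ?thesis unfolding bdry_def by (simp add: V.minus_eq_zero_iff)
qed

lemma cyc_res:
  assumes \<phi>: "mfam R A s \<phi>"
    and eq: "\<And>ws. ws \<in> words A \<Longrightarrow> length ws = n \<Longrightarrow> bdry s \<phi> ws = \<zero>\<^bsub>A (sdeg ws + s - 2)\<^esub>"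
  shows "cyc s (res s n \<phi>)"
  unfolding cyc_def
proof
  fix ws assume ws: "ws \<in> words A"
  show "bdry s (res s n \<phi>) ws = \<zero>\<^bsub>A (sdeg ws + s - 2)\<^esub>"
  proof (cases "length ws = n")
    case True
    thus ?thesis using bdry_res[OF True] eq[OF ws True] by simp
  next
    case False
    have "dpre s (res s n \<phi>) ws = \<zero>\<^bsub>A (sdeg ws + s - 2)\<^esub>"
      unfolding dpre_def
    proof (rule V.psum_zero)
      fix u x w assume uxw: "u @ x # w = ws"
      have "sdeg (u @ (fst x - 1, d (fst x) (snd x)) # w) + s - 1 = sdeg ws + s - 2" using uxw by auto
      moreover have "length (u @ (fst x - 1, d (fst x) (snd x)) # w) \<noteq> n" using uxw False by auto
      ultimately show "signed (A (sdeg ws + s - 2)) (sdeg u) (res s n \<phi> (u @ (fst x - 1, d (fst x) (snd x)) # w)) =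
          \<zero>\<^bsub>A (sdeg ws + s - 2)\<^esub>" by (simp only: res_def if_False V.signed_zero)
    qed
    moreover have "d (sdeg ws + s - 1) (res s n \<phi> ws) = \<zero>\<^bsub>A (sdeg ws + s - 2)\<^esub>"
      unfolding res_def using False by (simp add: d_zero)
    ultimately show ?thesis
      unfolding bdry_def by (simp only: V.signed_zero a_minus_def module_minus_zero[OF V.module_axioms] V.M.r_zero V.M.zero_closed)
  qed
qed

definition fam_neg :: "int \<Rightarrow> ((int \<times> 'a) list \<Rightarrow> 'a) \<Rightarrow> (int \<times> 'a) list \<Rightarrow> 'a" where
  "fam_neg s \<phi> ws = \<ominus>\<^bsub>A (sdeg ws + s - 1)\<^esub> \<phi> ws"

lemma mfam_fam_neg:
  assumes \<phi>: "mfam R A s \<phi>"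
  shows "mfam R A s (fam_neg s \<phi>)"
proof (rule mfamI)
  show "fam_neg s \<phi> ws \<in> carrier (A (sdeg ws + s - 1))" if "ws \<in> words A" for ws
    using mfam_closed[OF \<phi> that refl] by (simp add: fam_neg_def)
  fix us i x ws assume w: "us \<in> words A" "ws \<in> words A" "x \<in> carrier (A i)"
  define e where "e = sdeg us + i + sdeg ws + s"
  have e: "sdeg (us @ (i, z) # ws) + s - 1 = e" for z :: 'a by (simp add: e_def)
  have c: "\<phi> (us @ (i, z) # ws) \<in> carrier (A e)" if "z \<in> carrier (A i)" for z
    using w that by (auto intro!: mfam_closed[OF \<phi>] simp: e_def)
  show "fam_neg s \<phi> (us @ (i, x \<oplus>\<^bsub>A i\<^esub> y) # ws) =
      fam_neg s \<phi> (us @ (i, x) # ws) \<oplus>\<^bsub>A (sdeg us + i + sdeg ws + s)\<^esub> fam_neg s \<phi> (us @ (i, y) # ws)"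
    if y: "y \<in> carrier (A i)" for y
    unfolding fam_neg_def e e_def[symmetric] mfam_add[OF \<phi> w y e_def] using c[OF w(3)] c[OF y] by (simp add: V.M.minus_add)
  show "fam_neg s \<phi> (us @ (i, a \<odot>\<^bsub>A i\<^esub> x) # ws) =
      a \<odot>\<^bsub>A (sdeg us + i + sdeg ws + s)\<^esub> fam_neg s \<phi> (us @ (i, x) # ws)" if a: "a \<in> carrier R" for a
    unfolding fam_neg_def e e_def[symmetric] mfam_smult[OF \<phi> w a e_def] using c[OF w(3)] a by (simp add: V.smult_r_minus)
qed

lemma bdry_fam_neg:
  assumes \<phi>: "mfam R A s \<phi>" and ws: "ws \<in> words A" and e: "e = sdeg ws + s - 2"
  shows "bdry s (fam_neg s \<phi>) ws = \<ominus>\<^bsub>A e\<^esub> bdry s \<phi> ws"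
proof -
  have c: "\<phi> ws \<in> carrier (A (sdeg ws + s - 1))" by (rule mfam_closed[OF \<phi> ws refl])
  have dc: "d (sdeg ws + s - 1) (\<phi> ws) \<in> carrier (A e)" using c e by (intro d_closed) auto
  have pc: "dpre s \<phi> ws \<in> carrier (A e)" by (rule dpre_closed[OF \<phi> ws e])
  have tc: "\<phi> (u @ (fst x - 1, d (fst x) (snd x)) # w) \<in> carrier (A e)" "sdeg (u @ (fst x - 1, d (fst x) (snd x)) # w) + s - 1 = e"
    if "u @ x # w = ws" for u x w
    using that ws e by (auto intro!: dpre_term_closed[OF \<phi>])
  have "dpre s (fam_neg s \<phi>) ws = psum (A e) (\<lambda>u x w. signed (A e) 1 (signed (A e) (sdeg u) (\<phi> (u @ (fst x - 1, d (fst x) (snd x)) # w)))) ws"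
    unfolding dpre_def e[symmetric] by (rule psum_cong) (simp add: fam_neg_def tc V.signed_neg del: sdeg_simps V.signed_signed)
  also have "\<dots> = signed (A e) 1 (dpre s \<phi> ws)"
    unfolding dpre_def e[symmetric] by (rule V.psum_signed[symmetric]) (auto intro!: V.signed_closed tc)
  finally have p: "dpre s (fam_neg s \<phi>) ws = \<ominus>\<^bsub>A e\<^esub> dpre s \<phi> ws" by simp
  have "d (sdeg ws + s - 1) (fam_neg s \<phi> ws) = \<ominus>\<^bsub>A e\<^esub> d (sdeg ws + s - 1) (\<phi> ws)"
    unfolding fam_neg_def using mod_hom_neg[OF V.module_axioms V.module_axioms d_hom c, of e] e by simp
  thus ?thesis unfolding bdry_def p e[symmetric] using dc pc
    by (simp add: a_minus_def V.signed_neg V.M.minus_add)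
qed

text \<open>Changing \<open>b\<close> in arity \<open>q\<close> only affects \<open>b \<circ> b\<close> from arity \<open>q\<close> on, and in arities \<open>q\<close> and \<open>q + 1\<close>
  it does so through the unary and the binary operation alone. The change \<open>g\<close> meets itself only in
  arity \<open>2 q - 1\<close>, which is greater than \<open>q + 1\<close> because \<open>q \<ge> 3\<close>.\<close>

lemma perturb:
  assumes b: "mfam R A (- 1) b" "vanishes (- 1) (\<lambda>k. k = 0) b"
    and "\<forall>ws\<in>words A. length ws = 1 \<longrightarrow> b ws = dfam ws"
    and \<beta>: "mfam R A (- 1) \<beta>" "vanishes (- 1) (\<lambda>k. k \<noteq> 2) \<beta>"
    and "\<forall>ws\<in>words A. length ws = 2 \<longrightarrow> b ws = \<beta> ws"
    and g: "mfam R A (- 1) g" "vanishes (- 1) (\<lambda>k. k \<noteq> q) g" and q: "q \<ge> 3"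
    and ws: "ws \<in> words A" and e: "e = sdeg ws - 3"
  defines "b' \<equiv> fam_add (- 1) b g"
  shows "length ws < q \<Longrightarrow> icomp A (- 1) (- 1) b' b' ws = icomp A (- 1) (- 1) b b ws"
    and "length ws = q \<Longrightarrow> icomp A (- 1) (- 1) b' b' ws = icomp A (- 1) (- 1) b b ws \<oplus>\<^bsub>A e\<^esub> bdry (- 1) g ws"
    and "length ws = q + 1 \<Longrightarrow> icomp A (- 1) (- 1) b' b' ws = icomp A (- 1) (- 1) b b ws \<oplus>\<^bsub>A e\<^esub>
      (icomp A (- 1) (- 1) \<beta> g ws \<oplus>\<^bsub>A e\<^esub> icomp A (- 1) (- 1) g \<beta> ws)"
proof -
  have b1: "b ws = dfam ws" if "ws \<in> words A" "length ws = 1" for ws using assms(3) that by simp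
  have b2: "b ws = \<beta> ws" if "ws \<in> words A" "length ws = 2" for ws using assms(6) that by simp
  have mb': "mfam R A (- 1) b'" unfolding b'_def by (rule mfam_fam_add[OF b(1) g(1)])
  have b'b: "b' v = b v" if "v \<in> words A" "length v \<noteq> q" for v
    unfolding b'_def fam_add_def vanishesD[OF g(2) that refl] using mfam_closed[OF b(1) that(1) refl] by simp
  have b'0: "vanishes (- 1) (\<lambda>k. k = 0) b'"
    unfolding vanishes_def using b'b vanishesD[OF b(2) _ _ refl] q by auto
  have ee: "e = sdeg ws + - 1 + - 1 - 1" using e by simp
  have W: "u \<in> words A" "v \<in> words A" "w \<in> words A" "e = sdeg u + sdeg v + sdeg w + - 1 + - 1 - 1"
    "length u + length v + length w = length ws"
    if "u @ v @ w = ws" for u v w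
    using that ws ee by auto
  have bg: "icomp A (- 1) (- 1) b g ws = icomp A (- 1) (- 1) \<phi> g ws"
    if \<phi>: "mfam R A (- 1) \<phi>" "\<And>x. x \<in> words A \<Longrightarrow> length x + q = length ws + 1 \<Longrightarrow> b x = \<phi> x" for \<phi>
  proof (rule icomp_terms_cong)
    fix u v w assume uvw: "u @ v @ w = ws"
    note w = W[OF uvw]
    show "b (u @ (sdeg v + - 1 - 1, g v) # w) = \<phi> (u @ (sdeg v + - 1 - 1, g v) # w)"
    proof (cases "length v = q")
      case True
      show ?thesis by (rule \<phi>(2)) (use w(1-3,5) mfam_closed[OF g(1) w(2) refl] True in auto)
    next
      case False
      show ?thesis
        using term_zero_inner[OF b(1) g(2) w(1-3) False w(4)] term_zero_inner[OF \<phi>(1) g(2) w(1-3) False w(4)] by simp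
    qed
  qed
  have gb: "icomp A (- 1) (- 1) g b' ws = icomp A (- 1) (- 1) g \<psi> ws"
    if \<psi>: "mfam R A (- 1) \<psi>" "\<And>x. x \<in> words A \<Longrightarrow> length x + q = length ws + 1 \<Longrightarrow> b' x = \<psi> x" for \<psi>
  proof (rule icomp_terms_cong)
    fix u v w assume uvw: "u @ v @ w = ws"
    note w = W[OF uvw]
    show "g (u @ (sdeg v + - 1 - 1, b' v) # w) = g (u @ (sdeg v + - 1 - 1, \<psi> v) # w)"
    proof (cases "length u + length w + 1 = q")
      case True
      hence "b' v = \<psi> v" using w(2,5) by (intro \<psi>(2)) auto
      thus ?thesis by simp
    next
      case False
      show ?thesis
        using term_zero_outer[OF g(2) mb' w(1-3) False w(4)] term_zero_outer[OF g(2) \<psi>(1) w(1-3) False w(4)] by simp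
    qed
  qed
  have c: "icomp A (- 1) (- 1) x y ws \<in> carrier (A e)" if "mfam R A (- 1) x" "mfam R A (- 1) y" for x y
    by (rule mfam_closed[OF mfam_icomp[OF that] ws]) (simp add: e)
  have "icomp A (- 1) (- 1) b' b' ws = icomp A (- 1) (- 1) b b' ws \<oplus>\<^bsub>A e\<^esub> icomp A (- 1) (- 1) g b' ws"
  proof (rule icomp_terms_add[OF b(1) mb' g(1) mb' ws ee])
    fix u v w assume uvw: "u @ v @ w = ws"
    have "sdeg (u @ (sdeg v + - 1 - 1, b' v) # w) + - 1 - 1 = e" using W(4)[OF uvw] by simp
    thus "b' (u @ (sdeg v + - 1 - 1, b' v) # w) =
        b (u @ (sdeg v + - 1 - 1, b' v) # w) \<oplus>\<^bsub>A e\<^esub> g (u @ (sdeg v + - 1 - 1, b' v) # w)"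
      unfolding b'_def fam_add_def by (simp only:)
  qed
  also have "icomp A (- 1) (- 1) b b' ws = icomp A (- 1) (- 1) b b ws \<oplus>\<^bsub>A e\<^esub> icomp A (- 1) (- 1) b g ws"
  proof (rule icomp_terms_add[OF b(1) b(1) b(1) g(1) ws ee])
    fix u v w assume uvw: "u @ v @ w = ws"
    note w = W[OF uvw]
    show "b (u @ (sdeg v + - 1 - 1, b' v) # w) =
        b (u @ (sdeg v + - 1 - 1, b v) # w) \<oplus>\<^bsub>A e\<^esub> b (u @ (sdeg v + - 1 - 1, g v) # w)"
      unfolding b'_def fam_add_def
      by (rule mfam_add[OF b(1) w(1,3) mfam_closed[OF b(1) w(2) refl] mfam_closed[OF g(1) w(2) refl]]) (simp add: w(4))
  qed
  finally have sum: "icomp A (- 1) (- 1) b' b' ws = icomp A (- 1) (- 1) b b ws \<oplus>\<^bsub>A e\<^esub>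
      (icomp A (- 1) (- 1) b g ws \<oplus>\<^bsub>A e\<^esub> icomp A (- 1) (- 1) g b' ws)"
    using c b(1) g(1) mb' by (simp add: V.M.a_assoc)
  show "icomp A (- 1) (- 1) b' b' ws = icomp A (- 1) (- 1) b b ws" if len: "length ws < q"
  proof -
    have "icomp A (- 1) (- 1) b g ws = \<zero>\<^bsub>A e\<^esub>"
    proof (rule icomp_terms_zero[OF ee])
      fix u v w assume uvw: "u @ v @ w = ws"
      note w = W[OF uvw]
      show "b (u @ (sdeg v + - 1 - 1, g v) # w) = \<zero>\<^bsub>A e\<^esub>"
        by (rule term_zero_inner[OF b(1) g(2) w(1-3) _ w(4)]) (use w(5) len in simp)
    qed
    moreover have "icomp A (- 1) (- 1) g b' ws = \<zero>\<^bsub>A e\<^esub>"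
    proof (rule icomp_terms_zero[OF ee])
      fix u v w assume uvw: "u @ v @ w = ws"
      note w = W[OF uvw]
      show "g (u @ (sdeg v + - 1 - 1, b' v) # w) = \<zero>\<^bsub>A e\<^esub>"
      proof (cases "length v = 0")
        case True
        show ?thesis by (rule term_zero_inner[OF g(1) b'0 w(1-3) True w(4)])
      next
        case False
        show ?thesis by (rule term_zero_outer[OF g(2) mb' w(1-3) _ w(4)]) (use w(5) len False in linarith)
      qed
    qed
    ultimately show ?thesis using sum c[OF b(1) b(1)] by simp
  qed
  show "icomp A (- 1) (- 1) b' b' ws = icomp A (- 1) (- 1) b b ws \<oplus>\<^bsub>A e\<^esub> bdry (- 1) g ws" if len: "length ws = q"
  proof -
    have "icomp A (- 1) (- 1) b g ws = d (sdeg ws - 2) (g ws)"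
      using bg[OF mfam_dfam] b1 len icomp_dfam_left[OF g(1) ws, of "sdeg ws - 2"] by simp
    moreover have "icomp A (- 1) (- 1) g b' ws = dpre (- 1) g ws"
      using gb[OF mfam_dfam] b1 b'b len q icomp_dfam_right[OF g(1) ws] by simp
    moreover have "dpre (- 1) g ws \<in> carrier (A e)" by (rule dpre_closed[OF g(1) ws]) (simp add: e)
    ultimately show ?thesis unfolding sum bdry_def by (simp add: a_minus_def e)
  qed
  show "icomp A (- 1) (- 1) b' b' ws = icomp A (- 1) (- 1) b b ws \<oplus>\<^bsub>A e\<^esub>
      (icomp A (- 1) (- 1) \<beta> g ws \<oplus>\<^bsub>A e\<^esub> icomp A (- 1) (- 1) g \<beta> ws)" if len: "length ws = q + 1"
    unfolding sum using bg[OF \<beta>(1)] gb[OF \<beta>(1)] b2 b'b len q by simp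
qed

end

context dg_mod
begin

text \<open>The first \<open>r\<close> operations of an \<open>A\<^sub>\<infinity>\<close>-structure with the given differential and the product \<open>\<beta>\<close>. The
  equations up to arity \<open>r\<close> are those in which no operation of higher arity occurs.\<close>

definition partial_structure :: "((int \<times> 'a) list \<Rightarrow> 'a) \<Rightarrow> nat \<Rightarrow> ((int \<times> 'a) list \<Rightarrow> 'a) \<Rightarrow> bool" where
  "partial_structure \<beta> r b \<longleftrightarrow> mfam R A (- 1) b \<and> vanishes (- 1) (\<lambda>k. k = 0 \<or> k > r) b \<and>
     (\<forall>ws\<in>words A. length ws = 1 \<longrightarrow> b ws = dfam ws) \<and> (\<forall>ws\<in>words A. length ws = 2 \<longrightarrow> b ws = \<beta> ws) \<and>
     vanishes (- 2) (\<lambda>k. k \<le> r) (icomp A (- 1) (- 1) b b)"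

lemma mfam_square: "mfam R A (- 1) b \<Longrightarrow> mfam R A (- 2) (icomp A (- 1) (- 1) b b)"
  using mfam_icomp[of "- 1" b "- 1" b] by simp

text \<open>Comparing both sides of \<open>b \<circ> (b \<circ> b) = (b \<circ> b) \<circ> b\<close> in the arities \<open>r + 1\<close> and \<open>r + 2\<close>, when
  \<open>b \<circ> b\<close> is zero up to arity \<open>r\<close>: the obstruction is a cycle for the differential of
  \<open>End(A)\<close>, and it commutes with the product up to a boundary.\<close>

lemma obstruction:
  assumes b: "partial_structure \<beta> r b" and \<beta>: "mfam R A (- 1) \<beta>" "vanishes (- 1) (\<lambda>k. k \<noteq> 2) \<beta>"
    and ws: "ws \<in> words A"
  defines "P \<equiv> icomp A (- 1) (- 1) b b"
  shows "length ws = r + 1 \<Longrightarrow> bdry (- 2) P ws = \<zero>\<^bsub>A (sdeg ws - 4)\<^esub>"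
    and "length ws = r + 2 \<Longrightarrow> d (sdeg ws - 3) (P ws) \<oplus>\<^bsub>A (sdeg ws - 4)\<^esub> icomp A (- 1) (- 2) \<beta> (res (- 2) (r + 1) P) ws =
      dpre (- 2) P ws \<oplus>\<^bsub>A (sdeg ws - 4)\<^esub> icomp A (- 2) (- 1) (res (- 2) (r + 1) P) \<beta> ws"
proof -
  have mb: "mfam R A (- 1) b" and vb: "vanishes (- 1) (\<lambda>k. k = 0 \<or> k > r) b"
    and b1: "\<And>ws. ws \<in> words A \<Longrightarrow> length ws = 1 \<Longrightarrow> b ws = dfam ws"
    and b2: "\<And>ws. ws \<in> words A \<Longrightarrow> length ws = 2 \<Longrightarrow> b ws = \<beta> ws"
    and vP: "vanishes (- 2) (\<lambda>k. k \<le> r) P"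
    using b by (auto simp: partial_structure_def P_def)
  have mP: "mfam R A (- 2) P" unfolding P_def by (rule mfam_square[OF mb])
  define e where "e = sdeg ws - 4"
  let ?O = "res (- 2) (r + 1) P"
  have mO: "mfam R A (- 2) ?O" by (rule mfam_res[OF mP])
  have vO: "vanishes (- 2) (\<lambda>k. k \<noteq> r + 1) ?O" by (rule vanishes_res)
  have square: "icomp A (- 2) (- 1) P b ws = icomp A (- 1) (- 2) b P ws"
    using icomp_icomp[OF mb mb ws] unfolding P_def by simp
  have W: "u \<in> words A" "v \<in> words A" "w \<in> words A" "e = sdeg u + sdeg v + sdeg w + - 1 + - 2 - 1"
      "e = sdeg u + sdeg v + sdeg w + - 2 + - 1 - 1" "length u + length v + length w = length ws"
    if "u @ v @ w = ws" for u v w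
    using that[symmetric] ws by (auto simp: e_def)
  have Wd: "u @ (sdeg v + t - 1, f v) # w \<in> words A" if "u @ v @ w = ws" "mfam R A t f" for u v w f t
    using W[OF that(1)] mfam_closed[OF that(2), of v] by auto
  have tc1: "f (u @ (sdeg v + - 2 - 1, h v) # w) \<in> carrier (A e)"
    if "u @ v @ w = ws" "mfam R A (- 1) f" "mfam R A (- 2) h" for u v w f h
    using W[OF that(1)] by (intro icomp_term_closed[OF that(2,3)]) auto
  have tc2: "f (u @ (sdeg v + - 1 - 1, h v) # w) \<in> carrier (A e)"
    if "u @ v @ w = ws" "mfam R A (- 2) f" "mfam R A (- 1) h" for u v w f h
    using W[OF that(1)] by (intro icomp_term_closed[OF that(2,3)]) auto
  have left: "icomp A (- 1) (- 2) dfam P ws = d (sdeg ws - 3) (P ws)"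
    by (rule icomp_dfam_left[OF mP ws]) simp
  have right: "icomp A (- 2) (- 1) P dfam ws = dpre (- 2) P ws"
    by (rule icomp_dfam_right[OF mP ws])
  show "bdry (- 2) P ws = \<zero>\<^bsub>A (sdeg ws - 4)\<^esub>" if len: "length ws = r + 1"
  proof -
    have "icomp A (- 1) (- 2) b P ws = icomp A (- 1) (- 2) dfam P ws"
    proof (rule icomp_terms_cong)
      fix u v w assume uvw: "u @ v @ w = ws"
      note w = W[OF uvw]
      show "b (u @ (sdeg v + - 2 - 1, P v) # w) = dfam (u @ (sdeg v + - 2 - 1, P v) # w)"
      proof (cases "length v \<le> r")
        case True
        show ?thesis
          using term_zero_inner[OF mb vP w(1-3) True w(4)] term_zero_inner[OF mfam_dfam vP w(1-3) True w(4)] by simp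
      next
        case False
        hence "length u + length w + 1 = 1" using w(6) len by linarith
        thus ?thesis by (intro b1 Wd[OF uvw mP]) simp
      qed
    qed
    moreover have "icomp A (- 2) (- 1) P b ws = icomp A (- 2) (- 1) P dfam ws"
    proof (rule icomp_terms_cong)
      fix u v w assume uvw: "u @ v @ w = ws"
      note w = W[OF uvw]
      consider "length v = 0" | "length v = 1" | "length u + length w + 1 \<le> r" using w(6) len by linarith
      thus "P (u @ (sdeg v + - 1 - 1, b v) # w) = P (u @ (sdeg v + - 1 - 1, dfam v) # w)"
      proof cases
        case 1
        thus ?thesis
          using term_zero_inner[OF mP vb w(1-3) _ w(5)] term_zero_inner[OF mP vanishes_dfam w(1-3) _ w(5)] by simp
      next
        case 2
        thus ?thesis using b1[OF w(2)] by simp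
      next
        case 3
        show ?thesis
          using term_zero_outer[OF vP mb w(1-3) 3 w(5)] term_zero_outer[OF vP mfam_dfam w(1-3) 3 w(5)] by simp
      qed
    qed
    ultimately have "d (sdeg ws - 3) (P ws) = dpre (- 2) P ws" using square left right by simp
    thus ?thesis using bdry_eq_zero_iff[OF mP ws] by simp
  qed
  show "d (sdeg ws - 3) (P ws) \<oplus>\<^bsub>A (sdeg ws - 4)\<^esub> icomp A (- 1) (- 2) \<beta> ?O ws =
      dpre (- 2) P ws \<oplus>\<^bsub>A (sdeg ws - 4)\<^esub> icomp A (- 2) (- 1) ?O \<beta> ws" if len: "length ws = r + 2"
  proof -
    have "icomp A (- 1) (- 2) b P ws = icomp A (- 1) (- 2) dfam P ws \<oplus>\<^bsub>A e\<^esub> icomp A (- 1) (- 2) \<beta> ?O ws"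
    proof (rule icomp_terms_add[OF mfam_dfam mP \<beta>(1) mO ws])
      show "e = sdeg ws + - 1 + - 2 - 1" by (simp add: e_def)
      fix u v w assume uvw: "u @ v @ w = ws"
      note w = W[OF uvw]
      note zi = term_zero_inner[OF _ _ w(1-4)] and zo = term_zero_outer[OF _ _ w(1-3) _ w(4)]
      consider "length v \<le> r" | "length v = r + 1" "length u + length w + 1 = 2" | "length v = r + 2" "length u + length w + 1 = 1"
        using w(6) len by linarith
      thus "b (u @ (sdeg v + - 2 - 1, P v) # w) =
          dfam (u @ (sdeg v + - 2 - 1, P v) # w) \<oplus>\<^bsub>A e\<^esub> \<beta> (u @ (sdeg v + - 2 - 1, ?O v) # w)"
      proof cases
        case 1
        show ?thesis
          using term_zero_inner[OF mb vP w(1-3) 1 w(4)] term_zero_inner[OF mfam_dfam vP w(1-3) 1 w(4)]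
            term_zero_inner[OF \<beta>(1) vO w(1-3) _ w(4)] 1 by simp
      next
        case 2
        have "b (u @ (sdeg v + - 2 - 1, P v) # w) = \<beta> (u @ (sdeg v + - 2 - 1, P v) # w)"
          by (intro b2 Wd[OF uvw mP]) (use 2 in simp)
        moreover have "dfam (u @ (sdeg v + - 2 - 1, P v) # w) = \<zero>\<^bsub>A e\<^esub>"
          by (rule term_zero_outer[OF vanishes_dfam mP w(1-3) _ w(4)]) (use 2(2) in linarith)
        ultimately show ?thesis using 2 tc1[OF uvw \<beta>(1) mP] by simp
      next
        case 3
        have "b (u @ (sdeg v + - 2 - 1, P v) # w) = dfam (u @ (sdeg v + - 2 - 1, P v) # w)"
          by (intro b1 Wd[OF uvw mP]) (use 3 in simp)
        moreover have "\<beta> (u @ (sdeg v + - 2 - 1, ?O v) # w) = \<zero>\<^bsub>A e\<^esub>"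
          by (rule term_zero_outer[OF \<beta>(2) mO w(1-3) _ w(4)]) (use 3(2) in linarith)
        ultimately show ?thesis using tc1[OF uvw mfam_dfam mP] by simp
      qed
    qed
    moreover have "icomp A (- 2) (- 1) P b ws = icomp A (- 2) (- 1) P dfam ws \<oplus>\<^bsub>A e\<^esub> icomp A (- 2) (- 1) ?O \<beta> ws"
    proof (rule icomp_terms_add[OF mP mfam_dfam mO \<beta>(1) ws])
      show "e = sdeg ws + - 2 + - 1 - 1" by (simp add: e_def)
      fix u v w assume uvw: "u @ v @ w = ws"
      note w = W[OF uvw]
      consider "length v = 0" | "length v = 1" | "length v = 2" "length u + length w + 1 = r + 1"
        | "length v > 2" "length u + length w + 1 \<le> r" using w(6) len by linarith
      thus "P (u @ (sdeg v + - 1 - 1, b v) # w) =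
          P (u @ (sdeg v + - 1 - 1, dfam v) # w) \<oplus>\<^bsub>A e\<^esub> ?O (u @ (sdeg v + - 1 - 1, \<beta> v) # w)"
      proof cases
        case 1
        thus ?thesis
          using term_zero_inner[OF mP vb w(1-3) _ w(5)] term_zero_inner[OF mP vanishes_dfam w(1-3) _ w(5)]
            term_zero_inner[OF mO \<beta>(2) w(1-3) _ w(5)] by simp
      next
        case 2
        thus ?thesis
          using b1[OF w(2)] term_zero_inner[OF mO \<beta>(2) w(1-3) _ w(5)] tc2[OF uvw mP mfam_dfam] by simp
      next
        case 3
        thus ?thesis
          using b2[OF w(2)] term_zero_inner[OF mP vanishes_dfam w(1-3) _ w(5)] tc2[OF uvw mP \<beta>(1)] by simp
      next
        case 4
        thus ?thesis
          using term_zero_outer[OF vP mb w(1-3) 4(2) w(5)] term_zero_outer[OF vP mfam_dfam w(1-3) 4(2) w(5)]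
            term_zero_inner[OF mO \<beta>(2) w(1-3) _ w(5)] by simp
      qed
    qed
    ultimately show ?thesis using square left right by (simp add: e_def)
  qed
qed

end

context dg_retract
begin

lemma push_res_zero:
  assumes "length ws \<noteq> n"
  shows "push s (res s n \<phi>) ws = zero (H (sdeg ws + s - 1))"
  using assms by (simp add: push_def res_def prj_zero)

text \<open>If the obstruction induces a Hochschild coboundary on homology, adding a lift of a primitive of its negative to
  the operation of arity \<open>r\<close> makes it zero on homology. It is then a boundary, and a primitive of it is
  the operation of arity \<open>r + 1\<close>. Operations of arity less than \<open>r\<close> stay as they are.\<close>

theorem extend_structure:
  assumes b: "partial_structure \<beta> r b" and r: "r \<ge> 3"
    and \<beta>: "mfam R A (- 1) \<beta>" "vanishes (- 1) (\<lambda>k. k \<noteq> 2) \<beta>" "cyc (- 1) \<beta>"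
    and exact: "\<And>\<Phi>. mfam R H (- 2) \<Phi> \<Longrightarrow> H.vanishes (- 2) (\<lambda>k. k \<noteq> r + 1) \<Phi> \<Longrightarrow>
      (\<And>ws. ws \<in> words H \<Longrightarrow> length ws = r + 2 \<Longrightarrow>
        icomp H (- 1) (- 2) (push (- 1) \<beta>) \<Phi> ws = icomp H (- 2) (- 1) \<Phi> (push (- 1) \<beta>) ws) \<Longrightarrow>
      \<exists>\<gamma>. mfam R H (- 1) \<gamma> \<and> H.vanishes (- 1) (\<lambda>k. k \<noteq> r) \<gamma> \<and>
        (\<forall>ws\<in>words H. length ws = r + 1 \<longrightarrow> \<Phi> ws \<oplus>\<^bsub>H (sdeg ws - 3)\<^esub>
          (icomp H (- 1) (- 1) (push (- 1) \<beta>) \<gamma> ws \<oplus>\<^bsub>H (sdeg ws - 3)\<^esub>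
           icomp H (- 1) (- 1) \<gamma> (push (- 1) \<beta>) ws) = \<zero>\<^bsub>H (sdeg ws - 3)\<^esub>)"
  obtains b' where "partial_structure \<beta> (r + 1) b'" "\<And>ws. ws \<in> words A \<Longrightarrow> length ws < r \<Longrightarrow> b' ws = b ws"
proof -
  have mb: "mfam R A (- 1) b" and vb: "vanishes (- 1) (\<lambda>k. k = 0 \<or> k > r) b"
    and b1: "\<forall>ws\<in>words A. length ws = 1 \<longrightarrow> b ws = dfam ws"
    and b2: "\<forall>ws\<in>words A. length ws = 2 \<longrightarrow> b ws = \<beta> ws"
    and vP: "vanishes (- 2) (\<lambda>k. k \<le> r) (icomp A (- 1) (- 1) b b)"
    using b by (auto simp: partial_structure_def)
  have vb0: "vanishes (- 1) (\<lambda>k. k = 0) b" using vb by (auto simp: vanishes_def)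
  define P where "P = icomp A (- 1) (- 1) b b"
  have mP: "mfam R A (- 2) P" unfolding P_def by (rule mfam_square[OF mb])
  define O' where "O' = res (- 2) (r + 1) P"
  have mO: "mfam R A (- 2) O'" unfolding O'_def by (rule mfam_res[OF mP])
  have cO: "cyc (- 2) O'"
    unfolding O'_def by (rule cyc_res[OF mP]) (use obstruction(1)[OF b \<beta>(1,2)] in \<open>simp add: P_def\<close>)
  let ?\<mu> = "push (- 1) \<beta>"
  define \<Phi> where "\<Phi> = push (- 2) O'"
  have m\<mu>: "mfam R H (- 1) ?\<mu>" by (rule mfam_push[OF \<beta>(1)])
  have m\<Phi>: "mfam R H (- 2) \<Phi>" unfolding \<Phi>_def by (rule mfam_push[OF mO])
  have v\<Phi>: "H.vanishes (- 2) (\<lambda>k. k \<noteq> r + 1) \<Phi>"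
    unfolding H.vanishes_def \<Phi>_def O'_def using push_res_zero by blast
  have "icomp H (- 1) (- 2) ?\<mu> \<Phi> ws = icomp H (- 2) (- 1) \<Phi> ?\<mu> ws"
    if ws: "ws \<in> words H" "length ws = r + 2" for ws
  proof -
    define e where "e = sdeg ws - 4"
    let ?w = "wmap inc ws"
    have w: "?w \<in> words A" "?w \<in> cycle_words" "length ws = r + 2" "sdeg ?w = sdeg ws"
      using ws inc_words inc_cycle_words by auto
    have Pc: "P ?w \<in> carrier (A (sdeg ws - 3))" by (rule mfam_closed[OF mP w(1)]) simp
    have dc: "d (sdeg ws - 3) (P ?w) \<in> carrier (A e)" using Pc by (rule d_closed) (simp add: e_def)
    have L: "icomp A (- 1) (- 2) \<beta> O' ?w \<in> carrier (A e)"
      by (rule mfam_closed[OF mfam_icomp[OF \<beta>(1) mO] w(1)]) (simp add: e_def)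
    have Rr: "icomp A (- 2) (- 1) O' \<beta> ?w \<in> carrier (A e)"
      by (rule mfam_closed[OF mfam_icomp[OF mO \<beta>(1)] w(1)]) (simp add: e_def)
    have "dpre (- 2) P ?w = \<zero>\<^bsub>A e\<^esub>"
      by (rule dpre_cycle_words[OF mP w(2)]) (simp add: e_def)
    hence eq: "d (sdeg ws - 3) (P ?w) \<oplus>\<^bsub>A e\<^esub> icomp A (- 1) (- 2) \<beta> O' ?w = icomp A (- 2) (- 1) O' \<beta> ?w"
      using obstruction(2)[OF b \<beta>(1,2) w(1)] w Rr by (simp add: O'_def P_def e_def)
    have "prj e (d (sdeg ws - 3) (P ?w)) = \<zero>\<^bsub>H e\<^esub>" using prj_d[OF Pc] by (simp add: e_def)
    hence "prj e (icomp A (- 1) (- 2) \<beta> O' ?w) = prj e (icomp A (- 2) (- 1) O' \<beta> ?w)"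
      using mod_hom_add[OF prj dc L] prj_closed[OF L] unfolding eq by simp
    hence "push (- 1 + - 2) (icomp A (- 1) (- 2) \<beta> O') ws = push (- 2 + - 1) (icomp A (- 2) (- 1) O' \<beta>) ws"
      by (simp add: push_def e_def)
    thus ?thesis
      unfolding push_icomp[OF \<beta>(1,3) mO cO ws(1)] push_icomp[OF mO cO \<beta>(1,3) ws(1)] \<Phi>_def .
  qed
  from exact[OF m\<Phi> v\<Phi> this] obtain \<gamma> where \<gamma>: "mfam R H (- 1) \<gamma>" "H.vanishes (- 1) (\<lambda>k. k \<noteq> r) \<gamma>"
    "\<And>ws. ws \<in> words H \<Longrightarrow> length ws = r + 1 \<Longrightarrow> \<Phi> ws \<oplus>\<^bsub>H (sdeg ws - 3)\<^esub>
      (icomp H (- 1) (- 1) ?\<mu> \<gamma> ws \<oplus>\<^bsub>H (sdeg ws - 3)\<^esub> icomp H (- 1) (- 1) \<gamma> ?\<mu> ws) = \<zero>\<^bsub>H (sdeg ws - 3)\<^esub>"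
    by blast
  \<comment> \<open>As \<open>g\<close> is a cycle, adding it to \<open>b\<close> does not affect \<open>b \<circ> b\<close> in arity \<open>r\<close>.\<close>
  define g where "g = pull (- 1) \<gamma>"
  have mg: "mfam R A (- 1) g" unfolding g_def by (rule mfam_pull[OF \<gamma>(1)])
  have cg: "cyc (- 1) g" unfolding g_def by (rule cyc_pull[OF \<gamma>(1)])
  have vg: "vanishes (- 1) (\<lambda>k. k \<noteq> r) g"
    unfolding vanishes_def g_def pull_def
  proof (intro ballI impI)
    fix ws assume ws: "ws \<in> words A" "length ws \<noteq> r"
    have "\<gamma> (wmap prj ws) = \<zero>\<^bsub>H (sdeg ws + - 1 - 1)\<^esub>"
      by (rule H.vanishesD[OF \<gamma>(2) prj_words[OF ws(1)]]) (use ws in auto)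
    thus "inc (sdeg ws + - 1 - 1) (\<gamma> (wmap prj ws)) = \<zero>\<^bsub>A (sdeg ws + - 1 - 1)\<^esub>" by (simp only: inc_zero)
  qed
  have pg: "push (- 1) g ws = \<gamma> ws" if "ws \<in> words H" for ws
    unfolding g_def by (rule push_pull[OF \<gamma>(1) that])
  define c where "c = fam_add (- 1) b g"
  note pc = perturb[OF mb vb0 b1 \<beta>(1,2) b2 mg vg r, folded c_def]
  have mc: "mfam R A (- 1) c" unfolding c_def by (rule mfam_fam_add[OF mb mg])
  have cb: "c ws = b ws" if "ws \<in> words A" "length ws \<noteq> r" for ws
    unfolding c_def fam_add_def vanishesD[OF vg that refl] using mfam_closed[OF mb that(1) refl] by simp
  define Q where "Q = icomp A (- 1) (- 1) c c"
  have mQ: "mfam R A (- 2) Q" unfolding Q_def by (rule mfam_square[OF mc])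
  have pcs: "partial_structure \<beta> r c"
    unfolding partial_structure_def
  proof (intro conjI ballI impI mc)
    show "vanishes (- 1) (\<lambda>k. k = 0 \<or> k > r) c"
      unfolding vanishes_def using cb vanishesD[OF vb] r by auto
    show "c ws = dfam ws" if "ws \<in> words A" "length ws = 1" for ws using cb b1 that r by simp
    show "c ws = \<beta> ws" if "ws \<in> words A" "length ws = 2" for ws using cb b2 that r by simp
    show "vanishes (- 2) (\<lambda>k. k \<le> r) (icomp A (- 1) (- 1) c c)"
      unfolding vanishes_def
    proof (intro ballI impI)
      fix ws assume ws: "ws \<in> words A" "length ws \<le> r"
      have Pz: "icomp A (- 1) (- 1) b b ws = \<zero>\<^bsub>A (sdeg ws - 3)\<^esub>" by (rule vanishesD[OF vP ws]) simp
      have bz: "bdry (- 1) g ws = \<zero>\<^bsub>A (sdeg ws - 3)\<^esub>" using cg ws by (simp add: cyc_def)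
      show "icomp A (- 1) (- 1) c c ws = \<zero>\<^bsub>A (sdeg ws + - 2 - 1)\<^esub>"
        using pc(1)[OF ws(1) refl] pc(2)[OF ws(1) refl] ws(2) Pz bz by (cases "length ws = r") auto
    qed
  qed
  define O'' where "O'' = res (- 2) (r + 1) Q"
  have mO2: "mfam R A (- 2) O''" unfolding O''_def by (rule mfam_res[OF mQ])
  have "push (- 2) O'' ws = \<zero>\<^bsub>H (sdeg ws + - 2 - 1)\<^esub>" if ws: "ws \<in> words H" "length ws = r + 1" for ws
  proof -
    define e where "e = sdeg ws - 3"
    let ?w = "wmap inc ws"
    have w: "?w \<in> words A" using ws inc_words by auto
    have L: "icomp A (- 1) (- 1) \<beta> g ?w \<in> carrier (A e)"
      by (rule mfam_closed[OF mfam_icomp[OF \<beta>(1) mg] w]) (simp add: e_def)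
    have Rr: "icomp A (- 1) (- 1) g \<beta> ?w \<in> carrier (A e)"
      by (rule mfam_closed[OF mfam_icomp[OF mg \<beta>(1)] w]) (simp add: e_def)
    have Pc: "P ?w \<in> carrier (A e)" by (rule mfam_closed[OF mP w]) (simp add: e_def)
    have "Q ?w = P ?w \<oplus>\<^bsub>A e\<^esub> (icomp A (- 1) (- 1) \<beta> g ?w \<oplus>\<^bsub>A e\<^esub> icomp A (- 1) (- 1) g \<beta> ?w)"
      unfolding Q_def P_def using pc(3)[OF w refl] ws(2) by (simp add: e_def)
    hence "prj e (Q ?w) = prj e (P ?w) \<oplus>\<^bsub>H e\<^esub>
        (prj e (icomp A (- 1) (- 1) \<beta> g ?w) \<oplus>\<^bsub>H e\<^esub> prj e (icomp A (- 1) (- 1) g \<beta> ?w))"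
      using mod_hom_add[OF prj Pc V.M.a_closed[OF L Rr]] mod_hom_add[OF prj L Rr] by simp
    moreover have "prj e (P ?w) = \<Phi> ws" using ws by (simp add: \<Phi>_def O'_def push_def e_def)
    moreover have "prj e (icomp A (- 1) (- 1) \<beta> g ?w) = icomp H (- 1) (- 1) ?\<mu> \<gamma> ws"
    proof -
      have "prj e (icomp A (- 1) (- 1) \<beta> g ?w) = push (- 1 + - 1) (icomp A (- 1) (- 1) \<beta> g) ws"
        by (simp add: push_def e_def)
      also have "\<dots> = icomp H (- 1) (- 1) ?\<mu> (push (- 1) g) ws"
        by (rule push_icomp[OF \<beta>(1,3) mg cg ws(1)])
      also have "\<dots> = icomp H (- 1) (- 1) ?\<mu> \<gamma> ws"
        by (rule H.icomp_terms_cong) (use ws pg in auto)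
      finally show ?thesis .
    qed
    moreover have "prj e (icomp A (- 1) (- 1) g \<beta> ?w) = icomp H (- 1) (- 1) \<gamma> ?\<mu> ws"
    proof -
      have "prj e (icomp A (- 1) (- 1) g \<beta> ?w) = push (- 1 + - 1) (icomp A (- 1) (- 1) g \<beta>) ws"
        by (simp add: push_def e_def)
      also have "\<dots> = icomp H (- 1) (- 1) (push (- 1) g) ?\<mu> ws"
        by (rule push_icomp[OF mg cg \<beta>(1,3) ws(1)])
      also have "\<dots> = icomp H (- 1) (- 1) \<gamma> ?\<mu> ws"
      proof (rule H.icomp_terms_cong, rule pg)
        fix u v w assume "u @ v @ w = ws"
        thus "u @ (sdeg v + - 1 - 1, ?\<mu> v) # w \<in> words H"
          using ws mfam_closed[OF m\<mu>, of v] by auto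
      qed
      finally show ?thesis .
    qed
    ultimately have "prj e (Q ?w) = \<zero>\<^bsub>H e\<^esub>" using \<gamma>(3)[OF ws] by (simp add: e_def)
    thus ?thesis using ws by (simp add: push_def O''_def e_def)
  qed
  moreover have "bdry (- 2) O'' ws = \<zero>\<^bsub>A (sdeg ws + - 2 - 2)\<^esub>" if "ws \<in> words A" "length ws = r + 1" for ws
    using obstruction(1)[OF pcs \<beta>(1,2) that] bdry_res[OF that(2), of "- 2" Q] by (simp add: O''_def Q_def)
  ultimately obtain \<psi> where \<psi>: "mfam R A (- 2 + 1) \<psi>"
    "\<And>ws. ws \<in> words A \<Longrightarrow> length ws = r + 1 \<Longrightarrow> O'' ws = bdry (- 2 + 1) \<psi> ws"
    using push_zero_imp_bdry[OF mO2, of "r + 1"] by blast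
  have m\<psi>: "mfam R A (- 1) \<psi>" using \<psi>(1) by simp
  \<comment> \<open>The boundary of \<open>f\<close> is the negative of the obstruction.\<close>
  define f where "f = fam_neg (- 1) (res (- 1) (r + 1) \<psi>)"
  have mf: "mfam R A (- 1) f" unfolding f_def by (rule mfam_fam_neg[OF mfam_res[OF m\<psi>]])
  have vf: "vanishes (- 1) (\<lambda>k. k \<noteq> r + 1) f"
    by (simp add: vanishes_def f_def fam_neg_def res_def module_minus_zero[OF V.module_axioms])
  have mc0: "vanishes (- 1) (\<lambda>k. k = 0) c" and c1: "\<forall>ws\<in>words A. length ws = 1 \<longrightarrow> c ws = dfam ws"
    and c2: "\<forall>ws\<in>words A. length ws = 2 \<longrightarrow> c ws = \<beta> ws"
    and vc: "vanishes (- 1) (\<lambda>k. k = 0 \<or> k > r) c"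
    and vQ: "vanishes (- 2) (\<lambda>k. k \<le> r) Q"
    using pcs by (auto simp: partial_structure_def vanishes_def Q_def)
  define b' where "b' = fam_add (- 1) c f"
  have r1: "r + 1 \<ge> 3" using r by simp
  note pf = perturb[OF mc mc0 c1 \<beta>(1,2) c2 mf vf r1, folded b'_def]
  have b'c: "b' ws = c ws" if "ws \<in> words A" "length ws \<noteq> r + 1" for ws
    unfolding b'_def fam_add_def vanishesD[OF vf that refl] using mfam_closed[OF mc that(1) refl] by simp
  show ?thesis
  proof (rule that)
    show "b' ws = b ws" if "ws \<in> words A" "length ws < r" for ws using b'c cb that by simp
    show "partial_structure \<beta> (r + 1) b'"
      unfolding partial_structure_def
    proof (intro conjI ballI impI)
      show "mfam R A (- 1) b'" unfolding b'_def by (rule mfam_fam_add[OF mc mf])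
      show "vanishes (- 1) (\<lambda>k. k = 0 \<or> k > r + 1) b'"
        unfolding vanishes_def
      proof (intro ballI impI)
        fix ws assume ws: "ws \<in> words A" "length ws = 0 \<or> length ws > r + 1"
        show "b' ws = \<zero>\<^bsub>A (sdeg ws + - 1 - 1)\<^esub>"
          using b'c[OF ws(1)] vanishesD[OF vc ws(1) _ refl] ws(2) by auto
      qed
      show "b' ws = dfam ws" if "ws \<in> words A" "length ws = 1" for ws using b'c c1 that r by simp
      show "b' ws = \<beta> ws" if "ws \<in> words A" "length ws = 2" for ws using b'c c2 that r by simp
      show "vanishes (- 2) (\<lambda>k. k \<le> r + 1) (icomp A (- 1) (- 1) b' b')"
        unfolding vanishes_def
      proof (intro ballI impI)
        fix ws assume ws: "ws \<in> words A" "length ws \<le> r + 1"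
        define e where "e = sdeg ws - 3"
        have "icomp A (- 1) (- 1) b' b' ws = \<zero>\<^bsub>A e\<^esub>"
        proof (cases "length ws = r + 1")
          case False
          hence "icomp A (- 1) (- 1) b' b' ws = Q ws" unfolding Q_def using pf(1)[OF ws(1) e_def] ws(2) by auto
          also have "\<dots> = \<zero>\<^bsub>A e\<^esub>" by (rule vanishesD[OF vQ ws(1)]) (use ws False in \<open>auto simp: e_def\<close>)
          finally show ?thesis .
        next
          case True
          have bc: "bdry (- 1) \<psi> ws \<in> carrier (A e)" by (rule bdry_closed[OF m\<psi> ws(1)]) (simp add: e_def)
          have "bdry (- 1) f ws = \<ominus>\<^bsub>A e\<^esub> bdry (- 1) \<psi> ws"
            unfolding f_def using bdry_fam_neg[OF mfam_res[OF m\<psi>] ws(1), of e "r + 1"] bdry_res[OF True]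
            by (simp add: e_def)
          moreover have "Q ws = bdry (- 1) \<psi> ws" using \<psi>(2)[OF ws(1) True] True by (simp add: O''_def)
          moreover have "icomp A (- 1) (- 1) b' b' ws = Q ws \<oplus>\<^bsub>A e\<^esub> bdry (- 1) f ws"
            unfolding Q_def using pf(2)[OF ws(1) e_def] True by simp
          ultimately show ?thesis using bc by (simp add: V.M.r_neg)
        qed
        thus "icomp A (- 1) (- 1) b' b' ws = \<zero>\<^bsub>A (sdeg ws + - 2 - 1)\<^esub>" by (simp add: e_def)
      qed
    qed
  qed
qed

end

context dg_mod
begin

text \<open>The operation of arity \<open>r\<close> is changed once more when that of arity \<open>r + 1\<close> is constructed,
  and never after that. So the sequence of partial structures is eventually constant on each word.\<close>

theorem limit_structure:
  assumes b0: "partial_structure \<beta> 3 b0"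
    and step: "\<And>r b. r \<ge> 3 \<Longrightarrow> partial_structure \<beta> r b \<Longrightarrow>
      \<exists>b'. partial_structure \<beta> (r + 1) b' \<and> (\<forall>ws\<in>words A. length ws < r \<longrightarrow> b' ws = b ws)"
  obtains b where "mfam R A (- 1) b" "vanishes (- 1) (\<lambda>k. k = 0) b"
    "\<And>ws. ws \<in> words A \<Longrightarrow> length ws = 1 \<Longrightarrow> b ws = dfam ws"
    "\<And>ws. ws \<in> words A \<Longrightarrow> length ws = 2 \<Longrightarrow> b ws = \<beta> ws"
    "\<And>ws. ws \<in> words A \<Longrightarrow> icomp A (- 1) (- 1) b b ws = \<zero>\<^bsub>A (sdeg ws - 3)\<^esub>"
proof -
  have "\<exists>f. \<forall>n. partial_structure \<beta> (n + 3) (f n) \<and>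
      (\<forall>ws\<in>words A. length ws < n + 3 \<longrightarrow> f (Suc n) ws = f n ws)"
  proof (rule dependent_nat_choice)
    show "\<exists>b. partial_structure \<beta> (0 + 3) b" using b0 by auto
    show "\<exists>b'. partial_structure \<beta> (Suc n + 3) b' \<and> (\<forall>ws\<in>words A. length ws < n + 3 \<longrightarrow> b' ws = b ws)"
      if "partial_structure \<beta> (n + 3) b" for b n
      using step[OF _ that] by (simp add: eval_nat_numeral)
  qed
  then obtain f where f: "\<And>n. partial_structure \<beta> (n + 3) (f n)"
    "\<And>n ws. ws \<in> words A \<Longrightarrow> length ws < n + 3 \<Longrightarrow> f (Suc n) ws = f n ws" by blast
  define b where "b = (\<lambda>ws. f (length ws) ws)"
  have stable: "f (length ws + k) ws = f (length ws) ws" if "ws \<in> words A" for ws k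
    by (induct k) (use f(2)[OF that] in auto)
  have bf: "b ws = f n ws" if "ws \<in> words A" "length ws \<le> n" for ws n
    using stable[OF that(1), of "n - length ws"] that(2) by (simp add: b_def)
  have mf: "mfam R A (- 1) (f n)" for n using f(1) by (simp add: partial_structure_def)
  have mb: "mfam R A (- 1) b"
  proof (rule mfamI)
    show "b ws \<in> carrier (A (sdeg ws + - 1 - 1))" if "ws \<in> words A" for ws
      unfolding b_def by (rule mfam_closed[OF mf that refl])
    fix us i x ws assume w: "us \<in> words A" "ws \<in> words A" "x \<in> carrier (A i)"
    have l: "b (us @ (i, z) # ws) = f (length us + length ws + 1) (us @ (i, z) # ws)" for z by (simp add: b_def)
    show "b (us @ (i, x \<oplus>\<^bsub>A i\<^esub> y) # ws) = b (us @ (i, x) # ws) \<oplus>\<^bsub>A (sdeg us + i + sdeg ws + - 1)\<^esub> b (us @ (i, y) # ws)"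
      if "y \<in> carrier (A i)" for y
      unfolding l by (rule mfam_add[OF mf w that refl])
    show "b (us @ (i, a \<odot>\<^bsub>A i\<^esub> x) # ws) = a \<odot>\<^bsub>A (sdeg us + i + sdeg ws + - 1)\<^esub> b (us @ (i, x) # ws)"
      if "a \<in> carrier R" for a
      unfolding l by (rule mfam_smult[OF mf w that refl])
  qed
  show ?thesis
  proof (rule that[OF mb])
    show "vanishes (- 1) (\<lambda>k. k = 0) b"
      using f(1)[of 0] by (simp add: vanishes_def partial_structure_def b_def)
    show "b ws = dfam ws" if "ws \<in> words A" "length ws = 1" for ws
      using f(1)[of "length ws"] that by (simp add: partial_structure_def b_def)
    show "b ws = \<beta> ws" if "ws \<in> words A" "length ws = 2" for ws
      using f(1)[of "length ws"] that by (simp add: partial_structure_def b_def)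
    fix ws assume ws: "ws \<in> words A"
    \<comment> \<open>If \<open>v\<close> is empty, the word to which the outer operation is applied is longer than \<open>ws\<close> by one letter.\<close>
    let ?n = "length ws + 1"
    have "icomp A (- 1) (- 1) b b ws = icomp A (- 1) (- 1) (f ?n) (f ?n) ws"
    proof (rule icomp_terms_cong)
      fix u v w assume uvw: "u @ v @ w = ws"
      have W: "u \<in> words A" "v \<in> words A" "w \<in> words A" using uvw ws by auto
      have "b v = f ?n v" using uvw W by (intro bf) auto
      moreover have "b (u @ (sdeg v + - 1 - 1, f ?n v) # w) = f ?n (u @ (sdeg v + - 1 - 1, f ?n v) # w)"
        using uvw W mfam_closed[OF mf W(2), of _ ?n] by (intro bf) auto
      ultimately show "b (u @ (sdeg v + - 1 - 1, b v) # w) = f ?n (u @ (sdeg v + - 1 - 1, f ?n v) # w)" by simp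
    qed
    also have "\<dots> = \<zero>\<^bsub>A (sdeg ws - 3)\<^esub>"
      using f(1)[of ?n] ws by (simp add: partial_structure_def vanishes_def)
    finally show "icomp A (- 1) (- 1) b b ws = \<zero>\<^bsub>A (sdeg ws - 3)\<^esub>" .
  qed
qed

end

section \<open>The given data as multilinear families\<close>

context graded_mod
begin

lemma vanishes_twist: "vanishes s (\<lambda>k. k \<noteq> n) (twist R V n s f)"
  by (simp add: vanishes_def twist_length)

text \<open>The product has weight 1, and the weight of \<open>f\<close> is \<open>s\<close> up to an even number; this is the sign in the bracket.\<close>

lemma twist_hochschild:
  assumes \<mu>: "\<mu> \<in> carrier (gEnd R V 2 0)" and f: "f \<in> carrier (gEnd R V n i)" and i: "i = int n - 1 + s"
    and n: "n \<ge> 1" and ws: "ws \<in> words V" and e: "e = sdeg ws + s - 2"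
  shows "hochschild_diff R V \<mu> n i f \<in> carrier (gEnd R V (n + 1) i)"
    and "twist R V (n + 1) (s - 1) (hochschild_diff R V \<mu> n i f) ws =
      icomp V (- 1) s (twist R V 2 (- 1) \<mu>) (twist R V n s f) ws \<ominus>\<^bsub>V e\<^esub>
      signed (V e) s (icomp V s (- 1) (twist R V n s f) (twist R V 2 (- 1) \<mu>) ws)"
proof -
  interpret E: plain_module R "gEnd R V (n + 1) i" by (rule plain_module.intro[OF gEnd_module])
  let ?c1 = "circ R V 2 0 \<mu> n i f"
  let ?c2 = "circ R V n i f 2 0 \<mu>"
  have a: "2 + n - 1 = n + 1" "n + 2 - 1 = n + 1" "0 + i = i" "i + 0 = i" using n by auto
  have c1: "?c1 \<in> carrier (gEnd R V (n + 1) i)" using circ_closed[OF \<mu> f] unfolding a .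
  have c2: "?c2 \<in> carrier (gEnd R V (n + 1) i)" using circ_closed[OF f \<mu>] unfolding a .
  have h: "hochschild_diff R V \<mu> n i f = ?c1 \<ominus>\<^bsub>gEnd R V (n + 1) i\<^esub> signed (gEnd R V (n + 1) i) (weight 2 0 * weight n i) ?c2"
    unfolding hochschild_diff_def bracket_def a ..
  show "hochschild_diff R V \<mu> n i f \<in> carrier (gEnd R V (n + 1) i)"
    unfolding h by (intro E.M.minus_closed E.signed_closed c1 c2)
  have i': "i = int (n + 1) - 1 + (s - 1)" using i by simp
  have z: "0 = int 2 - 1 + - 1" by simp
  have ei: "sdeg ws + (s - 1) - 1 = e" using e by simp
  have t1: "twist R V (n + 1) (s - 1) ?c1 ws = icomp V (- 1) s (twist R V 2 (- 1) \<mu>) (twist R V n s f) ws"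
    using twist_circ[OF _ \<mu> f z i ws] by (simp add: a)
  have t2: "twist R V (n + 1) (s - 1) ?c2 ws = icomp V s (- 1) (twist R V n s f) (twist R V 2 (- 1) \<mu>) ws"
    using twist_circ[OF n f \<mu> i z ws] by (simp add: a)
  have ev: "signed (V e) (weight 2 0 * weight n i) x = signed (V e) s x" for x
    by (rule signed_cong) (simp add: weight_def i)
  show "twist R V (n + 1) (s - 1) (hochschild_diff R V \<mu> n i f) ws =
      icomp V (- 1) s (twist R V 2 (- 1) \<mu>) (twist R V n s f) ws \<ominus>\<^bsub>V e\<^esub>
      signed (V e) s (icomp V s (- 1) (twist R V n s f) (twist R V 2 (- 1) \<mu>) ws)"
    unfolding h twist_minus[OF c1 E.signed_closed[OF c2] i' ws] twist_signed[OF c2 i' ws] ei t1 t2 ev ..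
qed

text \<open>As \<open>\<Phi>\<close> is the twist of a cocycle and the cohomology is zero, it is the twist of a coboundary. The family \<open>\<gamma>\<close> is
  the twist of the negative of a primitive, so that its coboundary cancels \<open>\<Phi>\<close>.\<close>

lemma HH_zero_exact:
  assumes \<mu>: "\<mu> \<in> carrier (gEnd R V 2 0)" and r: "r \<ge> 3" and HH: "zero_module (HH R V \<mu> (r + 1) (int r - 2))"
    and m: "\<And>ws. ws \<in> words V \<Longrightarrow> twist R V 2 (- 1) \<mu> ws = m ws" and mm: "mfam R V (- 1) m"
    and \<Phi>: "mfam R V (- 2) \<Phi>" "vanishes (- 2) (\<lambda>k. k \<noteq> r + 1) \<Phi>"
    and cocycle: "\<And>ws. ws \<in> words V \<Longrightarrow> length ws = r + 2 \<Longrightarrow>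
      icomp V (- 1) (- 2) m \<Phi> ws = icomp V (- 2) (- 1) \<Phi> m ws"
  shows "\<exists>\<gamma>. mfam R V (- 1) \<gamma> \<and> vanishes (- 1) (\<lambda>k. k \<noteq> r) \<gamma> \<and>
        (\<forall>ws\<in>words V. length ws = r + 1 \<longrightarrow> \<Phi> ws \<oplus>\<^bsub>V (sdeg ws - 3)\<^esub>
          (icomp V (- 1) (- 1) m \<gamma> ws \<oplus>\<^bsub>V (sdeg ws - 3)\<^esub> icomp V (- 1) (- 1) \<gamma> m ws) = \<zero>\<^bsub>V (sdeg ws - 3)\<^esub>)"
proof -
  let ?i = "int r - 2"
  let ?h = "hochschild_diff R V \<mu>"
  let ?m = "twist R V 2 (- 1) \<mu>"
  have i1: "?i = int (r + 1) - 1 + - 2" "?i = int r - 1 + - 1" "?i = int (r + 2) - 1 + - 3" by auto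
  have m\<mu>: "mfam R V (- 1) ?m" by (rule mfam_twist) (use \<mu> in simp)
  obtain F where F: "F \<in> carrier (gEnd R V (r + 1) ?i)"
    "\<And>ws. ws \<in> words V \<Longrightarrow> length ws = r + 1 \<Longrightarrow> twist R V (r + 1) (- 2) F ws = \<Phi> ws"
    using twist_surj[OF \<Phi>(1), of "r + 1"] unfolding i1(1)[symmetric] by blast
  have tF: "twist R V (r + 1) (- 2) F ws = \<Phi> ws" if "ws \<in> words V" for ws
    using F(2)[OF that] twist_length[of ws "r + 1" "- 2" F] vanishesD[OF \<Phi>(2) that _ refl] by (cases "length ws = r + 1") auto
  have cong1: "icomp V (- 1) t ?m \<psi> ws = icomp V (- 1) t m \<psi>' ws"
    if ws: "ws \<in> words V" and \<psi>: "mfam R V t \<psi>'" "\<And>v. v \<in> words V \<Longrightarrow> \<psi> v = \<psi>' v" for ws t \<psi> \<psi>'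
  proof (rule icomp_terms_cong)
    fix u v w assume uvw: "u @ v @ w = ws"
    hence W: "u \<in> words V" "v \<in> words V" "w \<in> words V" using ws by auto
    have "u @ (sdeg v + t - 1, \<psi>' v) # w \<in> words V" using W mfam_closed[OF \<psi>(1) W(2) refl] by simp
    thus "?m (u @ (sdeg v + t - 1, \<psi> v) # w) = m (u @ (sdeg v + t - 1, \<psi>' v) # w)"
      using m \<psi>(2)[OF W(2)] by simp
  qed
  have cong2: "icomp V t (- 1) \<psi> ?m ws = icomp V t (- 1) \<psi>' m ws"
    if ws: "ws \<in> words V" and \<psi>: "\<And>v. v \<in> words V \<Longrightarrow> \<psi> v = \<psi>' v" for ws t \<psi> \<psi>'
  proof (rule icomp_terms_cong)
    fix u v w assume uvw: "u @ v @ w = ws"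
    hence W: "u \<in> words V" "v \<in> words V" "w \<in> words V" using ws by auto
    have "u @ (sdeg v + - 1 - 1, m v) # w \<in> words V" using W mfam_closed[OF mm W(2) refl] by simp
    thus "\<psi> (u @ (sdeg v + - 1 - 1, ?m v) # w) = \<psi>' (u @ (sdeg v + - 1 - 1, m v) # w)"
      using m[OF W(2)] \<psi> by simp
  qed
  have hF: "?h (r + 1) ?i F \<in> carrier (gEnd R V (r + 2) ?i)"
    using twist_hochschild(1)[OF \<mu> F(1) i1(1) _ words_simps(1)] by simp
  interpret E2: module R "gEnd R V (r + 2) ?i" by (rule gEnd_module)
  have "?h (r + 1) ?i F = \<zero>\<^bsub>gEnd R V (r + 2) ?i\<^esub>"
  proof (rule twist_inj[where s = "- 3"])
    show "?h (r + 1) ?i F \<in> carrier (gEnd R V (r + 2) (int (r + 2) - 1 + - 3))" using hF by simp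
    show "\<zero>\<^bsub>gEnd R V (r + 2) ?i\<^esub> \<in> carrier (gEnd R V (r + 2) (int (r + 2) - 1 + - 3))"
      using E2.M.zero_closed by simp
    fix ws assume ws: "ws \<in> words V" "length ws = r + 2"
    define e where "e = sdeg ws - 4"
    have e: "e = sdeg ws + - 2 - 2" by (simp add: e_def)
    have c: "icomp V (- 2) (- 1) \<Phi> m ws \<in> carrier (V e)"
      by (rule mfam_closed[OF mfam_icomp[OF \<Phi>(1) mm] ws(1)]) (simp add: e_def)
    have x1: "icomp V (- 1) (- 2) ?m (twist R V (r + 1) (- 2) F) ws = icomp V (- 1) (- 2) m \<Phi> ws"
      by (rule cong1[OF ws(1) \<Phi>(1)]) (rule tF)
    have x2: "icomp V (- 2) (- 1) (twist R V (r + 1) (- 2) F) ?m ws = icomp V (- 2) (- 1) \<Phi> m ws"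
      by (rule cong2[OF ws(1)]) (rule tF)
    have "twist R V (r + 2) (- 3) (?h (r + 1) ?i F) ws =
        icomp V (- 1) (- 2) ?m (twist R V (r + 1) (- 2) F) ws \<ominus>\<^bsub>V e\<^esub> icomp V (- 2) (- 1) (twist R V (r + 1) (- 2) F) ?m ws"
      using twist_hochschild(2)[OF \<mu> F(1) i1(1) _ ws(1) e] by simp
    also have "\<dots> = icomp V (- 1) (- 2) m \<Phi> ws \<ominus>\<^bsub>V e\<^esub> icomp V (- 2) (- 1) \<Phi> m ws"
      unfolding x1 x2 ..
    also have "\<dots> = \<zero>\<^bsub>V e\<^esub>" unfolding cocycle[OF ws] using c by (simp add: V.minus_eq_zero_iff)
    also have "\<dots> = twist R V (r + 2) (- 3) (\<zero>\<^bsub>gEnd R V (r + 2) ?i\<^esub>) ws"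
      using twist_zero[OF ws(1) i1(3)] by (simp add: e_def)
    finally show "twist R V (r + 2) (- 3) (?h (r + 1) ?i F) ws = twist R V (r + 2) (- 3) (\<zero>\<^bsub>gEnd R V (r + 2) ?i\<^esub>) ws" .
  qed
  moreover have r2: "r + 1 + 1 = r + 2" by simp
  ultimately have FK: "F \<in> carrier (ker_module (gEnd R V (r + 1) ?i) (gEnd R V (r + 1 + 1) ?i) (?h (r + 1) ?i))"
    (is "_ \<in> carrier ?K") unfolding r2 using F(1) by (simp add: ker_module_def)
  interpret E0: module R "gEnd R V r ?i" by (rule gEnd_module)
  interpret E1: module R "gEnd R V (r + 1) ?i" by (rule gEnd_module)
  let ?N = "?h r ?i ` carrier (gEnd R V r ?i)"
  have r1: "1 \<le> r" using r by simp
  have h0: "?h r ?i \<zero>\<^bsub>gEnd R V r ?i\<^esub> = \<zero>\<^bsub>gEnd R V (r + 1) ?i\<^esub>"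
  proof (rule twist_inj[where s = "- 2"])
    have "?h r ?i \<zero>\<^bsub>gEnd R V r ?i\<^esub> \<in> carrier (gEnd R V (r + 1) ?i)"
      by (rule twist_hochschild(1)[OF \<mu> E0.M.zero_closed i1(2) r1 words_simps(1) refl])
    thus "?h r ?i \<zero>\<^bsub>gEnd R V r ?i\<^esub> \<in> carrier (gEnd R V (r + 1) (int (r + 1) - 1 + - 2))"
      "\<zero>\<^bsub>gEnd R V (r + 1) ?i\<^esub> \<in> carrier (gEnd R V (r + 1) (int (r + 1) - 1 + - 2))"
      using E1.M.zero_closed by simp_all
    fix ws assume ws: "ws \<in> words V"
    define e where "e = sdeg ws - 3"
    have e: "e = sdeg ws + - 1 - 2" by (simp add: e_def)
    let ?z = "twist R V r (- 1) \<zero>\<^bsub>gEnd R V r ?i\<^esub>"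
    have mz: "mfam R V (- 1) ?z" by (rule mfam_twist) (use E0.M.zero_closed in simp)
    have vz: "vanishes (- 1) (\<lambda>_. True) ?z" unfolding vanishes_def using twist_zero[OF _ i1(2)] by blast
    have W: "u \<in> words V" "v \<in> words V" "w \<in> words V" "e = sdeg u + sdeg v + sdeg w + - 1 + - 1 - 1"
      if "u @ v @ w = ws" for u v w using that ws by (auto simp: e_def)
    have "icomp V (- 1) (- 1) ?m ?z ws = \<zero>\<^bsub>V e\<^esub>"
      by (rule icomp_terms_zero) (simp add: e_def, rule term_zero_inner[OF m\<mu> vz W(1-3) TrueI W(4)], assumption+)
    moreover have "icomp V (- 1) (- 1) ?z ?m ws = \<zero>\<^bsub>V e\<^esub>"
      by (rule icomp_terms_zero) (simp add: e_def, rule term_zero_outer[OF vz m\<mu> W(1-3) TrueI W(4)], assumption+)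
    ultimately have "twist R V (r + 1) (- 2) (?h r ?i \<zero>\<^bsub>gEnd R V r ?i\<^esub>) ws = \<zero>\<^bsub>V e\<^esub>"
      using twist_hochschild(2)[OF \<mu> E0.M.zero_closed i1(2) r1 ws e]
      by (simp add: a_minus_def module_minus_zero[OF V.module_axioms])
    thus "twist R V (r + 1) (- 2) (?h r ?i \<zero>\<^bsub>gEnd R V r ?i\<^esub>) ws = twist R V (r + 1) (- 2) \<zero>\<^bsub>gEnd R V (r + 1) ?i\<^esub> ws"
      using twist_zero[OF ws i1(1)] by (simp add: e_def)
  qed
  \<comment> \<open>In the zero module the coset of \<open>F\<close> is the image \<open>?N\<close> itself, which contains zero. So \<open>F\<close> lies in \<open>?N\<close>.\<close>
  have "F \<in> ?N"
  proof -
    have rr: "(if r + 1 = 0 then {\<zero>\<^bsub>gEnd R V 0 ?i\<^esub>} else ?h (r + 1 - 1) ?i ` carrier (gEnd R V (r + 1 - 1) ?i)) = ?N"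
      by simp
    have "?N +>\<^bsub>?K\<^esub> F \<in> a_rcosets\<^bsub>?K\<^esub> ?N" using FK by (auto simp: A_RCOSETS_def')
    hence "?N +>\<^bsub>?K\<^esub> F = ?N"
      using HH unfolding zero_module_def HH_def rr by (simp add: quot_module_def)
    moreover have "add ?K \<zero>\<^bsub>gEnd R V (r + 1) ?i\<^esub> F = F"
      using E1.M.l_zero[OF F(1)] by (simp add: ker_module_def)
    moreover have "\<zero>\<^bsub>gEnd R V (r + 1) ?i\<^esub> \<in> ?N" using h0 E0.M.zero_closed by (metis image_eqI)
    ultimately show ?thesis unfolding a_r_coset_def' by blast
  qed
  then obtain g where g: "g \<in> carrier (gEnd R V r ?i)" "F = ?h r ?i g" by blast
  define \<gamma>0 where "\<gamma>0 = twist R V r (- 1) g"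
  define \<gamma> where "\<gamma> = twist R V r (- 1) (signed (gEnd R V r ?i) 1 g)"
  have m0: "mfam R V (- 1) \<gamma>0" unfolding \<gamma>0_def by (rule mfam_twist) (use g in simp)
  interpret E0': plain_module R "gEnd R V r ?i" by (rule plain_module.intro[OF gEnd_module])
  have m1: "mfam R V (- 1) \<gamma>" unfolding \<gamma>_def by (rule mfam_twist) (use g in simp)
  have neg: "\<gamma> ws = \<ominus>\<^bsub>V (sdeg ws + - 1 - 1)\<^esub> \<gamma>0 ws" if "ws \<in> words V" for ws
    unfolding \<gamma>_def \<gamma>0_def using twist_signed[OF g(1) i1(2) that, of 1] by simp
  show ?thesis
  proof (intro exI[of _ \<gamma>] conjI ballI impI)
    show "mfam R V (- 1) \<gamma>" by (rule m1)
    show "vanishes (- 1) (\<lambda>k. k \<noteq> r) \<gamma>" unfolding \<gamma>_def by (rule vanishes_twist)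
    fix ws assume ws: "ws \<in> words V" "length ws = r + 1"
    define e where "e = sdeg ws - 3"
    have e: "e = sdeg ws + - 1 - 2" and e': "e = sdeg ws + - 1 + - 1 - 1" by (simp_all add: e_def)
    have W: "u \<in> words V" "v \<in> words V" "w \<in> words V" "e = sdeg u + (sdeg v + - 1 - 1) + sdeg w + - 1"
      if "u @ v @ w = ws" for u v w using that ws by (auto simp: e_def)
    have x1: "icomp V (- 1) (- 1) ?m \<gamma>0 ws = icomp V (- 1) (- 1) m \<gamma>0 ws"
      by (rule cong1[OF ws(1) m0]) (rule refl)
    have x2: "icomp V (- 1) (- 1) \<gamma>0 ?m ws = icomp V (- 1) (- 1) \<gamma>0 m ws"
      by (rule cong2[OF ws(1)]) (rule refl)
    have "\<Phi> ws = icomp V (- 1) (- 1) ?m \<gamma>0 ws \<ominus>\<^bsub>V e\<^esub> signed (V e) (- 1) (icomp V (- 1) (- 1) \<gamma>0 ?m ws)"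
      using twist_hochschild(2)[OF \<mu> g(1) i1(2) r1 ws(1) e] tF[OF ws(1)] g(2) by (simp add: \<gamma>0_def)
    also have "\<dots> = icomp V (- 1) (- 1) m \<gamma>0 ws \<ominus>\<^bsub>V e\<^esub> signed (V e) (- 1) (icomp V (- 1) (- 1) \<gamma>0 m ws)"
      unfolding x1 x2 ..
    finally have eq: "\<Phi> ws = icomp V (- 1) (- 1) m \<gamma>0 ws \<oplus>\<^bsub>V e\<^esub> icomp V (- 1) (- 1) \<gamma>0 m ws"
      using mfam_closed[OF mfam_icomp[OF m0 mm] ws(1), of e] by (simp add: a_minus_def e_def)
    have n1: "icomp V (- 1) (- 1) m \<gamma> ws = \<ominus>\<^bsub>V e\<^esub> icomp V (- 1) (- 1) m \<gamma>0 ws"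
    proof (rule icomp_terms_neg[OF mm m0 mm m1 ws(1) e'])
      fix u v w assume uvw: "u @ v @ w = ws"
      note w = W[OF uvw]
      have c: "\<gamma>0 v \<in> carrier (V (sdeg v + - 1 - 1))" by (rule mfam_closed[OF m0 w(2) refl])
      show "m (u @ (sdeg v + - 1 - 1, \<gamma> v) # w) = \<ominus>\<^bsub>V e\<^esub> m (u @ (sdeg v + - 1 - 1, \<gamma>0 v) # w)"
        using mfam_signed[OF mm w(1,3) c w(4), of 1] neg[OF w(2)] by simp
    qed
    have n2: "icomp V (- 1) (- 1) \<gamma> m ws = \<ominus>\<^bsub>V e\<^esub> icomp V (- 1) (- 1) \<gamma>0 m ws"
    proof (rule icomp_terms_neg[OF m0 mm m1 mm ws(1) e'])
      fix u v w assume uvw: "u @ v @ w = ws"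
      note w = W[OF uvw]
      have x: "u @ (sdeg v + - 1 - 1, m v) # w \<in> words V" using w mfam_closed[OF mm w(2) refl] by simp
      have "sdeg (u @ (sdeg v + - 1 - 1, m v) # w) + - 1 - 1 = e" using w(4) by simp
      thus "\<gamma> (u @ (sdeg v + - 1 - 1, m v) # w) = \<ominus>\<^bsub>V e\<^esub> \<gamma>0 (u @ (sdeg v + - 1 - 1, m v) # w)"
        using neg[OF x] by (simp only:)
    qed
    have c: "icomp V (- 1) (- 1) m \<gamma>0 ws \<in> carrier (V e)" "icomp V (- 1) (- 1) \<gamma>0 m ws \<in> carrier (V e)"
      by (rule mfam_closed[OF mfam_icomp[OF mm m0] ws(1)] mfam_closed[OF mfam_icomp[OF m0 mm] ws(1)], simp add: e_def)+
    show "\<Phi> ws \<oplus>\<^bsub>V (sdeg ws - 3)\<^esub> (icomp V (- 1) (- 1) m \<gamma> ws \<oplus>\<^bsub>V (sdeg ws - 3)\<^esub>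
        icomp V (- 1) (- 1) \<gamma> m ws) = \<zero>\<^bsub>V (sdeg ws - 3)\<^esub>"
      unfolding e_def[symmetric] eq n1 n2 using c by (simp add: V.M.minus_add[symmetric] V.M.r_neg)
  qed
qed

end

context dg_mod
begin

lemma unary_op_spec:
  shows "unary_op R A d \<in> carrier (gEnd R A 1 (- 1))"
    and "ws \<in> words A \<Longrightarrow> twist R A 1 (- 1) (unary_op R A d) ws = dfam ws"
proof -
  have m: "mlin R A 1 A (- 1) (letter d)" by (rule mlin_letter) (rule d_hom, simp)
  have eq: "d (hd is) (hd xs) = letter d (zip is xs)" if "length is = 1" "length xs = 1" for "is" and xs :: "'a list"
    using that by (cases "is"; cases xs) (auto simp: letter_def)
  have s1: "unary_op R A d \<in> carrier (gHom R (tensor_power R A 1) A (- 1))"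
    unfolding unary_op_def by (rule tensor_lift_spec(1)[OF graded graded m]) (rule eq)
  have s2: "unary_op R A d (wdeg ws) (etens R A ws) = letter d ws" if "ws \<in> words A" "length ws = 1" for ws
    unfolding unary_op_def by (rule tensor_lift_spec(2)[OF graded graded m _ that]) (rule eq)
  show "unary_op R A d \<in> carrier (gEnd R A 1 (- 1))" unfolding gEnd_def by (rule s1)
  show "twist R A 1 (- 1) (unary_op R A d) ws = dfam ws" if "ws \<in> words A"
  proof (cases "length ws = 1")
    case True
    hence "eps (map fst ws) = 0" by (cases ws) auto
    thus ?thesis using True s2[OF that True] by (simp add: twist_def dfam_def letter_def)
  qed (simp add: twist_def dfam_def)
qed

lemma tensor_diff_spec:
  assumes ws: "ws \<in> words A" "length ws = n"
  shows "tensor_diff R A d n (wdeg ws) (etens R A ws) =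
    finsum (tensor_power R A n (wdeg ws - 1)) (\<lambda>k. signed (tensor_power R A n (wdeg ws - 1)) (wdeg (take k ws))
      (etens R A (ins k 1 (- 1) (letter d) ws))) {..<n}"
proof -
  let ?T = "\<lambda>ws. tensor_power R A n (wdeg ws + - 1)"
  let ?e = "\<lambda>k ws. signed (?T ws) (sum_list (take k (map fst ws))) (etens R A (ins k 1 (- 1) (letter d) ws))"
  have m: "mlin R A n (tensor_power R A n) (- 1) (?e k)" if "k \<in> {..<n}" for k
  proof (rule mlin_signed[OF V.module_axioms tensor_power_module[OF graded], where k = "\<lambda>is. sum_list (take k is)"])
    have "mlin R A (n + 1 - 1) (tensor_power R A n) (0 + - 1) (\<lambda>ws. etens R A (ins k 1 (- 1) (letter d) ws))"
      by (rule mlin_ins[OF V.module_axioms mlin_etens[OF graded] mlin_letter]) (rule d_hom, simp, use that in simp)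
    thus "mlin R A n (tensor_power R A n) (- 1) (\<lambda>ws. etens R A (ins k 1 (- 1) (letter d) ws))" by simp
  qed
  have M: "mlin R A n (tensor_power R A n) (- 1) (\<lambda>ws. finsum (?T ws) (\<lambda>k. ?e k ws) {..<n})"
    by (rule mlin_finsum[OF V.module_axioms tensor_power_module[OF graded] m])
  have eq: "finsum (tensor_power R A n (sum_list is - 1)) (\<lambda>k.
       signed (tensor_power R A n (sum_list is - 1)) (sum_list (take k is))
         (elem_tensor R A (is[k := is ! k - 1]) (xs[k := d (is ! k) (xs ! k)]))) {..<n}
      = finsum (?T (zip is xs)) (\<lambda>k. ?e k (zip is xs)) {..<n}"
    if l: "length is = n" "length xs = n" and z: "zip is xs \<in> words A" for "is" xs
  proof -
    interpret T: module R "?T (zip is xs)" by (rule tensor_power_module[OF graded])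
    have d: "sum_list is - 1 = wdeg (zip is xs) + - 1" using l by (simp add: wdeg_def)
    have "etens R A (ins k 1 (- 1) (letter d) (zip is xs)) = elem_tensor R A (is[k := is ! k - 1]) (xs[k := d (is ! k) (xs ! k)])"
      if k: "k < n" for k
    proof -
      have "zip is xs = take k (zip is xs) @ (is ! k, xs ! k) # drop (Suc k) (zip is xs)"
        using id_take_nth_drop[of k "zip is xs"] k l by simp
      hence "ins k 1 (- 1) (letter d) (zip is xs) = take k (zip is xs) @ (is ! k + - 1, d (is ! k) (xs ! k)) # drop (Suc k) (zip is xs)"
        using ins_letter[of "take k (zip is xs)" k "- 1" d] k l by (metis length_take length_zip min.idem min.absorb2 less_imp_le)
      thus ?thesis using k l by (simp add: etens_def upd_conv_take_nth_drop take_map drop_map map_fst_zip map_snd_zip flip: take_map drop_map)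
    qed
    thus ?thesis unfolding d using l mlin_closed[OF m z _ refl]
      by (intro T.M.finsum_cong') (auto simp: map_fst_zip)
  qed
  show ?thesis
    using tensor_lift_spec(2)[OF graded graded_tensor_power[OF graded] M eq ws]
    unfolding tensor_diff_def by (simp add: wdeg_def take_map)
qed

text \<open>Applying the differential to the letter after the first \<open>k\<close> ones changes \<^const>\<open>eps\<close> by the number of
  letters that follow. This accounts for the difference between the Koszul signs of \<open>A\<close> and of its suspension.\<close>

lemma twist_end_diff:
  assumes f: "f \<in> carrier (gEnd R A n i)" and i: "i = int n - 1 + s" and ws: "ws \<in> words A" "length ws = n"
  shows "twist R A n (s - 1) (end_diff R A d n i f) ws = bdry s (twist R A n s f) ws"
proof -
  define e where "e = wdeg ws + i - 1"
  let ?\<phi> = "twist R A n s f"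
  let ?T = "tensor_power R A n (wdeg ws - 1)"
  have T: "module R ?T" by (rule tensor_power_module[OF graded])
  interpret T: plain_module R ?T by (rule plain_module.intro[OF T])
  have m\<phi>: "mfam R A s ?\<phi>" by (rule mfam_twist) (use f i in simp)
  have et: "etens R A ws \<in> carrier (tensor_power R A n (wdeg ws))" using etens_carrier[OF ws(1)] ws(2) by simp
  have ei: "sdeg ws + (s - 1) - 1 = e" "sdeg ws + s - 2 = e" "sdeg ws + s - 1 = e + 1" "wdeg ws + i = e + 1"
    using i ws(2) by (auto simp: e_def sdeg_def)
  have fc: "f (wdeg ws) (etens R A ws) \<in> carrier (A (e + 1))"
    using mlin_closed[OF gEnd_eval_mlin[OF f] ws refl] by (simp add: ei)
  have fh: "f (wdeg ws - 1) \<in> mod_hom R ?T (A e)" using gEnd_hom[OF f, of "wdeg ws - 1"] by (simp add: e_def algebra_simps)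
  define y where "y k = ins k 1 (- 1) (letter d) ws" for k
  have split: "\<exists>u ii x w. ws = u @ (ii, x) # w \<and> length u = k" if "k < n" for k
    using word_split[of k ws] that ws(2) by simp
  have wk: "y k \<in> words A \<and> length (y k) = n \<and> wdeg (y k) = wdeg ws - 1 \<and>
      y k = take k ws @ (fst (ws ! k) - 1, d (fst (ws ! k)) (snd (ws ! k))) # drop (Suc k) ws \<and>
      even (eps (map fst ws) + i + wdeg (take k ws) - (s + sdeg (take k ws) + eps (map fst (y k))))" if k: "k < n" for k
  proof -
    obtain u ii x w where uw: "ws = u @ (ii, x) # w" "length u = k" using split[OF k] by blast
    have W: "y k = u @ (ii + - 1, d ii x) # w" unfolding y_def uw(1) by (rule ins_letter[OF uw(2)])
    have "eps (map fst ws) - eps (map fst (y k)) = int (length w)"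
      unfolding W uw(1) by (simp add: eps_append algebra_simps)
    moreover have "int n = int k + 1 + int (length w)" using uw ws(2) by auto
    moreover have "wdeg (take k ws) - sdeg (take k ws) = - int k" using uw by (simp add: sdeg_def)
    ultimately have "eps (map fst ws) + i + wdeg (take k ws) - (s + sdeg (take k ws) + eps (map fst (y k))) = 2 * int (length w)"
      using i by simp
    hence "even (eps (map fst ws) + i + wdeg (take k ws) - (s + sdeg (take k ws) + eps (map fst (y k))))" by simp
    thus ?thesis unfolding W using uw ws(1) d_closed[of x ii "ii - 1"] k ws(2) by (auto simp: nth_append)
  qed
  have ek: "etens R A (y k) \<in> carrier ?T" if "k < n" for k
    using wk[OF that] by (intro etens_closed[OF graded]) auto
  have fk: "f (wdeg ws - 1) (etens R A (y k)) \<in> carrier (A e)" if "k < n" for k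
    by (rule mod_hom_closed[OF fh ek[OF that]])
  have "end_diff R A d n i f (wdeg ws) (etens R A ws) =
      d (e + 1) (f (wdeg ws) (etens R A ws)) \<ominus>\<^bsub>A e\<^esub> signed (A e) i (f (wdeg ws - 1) (tensor_diff R A d n (wdeg ws) (etens R A ws)))"
    unfolding end_diff_def hom_diff_def using et by (simp add: ei)
  also have "f (wdeg ws - 1) (tensor_diff R A d n (wdeg ws) (etens R A ws)) =
      finsum (A e) (\<lambda>k. f (wdeg ws - 1) (signed ?T (wdeg (take k ws)) (etens R A (y k)))) {..<n}"
    unfolding tensor_diff_spec[OF ws, folded y_def] by (rule mod_hom_finsum[OF T V.module_axioms fh]) (auto simp: ek)
  also have "\<dots> = finsum (A e) (\<lambda>k. signed (A e) (wdeg (take k ws)) (f (wdeg ws - 1) (etens R A (y k)))) {..<n}"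
    using ek fk by (intro V.M.finsum_cong') (auto simp: mod_hom_signed[OF T V.module_axioms fh])
  finally have ed: "end_diff R A d n i f (wdeg ws) (etens R A ws) = d (e + 1) (f (wdeg ws) (etens R A ws)) \<ominus>\<^bsub>A e\<^esub>
      signed (A e) i (finsum (A e) (\<lambda>k. signed (A e) (wdeg (take k ws)) (f (wdeg ws - 1) (etens R A (y k)))) {..<n})" .
  have "dpre s ?\<phi> ws = finsum (A e) (\<lambda>k. signed (A e) (sdeg (take k ws)) (?\<phi> (take k ws @ (fst (ws ! k) - 1, d (fst (ws ! k)) (snd (ws ! k))) # drop (Suc k) ws))) {..<length ws}"
    unfolding dpre_def ei
  proof (rule V.psum_finsum)
    fix u x w assume "u @ x # w = ws"
    thus "signed (A e) (sdeg u) (?\<phi> (u @ (fst x - 1, d (fst x) (snd x)) # w)) \<in> carrier (A e)"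
      using ws(1) ei(2) by (intro V.signed_closed dpre_term_closed[OF m\<phi>]) auto
  qed
  also have "\<dots> = finsum (A e) (\<lambda>k. signed (A e) (sdeg (take k ws) + eps (map fst (y k))) (f (wdeg ws - 1) (etens R A (y k)))) {..<n}"
  proof (intro V.M.finsum_cong' refl)
    fix k assume "k \<in> {..<n}"
    hence k: "k < n" by simp
    note w = wk[OF k]
    have "?\<phi> (y k) = signed (A e) (eps (map fst (y k))) (f (wdeg ws - 1) (etens R A (y k)))"
    proof -
      have l: "length (y k) = n" "wdeg (y k) = wdeg ws - 1" using w by blast+
      have "wdeg (y k) + (int n - 1 + s) = e" unfolding l e_def i by simp
      thus ?thesis using twist_eval[OF l(1), of s f] unfolding l(2) by simp
    qed
    moreover have "?\<phi> (take k ws @ (fst (ws ! k) - 1, d (fst (ws ! k)) (snd (ws ! k))) # drop (Suc k) ws) = ?\<phi> (y k)"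
      using w by metis
    ultimately show "signed (A e) (sdeg (take k ws)) (?\<phi> (take k ws @ (fst (ws ! k) - 1, d (fst (ws ! k)) (snd (ws ! k))) # drop (Suc k) ws)) =
        signed (A e) (sdeg (take k ws) + eps (map fst (y k))) (f (wdeg ws - 1) (etens R A (y k)))"
      using fk[OF k] by simp
  qed (auto simp: fk ws(2))
  finally have "signed (A e) s (dpre s ?\<phi> ws) = finsum (A e) (\<lambda>k. signed (A e) s (signed (A e) (sdeg (take k ws) + eps (map fst (y k))) (f (wdeg ws - 1) (etens R A (y k))))) {..<n}"
    by (simp only:) (rule V.signed_finsum, auto simp: fk)
  also have "\<dots> = finsum (A e) (\<lambda>k. signed (A e) (eps (map fst ws) + i) (signed (A e) (wdeg (take k ws)) (f (wdeg ws - 1) (etens R A (y k))))) {..<n}"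
  proof (intro V.M.finsum_cong' refl)
    fix k assume "k \<in> {..<n}"
    hence k: "k < n" by simp
    have "signed (A e) (eps (map fst ws) + i + wdeg (take k ws)) x = signed (A e) (s + sdeg (take k ws) + eps (map fst (y k))) x" for x
      by (rule signed_cong) (use wk[OF k] in blast)
    thus "signed (A e) s (signed (A e) (sdeg (take k ws) + eps (map fst (y k))) (f (wdeg ws - 1) (etens R A (y k)))) =
        signed (A e) (eps (map fst ws) + i) (signed (A e) (wdeg (take k ws)) (f (wdeg ws - 1) (etens R A (y k))))"
      using fk[OF k] by (simp add: add.assoc)
  qed (auto simp: fk)
  also have "\<dots> = signed (A e) (eps (map fst ws)) (signed (A e) i (finsum (A e) (\<lambda>k. signed (A e) (wdeg (take k ws)) (f (wdeg ws - 1) (etens R A (y k)))) {..<n}))"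
    using V.signed_finsum[of "\<lambda>k. signed (A e) (wdeg (take k ws)) (f (wdeg ws - 1) (etens R A (y k)))" "{..<n}" e "eps (map fst ws) + i"]
    by (simp add: fk V.M.finsum_closed Pi_def)
  finally have sd: "signed (A e) s (dpre s ?\<phi> ws) = signed (A e) (eps (map fst ws)) (signed (A e) i (finsum (A e) (\<lambda>k. signed (A e) (wdeg (take k ws)) (f (wdeg ws - 1) (etens R A (y k)))) {..<n}))" .
  have sc: "finsum (A e) (\<lambda>k. signed (A e) (wdeg (take k ws)) (f (wdeg ws - 1) (etens R A (y k)))) {..<n} \<in> carrier (A e)"
    by (rule V.M.finsum_closed) (auto simp: fk)
  have dc: "d (e + 1) (f (wdeg ws) (etens R A ws)) \<in> carrier (A e)" using fc by (intro d_closed) auto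
  have dphi: "d (e + 1) (?\<phi> ws) = signed (A e) (eps (map fst ws)) (d (e + 1) (f (wdeg ws) (etens R A ws)))"
    unfolding twist_def using ws(2) d_signed[OF fc, of e] by (simp add: ei)
  have "twist R A n (s - 1) (end_diff R A d n i f) ws = signed (A e) (eps (map fst ws)) (end_diff R A d n i f (wdeg ws) (etens R A ws))"
    unfolding twist_def ei using ws(2) by simp
  also have "\<dots> = bdry s ?\<phi> ws"
    unfolding ed bdry_def ei dphi sd using sc dc by (simp add: a_minus_def V.signed_add V.signed_neg)
  finally show ?thesis .
qed

text \<open>The equations in arities 1, 2 and 3 say that the differential squares to zero, that the product is a
  cycle, and that the boundary of the operation of arity 3 is \<open>- m2 \<circ> m2\<close>.\<close>

lemma initial_structure:
  assumes m2: "m2 \<in> carrier (gEnd R A 2 0)" "end_diff R A d 2 0 m2 = \<zero>\<^bsub>gEnd R A 2 (- 1)\<^esub>"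
    and m3: "m3 \<in> carrier (gEnd R A 3 1)" "end_diff R A d 3 1 m3 = \<ominus>\<^bsub>gEnd R A 3 0\<^esub> circ R A 2 0 m2 2 0 m2"
  defines "\<beta> \<equiv> twist R A 2 (- 1) m2"
  shows "mfam R A (- 1) \<beta>" "vanishes (- 1) (\<lambda>k. k \<noteq> 2) \<beta>" "cyc (- 1) \<beta>" "\<exists>b. partial_structure \<beta> 3 b"
proof -
  show m\<beta>: "mfam R A (- 1) \<beta>" unfolding \<beta>_def by (rule mfam_twist) (use m2 in simp)
  show v\<beta>: "vanishes (- 1) (\<lambda>k. k \<noteq> 2) \<beta>" unfolding \<beta>_def by (rule vanishes_twist)
  have "cyc (- 1) (res (- 1) 2 \<beta>)"
  proof (rule cyc_res[OF m\<beta>])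
    fix ws assume ws: "ws \<in> words A" "length ws = 2"
    have "bdry (- 1) \<beta> ws = twist R A 2 (- 1 - 1) (\<zero>\<^bsub>gEnd R A 2 (- 1)\<^esub>) ws"
      unfolding \<beta>_def m2(2)[symmetric] by (rule twist_end_diff[OF m2(1) _ ws, symmetric]) simp
    also have "\<dots> = \<zero>\<^bsub>A (sdeg ws + - 1 - 2)\<^esub>" using twist_zero[OF ws(1), of "- 1" 2 "- 2"] by simp
    finally show "bdry (- 1) \<beta> ws = \<zero>\<^bsub>A (sdeg ws + - 1 - 2)\<^esub>" .
  qed
  moreover have "res (- 1) 2 \<beta> = \<beta>" by (auto simp: res_def \<beta>_def twist_def fun_eq_iff)
  ultimately show c\<beta>: "cyc (- 1) \<beta>" by simp
  define \<theta> where "\<theta> = twist R A 3 (- 1) m3"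
  have m\<theta>: "mfam R A (- 1) \<theta>" unfolding \<theta>_def by (rule mfam_twist) (use m3 in simp)
  have v\<theta>: "vanishes (- 1) (\<lambda>k. k \<noteq> 3) \<theta>" unfolding \<theta>_def by (rule vanishes_twist)
  define a where "a = fam_add (- 1) dfam \<beta>"
  have ma: "mfam R A (- 1) a" unfolding a_def by (rule mfam_fam_add[OF mfam_dfam m\<beta>])
  have a_other: "a ws = (if length ws = 1 then dfam ws else if length ws = 2 then \<beta> ws else \<zero>\<^bsub>A (sdeg ws + - 1 - 1)\<^esub>)"
    if "ws \<in> words A" for ws
    unfolding a_def fam_add_def
    using vanishesD[OF vanishes_dfam that _ refl] vanishesD[OF v\<beta> that _ refl]
      mfam_closed[OF mfam_dfam that refl] mfam_closed[OF m\<beta> that refl] by auto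
  have va0: "vanishes (- 1) (\<lambda>k. k = 0) a" using a_other by (auto simp: vanishes_def)
  have a1: "\<forall>ws\<in>words A. length ws = 1 \<longrightarrow> a ws = dfam ws" using a_other by auto
  have a2: "\<forall>ws\<in>words A. length ws = 2 \<longrightarrow> a ws = \<beta> ws" using a_other by auto
  have square: "icomp A (- 1) (- 1) a a ws = icomp A (- 1) (- 1) \<beta> \<beta> ws" if ws: "ws \<in> words A" for ws
  proof -
    define e where "e = sdeg ws - 3"
    have e: "e = sdeg ws + - 1 + - 1 - 1" by (simp add: e_def)
    have W: "u \<in> words A" "v \<in> words A" "w \<in> words A" "e = sdeg u + (sdeg v + - 1 - 1) + sdeg w + - 1"
      if "u @ v @ w = ws" for u v w using that ws by (auto simp: e_def)
    have "icomp A (- 1) (- 1) a a ws = icomp A (- 1) (- 1) dfam a ws \<oplus>\<^bsub>A e\<^esub> icomp A (- 1) (- 1) \<beta> a ws"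
    proof (rule icomp_terms_add[OF mfam_dfam ma m\<beta> ma ws e])
      fix u v w assume uvw: "u @ v @ w = ws"
      have "sdeg (u @ (sdeg v + - 1 - 1, a v) # w) + - 1 - 1 = e" using W[OF uvw] by simp
      thus "a (u @ (sdeg v + - 1 - 1, a v) # w) = dfam (u @ (sdeg v + - 1 - 1, a v) # w) \<oplus>\<^bsub>A e\<^esub> \<beta> (u @ (sdeg v + - 1 - 1, a v) # w)"
        unfolding a_def fam_add_def by (simp only:)
    qed
    moreover have "icomp A (- 1) (- 1) \<beta> a ws = icomp A (- 1) (- 1) \<beta> dfam ws \<oplus>\<^bsub>A e\<^esub> icomp A (- 1) (- 1) \<beta> \<beta> ws"
    proof (rule icomp_terms_add[OF m\<beta> mfam_dfam m\<beta> m\<beta> ws e])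
      fix u v w assume uvw: "u @ v @ w = ws"
      note w = W[OF uvw]
      show "\<beta> (u @ (sdeg v + - 1 - 1, a v) # w) = \<beta> (u @ (sdeg v + - 1 - 1, dfam v) # w) \<oplus>\<^bsub>A e\<^esub> \<beta> (u @ (sdeg v + - 1 - 1, \<beta> v) # w)"
        unfolding a_def fam_add_def
        by (rule mfam_add[OF m\<beta> w(1,3) mfam_closed[OF mfam_dfam w(2) refl] mfam_closed[OF m\<beta> w(2) refl] w(4)])
    qed
    moreover have "icomp A (- 1) (- 1) dfam a ws = d (sdeg ws - 2) (\<beta> ws)"
    proof -
      have c: "dfam ws \<in> carrier (A (sdeg ws - 2))" "\<beta> ws \<in> carrier (A (sdeg ws - 2))"
        by (rule mfam_closed[OF mfam_dfam ws] mfam_closed[OF m\<beta> ws], simp)+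
      have "d (sdeg ws - 2) (dfam ws) = \<zero>\<^bsub>A e\<^esub>"
      proof (cases "length ws = 1")
        case True
        then obtain i x where wx: "ws = [(i, x)]" by (cases ws) auto
        thus ?thesis using ws d_d[of x i "i - 1" e] by (simp add: dfam_def e_def)
      next
        case False
        thus ?thesis using d_zero[of e "sdeg ws - 2"] by (simp add: dfam_def e_def)
      qed
      moreover have "a ws = dfam ws \<oplus>\<^bsub>A (sdeg ws - 2)\<^esub> \<beta> ws" by (simp add: a_def fam_add_def)
      moreover have "d (sdeg ws - 2) (\<beta> ws) \<in> carrier (A e)" using c(2) by (rule d_closed) (simp add: e_def)
      ultimately have "d (sdeg ws - 2) (a ws) = d (sdeg ws - 2) (\<beta> ws)"
        using d_add[OF c, of e] by (simp add: e_def)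
      thus ?thesis using icomp_dfam_left[OF ma ws, of "sdeg ws - 2"] by simp
    qed
    moreover have "icomp A (- 1) (- 1) \<beta> dfam ws = dpre (- 1) \<beta> ws" by (rule icomp_dfam_right[OF m\<beta> ws])
    moreover have "d (sdeg ws - 2) (\<beta> ws) \<oplus>\<^bsub>A e\<^esub> dpre (- 1) \<beta> ws = \<zero>\<^bsub>A e\<^esub>"
    proof -
      have "dpre (- 1) \<beta> ws \<in> carrier (A e)" by (rule dpre_closed[OF m\<beta> ws]) (simp add: e_def)
      moreover have "bdry (- 1) \<beta> ws = \<zero>\<^bsub>A e\<^esub>" using c\<beta> ws by (simp add: cyc_def e_def)
      ultimately show ?thesis unfolding bdry_def by (simp add: e_def a_minus_def)
    qed
    moreover have "d (sdeg ws - 2) (\<beta> ws) \<in> carrier (A e)"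
      by (rule d_closed[OF mfam_closed[OF m\<beta> ws]], simp) (simp add: e_def)
    moreover have "dpre (- 1) \<beta> ws \<in> carrier (A e)" by (rule dpre_closed[OF m\<beta> ws]) (simp add: e_def)
    moreover have "icomp A (- 1) (- 1) \<beta> \<beta> ws \<in> carrier (A e)"
      by (rule mfam_closed[OF mfam_icomp[OF m\<beta> m\<beta>] ws]) (simp add: e_def)
    ultimately show ?thesis by (simp add: V.M.a_assoc[symmetric])
  qed
  have tc: "icomp A (- 1) (- 1) \<beta> \<beta> ws = twist R A 3 (- 2) (circ R A 2 0 m2 2 0 m2) ws" if "ws \<in> words A" for ws
    unfolding \<beta>_def using twist_circ[OF _ m2(1) m2(1) _ _ that, of "- 1" "- 1"] by simp
  have cc: "circ R A 2 0 m2 2 0 m2 \<in> carrier (gEnd R A 3 0)" using circ_closed[OF m2(1) m2(1)] by simp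
  define b where "b = fam_add (- 1) a \<theta>"
  note pt = perturb[OF ma va0 a1 m\<beta> v\<beta> a2 m\<theta> v\<theta> order_refl, folded b_def]
  have ba: "b ws = a ws" if "ws \<in> words A" "length ws \<noteq> 3" for ws
    unfolding b_def fam_add_def vanishesD[OF v\<theta> that refl] using mfam_closed[OF ma that(1) refl] by simp
  have "partial_structure \<beta> 3 b"
    unfolding partial_structure_def
  proof (intro conjI ballI impI)
    show "mfam R A (- 1) b" unfolding b_def by (rule mfam_fam_add[OF ma m\<theta>])
    show "vanishes (- 1) (\<lambda>k. k = 0 \<or> k > 3) b" using ba a_other by (auto simp: vanishes_def)
    show "b ws = dfam ws" if "ws \<in> words A" "length ws = 1" for ws using ba a1 that by simp
    show "b ws = \<beta> ws" if "ws \<in> words A" "length ws = 2" for ws using ba a2 that by simp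
    show "vanishes (- 2) (\<lambda>k. k \<le> 3) (icomp A (- 1) (- 1) b b)"
      unfolding vanishes_def
    proof (intro ballI impI)
      fix ws assume ws: "ws \<in> words A" "length ws \<le> 3"
      show "icomp A (- 1) (- 1) b b ws = \<zero>\<^bsub>A (sdeg ws + - 2 - 1)\<^esub>"
      proof (cases "length ws = 3")
        case False
        hence "icomp A (- 1) (- 1) b b ws = twist R A 3 (- 2) (circ R A 2 0 m2 2 0 m2) ws"
          using pt(1)[OF ws(1) refl] ws(2) square[OF ws(1)] tc[OF ws(1)] by simp
        thus ?thesis using twist_length[OF False] by simp
      next
        case True
        define e where "e = sdeg ws - 3"
        have "bdry (- 1) \<theta> ws = twist R A 3 (- 2) (signed (gEnd R A 3 0) 1 (circ R A 2 0 m2 2 0 m2)) ws"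
          unfolding \<theta>_def using twist_end_diff[OF m3(1) _ ws(1) True, of "- 1"] m3(2) by simp
        also have "\<dots> = \<ominus>\<^bsub>A e\<^esub> icomp A (- 1) (- 1) \<beta> \<beta> ws"
          unfolding tc[OF ws(1)] using twist_signed[OF cc _ ws(1), of "- 2" 1] by (simp add: e_def)
        finally have "icomp A (- 1) (- 1) b b ws = icomp A (- 1) (- 1) \<beta> \<beta> ws \<oplus>\<^bsub>A e\<^esub> \<ominus>\<^bsub>A e\<^esub> icomp A (- 1) (- 1) \<beta> \<beta> ws"
          using pt(2)[OF ws(1) e_def True] square[OF ws(1)] by simp
        moreover have "icomp A (- 1) (- 1) \<beta> \<beta> ws \<in> carrier (A e)"
          by (rule mfam_closed[OF mfam_icomp[OF m\<beta> m\<beta>] ws(1)]) (simp add: e_def)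
        ultimately show ?thesis by (simp add: V.M.r_neg e_def)
      qed
    qed
  qed
  thus "\<exists>b. partial_structure \<beta> 3 b" by blast
qed

end

locale retract_to_homology = dg_retract R A d "homology A d" inc prj hot
  for R :: "('r, 'c) ring_scheme" and A :: "('r, 'a) gmodule" and d inc prj hot +
  assumes prj_cycle: "\<And>i x. x \<in> carrier (cycles A d i) \<Longrightarrow> prj i x = hom_class A d i x"
begin

text \<open>A cycle \<open>x\<close> is homologous to \<open>inc (prj x)\<close>, and the product only depends on classes by \<open>prj_slot\<close>. So the
  induced map satisfies the description of the product on homology. It is the only one, since every class
  has a representative.\<close>

lemma homology_product_push:
  assumes m2: "m2 \<in> carrier (gEnd R A 2 0)" and cyc: "cyc (- 1) (twist R A 2 (- 1) m2)"
  shows "homology_product R A d m2 \<in> carrier (gEnd R (homology A d) 2 0)"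
    and "ws \<in> words (homology A d) \<Longrightarrow> twist R (homology A d) 2 (- 1) (homology_product R A d m2) ws = push (- 1) (twist R A 2 (- 1) m2) ws"
proof -
  let ?H = "homology A d"
  let ?\<beta> = "twist R A 2 (- 1) m2"
  have m\<beta>: "mfam R A (- 1) ?\<beta>" by (rule mfam_twist) (use m2 in simp)
  let ?P = "\<lambda>\<mu>. \<mu> \<in> carrier (gEnd R ?H 2 0) \<and>
     (\<forall>p q. \<forall>x\<in>carrier (cycles A d p). \<forall>y\<in>carrier (cycles A d q).
        \<mu> (p + q) (elem_tensor R ?H [p, q] [hom_class A d p x, hom_class A d q y])
          = hom_class A d (p + q) (m2 (p + q) (elem_tensor R A [p, q] [x, y])))"
  have et: "etens R V [(p, x), (q, y)] = elem_tensor R V [p, q] [x, y]" for V :: "('r, 'z) gmodule" and p q x y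
    by (simp add: etens_def)
  obtain \<mu> where \<mu>: "\<mu> \<in> carrier (gEnd R ?H 2 0)"
    "\<And>ws. ws \<in> words ?H \<Longrightarrow> length ws = 2 \<Longrightarrow> twist R ?H 2 (- 1) \<mu> ws = push (- 1) ?\<beta> ws"
    using H.twist_surj[OF mfam_push[OF m\<beta>], of 2] by auto
  have val: "\<mu> (p + q) (elem_tensor R ?H [p, q] [hom_class A d p x, hom_class A d q y])
      = hom_class A d (p + q) (m2 (p + q) (elem_tensor R A [p, q] [x, y]))"
    if x: "x \<in> carrier (cycles A d p)" and y: "y \<in> carrier (cycles A d q)" for p q x y
  proof -
    have xA: "x \<in> carrier (A p)" "d p x = \<zero>\<^bsub>A (p - 1)\<^esub>" and yA: "y \<in> carrier (A q)" "d q y = \<zero>\<^bsub>A (q - 1)\<^esub>"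
      using x y by auto
    let ?e = "eps [p, q]"
    let ?X = "inc p (prj p x)"
    let ?Y = "inc q (prj q y)"
    have X: "?X \<in> carrier (A p)" "d p ?X = \<zero>\<^bsub>A (p - 1)\<^esub>" and Y: "?Y \<in> carrier (A q)" "d q ?Y = \<zero>\<^bsub>A (q - 1)\<^esub>"
      using xA yA by (auto intro!: inc_closed prj_closed d_inc)
    have cw: "[(p, x)] \<in> cycle_words" "[(p, ?X)] \<in> cycle_words" "[(q, y)] \<in> cycle_words" "[(p, x), (q, y)] \<in> cycle_words"
      using xA yA X by (auto simp: cycle_words_def)
    have nil: "[] \<in> cycle_words" by (simp add: cycle_words_def)
    have "prj (p + q) (?\<beta> [(p, x), (q, y)]) = prj (p + q) (?\<beta> [(p, ?X), (q, y)])"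
      using prj_slot[OF m\<beta> cyc nil cw(3) xA, of "p + q"] by simp
    also have "\<dots> = prj (p + q) (?\<beta> [(p, ?X), (q, ?Y)])"
      using prj_slot[OF m\<beta> cyc cw(2) nil yA, of "p + q"] by simp
    also have "\<dots> = push (- 1) ?\<beta> [(p, prj p x), (q, prj q y)]" by (simp add: push_def algebra_simps)
    also have "\<dots> = twist R ?H 2 (- 1) \<mu> [(p, prj p x), (q, prj q y)]"
      by (rule \<mu>(2)[symmetric]) (use xA yA prj_closed in auto)
    also have "\<dots> = signed (?H (p + q)) ?e (\<mu> (p + q) (elem_tensor R ?H [p, q] [prj p x, prj q y]))"
      by (simp add: twist_def et algebra_simps del: eps.simps)
    finally have 1: "prj (p + q) (?\<beta> [(p, x), (q, y)]) =
        signed (?H (p + q)) ?e (\<mu> (p + q) (elem_tensor R ?H [p, q] [prj p x, prj q y]))" .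
    define z where "z = m2 (p + q) (elem_tensor R A [p, q] [x, y])"
    have zc: "z \<in> carrier (A (p + q))"
      using mlin_closed[OF gEnd_eval_mlin[OF m2], of "[(p, x), (q, y)]" "p + q"] xA yA by (simp add: z_def et)
    have \<beta>z: "?\<beta> [(p, x), (q, y)] = signed (A (p + q)) ?e z"
      by (simp add: twist_def et z_def algebra_simps del: eps.simps)
    have "d (p + q) (?\<beta> [(p, x), (q, y)]) = \<zero>\<^bsub>A (p + q - 1)\<^esub>"
      by (rule cyc_cycle_words[OF m\<beta> cyc cw(4)]) simp
    hence "signed (A (p + q - 1)) ?e (d (p + q) z) = \<zero>\<^bsub>A (p + q - 1)\<^esub>"
      unfolding \<beta>z using d_signed[OF zc refl] by simp
    hence "signed (A (p + q - 1)) ?e (signed (A (p + q - 1)) ?e (d (p + q) z)) = \<zero>\<^bsub>A (p + q - 1)\<^esub>"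
      by (simp del: eps.simps V.signed_signed)
    hence dz: "d (p + q) z = \<zero>\<^bsub>A (p + q - 1)\<^esub>" using d_closed[OF zc refl] by (simp del: eps.simps)
    have "signed (?H (p + q)) ?e (prj (p + q) z) =
        signed (?H (p + q)) ?e (\<mu> (p + q) (elem_tensor R ?H [p, q] [prj p x, prj q y]))"
      using 1 unfolding \<beta>z using mod_hom_signed[OF V.module_axioms H.V.module_axioms prj zc] by simp
    hence "signed (?H (p + q)) ?e (signed (?H (p + q)) ?e (prj (p + q) z)) =
        signed (?H (p + q)) ?e (signed (?H (p + q)) ?e (\<mu> (p + q) (elem_tensor R ?H [p, q] [prj p x, prj q y])))"
      by (simp only:)
    moreover have "\<mu> (p + q) (elem_tensor R ?H [p, q] [prj p x, prj q y]) \<in> carrier (?H (p + q))"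
      using mlin_closed[OF H.gEnd_eval_mlin[OF \<mu>(1)], of "[(p, prj p x), (q, prj q y)]" "p + q"] xA yA prj_closed
      by (simp add: et)
    ultimately have "prj (p + q) z = \<mu> (p + q) (elem_tensor R ?H [p, q] [prj p x, prj q y])"
      using prj_closed[OF zc] by (simp del: eps.simps)
    thus ?thesis using prj_cycle[of z "p + q"] zc dz prj_cycle[OF x] prj_cycle[OF y] by (simp add: z_def)
  qed
  have "?P \<mu>" using \<mu>(1) val by blast
  moreover have "\<nu> = \<mu>" if \<nu>: "?P \<nu>" for \<nu>
  proof (rule H.gEnd_ext[of _ 2 0])
    show "\<nu> \<in> carrier (gEnd R ?H 2 0)" "\<mu> \<in> carrier (gEnd R ?H 2 0)" using \<nu> \<mu>(1) by auto
    fix ws assume ws: "ws \<in> words ?H" "length ws = 2"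
    then obtain p X q Y where w: "ws = [(p, X), (q, Y)]"
      by (metis (no_types, opaque_lifting) One_nat_def Suc_1 length_0_conv length_Suc_conv surj_pair)
    have "X \<in> carrier (?H p)" "Y \<in> carrier (?H q)" using ws w by auto
    then obtain x y where "x \<in> carrier (cycles A d p)" "X = hom_class A d p x" "y \<in> carrier (cycles A d q)" "Y = hom_class A d q y"
      unfolding hom_class_surj by blast
    thus "\<nu> (wdeg ws) (etens R ?H ws) = \<mu> (wdeg ws) (etens R ?H ws)" using \<nu> val by (simp add: w et)
  qed
  ultimately have "homology_product R A d m2 = \<mu>"
    unfolding homology_product_def by (rule the_equality)
  moreover have "twist R ?H 2 (- 1) \<mu> ws = push (- 1) ?\<beta> ws" if "ws \<in> words ?H"
  proof (cases "length ws = 2")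
    case False
    thus ?thesis using twist_length[of "wmap inc ws" 2 "- 1" m2] by (simp add: push_def H.twist_length prj_zero)
  qed (rule \<mu>(2)[OF that])
  ultimately show "homology_product R A d m2 \<in> carrier (gEnd R ?H 2 0)"
    "ws \<in> words ?H \<Longrightarrow> twist R ?H 2 (- 1) (homology_product R A d m2) ws = push (- 1) ?\<beta> ws"
    using \<mu>(1) by simp_all
qed

end

section \<open>Existence of the \<open>A\<^sub>\<infinity>\<close>-structure\<close>

context graded_mod
begin

text \<open>If \<open>v\<close> is the inserted part of a word, only the summand for \<open>(i, j)\<close> with \<open>j = length v\<close> is nonzero, so that
  the sum over \<open>(i, j)\<close> is a single composite. An empty \<open>v\<close> contributes nothing as there is no operation of
  arity 0.\<close>

lemma A_infinity_structureI:
  assumes b: "mfam R V (- 1) b" "vanishes (- 1) (\<lambda>k. k = 0) b"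
    and square: "\<And>ws. ws \<in> words V \<Longrightarrow> icomp V (- 1) (- 1) b b ws = \<zero>\<^bsub>V (sdeg ws - 3)\<^esub>"
    and m: "\<And>i. i \<ge> 1 \<Longrightarrow> m i \<in> carrier (gEnd R V i (int i - 2))"
    and mb: "\<And>i ws. i \<ge> 1 \<Longrightarrow> ws \<in> words V \<Longrightarrow> length ws = i \<Longrightarrow> twist R V i (- 1) (m i) ws = b ws"
  shows "A_infinity_structure R V m"
  unfolding A_infinity_structure_def
proof (intro conjI allI impI)
  show "m i \<in> carrier (gEnd R V i (int i - 2))" if "1 \<le> i" for i by (rule m[OF that])
  fix n :: nat assume n: "1 \<le> n"
  let ?I = "{(i, j). i \<ge> 1 \<and> j \<ge> 1 \<and> i + j = n + 1}"
  let ?F = "\<lambda>(i, j). circ R V i (int i - 2) (m i) j (int j - 2) (m j)"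
  let ?t = "\<lambda>i. twist R V i (- 1) (m i)"
  have "?I \<subseteq> {..n} \<times> {..n}" by auto
  hence fin: "finite ?I" by (rule finite_subset) simp
  interpret E: module R "gEnd R V n (int n - 3)" by (rule gEnd_module)
  have d: "int i - 2 = int i - 1 + - 1" for i by simp
  have F: "?F \<in> ?I \<rightarrow> carrier (gEnd R V n (int n - 3))"
  proof (clarsimp simp del: One_nat_def)
    fix i j assume ij: "1 \<le> i" "1 \<le> j" "i + j = n + 1"
    have "i + j - 1 = n" "int i - 2 + (int j - 2) = int n - 3" using ij by auto
    thus "circ R V i (int i - 2) (m i) j (int j - 2) (m j) \<in> carrier (gEnd R V n (int n - 3))"
      using circ_closed[OF m[OF ij(1)] m[OF ij(2)]] by (simp only:)
  qed
  have mt: "mfam R V (- 1) (?t i)" if "1 \<le> i" for i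
    by (rule mfam_twist) (use m[OF that] in simp)
  have n3: "int n - 3 = int n - 1 + - 2" by simp
  show "finsum (gEnd R V n (int n - 3)) ?F ?I = \<zero>\<^bsub>gEnd R V n (int n - 3)\<^esub>"
  proof (rule twist_inj[where s = "- 2"])
    show "finsum (gEnd R V n (int n - 3)) ?F ?I \<in> carrier (gEnd R V n (int n - 1 + - 2))"
      unfolding n3[symmetric] by (rule E.M.finsum_closed[OF F])
    show "\<zero>\<^bsub>gEnd R V n (int n - 3)\<^esub> \<in> carrier (gEnd R V n (int n - 1 + - 2))"
      unfolding n3[symmetric] by (rule E.M.zero_closed)
    fix ws assume ws: "ws \<in> words V" "length ws = n"
    define e where "e = sdeg ws - 3"
    have e: "sdeg ws + - 2 - 1 = e" "sdeg ws + - 1 + - 1 - 1 = e" by (simp_all add: e_def)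
    let ?D = "dsum (V e)"
    let ?T = "\<lambda>p u v w. signed (V e) (- 1 * sdeg u) (?t (fst p) (u @ (sdeg v + - 1 - 1, ?t (snd p) v) # w))"
    have W: "u \<in> words V" "v \<in> words V" "w \<in> words V" "e = sdeg u + sdeg v + sdeg w + - 1 + - 1 - 1"
      "length u + length v + length w = n"
      if "u @ v @ w = ws" for u v w using that ws by (auto simp: e_def)
    have Tc: "?T p u v w \<in> carrier (V e)" if "p \<in> ?I" "u @ v @ w = ws" for p u v w
      using that(1) W[OF that(2)] by (intro V.signed_closed icomp_term_closed[OF mt mt]) auto
    have tw: "twist R V n (- 2) (?F p) ws = ?D (\<lambda>u y. ?D (\<lambda>v w. ?T p u v w) y) ws" if p: "p \<in> ?I" for p
    proof -
      obtain i j where ij: "p = (i, j)" "1 \<le> i" "1 \<le> j" "i + j = n + 1" using p by auto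
      have nn: "i + j - 1 = n" using ij by simp
      show ?thesis
        using twist_circ[OF ij(2) m[OF ij(2)] m[OF ij(3)] d d ws(1)]
        unfolding nn icomp_def e ij(1) by simp
    qed
    have sum_term: "finsum (V e) (\<lambda>p. ?T p u v w) ?I = signed (V e) (- 1 * sdeg u) (b (u @ (sdeg v + - 1 - 1, b v) # w))"
      if uvw: "u @ v @ w = ws" for u v w
    proof (cases "length v = 0")
      case True
      note w = W[OF uvw]
      have "b (u @ (sdeg v + - 1 - 1, b v) # w) = \<zero>\<^bsub>V e\<^esub>"
        by (rule term_zero_inner[OF b w(1-3) True w(4)])
      moreover have "?T p u v w = \<zero>\<^bsub>V e\<^esub>" if "p \<in> ?I" for p
      proof -
        have p: "1 \<le> fst p" "0 \<noteq> snd p" using that by auto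
        have "?t (fst p) (u @ (sdeg v + - 1 - 1, ?t (snd p) v) # w) = \<zero>\<^bsub>V e\<^esub>"
          by (rule term_zero_inner[OF mt[OF p(1)] vanishes_twist w(1-3) _ w(4)]) (use True p in simp)
        thus ?thesis by simp
      qed
      hence "finsum (V e) (\<lambda>p. ?T p u v w) ?I = finsum (V e) (\<lambda>p. \<zero>\<^bsub>V e\<^esub>) ?I"
        by (intro V.M.finsum_cong') auto
      ultimately show ?thesis by (simp add: V.M.finsum_zero)
    next
      case False
      note w = W[OF uvw]
      define p0 where "p0 = (length u + length w + 1, length v)"
      have p0: "p0 \<in> ?I" using False w(5) by (auto simp: p0_def Suc_le_eq)
      have "?T p u v w = (if p = p0 then signed (V e) (- 1 * sdeg u) (b (u @ (sdeg v + - 1 - 1, b v) # w)) else \<zero>\<^bsub>V e\<^esub>)"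
        if p: "p \<in> ?I" for p
      proof (cases "p = p0")
        case True
        have v: "?t (length v) v = b v" by (rule mb) (use False w in \<open>auto simp: Suc_le_eq\<close>)
        have "?t (length u + length w + 1) (u @ (sdeg v + - 1 - 1, b v) # w) = b (u @ (sdeg v + - 1 - 1, b v) # w)"
          by (rule mb) (use w mfam_closed[OF b(1) w(2) refl] in auto)
        thus ?thesis using True v by (simp add: p0_def)
      next
        case ne: False
        hence "snd p \<noteq> length v" using p w(5) by (cases p) (auto simp: p0_def)
        hence "?t (fst p) (u @ (sdeg v + - 1 - 1, ?t (snd p) v) # w) = \<zero>\<^bsub>V e\<^esub>"
          by (intro term_zero_inner[OF mt vanishes_twist w(1-3) _ w(4)]) (use p in auto)
        thus ?thesis using ne by simp
      qed
      moreover have c: "signed (V e) (- 1 * sdeg u) (b (u @ (sdeg v + - 1 - 1, b v) # w)) \<in> carrier (V e)"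
        using w by (intro V.signed_closed icomp_term_closed[OF b(1) b(1)]) auto
      ultimately have "finsum (V e) (\<lambda>p. ?T p u v w) ?I =
          finsum (V e) (\<lambda>p. if p = p0 then signed (V e) (- 1 * sdeg u) (b (u @ (sdeg v + - 1 - 1, b v) # w)) else \<zero>\<^bsub>V e\<^esub>) ?I"
        by (intro V.M.finsum_cong') auto
      also have "\<dots> = signed (V e) (- 1 * sdeg u) (b (u @ (sdeg v + - 1 - 1, b v) # w))"
        by (rule V.M.add.finprod_singleton_swap[OF p0 fin]) (use c in simp)
      finally show ?thesis .
    qed
    have "twist R V n (- 2) (finsum (gEnd R V n (int n - 3)) ?F ?I) ws = finsum (V e) (\<lambda>p. twist R V n (- 2) (?F p) ws) ?I"
      using twist_finsum[OF F n3 ws(1)] unfolding e .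
    also have "\<dots> = finsum (V e) (\<lambda>p. ?D (\<lambda>u y. ?D (\<lambda>v w. ?T p u v w) y) ws) ?I"
      by (intro V.M.finsum_cong' refl tw Pi_I V.dsum_closed Tc; simp)
    also have "\<dots> = ?D (\<lambda>u y. finsum (V e) (\<lambda>p. ?D (\<lambda>v w. ?T p u v w) y) ?I) ws"
      by (rule V.dsum_of_finsum[symmetric]) (intro V.dsum_closed Tc, auto)
    also have "\<dots> = ?D (\<lambda>u y. ?D (\<lambda>v w. finsum (V e) (\<lambda>p. ?T p u v w) ?I) y) ws"
      by (intro dsum_cong V.dsum_of_finsum[symmetric] Tc) auto
    also have "\<dots> = ?D (\<lambda>u y. ?D (\<lambda>v w. signed (V e) (- 1 * sdeg u) (b (u @ (sdeg v + - 1 - 1, b v) # w))) y) ws"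
      by (intro dsum_cong sum_term) auto
    also have "\<dots> = icomp V (- 1) (- 1) b b ws" unfolding icomp_def e ..
    also have "\<dots> = twist R V n (- 2) \<zero>\<^bsub>gEnd R V n (int n - 3)\<^esub> ws"
      using square[OF ws(1)] twist_zero[OF ws(1) n3] by simp
    finally show "twist R V n (- 2) (finsum (gEnd R V n (int n - 3)) ?F ?I) ws =
        twist R V n (- 2) \<zero>\<^bsub>gEnd R V n (int n - 3)\<^esub> ws" .
  qed
qed

end

theorem corollary3p9:
  fixes R :: "('r, 'c) ring_scheme"
    and A :: "('r, 'a) gmodule"
    and d :: "int \<Rightarrow> 'a \<Rightarrow> 'a"
    and m2 :: "int \<Rightarrow> ('r, 'a) tens \<Rightarrow> 'a"
  assumes "cring R"
    and "homotopy_assoc_algebra R A d m2"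
    and "graded_projective R (homology A d)"
    and "graded_projective R (cycles A d)"
    and "\<And>r::nat. r \<ge> 3 \<Longrightarrow>
           zero_module (HH R (homology A d) (homology_product R A d m2) (r + 1) (int r - 2))"
  shows "\<exists>m. A_infinity_structure R A m \<and> m 1 = unary_op R A d \<and> m 2 = m2"
proof -
  obtain m3 where dg: "dgmodule R A d" and m2: "m2 \<in> carrier (gEnd R A 2 0)" "end_diff R A d 2 0 m2 = \<zero>\<^bsub>gEnd R A 2 (- 1)\<^esub>"
    and m3: "m3 \<in> carrier (gEnd R A 3 1)" "end_diff R A d 3 1 m3 = \<ominus>\<^bsub>gEnd R A 3 0\<^esub> circ R A 2 0 m2 2 0 m2"
    using assms(2) unfolding homotopy_assoc_algebra_def by blast
  have gr: "graded_module R A" using dg by (simp add: dgmodule_def)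
  interpret dg_mod R A d by (intro dg_mod.intro graded_mod.intro gr dg_mod_axioms.intro dg)
  obtain inc prj hot where ret: "dg_retract R A d (homology A d) inc prj hot"
    and prjZ: "\<And>i x. x \<in> carrier (cycles A d i) \<Longrightarrow> prj i x = hom_class A d i x"
    using homology_retract[OF assms(3,4)] by blast
  interpret retract_to_homology R A d inc prj hot
    by (intro retract_to_homology.intro retract_to_homology_axioms.intro ret prjZ)
  define \<beta> where "\<beta> = twist R A 2 (- 1) m2"
  note init = initial_structure[OF m2 m3, folded \<beta>_def]
  obtain b0 where b0: "partial_structure \<beta> 3 b0" using init(4) by blast
  note \<mu> = homology_product_push[OF m2(1) init(3)[unfolded \<beta>_def]]
  have exact: "\<exists>\<gamma>. mfam R (homology A d) (- 1) \<gamma> \<and> H.vanishes (- 1) (\<lambda>k. k \<noteq> r) \<gamma> \<and>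
        (\<forall>ws\<in>words (homology A d). length ws = r + 1 \<longrightarrow> \<Phi> ws \<oplus>\<^bsub>homology A d (sdeg ws - 3)\<^esub>
          (icomp (homology A d) (- 1) (- 1) (push (- 1) \<beta>) \<gamma> ws \<oplus>\<^bsub>homology A d (sdeg ws - 3)\<^esub>
           icomp (homology A d) (- 1) (- 1) \<gamma> (push (- 1) \<beta>) ws) = \<zero>\<^bsub>homology A d (sdeg ws - 3)\<^esub>)"
    if r: "3 \<le> r" and \<Phi>: "mfam R (homology A d) (- 2) \<Phi>" "H.vanishes (- 2) (\<lambda>k. k \<noteq> r + 1) \<Phi>"
      "\<And>ws. ws \<in> words (homology A d) \<Longrightarrow> length ws = r + 2 \<Longrightarrow>
        icomp (homology A d) (- 1) (- 2) (push (- 1) \<beta>) \<Phi> ws = icomp (homology A d) (- 2) (- 1) \<Phi> (push (- 1) \<beta>) ws"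
    for r \<Phi>
    by (rule H.HH_zero_exact[OF \<mu>(1) r assms(5)[OF r] \<mu>(2)[folded \<beta>_def] mfam_push[OF init(1)] \<Phi>])
  have step: "\<exists>b'. partial_structure \<beta> (r + 1) b' \<and> (\<forall>ws\<in>words A. length ws < r \<longrightarrow> b' ws = b ws)"
    if r: "3 \<le> r" and b: "partial_structure \<beta> r b" for r b
  proof -
    obtain b' where "partial_structure \<beta> (r + 1) b'" "\<And>ws. ws \<in> words A \<Longrightarrow> length ws < r \<Longrightarrow> b' ws = b ws"
      using extend_structure[OF b r init(1-3) exact[OF r]] by blast
    thus ?thesis by blast
  qed
  obtain b where b: "mfam R A (- 1) b" "vanishes (- 1) (\<lambda>k. k = 0) b"
    "\<And>ws. ws \<in> words A \<Longrightarrow> length ws = 1 \<Longrightarrow> b ws = dfam ws"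
    "\<And>ws. ws \<in> words A \<Longrightarrow> length ws = 2 \<Longrightarrow> b ws = \<beta> ws"
    "\<And>ws. ws \<in> words A \<Longrightarrow> icomp A (- 1) (- 1) b b ws = \<zero>\<^bsub>A (sdeg ws - 3)\<^esub>"
    using limit_structure[OF b0 step] by blast
  have "\<exists>f. f \<in> carrier (gEnd R A i (int i - 2)) \<and>
      (\<forall>ws\<in>words A. length ws = i \<longrightarrow> twist R A i (- 1) f ws = b ws)" for i
  proof -
    have "int i - 1 + - 1 = int i - 2" by simp
    thus ?thesis using twist_surj[OF b(1), of i] by (metis (no_types, lifting))
  qed
  then obtain f where f: "\<And>i. f i \<in> carrier (gEnd R A i (int i - 2))"
    "\<And>i ws. ws \<in> words A \<Longrightarrow> length ws = i \<Longrightarrow> twist R A i (- 1) (f i) ws = b ws" by metis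
  \<comment> \<open>The twists of the given operations are the components of \<open>b\<close> in arities 1 and 2.\<close>
  define m where "m = f(1 := unary_op R A d, 2 := m2)"
  have "A_infinity_structure R A m"
  proof (rule A_infinity_structureI[OF b(1,2,5)])
    show "m i \<in> carrier (gEnd R A i (int i - 2))" if "1 \<le> i" for i
      using f(1)[of i] unary_op_spec(1) m2(1) by (simp add: m_def)
    show "twist R A i (- 1) (m i) ws = b ws" if "1 \<le> i" "ws \<in> words A" "length ws = i" for i ws
      using f(2)[OF that(2,3)] unary_op_spec(2)[OF that(2)] b(3,4)[OF that(2)] that(3) by (simp add: m_def \<beta>_def)
  qed
  thus ?thesis by (intro exI[of _ m]) (simp add: m_def)
qed

end
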